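(* Assume the setting and assumptions (A1)–(A4) described in the context. For each $x\in V$, the family $\{\mathbb P_x\circ(\mu^{(n)},Q^{(n)})^{-1}\}_{n\ge1}$ of probability measures on $\mathcal M_*$ satisfies a large deviation principle with speed $n$ and good convex rate functional $$I(\mu,Q)=\begin{cases}\int_0^{T_0}I_t(\mu_t,Q_t)\,dt&\text{if }(\mu,Q)\in\Lambda,\\ +\infty&\text{otherwise.}\end{cases}$$ That is, for every closed $\mathcal C\subset\mathcal M_*$ and open $\mathcal G\subset\mathcal M_*$, $\limsup_n\frac1n\log\mathbb P_x((\mu^{(n)},Q^{(n)})\in\mathcal C)\le-\inf_{\mathcal C}I$ and $\liminf_n\frac1n\log\mathbb P_x((\mu^{(n)},Q^{(n)})\in\mathcal G)\ge-\inf_{\mathcal G}I$.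
   Context: Let $V$ be a finite set and $T_0>0$; let $\mathcal S_{T_0}:=\mathbb R/T_0\mathbb Z$ (functions on $\mathcal S_{T_0}$ are identified with $T_0$-periodic functions; $C^1$ refers to the time variable). For $y,z\in V$ let $r(y,z;\cdot):[0,\infty)\to[0,\infty)$ be measurable, locally integrable and $T_0$-periodic, with $r(x,x;t)\equiv0$. Let $E$ be the set of ordered pairs $(y,z)$, $y\ne z$, with $r(y,z;t)>0$ for all $t>0$. Assumptions: (A1) if $r(y,z;t)>0$ for some $t>0$ then $r(y,z;t)>0$ for all $t>0$; (A2) the directed graph $(V,E)$ is strongly connected; (A3) $\max_{(y,z)\in E}\sup_{t\in[0,T_0]}r(y,z;t)<\infty$ and $\min_{(y,z)\in E}\inf_{t\in[0,T_0]}r(y,z;t)>0$; (A4) the set of points of $\mathcal S_{T_0}$ at which some map $t\mapsto r(y,z;t)$ is discontinuous has Lebesgue measure zero. $(\xi_t)_{t\ge0}$ is the time-inhomogeneous continuous-time Markov chain on $V$ with càdlàg paths and jump rate $r(y,z;t)$ from $y$ to $z$ at time $t$; $\mathbb P_x$ is its law when $\xi_0=x$. $\mathcal M_*:=\mathcal M_{+,T_0}(V\times\mathcal S_{T_0})\times\mathcal M_+(E\times\mathcal S_{T_0})$, where the first factor is the set of nonnegative measures on $V\times\mathcal S_{T_0}$ of total mass $T_0$ and the second the finite nonnegative measures on $E\times\mathcal S_{T_0}$, both with the weak topology. For a path $X$ and integer $n\ge1$, the extended empirical measure $\mu^{(n)}$ and flow $Q^{(n)}$ are given by $\mu^{(n)}(f)=\frac1n\int_0^{nT_0}f(X_t,t)\,dt$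 and $Q^{(n)}(g)=\frac1n\sum_{t\in(0,nT_0]:X_{t-}\ne X_t}g(X_{t-},X_t,t)$ for bounded measurable $f$ on $V\times\mathcal S_{T_0}$, $g$ on $E\times\mathcal S_{T_0}$. $\Phi(q,p)=q\log\frac qp-(q-p)$ if $q,p>0$; $\Phi(0,p)=p$; $\Phi(q,0)=+\infty$ for $q>0$. $I_t(\mu_t,Q_t)=\sum_{(y,z)\in E}\Phi(Q_t(y,z),\mu_t(y)r(y,z;t))$. $\mathrm{div}A(y)=\sum_zA(y,z)-\sum_zA(z,y)$ (with $A=0$ off $E$). $\Lambda$ is the set of $(\mu,Q)\in\mathcal M_*$ such that: (i) $\mu=\mu_t\,dt$ with $\mu_t(V)=1$ for a.e. $t$; (ii) $Q=Q_t\,dt$; (iii) $\partial_t\mu_t+\mathrm{div}\,Q_t=0$ weakly, i.e. $\int_0^{T_0}\sum_y\mu_s(y)\partial_sf(y,s)ds=\int_0^{T_0}\sum_y\mathrm{div}Q_s(y)f(y,s)ds$ for all $C^1$ $f:V\times\mathcal S_{T_0}\to\mathbb R$; (iv) for a.e. $t$, $\mu_t(y)=0$ implies $Q_t(y,z)=0$ for all $(y,z)\in E$. *)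

theory Defs
  imports "HOL-Probability.Probability"
begin

definition pmod :: "real \<Rightarrow> real \<Rightarrow> real" where
  "pmod t T0 = t - T0 * of_int \<lfloor>t / T0\<rfloor>"

definition Edges :: "('v \<Rightarrow> 'v \<Rightarrow> real \<Rightarrow> real) \<Rightarrow> ('v \<times> 'v) set" where
  "Edges r = {(y, z). y \<noteq> z \<and> (\<forall>t>0. r y z t > 0)}"

definition gen :: "('v::finite \<Rightarrow> 'v \<Rightarrow> real \<Rightarrow> real) \<Rightarrow> 'v \<Rightarrow> 'v \<Rightarrow> real \<Rightarrow> real" where
  "gen r w z u = (if w = z then - (\<Sum>z'\<in>UNIV - {w}. r w z' u) else r w z u)"

text \<open>p is the transition function of the time-inhomogeneous chain with rates r:
  the solution of the integrated Kolmogorov forward equation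
  p(s,t) = Id + int_s^t p(s,u) L(u) du.\<close>
definition kolmogorov_transition ::
  "('v::finite \<Rightarrow> 'v \<Rightarrow> real \<Rightarrow> real) \<Rightarrow> (real \<Rightarrow> real \<Rightarrow> 'v \<Rightarrow> 'v \<Rightarrow> real) \<Rightarrow> bool" where
  "kolmogorov_transition r p \<longleftrightarrow>
     (\<forall>s t y z. 0 \<le> s \<and> s \<le> t \<longrightarrow>
        (\<lambda>u. \<Sum>w\<in>UNIV. p s u y w * gen r w z u) integrable_on {s..t} \<and>
        p s t y z = (if y = z then 1 else 0)
                    + integral {s..t} (\<lambda>u. \<Sum>w\<in>UNIV. p s u y w * gen r w z u))"

text \<open>Finite-dimensional distributions of the chain started at y at time s,
  observed at the (sorted) times ts in the states ys.\<close>
fun fdd :: "(real \<Rightarrow> real \<Rightarrow> 'v \<Rightarrow> 'v \<Rightarrow> real) \<Rightarrow> real \<Rightarrow> 'v \<Rightarrow> real list \<Rightarrow> 'v list \<Rightarrow> real" where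
  "fdd p s y [] [] = 1"
| "fdd p s y (t # ts) (z # zs) = p s t y z * fdd p t z ts zs"
| "fdd p s y _ _ = 0"

text \<open>Cadlag paths with values in the (discrete) finite state space, on [0,infinity).\<close>
definition cadlag :: "(real \<Rightarrow> 'v) \<Rightarrow> bool" where
  "cadlag X \<longleftrightarrow>
     (\<forall>t\<ge>0. eventually (\<lambda>s. X s = X t) (at_right t)) \<and>
     (\<forall>t>0. \<exists>y. eventually (\<lambda>s. X s = y) (at_left t))"

definition left_lim :: "(real \<Rightarrow> 'v) \<Rightarrow> real \<Rightarrow> 'v" where
  "left_lim X t = (THE y. eventually (\<lambda>s. X s = y) (at_left t))"

definition jumps :: "(real \<Rightarrow> 'v) \<Rightarrow> real \<Rightarrow> real set" where
  "jumps X b = {t \<in> {0<..b}. left_lim X t \<noteq> X t}"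

definition markov_chain ::
  "'w measure \<Rightarrow> ('w \<Rightarrow> real \<Rightarrow> 'v::finite) \<Rightarrow> (real \<Rightarrow> real \<Rightarrow> 'v \<Rightarrow> 'v \<Rightarrow> real) \<Rightarrow> 'v \<Rightarrow> bool" where
  "markov_chain M X p x \<longleftrightarrow>
     prob_space M \<and>
     (\<forall>t\<ge>0. (\<lambda>\<omega>. X \<omega> t) \<in> measurable M (count_space UNIV)) \<and>
     (\<forall>\<omega>\<in>space M. cadlag (X \<omega>)) \<and>
     (\<forall>ts ys. length ts = length ys \<longrightarrow> sorted ts \<longrightarrow> (\<forall>t\<in>set ts. 0 \<le> t) \<longrightarrow>
        measure M {\<omega>\<in>space M. \<forall>i<length ts. X \<omega> (ts ! i) = ys ! i} = fdd p 0 x ts ys)"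

text \<open>The circle S_T0 is represented by [0,T0) inside the reals; measures on V x S_T0
  are measures on V x R (product of counting and Borel sigma-algebras) concentrated on V x [0,T0).\<close>
abbreviation SpV :: "('v \<times> real) measure" where
  "SpV \<equiv> count_space UNIV \<Otimes>\<^sub>M lborel"

definition Mstar :: "real \<Rightarrow> ('v \<times> 'v) set \<Rightarrow> (('v \<times> real) measure \<times> (('v \<times> 'v) \<times> real) measure) set" where
  "Mstar T0 E = {(\<mu>, Q).
      sets \<mu> = sets SpV \<and> emeasure \<mu> (space \<mu>) = ennreal T0 \<and>
      emeasure \<mu> (space \<mu> - UNIV \<times> {0..<T0}) = 0 \<and>
      sets Q = sets SpV \<and> emeasure Q (space Q) < \<infinity> \<and>
      emeasure Q (space Q - E \<times> {0..<T0}) = 0}"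

text \<open>Continuous functions on V x S_T0 = continuous T0-periodic functions of time.\<close>
definition cont_per :: "real \<Rightarrow> ('a \<Rightarrow> real \<Rightarrow> real) \<Rightarrow> bool" where
  "cont_per T0 f \<longleftrightarrow> (\<forall>y. continuous_on UNIV (f y) \<and> (\<forall>t. f y (t + T0) = f y t))"

definition weak_top :: "real \<Rightarrow> (('v \<times> real) measure \<times> (('v \<times> 'v) \<times> real) measure) topology" where
  "weak_top T0 = topology_generated_by
     ({{(\<mu>, Q). (\<integral>p. f (fst p) (snd p) \<partial>\<mu>) \<in> U} | f U. cont_per T0 f \<and> open U} \<union>
      {{(\<mu>, Q). (\<integral>p. g (fst p) (snd p) \<partial>Q) \<in> U} | g U. cont_per T0 g \<and> open U})"

definition Mstar_top :: "real \<Rightarrow> ('v \<times> 'v) set \<Rightarrow> (('v \<times> real) measure \<times> (('v \<times> 'v) \<times> real) measure) topology" where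
  "Mstar_top T0 E = subtopology (weak_top T0) (Mstar T0 E)"

definition emp_meas :: "real \<Rightarrow> nat \<Rightarrow> (real \<Rightarrow> 'v) \<Rightarrow> ('v \<times> real) measure" where
  "emp_meas T0 n X = scale_measure (ennreal (1 / real n))
     (distr (restrict_space lborel {0..real n * T0}) SpV (\<lambda>t. (X t, pmod t T0)))"

definition emp_flow :: "real \<Rightarrow> nat \<Rightarrow> (real \<Rightarrow> 'v) \<Rightarrow> (('v \<times> 'v) \<times> real) measure" where
  "emp_flow T0 n X = scale_measure (ennreal (1 / real n))
     (distr (count_space (jumps X (real n * T0))) SpV (\<lambda>t. ((left_lim X t, X t), pmod t T0)))"

definition Phi :: "real \<Rightarrow> real \<Rightarrow> ennreal" where
  "Phi q p = (if q = 0 then ennreal p else if p = 0 then \<infinity>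
              else ennreal (q * ln (q / p) - (q - p)))"

definition divg :: "('v \<times> 'v) set \<Rightarrow> ('v \<times> 'v \<Rightarrow> real) \<Rightarrow> 'v::finite \<Rightarrow> real" where
  "divg E A y = (\<Sum>z\<in>UNIV. if (y, z) \<in> E then A (y, z) else 0)
              - (\<Sum>z\<in>UNIV. if (z, y) \<in> E then A (z, y) else 0)"

definition Lambda_wit :: "real \<Rightarrow> ('v::finite \<times> 'v) set \<Rightarrow> ('v \<times> real) measure \<Rightarrow> (('v \<times> 'v) \<times> real) measure
    \<Rightarrow> (real \<Rightarrow> 'v \<Rightarrow> real) \<Rightarrow> (real \<Rightarrow> 'v \<times> 'v \<Rightarrow> real) \<Rightarrow> bool" where
  "Lambda_wit T0 E \<mu> Q m q \<longleftrightarrow>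
     (\<lambda>p. m (snd p) (fst p)) \<in> borel_measurable SpV \<and> (\<forall>t y. 0 \<le> m t y) \<and>
     (\<lambda>p. q (snd p) (fst p)) \<in> borel_measurable SpV \<and> (\<forall>t e. 0 \<le> q t e) \<and>
     \<mu> = density SpV (\<lambda>p. ennreal (m (snd p) (fst p)) * indicator {0..<T0} (snd p)) \<and>
     Q = density SpV (\<lambda>p. ennreal (q (snd p) (fst p)) * indicator {0..<T0} (snd p)) \<and>
     (AE t in lborel. t \<in> {0..<T0} \<longrightarrow> (\<Sum>y\<in>UNIV. m t y) = 1) \<and>
     (\<forall>f :: 'v \<Rightarrow> real \<Rightarrow> real.
        (\<forall>y. f y C1_differentiable_on UNIV \<and> (\<forall>t. f y (t + T0) = f y t)) \<longrightarrow>
        (LINT s:{0..T0}|lborel. \<Sum>y\<in>UNIV. m s y * deriv (f y) s)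
          = (LINT s:{0..T0}|lborel. \<Sum>y\<in>UNIV. divg E (q s) y * f y s)) \<and>
     (AE t in lborel. t \<in> {0..<T0} \<longrightarrow> (\<forall>y z. (y, z) \<in> E \<longrightarrow> m t y = 0 \<longrightarrow> q t (y, z) = 0))"

definition Lambda :: "real \<Rightarrow> ('v::finite \<times> 'v) set \<Rightarrow> (('v \<times> real) measure \<times> (('v \<times> 'v) \<times> real) measure) set" where
  "Lambda T0 E = {(\<mu>, Q). (\<mu>, Q) \<in> Mstar T0 E \<and> (\<exists>m q. Lambda_wit T0 E \<mu> Q m q)}"

definition rate_int :: "('v \<Rightarrow> 'v \<Rightarrow> real \<Rightarrow> real) \<Rightarrow> real \<Rightarrow> ('v \<times> 'v) set
    \<Rightarrow> (real \<Rightarrow> 'v \<Rightarrow> real) \<Rightarrow> (real \<Rightarrow> 'v \<times> 'v \<Rightarrow> real) \<Rightarrow> ennreal" where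
  "rate_int r T0 E m q = (\<integral>\<^sup>+ t. indicator {0..<T0} t *
       (\<Sum>e\<in>E. Phi (q t e) (m t (fst e) * r (fst e) (snd e) t)) \<partial>lborel)"

text \<open>I(mu,Q) = int_0^T0 I_t(mu_t,Q_t) dt on Lambda (independent of the chosen densities), +infinity otherwise.\<close>
definition rate :: "('v::finite \<Rightarrow> 'v \<Rightarrow> real \<Rightarrow> real) \<Rightarrow> real
    \<Rightarrow> ('v \<times> real) measure \<times> (('v \<times> 'v) \<times> real) measure \<Rightarrow> ennreal" where
  "rate r T0 PQ = (if PQ \<in> Lambda T0 (Edges r)
      then (let mq = (SOME mq. Lambda_wit T0 (Edges r) (fst PQ) (snd PQ) (fst mq) (snd mq))
            in rate_int r T0 (Edges r) (fst mq) (snd mq))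
      else \<infinity>)"

definition eln :: "real \<Rightarrow> ereal" where
  "eln p = (if p \<le> 0 then -\<infinity> else ereal (ln p))"

end

theory Submission
 imports Defs
begin

text \<open>For continuous periodic \<open>f\<close>, \<open>g\<close> put \<open>S\<^sub>n = n (\<mu>\<^sup>(\<^sup>n\<^sup>)(f) + Q\<^sup>(\<^sup>n\<^sup>)(g))\<close>.
The Feynman--Kac formula, applied to a positive periodic solution \<open>h\<close> of the backward equation (which
exists by Brouwer's theorem), gives a number \<open>lam f g\<close> with \<open>E exp S\<^sub>n\<close> comparable to
\<open>exp (n lam f g)\<close>. The rate function is the conjugate of \<open>lam\<close>: it dominates
\<open>\<mu>(f) + Q(g) - lam f g\<close> because \<open>log h\<close> may be inserted into the continuity equation, where (A4)
is used, and it is attained by the functions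
\<open>f = - d\<phi>/dt - sum r (exp (g + grad \<phi>) - 1)\<close>, for which \<open>h = exp \<phi>\<close> and \<open>lam f g = 0\<close>.
Hence the rate function is convex and lower semicontinuous, and the upper bound follows from
Chebyshev's inequality on half-spaces and the compactness of the sets \<open>Q(1) \<le> b\<close>.
For the lower bound near \<open>v\<close>, almost minimise \<open>lam(\<theta> F) - \<theta> v + \<eta> |\<theta>|\<^sup>2\<close> over \<open>\<theta>\<close>: a second-order
bound on \<open>lam\<close> shows that under the exponential tilt by \<open>\<theta> F\<close> the empirical values of \<open>F\<close> concentrate near \<open>v\<close>.\<close>

type_synonym 'a tfun = "'a => real => real"

section \<open>Indefinite integrals of bounded measurable functions\<close>

definition bdd_borel :: "(real => real) => bool" where
 "bdd_borel k \<longleftrightarrow> k \<in> borel_measurable borel \<and> (\<exists>K. \<forall>t. abs (k t) <= K)"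

lemma bdd_borelI: "k \<in> borel_measurable borel ==> (\<And>t. abs (k t) <= K) ==> bdd_borel k"
 unfolding bdd_borel_def by blast

lemma bdd_borel_measurable: "bdd_borel k ==> k \<in> borel_measurable borel"
 unfolding bdd_borel_def by blast

lemma bdd_borel_bound:
 assumes "bdd_borel k"
 obtains K where "K >= 0" "\<And>t. abs (k t) <= K"
 using assms unfolding bdd_borel_def by (meson abs_ge_zero order_trans)

lemma bdd_borel_const [simp]: "bdd_borel (%_. c)"
 by (rule bdd_borelI[where K = "abs c"]) auto

lemma bdd_borel_add:
 assumes "bdd_borel k" "bdd_borel l" shows "bdd_borel (%t. k t + l t)"
proof -
 obtain K L where "\<And>t. abs (k t) <= K" "\<And>t. abs (l t) <= L" using assms by (metis bdd_borel_bound)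
 hence "abs (k t + l t) <= K + L" for t
  using abs_triangle_ineq[of "k t" "l t"] add_mono[of "abs (k t)" K "abs (l t)" L] by fastforce
 thus ?thesis using assms[THEN bdd_borel_measurable] by (intro bdd_borelI) auto
qed

lemma bdd_borel_mult:
 assumes "bdd_borel k" "bdd_borel l" shows "bdd_borel (%t. k t * l t)"
proof -
 obtain K L where "K >= 0" "L >= 0" "\<And>t. abs (k t) <= K" "\<And>t. abs (l t) <= L"
  using assms by (metis bdd_borel_bound)
 hence "abs (k t * l t) <= K * L" for t by (simp add: abs_mult mult_mono)
 thus ?thesis using assms[THEN bdd_borel_measurable] by (intro bdd_borelI) auto
qed

lemma bdd_borel_uminus: "bdd_borel k ==> bdd_borel (%t. - k t)"
 using bdd_borel_mult[of "%_. -1" k] by simp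

lemma bdd_borel_diff: "bdd_borel k ==> bdd_borel l ==> bdd_borel (%t. k t - l t)"
 using bdd_borel_add[of k "%t. - l t"] bdd_borel_uminus by simp

lemma bdd_borel_sum:
 "(\<And>i. i \<in> I ==> bdd_borel (k i)) ==> bdd_borel (%t. \<Sum>i\<in>I. k i t)"
 by (induction I rule: infinite_finite_induct) (auto intro: bdd_borel_add)

lemma bdd_borel_compose:
 assumes k: "bdd_borel k" "\<And>t. k t \<in> S" and S: "closed S" and F: "continuous_on S F"
 shows "bdd_borel (%t. F (k t))"
proof -
 obtain K where K: "\<And>t. abs (k t) <= K" using k(1) by (metis bdd_borel_bound)
 have "compact (F ` (S \<inter> {- K..K}))"
  using S by (intro compact_continuous_image continuous_on_subset[OF F] closed_Int_compact) auto
 then obtain L where L: "\<And>v. v \<in> F ` (S \<inter> {- K..K}) ==> norm v <= L"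
  by (metis bounded_iff compact_imp_bounded)
 have "k \<in> measurable borel (restrict_space borel S)"
  using k bdd_borel_measurable by (intro measurable_restrict_space2) auto
 hence "(%t. F (k t)) \<in> borel_measurable borel"
  by (rule measurable_compose) (rule borel_measurable_continuous_on_restrict[OF F])
 moreover have "k t \<in> S \<inter> {- K..K}" for t using k(2) K[of t] by (auto simp: abs_le_iff)
 hence "abs (F (k t)) <= L" for t using L[of "F (k t)"] by auto
 ultimately show ?thesis by (rule bdd_borelI)
qed

lemma bdd_borel_exp: "bdd_borel k ==> bdd_borel (%t. exp (k t))"
 by (rule bdd_borel_compose[where S = UNIV and F = exp]) (auto intro!: continuous_intros)

lemma bdd_borel_abs: "bdd_borel k ==> bdd_borel (%t. abs (k t))"
 by (rule bdd_borel_compose[where S = UNIV and F = abs]) (auto intro!: continuous_intros)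

lemma bdd_borel_divide:
 assumes "bdd_borel k" "bdd_borel l" "c > 0" "\<And>t. c <= l t"
 shows "bdd_borel (%t. k t / l t)"
proof -
 have "bdd_borel (%t. inverse (l t))"
  using assms by (intro bdd_borel_compose[where S = "{c..}" and F = inverse]) (auto intro!: continuous_intros)
 thus ?thesis using bdd_borel_mult[OF assms(1)] by (simp add: divide_inverse)
qed

lemma bdd_borel_ln:
 "bdd_borel k ==> c > 0 ==> (\<And>t. c <= k t) ==> bdd_borel (%t. ln (k t))"
 by (rule bdd_borel_compose[where S = "{c..}" and F = ln]) (auto intro!: continuous_intros)

lemmas bdd_borel_intros = bdd_borel_const bdd_borel_add bdd_borel_mult bdd_borel_uminus
 bdd_borel_diff bdd_borel_exp bdd_borel_abs bdd_borel_sum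

lemma bdd_borel_family_bound:
 fixes k :: "'i::finite => real => real"
 assumes "\<And>i. bdd_borel (k i)"
 obtains K where "K >= 0" "\<And>i t. abs (k i t) <= K"
proof -
 obtain K where K: "\<And>i. K i >= 0" "\<And>i t. abs (k i t) <= K i"
  using assms unfolding bdd_borel_def by (metis abs_ge_zero order_trans)
 have "abs (k i t) <= (\<Sum>i\<in>UNIV. K i)" for i t
  using K member_le_sum[of i UNIV K] by (meson UNIV_I finite order_trans)
 moreover have "(\<Sum>i\<in>UNIV. K i) >= 0" using K by (simp add: sum_nonneg)
 ultimately show ?thesis using that by blast
qed

lemma bdd_borel_set_integrable:
 assumes "bdd_borel k" shows "set_integrable lborel {a..b} k"
proof -
 obtain K where "\<And>t. abs (k t) <= K" using assms by (metis bdd_borel_bound)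
 thus ?thesis
  unfolding set_integrable_def using assms[THEN bdd_borel_measurable]
  by (intro integrableI_bounded_set_indicator[where B = K])
   (auto simp: emeasure_lborel_Icc_eq)
qed

lemma bdd_borel_integrable: "bdd_borel k ==> k integrable_on {a..b}"
 using bdd_borel_set_integrable set_borel_integral_eq_integral(1) by blast

lemma bdd_borel_LINT: "bdd_borel k ==> (LINT t:{a..b}|lborel. k t) = integral {a..b} k"
 using bdd_borel_set_integrable set_borel_integral_eq_integral(2) by blast

lemma integral_bdd_add:
 "bdd_borel k ==> bdd_borel l ==> integral {a..b} (%t. k t + l t) = integral {a..b} k + integral {a..b} l"
 by (intro Henstock_Kurzweil_Integration.integral_add bdd_borel_integrable)

lemma integral_bdd_diff:
 "bdd_borel k ==> bdd_borel l ==> integral {a..b} (%t. k t - l t) = integral {a..b} k - integral {a..b} l"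
 by (intro Henstock_Kurzweil_Integration.integral_diff bdd_borel_integrable)

lemma integral_bdd_sum:
 assumes "\<And>i. i \<in> I ==> bdd_borel (k i)" "finite I"
 shows "integral {a..b} (%t. \<Sum>i\<in>I. k i t) = (\<Sum>i\<in>I. integral {a..b} (k i))"
 using assms by (intro Henstock_Kurzweil_Integration.integral_sum bdd_borel_integrable)

lemma integral_bdd_mono:
 assumes "bdd_borel k" "bdd_borel l" "\<And>t. t \<in> {a..b} ==> k t <= l t"
 shows "integral {a..b} k <= integral {a..b} l"
 using assms by (intro integral_le bdd_borel_integrable)

lemma abs_integral_bound:
 fixes k l :: "real => real"
 assumes "k integrable_on {a..b}" "l integrable_on {a..b}" "\<And>u. u \<in> {a..b} ==> abs (k u) <= l u"
 shows "abs (integral {a..b} k) <= integral {a..b} l"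
 using integral_norm_bound_integral[OF assms(1,2)] assms(3) by simp

lemma abs_integral_le:
 assumes "bdd_borel k" "\<And>t. t \<in> {a..b} ==> abs (k t) <= K" "a <= b"
 shows "abs (integral {a..b} k) <= K * (b - a)"
 using abs_integral_bound[of k a b "%_. K", OF bdd_borel_integrable[OF assms(1)]] assms(2,3)
 by (simp add: integrable_const_ivl mult.commute)

lemma integral_split:
 fixes k :: "real => real"
 assumes "bdd_borel k" "s <= u" "u <= t"
 shows "integral {s..t} k = integral {s..u} k + integral {u..t} k"
 using Henstock_Kurzweil_Integration.integral_combine[OF assms(2,3) bdd_borel_integrable[OF assms(1)]] by simp

lemma eq_of_quadratic_increments:
 fixes D :: "real => real"
 assumes D: "\<And>s t. a <= s ==> s <= t ==> t <= b ==> abs (D t - D s) <= C * (t - s)\<^sup>2" and "a <= b"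
 shows "D a = D b"
proof -
 have quotient_bound: "abs ((D y - D x) / (y - x)) <= C * abs (y - x)" if "x \<in> {a..b}" "y \<in> {a..b}" "y \<noteq> x" for x y
 proof -
  have "abs (D y - D x) <= C * (y - x)\<^sup>2"
   using D[of x y] D[of y x] that by (cases "x <= y") (auto simp: abs_minus_commute power2_commute)
  hence "abs (D y - D x) <= (C * abs (y - x)) * abs (y - x)"
   by (metis abs_mult_self_eq mult.assoc power2_eq_square)
  thus ?thesis using that by (simp add: abs_divide divide_le_eq)
 qed
 have "(D has_field_derivative 0) (at x within {a..b})" if x: "x \<in> {a..b}" for x
 proof -
  have "((%y. (D y - D x) / (y - x)) \<longlongrightarrow> 0) (at x within {a..b})"
  proof (rule Lim_null_comparison)
   show "\<forall>\<^sub>F y in at x within {a..b}. norm ((D y - D x) / (y - x)) <= C * abs (y - x)"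
    using quotient_bound[OF x] by (auto simp: eventually_at_filter)
   show "((%y. C * abs (y - x)) \<longlongrightarrow> 0) (at x within {a..b})" by (auto intro!: tendsto_eq_intros)
  qed
  thus ?thesis by (simp add: has_field_derivative_iff)
 qed
 then obtain c where "\<And>x. x \<in> {a..b} ==> D x = c"
  using has_field_derivative_zero_constant[of "{a..b}" D] by auto
 thus ?thesis using \<open>a <= b\<close> by auto
qed

text \<open>The sign convention is that of backward equations: \<open>h' = - k\<close>.\<close>

definition indef :: "real => real => (real => real) => (real => real) => bool" where
 "indef a b h k \<longleftrightarrow> (\<forall>s t. a <= s --> s <= t --> t <= b --> h s = h t + integral {s..t} k)"

lemma indefD: "indef a b h k ==> a <= s ==> s <= t ==> t <= b ==> h s = h t + integral {s..t} k"
 unfolding indef_def by blast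

lemma indefI_terminal:
 assumes "bdd_borel k" "\<And>t. a <= t ==> t <= b ==> h t = c + integral {t..b} k"
 shows "indef a b h k"
 unfolding indef_def
proof (intro allI impI)
 fix s t assume "a <= s" "s <= t" "t <= b"
 thus "h s = h t + integral {s..t} k"
  using assms(2)[of s] assms(2)[of t] integral_split[OF assms(1), of s t b] by simp
qed

lemma indef_lipschitz:
 assumes "indef a b h k" "bdd_borel k" "\<And>t. abs (k t) <= K" "s \<in> {a..b}" "t \<in> {a..b}"
 shows "abs (h t - h s) <= K * abs (t - s)"
proof -
 have "abs (h t - h s) <= K * (t - s)" if "a <= s" "s <= t" "t <= b" for s t
  using indefD[OF assms(1) that] abs_integral_le[OF assms(2) assms(3) that(2)] by simp
 from this[of s t] this[of t s] show ?thesis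
  using assms(4,5) by (cases "s <= t") (auto simp: abs_minus_commute)
qed

lemma indef_continuous_on:
 assumes "indef a b h k" "bdd_borel k" shows "continuous_on {a..b} h"
proof -
 obtain K where "K >= 0" "\<And>t. abs (k t) <= K" using assms(2) by (metis bdd_borel_bound)
 hence "K-lipschitz_on {a..b} h"
  using indef_lipschitz[OF assms] by (intro lipschitz_onI) (auto simp: dist_real_def)
 thus ?thesis by (rule lipschitz_on_continuous_on)
qed

lemma indef_add:
 assumes "indef a b h k" "indef a b h' k'" "bdd_borel k" "bdd_borel k'"
 shows "indef a b (%t. h t + h' t) (%t. k t + k' t)"
 using assms unfolding indef_def by (simp add: integral_bdd_add)

lemma indef_cmult:
 assumes "indef a b h k"
 shows "indef a b (%t. c * h t) (%t. c * k t)"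
 using assms unfolding indef_def by (simp add: distrib_left)

lemma indef_const: "indef a b (%t. c) (%t. 0)"
 unfolding indef_def by simp

lemma indef_cong:
 assumes "\<And>t. t \<in> {a..b} ==> h t = h' t" "\<And>t. t \<in> {a..b} ==> k t = k' t"
 shows "indef a b h k \<longleftrightarrow> indef a b h' k'"
proof -
 have "integral {s..t} k = integral {s..t} k'" if "a <= s" "t <= b" for s t
  using that assms(2) by (intro Henstock_Kurzweil_Integration.integral_cong) auto
 thus ?thesis unfolding indef_def using assms(1) by auto
qed

lemma indef_of_deriv:
 assumes "\<And>t. (h has_real_derivative - k t) (at t)"
 shows "indef a b h k"
 unfolding indef_def
proof (intro allI impI)
 fix s t assume "a <= s" "s <= t" "t <= b"
 hence "((%u. - k u) has_integral (h t - h s)) {s..t}"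
  using assms
  by (intro fundamental_theorem_of_calculus)
   (auto simp: has_real_derivative_iff_has_vector_derivative[symmetric] intro: has_field_derivative_at_within)
 hence "(k has_integral (h s - h t)) {s..t}"
  using has_integral_neg[of "%u. - k u" "h t - h s" "{s..t}"] by simp
 thus "h s = h t + integral {s..t} k"
  by (simp add: integral_unique)
qed

lemma mvt_between:
 fixes F :: "real => real"
 assumes S: "convex S" "x \<in> S" "y \<in> S" and F: "\<And>z. z \<in> S ==> (F has_real_derivative F' z) (at z within S)"
 obtains z where "z \<in> S" "abs (z - x) <= abs (y - x)" "F y - F x = F' z * (y - x)"
proof -
 have sub: "{min x y..max x y} \<subseteq> S"
  using S closed_segment_subset[of x S y] by (simp add: closed_segment_eq_real_ivl min_def max_def split: if_splits)
 have "\<exists>z\<in>{min x y..max x y}. F (max x y) - F (min x y) = F' z * (max x y - min x y)"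
  using sub has_field_derivative_subset[OF F, of _ "{min x y..max x y}"]
  by (intro mvt_very_simple[where f' = "%z d. F' z * d"]) (auto simp: has_field_derivative_def subset_iff)
 then obtain z where z: "z \<in> {min x y..max x y}" "F (max x y) - F (min x y) = F' z * (max x y - min x y)" by blast
 have "F y - F x = F' z * (y - x)" using z(2) by (cases "x <= y") (simp_all add: algebra_simps)
 moreover have "abs (z - x) <= abs (y - x)" using z(1) by (auto simp: min_def max_def split: if_splits)
 ultimately show ?thesis using that[of z] z(1) sub by blast
qed

lemma indef_compose:
 assumes h: "indef a b h k" "bdd_borel k" "bdd_borel h" "\<And>t. h t \<in> S" and S: "closed S" "convex S"
  and F: "\<And>x. x \<in> S ==> (F has_real_derivative F' x) (at x within S)" and F': "C-lipschitz_on S F'"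
 shows "indef a b (%t. F (h t)) (%t. F' (h t) * k t)"
 unfolding indef_def
proof (intro allI impI)
 fix s t assume st: "a <= s" "s <= t" "t <= b"
 have F'h: "bdd_borel (%t. F' (h t))"
  by (rule bdd_borel_compose[OF h(3,4) S(1) lipschitz_on_continuous_on[OF F']])
 have C: "0 <= C" by (rule lipschitz_on_nonneg[OF F'])
 obtain K where K: "K >= 0" "\<And>t. abs (k t) <= K" using h(2) by (metis bdd_borel_bound)
 define D where "D u = F (h u) + integral {s..u} (%t. F' (h t) * k t)" for u
 have "D s = D t"
 proof (rule eq_of_quadratic_increments[OF _ st(2)])
  fix u v assume uv: "s <= u" "u <= v" "v <= t"
  obtain z where z: "z \<in> S" "abs (z - h u) <= abs (h v - h u)" "F (h v) - F (h u) = F' z * (h v - h u)"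
   using mvt_between[OF S(2) h(4) h(4) F] by blast
  have lip: "abs (h w - h u) <= K * (v - u)" if "w \<in> {u..v}" for w
   using indef_lipschitz[OF h(1,2) K(2), of u w] that uv st mult_left_mono[OF _ K(1), of "w - u" "v - u"] by auto
  have "h v - h u = - integral {u..v} k" using indefD[OF h(1), of u v] uv st by auto
  hence "D v - D u = integral {u..v} (%w. F' (h w) * k w) - integral {u..v} (%w. F' z * k w)"
   using integral_split[OF bdd_borel_mult[OF F'h h(2)] uv(1,2)] z(3) by (simp add: D_def)
  also have "... = integral {u..v} (%w. (F' (h w) - F' z) * k w)"
   unfolding left_diff_distrib by (intro integral_bdd_diff[symmetric] bdd_borel_intros F'h h)
  also have "abs (...) <= (C * (2 * (K * (v - u))) * K) * (v - u)"
  proof (rule abs_integral_le[OF _ _ uv(2)])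
   fix w assume w: "w \<in> {u..v}"
   have "abs (h w - z) <= 2 * (K * (v - u))" using lip[OF w] lip[of v] z(2) uv by simp
   hence "abs (F' (h w) - F' z) <= C * (2 * (K * (v - u)))"
    using lipschitz_onD[OF F' h(4)[of w] z(1)] C by (simp add: dist_real_def) (meson mult_left_mono order_trans)
   thus "abs ((F' (h w) - F' z) * k w) <= C * (2 * (K * (v - u))) * K"
    unfolding abs_mult using K C uv by (intro mult_mono) auto
  qed (intro bdd_borel_intros F'h h)
  also have "... = 2 * C * K\<^sup>2 * (v - u)\<^sup>2" by (simp add: power2_eq_square mult_ac)
  finally show "abs (D v - D u) <= 2 * C * K\<^sup>2 * (v - u)\<^sup>2" .
 qed
 thus "F (h s) = F (h t) + integral {s..t} (%t. F' (h t) * k t)" by (simp add: D_def)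
qed

lemma indef_square:
 assumes "indef a b h k" "bdd_borel k" "bdd_borel h"
 shows "indef a b (%t. (h t)\<^sup>2) (%t. 2 * h t * k t)"
proof (rule indef_compose[OF assms, where S = UNIV and C = 2 and F = "%v. v\<^sup>2" and F' = "%v. 2 * v"])
 show "((%v. v\<^sup>2) has_real_derivative 2 * v) (at v within UNIV)" for v :: real
  by (auto intro!: derivative_eq_intros)
 show "2-lipschitz_on UNIV (%v::real. 2 * v)"
  by (rule lipschitz_onI) (simp_all add: dist_real_def abs_if)
qed auto

lemma indef_mult:
 assumes "indef a b h k" "bdd_borel k" "bdd_borel h" "indef a b h' k'" "bdd_borel k'" "bdd_borel h'"
 shows "indef a b (%t. h t * h' t) (%t. k t * h' t + h t * k' t)"
proof -
 have "indef a b (%t. 1 / 4 * ((h t + h' t)\<^sup>2 + -1 * (h t + -1 * h' t)\<^sup>2))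
  (%t. 1 / 4 * (2 * (h t + h' t) * (k t + k' t) + -1 * (2 * (h t + -1 * h' t) * (k t + -1 * k' t))))"
  by (intro indef_cmult indef_add indef_square bdd_borel_mult[OF bdd_borel_const] bdd_borel_add assms bdd_borel_mult)
 thus ?thesis by (rule indef_cong[THEN iffD1, rotated 2]) (simp_all add: power2_eq_square field_simps)
qed

lemma indef_ln:
 assumes h: "indef a b h k" "bdd_borel k" "bdd_borel h" and c: "c > 0" "\<And>t. c <= h t"
 shows "indef a b (%t. ln (h t)) (%t. k t / h t)"
proof -
 have "(1 / c\<^sup>2)-lipschitz_on {c..} inverse"
 proof (rule lipschitz_onI)
  fix x y assume xy: "x \<in> {c..}" "y \<in> {c..}"
  hence "dist (inverse x) (inverse y) = abs (x - y) / (x * y)"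
   using c(1) by (simp add: dist_real_def inverse_eq_divide field_simps abs_divide abs_mult abs_minus_commute)
  also have "... <= abs (x - y) / c\<^sup>2"
   using xy c(1) by (intro divide_left_mono) (auto simp: power2_eq_square intro: mult_mono)
  finally show "dist (inverse x) (inverse y) <= 1 / c\<^sup>2 * dist x y" by (simp add: dist_real_def)
 qed simp
 hence "indef a b (%t. ln (h t)) (%t. inverse (h t) * k t)"
  using c by (intro indef_compose[OF h, where S = "{c..}" and F = ln and F' = inverse] has_field_derivative_at_within[OF DERIV_ln]) auto
 thus ?thesis by (simp add: divide_inverse mult.commute)
qed

section \<open>Periodic functions\<close>

lemma pmod_bounds:
 assumes "T0 > 0" shows "0 <= pmod t T0" "pmod t T0 < T0"
proof -
 have "of_int \<lfloor>t / T0\<rfloor> * T0 <= t / T0 * T0" "t / T0 * T0 < (of_int \<lfloor>t / T0\<rfloor> + 1) * T0"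
  using assms by (auto intro!: mult_right_mono mult_strict_right_mono simp del: times_divide_eq_left)
 thus "0 <= pmod t T0" "pmod t T0 < T0"
  using assms by (auto simp: pmod_def algebra_simps)
qed

lemma pmod_add_of_int [simp]:
 assumes "T0 > 0" shows "pmod (t + of_int n * T0) T0 = pmod t T0"
proof -
 have "(t + of_int n * T0) / T0 = t / T0 + of_int n" using assms by (simp add: field_simps)
 thus ?thesis by (simp add: pmod_def algebra_simps)
qed

lemma pmod_add_period [simp]: "T0 > 0 ==> pmod (t + T0) T0 = pmod t T0"
 using pmod_add_of_int[of T0 t 1] by simp

lemma pmod_id: "0 <= t ==> t < T0 ==> pmod t T0 = t"
 by (simp add: pmod_def floor_eq_iff)

lemma pmod_decomp: "t = pmod t T0 + of_int \<lfloor>t / T0\<rfloor> * T0"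
 by (simp add: pmod_def)

lemma pmod_measurable [measurable]: "(%t. pmod t T0) \<in> borel_measurable borel"
 unfolding pmod_def by measurable

lemma periodic_add_nat:
 fixes k :: "real => 'b"
 assumes "\<And>t. k (t + T0) = (k t :: 'b)" shows "k (t + real n * T0) = k t"
proof (induction n)
 case (Suc n)
 have "k (t + real (Suc n) * T0) = k ((t + real n * T0) + T0)" by (simp add: algebra_simps)
 thus ?case using assms Suc by simp
qed simp

lemma periodic_add_int:
 fixes k :: "real => 'b"
 assumes "\<And>t. k (t + T0) = (k t :: 'b)" shows "k (t + of_int n * T0) = k t"
proof (cases "n >= 0")
 case True
 thus ?thesis using periodic_add_nat[of k T0 t "nat n", OF assms] by simp
next
 case False
 thus ?thesis
  using periodic_add_nat[of k T0 "t + of_int n * T0" "nat (- n)", OF assms] by (simp add: algebra_simps)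
qed

lemma periodic_pmod:
 fixes k :: "real => 'b"
 assumes "\<And>t. k (t + T0) = (k t :: 'b)" shows "k (pmod t T0) = k t"
 using periodic_add_int[of k T0 "pmod t T0" "\<lfloor>t / T0\<rfloor>", OF assms] pmod_decomp[of t T0] by simp

lemma integral_shift_real:
 fixes k :: "real => real"
 shows "integral {a..b} (%t. k (t + c)) = integral {a + c..b + c} k"
proof -
 have "((%t. k (t + c)) has_integral I) {a..b}" if "(k has_integral I) {a + c..b + c}" for a b c I :: real and k :: "real => real"
  using has_integral_affinity'[of k I "a + c" "b + c" 1 c] that by (simp add: cbox_interval)
 from this[of k _ a c b] this[of "%t. k (t + c)" _ "a + c" "-c" "b + c"]
 have "((%t. k (t + c)) has_integral I) {a..b} \<longleftrightarrow> (k has_integral I) {a + c..b + c}" for I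
  by (auto simp: o_def)
 thus ?thesis
  unfolding integral_def integrable_on_def by simp
qed

lemma integral_shift_periodic:
 fixes k :: "real => real"
 assumes "\<And>t. k (t + T0) = k t"
 shows "integral {a + of_int n * T0..b + of_int n * T0} k = integral {a..b} k"
 using integral_shift_real[of a b k "of_int n * T0"] periodic_add_int[of k T0, OF assms] by simp

lemma indef_periodic_cell:
 assumes ind: "indef 0 T0 h k" and per: "\<And>t. h (t + T0) = h t" "\<And>t. k (t + T0) = k t"
 shows "indef (of_int n * T0) (of_int n * T0 + T0) h k"
 unfolding indef_def
proof (intro allI impI)
 fix u v assume "of_int n * T0 <= u" "u <= v" "v <= of_int n * T0 + T0"
 hence "h (u - of_int n * T0) = h (v - of_int n * T0) + integral {u - of_int n * T0..v - of_int n * T0} k"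
  by (intro indefD[OF ind]) auto
 thus "h u = h v + integral {u..v} k"
  using periodic_add_int[of h T0 _ n, OF per(1)] integral_shift_periodic[of k T0, OF per(2)]
  by (metis diff_add_cancel)
qed

lemma indef_periodic:
 assumes T0: "T0 > 0" and ind: "indef 0 T0 h k" and k: "bdd_borel k"
  and per: "\<And>t. h (t + T0) = h t" "\<And>t. k (t + T0) = k t"
 shows "indef a b h k"
 unfolding indef_def
proof (intro allI impI)
 note cell = indefD[OF indef_periodic_cell[OF ind per]]
 fix s t :: real assume "s <= t"
 thus "h s = h t + integral {s..t} k"
 proof (induction rule: Bolzano)
  case (trans a b c)
  thus ?case using integral_split[OF k, of a b c] by simp
 next
  case (local x)
  define n where "n = \<lfloor>x / T0\<rfloor>"
  define p where "p = pmod x T0"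
  have x: "x = p + of_int n * T0" "0 <= p" "p < T0"
   unfolding n_def p_def using pmod_bounds[OF T0, of x] pmod_decomp[of x T0] by auto
  define d where "d = min (T0 - p) (if p = 0 then T0 else p)"
  have "h u = h v + integral {u..v} k" if uv: "u <= x" "x <= v" "v - u < d" for u v
  proof -
   have "h x = h v + integral {x..v} k"
    using uv x by (intro cell[of n]) (auto simp: d_def)
   moreover have "h u = h x + integral {u..x} k"
   proof (cases "p = 0")
    case True
    thus ?thesis using uv x by (intro cell[of "n - 1"]) (auto simp: d_def algebra_simps)
   next
    case False
    thus ?thesis using uv x by (intro cell[of n]) (auto simp: d_def)
   qed
   ultimately show ?thesis using integral_split[OF k uv(1,2)] by simp
  qed
  moreover have "d > 0" using x T0 by (auto simp: d_def)
  ultimately show ?case by blast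
 qed
qed

lemma continuous_pmod_extension:
 fixes v :: "real => real"
 assumes T0: "T0 > 0" and v: "continuous_on {0..T0} v" "v 0 = v T0"
 shows "continuous_on UNIV (%t. v (pmod t T0))"
proof -
 have cell: "continuous_on {of_int n * T0..of_int n * T0 + T0} (%t. v (pmod t T0))" for n
 proof -
  have "continuous_on {of_int n * T0..of_int n * T0 + T0} (%t. v (t - of_int n * T0))"
   by (intro continuous_on_compose2[OF v(1)]) (auto intro!: continuous_intros)
  moreover have "v (t - of_int n * T0) = v (pmod t T0)" if t: "t \<in> {of_int n * T0..of_int n * T0 + T0}" for t
  proof (cases "t = of_int n * T0 + T0")
   case True
   hence "pmod t T0 = 0" using pmod_add_of_int[OF T0, of 0 "n + 1"] pmod_id[of 0 T0] T0
    by (simp add: algebra_simps)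
   thus ?thesis using True v by simp
  next
   case False
   hence "pmod (t - of_int n * T0) T0 = t - of_int n * T0" using t by (intro pmod_id) auto
   thus ?thesis using pmod_add_of_int[OF T0, of "t - of_int n * T0" n] by simp
  qed
  ultimately show ?thesis using continuous_on_cong[OF refl] by (metis (no_types, lifting))
 qed
 have "isCont (%t. v (pmod t T0)) x" for x
 proof -
  define n where "n = \<lfloor>x / T0\<rfloor>"
  have x: "x = pmod x T0 + of_int n * T0" unfolding n_def by (rule pmod_decomp)
  have "continuous_on ({of_int (n - 1) * T0..of_int (n - 1) * T0 + T0} \<union> {of_int n * T0..of_int n * T0 + T0})
    (%t. v (pmod t T0))"
   by (intro continuous_on_closed_Un cell) auto
  moreover have "{of_int (n - 1) * T0..of_int (n - 1) * T0 + T0} \<union> {of_int n * T0..of_int n * T0 + T0}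
    = {of_int (n - 1) * T0..of_int n * T0 + T0}"
   using T0 by (auto simp: algebra_simps)
  ultimately have "continuous_on {of_int (n - 1) * T0..of_int n * T0 + T0} (%t. v (pmod t T0))" by simp
  moreover have "x \<in> interior {of_int (n - 1) * T0..of_int n * T0 + T0}"
   using x pmod_bounds[OF T0, of x] T0 by (auto simp: interior_atLeastAtMost_real algebra_simps)
  ultimately show ?thesis
   by (meson continuous_on_interior)
 qed
 thus ?thesis by (simp add: continuous_at_imp_continuous_on)
qed

lemma periodic_extension:
 assumes T0: "T0 > 0" and h: "bdd_borel h" "h 0 = h T0"
 shows "bdd_borel (%t. h (pmod t T0))" "\<And>t. t \<in> {0..T0} ==> h (pmod t T0) = h t"
proof -
 obtain K where "\<And>t. abs (h t) <= K" using h(1) unfolding bdd_borel_def by blast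
 thus "bdd_borel (%t. h (pmod t T0))"
  using bdd_borel_measurable[OF h(1)] by (intro bdd_borelI[where K = K]) auto
 fix t assume t: "t \<in> {0..T0}"
 show "h (pmod t T0) = h t"
 proof (cases "t = T0")
  case True
  hence "pmod t T0 = 0" using pmod_add_period[OF T0, of 0] pmod_id[of 0 T0] T0 by simp
  thus ?thesis using True h by simp
 qed (use t pmod_id in auto)
qed

lemma integral_periods:
 assumes k: "bdd_borel k" "\<And>t. k (t + T0) = k t" and T0: "0 <= T0"
 shows "integral {0..real n * T0} k = real n * integral {0..T0} k"
proof (induction n)
 case (Suc n)
 have "integral {0..real (Suc n) * T0} k = integral {0..real n * T0} k + integral {real n * T0..real (Suc n) * T0} k"
  using T0 by (intro integral_split k) (auto simp: mult_right_mono)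
 moreover have "integral {real n * T0..real (Suc n) * T0} k = integral {0..T0} k"
  using integral_shift_periodic[of k T0 0 "int n" T0, OF k(2)] by (simp add: algebra_simps)
 ultimately show ?case using Suc by (simp add: algebra_simps)
qed simp

section \<open>Linear backward equations\<close>

definition clip :: "real => real => real" where
 "clip T t = max 0 (min T t)"

lemma clip_mem: "0 <= T ==> clip T t \<in> {0..T}"
 by (auto simp: clip_def)

lemma clip_id: "t \<in> {0..T} ==> clip T t = t"
 by (auto simp: clip_def)

lemma continuous_on_clip:
 assumes "0 <= T" "continuous_on {0..T} h" shows "continuous_on UNIV (%t. h (clip T t))"
 unfolding clip_def
 by (rule continuous_on_compose2[OF assms(2)]) (use assms(1) in \<open>auto intro!: continuous_intros\<close>)

lemma bdd_borel_clip:
 assumes "0 <= T" "continuous_on {0..T} h" shows "bdd_borel (%t. h (clip T t))"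
proof (rule bdd_borel_compose[where S = "{0..T}" and F = h])
 show "bdd_borel (clip T)"
  unfolding clip_def[abs_def] by (rule bdd_borelI[where K = T]) (use assms(1) in \<open>auto simp: abs_if\<close>)
qed (use assms clip_mem in auto)

lemma continuous_on_integral_upto:
 assumes "bdd_borel k" shows "continuous_on {0..T} (%t. integral {t..T} k)"
 using indefinite_integral_continuous_1'[OF bdd_borel_integrable[OF assms]] .

definition exp_weight :: "real => real => real => real" where
 "exp_weight g T t = exp (g * (T - clip T t))"

lemma exp_weight_eq: "t \<in> {0..T} ==> exp_weight g T t = exp (g * (T - t))"
 by (simp add: exp_weight_def clip_id)

lemma exp_weight_inverse: "exp_weight (- g) T t * (exp_weight g T t * v) = v" "exp_weight g T t * (exp_weight (- g) T t * v) = v"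
 by (simp_all add: exp_weight_def mult.assoc[symmetric] mult_exp_exp)

lemma bdd_borel_exp_weight: "0 <= T ==> bdd_borel (exp_weight g T)"
 unfolding exp_weight_def[abs_def]
 by (rule bdd_borel_clip[where h = "%t. exp (g * (T - t))"]) (auto intro!: continuous_intros)

lemma indef_exp_weight: "indef 0 T (exp_weight g T) (%t. g * exp_weight g T t)"
proof -
 have "indef 0 T (%t. exp (g * (T - t))) (%t. g * exp (g * (T - t)))"
  by (rule indef_of_deriv) (auto intro!: derivative_eq_intros)
 thus ?thesis
  by (subst indef_cong[of _ _ _ "%t. exp (g * (T - t))" _ "%t. g * exp (g * (T - t))"])
   (auto simp: exp_weight_eq)
qed

lemma integral_exp:
 fixes t T g :: real
 assumes "t <= T" "g > 0"
 shows "integral {t..T} (%u. exp (g * (T - u))) = (exp (g * (T - t)) - 1) / g"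
proof -
 have "((%u. exp (g * (T - u))) has_integral (- inverse g * exp (g * (T - T)) - (- inverse g * exp (g * (T - t))))) {t..T}"
  by (rule fundamental_theorem_of_calculus[OF assms(1)])
   (use assms(2) in \<open>auto simp: has_real_derivative_iff_has_vector_derivative[symmetric] intro!: derivative_eq_intros\<close>)
 from integral_unique[OF this] show ?thesis by (simp add: diff_divide_distrib inverse_eq_divide)
qed

lemma integral_power_upto:
 assumes "t <= T" shows "integral {t..T} (%u. (T - u) ^ k) = (T - t) ^ Suc k / real (Suc k)"
proof -
 have "((%u. (- 1 / real (Suc k)) * (T - u) ^ Suc k) has_real_derivative (T - u) ^ k) (at u within S)" for u S
 proof -
  have "((%u. (T - u) ^ Suc k) has_real_derivative (1 + real k) * (- 1 * (T - u) ^ k)) (at u within S)"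
   by (rule DERIV_power_Suc) (auto intro!: derivative_eq_intros)
  from DERIV_cmult[OF this, of "- 1 / real (Suc k)"] show ?thesis by (simp add: add.commute)
 qed
 hence "((%u. (T - u) ^ k) has_integral
   ((- 1 / real (Suc k)) * (T - T) ^ Suc k - (- 1 / real (Suc k)) * (T - t) ^ Suc k)) {t..T}"
  by (intro fundamental_theorem_of_calculus[OF assms])
   (simp only: has_real_derivative_iff_has_vector_derivative[symmetric])
 thus ?thesis by (simp add: integral_unique)
qed

definition lin_rhs :: "('a::finite => 'a tfun) => 'a tfun => 'a tfun => 'a tfun" where
 "lin_rhs a b h y u = (\<Sum>z\<in>UNIV. a y z u * h z u) + b y u"

lemma bdd_borel_lin_rhs:
 "(\<And>y z. bdd_borel (a y z)) ==> (\<And>y. bdd_borel (b y)) ==> (\<And>y. bdd_borel (h y)) ==> bdd_borel (lin_rhs a b h y)"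
 unfolding lin_rhs_def[abs_def] by (intro bdd_borel_intros)

definition lin_sol :: "('a::finite => 'a tfun) => 'a tfun => real => 'a tfun => bool" where
 "lin_sol a b T h \<longleftrightarrow> (\<forall>y. bdd_borel (h y) \<and> indef 0 T (h y) (lin_rhs a b h y))"

lemma lin_sol_bdd: "lin_sol a b T h ==> bdd_borel (h y)"
 by (simp add: lin_sol_def)

lemma lin_sol_indef: "lin_sol a b T h ==> indef 0 T (h y) (lin_rhs a b h y)"
 by (simp add: lin_sol_def)

lemma lin_sol_eq:
 "lin_sol a b T h ==> t \<in> {0..T} ==> h y t = h y T + integral {t..T} (lin_rhs a b h y)"
 using indefD[OF lin_sol_indef] by fastforce

lemma lin_sol_diff:
 assumes h: "lin_sol a b T h" "lin_sol a b' T h'" and a: "\<And>y z. bdd_borel (a y z)" and b: "\<And>y. bdd_borel (b y)" "\<And>y. bdd_borel (b' y)"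
 shows "lin_sol a (%y t. b y t - b' y t) T (%y t. h y t - h' y t)"
 unfolding lin_sol_def
proof (intro allI conjI)
 fix y
 show "bdd_borel (%t. h y t - h' y t)" using h by (intro bdd_borel_diff lin_sol_bdd)
 have "indef 0 T (%t. h y t + (-1) * h' y t) (%t. lin_rhs a b h y t + (-1) * lin_rhs a b' h' y t)"
  using h a b by (intro indef_add indef_cmult lin_sol_indef bdd_borel_lin_rhs bdd_borel_mult[OF bdd_borel_const]) (auto simp: lin_sol_bdd)
 thus "indef 0 T (%t. h y t - h' y t) (lin_rhs a (%y t. b y t - b' y t) (%y t. h y t - h' y t) y)"
  by (simp add: lin_rhs_def[abs_def] right_diff_distrib sum_subtractf algebra_simps)
qed

definition unweighted :: "real => real => (real => real^'a) => 'a tfun" where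
 "unweighted g T v y t = exp_weight g T t * v t $ y"

definition picard :: "('a::finite => 'a tfun) => 'a tfun => real => real => real^'a => (real => real^'a) => real => real^'a" where
 "picard a b T g \<xi> v t = (\<chi> y. exp_weight (- g) T t * (\<xi> $ y + integral {clip T t..T} (lin_rhs a b (unweighted g T v) y)))"

lemma norm_vec_le: "(\<And>y. abs (v $ y) <= K) ==> norm (v :: real^'a::finite) <= real CARD('a) * K"
 using norm_le_l1_cart[of v] sum_bounded_above[of UNIV "%y. abs (v $ y)" K] by simp

lemma clip_bcontfun:
 fixes F :: "'a::finite => real => real"
 assumes "0 <= T" "\<And>y. continuous_on {0..T} (F y)" shows "(%t. \<chi> y. F y (clip T t)) \<in> bcontfun"
proof -
 obtain K where "\<And>y t. abs (F y (clip T t)) <= K"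
  using bdd_borel_family_bound[of "%y t. F y (clip T t)"] bdd_borel_clip[OF assms] by metis
 thus ?thesis
  by (intro bcontfun_normI[where b = "real CARD('a) * K"] continuous_on_vec_lambda continuous_on_clip[OF assms] norm_vec_le) simp
qed

lemma bdd_borel_unweighted:
 assumes v: "v \<in> bcontfun" and "0 <= T" shows "bdd_borel (unweighted g T v y)"
proof -
 obtain K where K: "\<And>t. norm (v t) <= K" using v by (auto simp: bcontfun_def bounded_iff)
 have "bdd_borel (%t. v t $ y)"
 proof (rule bdd_borelI)
  show "abs (v t $ y) <= K" for t using component_le_norm_cart[of "v t" y] K[of t] by linarith
  show "(%t. v t $ y) \<in> borel_measurable borel"
   using v by (intro borel_measurable_continuous_onI continuous_on_component) (auto simp: bcontfun_def)
 qed
 thus ?thesis unfolding unweighted_def[abs_def] using assms(2) by (intro bdd_borel_intros bdd_borel_exp_weight)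
qed

definition sol_bound :: "real => real => real => real" where
 "sol_bound n C T = 2 * n * exp ((2 * n\<^sup>2 * C + 1) * T)"

context
 fixes a :: "'a::finite => 'a tfun" and b :: "'a tfun" and T C g :: real
 assumes T: "0 <= T" and a: "\<And>y z. bdd_borel (a y z)" "\<And>y z t. abs (a y z t) <= C" and b: "\<And>y. bdd_borel (b y)"
  and g: "g = 2 * (real CARD('a))\<^sup>2 * C + 1"
begin

lemma bdd_borel_rhs: "v \<in> bcontfun ==> bdd_borel (lin_rhs a b (unweighted g T v) y)"
 using T a b by (intro bdd_borel_lin_rhs bdd_borel_unweighted)

lemma picard_bcontfun: "v \<in> bcontfun ==> picard a b T g \<xi> v \<in> bcontfun"
 unfolding picard_def[abs_def] exp_weight_def
 by (intro clip_bcontfun[OF T, where F = "%y t. exp (- g * (T - t)) * (\<xi> $ y + integral {t..T} (lin_rhs a b (unweighted g T v) y))"]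
   continuous_intros continuous_on_integral_upto bdd_borel_rhs)

lemma picard_contraction:
 fixes u v :: "real \<Rightarrow>\<^sub>C (real^'a)"
 shows "dist (picard a b T g \<xi> u t) (picard a b T g \<xi> v t) <= 1 / 2 * dist u v"
proof -
 let ?n = "real CARD('a)"
 have C: "0 <= C" using a(2) by (meson abs_ge_zero order_trans)
 define s where "s = clip T t"
 have s: "s \<in> {0..T}" unfolding s_def by (rule clip_mem[OF T])
 have g_pos: "0 < g" using C by (simp add: g add_nonneg_pos)
 have rhs: "abs (lin_rhs a b (unweighted g T u) y r - lin_rhs a b (unweighted g T v) y r) <= (?n * C * dist u v) * exp (g * (T - r))"
  if r: "r \<in> {s..T}" for y r
 proof -
  have "abs (u r $ z - v r $ z) <= dist u v" for z
   using component_le_norm_cart[of "u r - v r" z] dist_bounded[of u r v] by (simp add: dist_norm)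
  hence "abs (a y z r * (exp_weight g T r * (u r $ z - v r $ z))) <= C * (exp (g * (T - r)) * dist u v)" for z
   using r s a(2) C by (auto simp: abs_mult exp_weight_eq intro!: mult_mono)
  hence "abs (\<Sum>z\<in>UNIV. a y z r * (exp_weight g T r * (u r $ z - v r $ z))) <= (\<Sum>z\<in>(UNIV::'a set). C * (exp (g * (T - r)) * dist u v))"
   by (intro order_trans[OF sum_abs sum_mono])
  also have "... = (?n * C * dist u v) * exp (g * (T - r))" by (simp add: mult_ac)
  finally show ?thesis by (simp add: lin_rhs_def unweighted_def sum_subtractf[symmetric] right_diff_distrib[symmetric])
 qed
 have "abs ((picard a b T g \<xi> u t - picard a b T g \<xi> v t) $ y) <= ?n * C * dist u v / g" for y
 proof -
  let ?d = "%r. lin_rhs a b (unweighted g T u) y r - lin_rhs a b (unweighted g T v) y r"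
  have "(picard a b T g \<xi> u t - picard a b T g \<xi> v t) $ y = exp (- g * (T - s)) * integral {s..T} ?d"
   using apply_bcontfun[of u] apply_bcontfun[of v]
   by (simp add: picard_def exp_weight_def s_def[symmetric] integral_bdd_diff bdd_borel_rhs right_diff_distrib distrib_left)
  hence "abs ((picard a b T g \<xi> u t - picard a b T g \<xi> v t) $ y) = exp (- g * (T - s)) * abs (integral {s..T} ?d)"
   by (simp only: abs_mult abs_exp_cancel)
  also have "... <= exp (- g * (T - s)) * integral {s..T} (%r. (?n * C * dist u v) * exp (g * (T - r)))"
  proof (intro mult_left_mono exp_ge_zero abs_integral_bound)
   show "?d integrable_on {s..T}"
    by (intro bdd_borel_integrable bdd_borel_diff bdd_borel_rhs apply_bcontfun)
   show "(%r. (?n * C * dist u v) * exp (g * (T - r))) integrable_on {s..T}"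
    by (intro integrable_continuous_real continuous_intros)
  qed (rule rhs)
  also have "... = exp (- g * (T - s)) * ((?n * C * dist u v) * ((exp (g * (T - s)) - 1) / g))"
   using s g_pos by (simp only: integral_mult_right integral_exp atLeastAtMost_iff)
  also have "... = ?n * C * dist u v * (exp (- g * (T - s)) * (exp (g * (T - s)) - 1)) / g" by simp
  also have "exp (- g * (T - s)) * (exp (g * (T - s)) - 1) = 1 - exp (- g * (T - s))"
   by (simp add: right_diff_distrib mult_exp_exp)
  also have "?n * C * dist u v * (1 - exp (- g * (T - s))) / g <= ?n * C * dist u v / g"
   using C g_pos s by (intro divide_right_mono mult_left_le) auto
  finally show ?thesis .
 qed
 hence "dist (picard a b T g \<xi> u t) (picard a b T g \<xi> v t) <= ?n * (?n * C * dist u v / g)"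
  unfolding dist_norm by (rule norm_vec_le)
 also have "... <= 1 / 2 * dist u v"
  using C g_pos mult_right_mono[of "2 * ?n\<^sup>2 * C" g "dist u v"] by (simp add: g field_simps power2_eq_square)
 finally show ?thesis .
qed

lemma picard_fixpoint_exists:
 fixes S :: "(real \<Rightarrow>\<^sub>C (real^'a)) set"
 assumes "closed S" "S \<noteq> {}" and S: "\<And>v. v \<in> S ==> Bcontfun (picard a b T g \<xi> v) \<in> S"
 obtains v where "v \<in> S" "picard a b T g \<xi> v = v"
proof -
 have app: "apply_bcontfun (Bcontfun (picard a b T g \<xi> v)) = picard a b T g \<xi> v" for v :: "real \<Rightarrow>\<^sub>C (real^'a)"
  by (intro Bcontfun_inverse picard_bcontfun apply_bcontfun)
 have "\<exists>!v\<in>S. Bcontfun (picard a b T g \<xi> v) = v"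
 proof (rule Banach_fix[where c = "1 / 2"])
  show "dist (Bcontfun (picard a b T g \<xi> u)) (Bcontfun (picard a b T g \<xi> v)) <= 1 / 2 * dist u v" for u v :: "real \<Rightarrow>\<^sub>C (real^'a)"
   using picard_contraction by (intro dist_bound) (simp add: app)
 qed (use assms in \<open>auto simp: complete_eq_closed\<close>)
 thus ?thesis using that app by metis
qed

lemma picard_fixpoint_unique:
 fixes u v :: "real \<Rightarrow>\<^sub>C (real^'a)"
 assumes "picard a b T g \<xi> u = u" "picard a b T g \<xi> v = v" shows "u = v"
proof -
 have "dist u v <= 1 / 2 * dist u v" using picard_contraction[of \<xi> u _ v] assms by (intro dist_bound) simp
 thus ?thesis by simp
qed

lemma lin_sol_of_fixpoint:
 fixes v :: "real \<Rightarrow>\<^sub>C (real^'a)"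
 assumes v: "picard a b T g \<xi> v = v"
 shows "lin_sol a b T (unweighted g T v)" "unweighted g T v y T = \<xi> $ y"
proof -
 have integral_eq: "unweighted g T v y t = \<xi> $ y + integral {t..T} (lin_rhs a b (unweighted g T v) y)" if "t \<in> {0..T}" for y t
  using arg_cong[OF v, of "%v. exp_weight g T t * v t $ y"] that
  by (simp add: picard_def exp_weight_inverse unweighted_def clip_id)
 show "lin_sol a b T (unweighted g T v)"
  unfolding lin_sol_def using apply_bcontfun[of v] T integral_eq
  by (auto intro!: bdd_borel_unweighted indefI_terminal bdd_borel_rhs)
 show "unweighted g T v y T = \<xi> $ y" using integral_eq[of T y] T by simp
qed

lemma fixpoint_of_lin_sol:
 assumes h: "lin_sol a b T h"
 obtains v :: "real \<Rightarrow>\<^sub>C (real^'a)"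
 where "picard a b T g (\<chi> y. h y T) v = v" "\<And>y t. t \<in> {0..T} ==> unweighted g T v y t = h y t"
proof -
 define w where "w t = (\<chi> y. exp (- g * (T - clip T t)) * h y (clip T t))" for t
 have "bdd_borel (lin_rhs a b h y)" for y by (intro bdd_borel_lin_rhs a b lin_sol_bdd[OF h])
 from indef_continuous_on[OF lin_sol_indef[OF h] this] have "w \<in> bcontfun"
  unfolding w_def[abs_def] by (intro clip_bcontfun[OF T, where F = "%y t. exp (- g * (T - t)) * h y t"] continuous_intros)
 hence w: "apply_bcontfun (Bcontfun w) = w" by (rule Bcontfun_inverse)
 have hw: "unweighted g T w y t = h y t" if "t \<in> {0..T}" for y t
  using that by (simp add: unweighted_def w_def exp_weight_eq clip_id mult.assoc[symmetric] mult_exp_exp)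
 have "picard a b T g (\<chi> y. h y T) w t $ y = w t $ y" for t y
 proof -
  note s = clip_mem[OF T, of t]
  have "integral {clip T t..T} (lin_rhs a b (unweighted g T w) y) = integral {clip T t..T} (lin_rhs a b h y)"
   using s by (intro Henstock_Kurzweil_Integration.integral_cong) (auto simp: lin_rhs_def hw)
  thus ?thesis using lin_sol_eq[OF h s, of y] by (simp add: picard_def w_def exp_weight_def)
 qed
 hence "picard a b T g (\<chi> y. h y T) w = w" by (simp add: vec_eq_iff fun_eq_iff)
 thus ?thesis using that[of "Bcontfun w"] hw by (simp add: w)
qed

lemma lin_sol_exists: obtains h where "lin_sol a b T h" "\<And>y. h y T = \<xi> $ y"
proof -
 obtain v :: "real \<Rightarrow>\<^sub>C (real^'a)" where "picard a b T g \<xi> v = v"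
  by (rule picard_fixpoint_exists[of UNIV \<xi>]) auto
 thus ?thesis using that lin_sol_of_fixpoint by blast
qed

lemma lin_sol_nonneg:
 assumes h: "lin_sol a b T h" "\<And>y. 0 <= h y T" and nonneg: "\<And>y z t. 0 <= a y z t" "\<And>y t. 0 <= b y t" and t: "t \<in> {0..T}"
 shows "0 <= h y t"
proof -
 obtain v :: "real \<Rightarrow>\<^sub>C (real^'a)" where v: "picard a b T g (\<chi> y. h y T) v = v" "\<And>y t. t \<in> {0..T} ==> unweighted g T v y t = h y t"
  using that by (rule fixpoint_of_lin_sol[OF h(1)])
 let ?S = "PiC UNIV (%_. {x. \<forall>y. 0 <= x $ y}) :: (real \<Rightarrow>\<^sub>C (real^'a)) set"
 have "picard a b T g (\<chi> y. h y T) u t $ y >= 0" if "u \<in> ?S" for u t y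
  using that nonneg h(2) bdd_borel_rhs[OF apply_bcontfun[of u]]
  by (auto simp: picard_def lin_rhs_def unweighted_def exp_weight_def mem_PiC_iff Pi_iff
    intro!: mult_nonneg_nonneg add_nonneg_nonneg integral_nonneg bdd_borel_integrable sum_nonneg)
 hence invariant: "Bcontfun (picard a b T g (\<chi> y. h y T) u) \<in> ?S" if "u \<in> ?S" for u
  using that by (simp add: mem_PiC_iff Bcontfun_inverse[OF picard_bcontfun[OF apply_bcontfun]])
 have "closed ?S"
  by (intro closed_PiC closed_Collect_all closed_Collect_le continuous_intros)
 moreover have "0 \<in> ?S" by (simp add: mem_PiC_iff)
 ultimately obtain u where "u \<in> ?S" "picard a b T g (\<chi> y. h y T) u = u"
  using picard_fixpoint_exists[OF _ _ invariant] by blast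
 hence "v \<in> ?S" using picard_fixpoint_unique[OF v(1)] by blast
 hence "0 <= unweighted g T v y t" by (simp add: unweighted_def exp_weight_def mem_PiC_iff Pi_iff)
 thus ?thesis by (simp only: v(2)[OF t])
qed

lemma lin_sol_bound:
 assumes h: "lin_sol a b T h" "\<And>y. abs (h y T) <= m" and D: "\<And>y t. abs (b y t) <= D" and t: "t \<in> {0..T}"
 shows "abs (h y t) <= sol_bound (real CARD('a)) C T * (m + D * T)"
proof -
 let ?n = "real CARD('a)"
 obtain v :: "real \<Rightarrow>\<^sub>C (real^'a)" where v: "picard a b T g (\<chi> y. h y T) v = v" "\<And>y t. t \<in> {0..T} ==> unweighted g T v y t = h y t"
  using that by (rule fixpoint_of_lin_sol[OF h(1)])
 have g_nonneg: "0 <= g" using order_trans[OF abs_ge_zero a(2)] by (simp add: g)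
 have D0: "0 <= D" using order_trans[OF abs_ge_zero D] .
 have m_nonneg: "0 <= m" using order_trans[OF abs_ge_zero h(2)] .
 have "abs (picard a b T g (\<chi> y. h y T) (apply_bcontfun 0) s $ y) <= 1 * (m + D * T)" for s y
 proof -
  have "abs (integral {clip T s..T} (b y)) <= D * (T - clip T s)" using clip_mem[OF T, of s] by (intro abs_integral_le b D) auto
  also have "... <= D * T" using clip_mem[OF T, of s] D0 by (intro mult_left_mono) auto
  finally have "abs (h y T + integral {clip T s..T} (b y)) <= m + D * T" using h(2)[of y] by linarith
  moreover have "exp (- g * (T - clip T s)) <= 1" using clip_mem[OF T, of s] g_nonneg by simp
  ultimately have "exp (- g * (T - clip T s)) * abs (h y T + integral {clip T s..T} (b y)) <= 1 * (m + D * T)"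
   by (intro mult_mono abs_ge_zero zero_le_one)
  moreover have "picard a b T g (\<chi> y. h y T) (apply_bcontfun 0) s $ y = exp (- g * (T - clip T s)) * (h y T + integral {clip T s..T} (b y))"
   by (simp add: picard_def lin_rhs_def[abs_def] unweighted_def exp_weight_def)
  ultimately show ?thesis by (simp only: abs_mult abs_exp_cancel)
 qed
 from norm_vec_le[OF this] have at_zero: "norm (picard a b T g (\<chi> y. h y T) (apply_bcontfun 0) s) <= ?n * (m + D * T)" for s
  by simp
 have increment: "norm (v s - picard a b T g (\<chi> y. h y T) (apply_bcontfun 0) s) <= 1 / 2 * norm v" for s
  using picard_contraction[of "\<chi> y. h y T" v s 0] v(1) by (simp add: dist_norm)
 have "norm (v s) <= 1 / 2 * norm v + ?n * (m + D * T)" for s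
  using at_zero[of s] increment[of s] norm_triangle_sub[of "v s" "picard a b T g (\<chi> y. h y T) (apply_bcontfun 0) s"] by linarith
 hence "norm v <= 1 / 2 * norm v + ?n * (m + D * T)" by (rule norm_bound)
 hence "norm v <= 2 * ?n * (m + D * T)" by simp
 hence "abs (v t $ y) <= 2 * ?n * (m + D * T)"
  using component_le_norm_cart[of "v t" y] norm_bounded[of v t] by linarith
 moreover have "exp (g * (T - t)) <= exp (g * T)" using t g_nonneg by (simp add: mult_left_mono)
 ultimately have "exp (g * (T - t)) * abs (v t $ y) <= exp (g * T) * (2 * ?n * (m + D * T))" by (intro mult_mono) auto
 also have "exp (g * T) * (2 * ?n * (m + D * T)) = sol_bound ?n C T * (m + D * T)"
  by (simp add: sol_bound_def g)
 finally show ?thesis using v(2)[OF t, of y, symmetric] t by (simp add: unweighted_def exp_weight_eq abs_mult)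
qed

end

lemma lin_sol_solution_map:
 fixes a :: "'v::finite => 'v tfun"
 assumes T: "0 <= T" and a: "\<And>y z. bdd_borel (a y z)" "\<And>y z t. abs (a y z t) <= C" and b: "\<And>y. bdd_borel (b y)"
 obtains hs :: "real^'v => 'v tfun" where
  "\<And>\<xi>. lin_sol a b T (hs \<xi>)" "\<And>\<xi> y. hs \<xi> y T = \<xi> $ y"
  "\<And>S. continuous_on S (%\<xi>. \<chi> y. hs \<xi> y 0)"
proof -
 let ?U = "sol_bound (real CARD('v)) C T"
 have "\<exists>h. lin_sol a b T h \<and> (\<forall>y. h y T = \<xi> $ y)" for \<xi>
  by (rule lin_sol_exists[where a = a and b = b and \<xi> = \<xi>, OF T a b refl]) blast
 then obtain hs :: "real^'v => 'v tfun" where hs: "\<And>\<xi>. lin_sol a b T (hs \<xi>)" "\<And>\<xi> y. hs \<xi> y T = \<xi> $ y" by metis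
 have "dist (hs \<xi> y 0) (hs \<xi>' y 0) <= ?U * dist \<xi> \<xi>'" for \<xi> \<xi>' y
 proof -
  have "lin_sol a (%_ _. 0) T (%y t. hs \<xi> y t - hs \<xi>' y t)" using lin_sol_diff[OF hs(1) hs(1) a(1) b b] by simp
  hence "abs (hs \<xi> y 0 - hs \<xi>' y 0) <= ?U * (norm (\<xi> - \<xi>') + 0 * T)"
   by (rule lin_sol_bound[OF T a bdd_borel_const refl]) (use T component_le_norm_cart[of "\<xi> - \<xi>'"] in \<open>auto simp: hs\<close>)
  thus ?thesis by (simp add: dist_real_def dist_norm)
 qed
 hence "continuous_on S (%\<xi>. hs \<xi> y 0)" for S y
  by (intro lipschitz_on_continuous_on[of ?U] lipschitz_onI) (auto simp: sol_bound_def)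
 hence "continuous_on S (%\<xi>. \<chi> y. hs \<xi> y 0)" for S by (intro continuous_on_vec_lambda)
 thus ?thesis using that hs by blast
qed

definition diag_shift :: "real => ('a => 'a tfun) => 'a => 'a tfun" where
 "diag_shift g a y z t = a y z t + (if y = z then g else 0)"

lemma bdd_borel_diag_shift: "bdd_borel (a y z) ==> bdd_borel (diag_shift g a y z)"
 unfolding diag_shift_def[abs_def] by (intro bdd_borel_intros)

lemma lin_sol_exp_weight:
 fixes a :: "'a::finite => 'a tfun"
 assumes sol: "lin_sol a (%_ _. 0) T h" and T: "0 <= T" and a: "\<And>y z. bdd_borel (a y z)"
 shows "lin_sol (diag_shift g a) (%_ _. 0) T (%y t. exp_weight g T t * h y t)"
 unfolding lin_sol_def
proof (intro allI conjI)
 fix y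
 note h = lin_sol_bdd[OF sol] and weight = bdd_borel_exp_weight[OF T]
 show "bdd_borel (%t. exp_weight g T t * h y t)" by (intro bdd_borel_intros weight h)
 have "indef 0 T (%t. exp_weight g T t * h y t)
  (%t. (g * exp_weight g T t) * h y t + exp_weight g T t * lin_rhs a (%_ _. 0) h y t)"
  by (intro indef_mult indef_exp_weight lin_sol_indef[OF sol] bdd_borel_intros weight h bdd_borel_lin_rhs a)
 moreover have "lin_rhs (diag_shift g a) (%_ _. 0) (%y t. exp_weight g T t * h y t) y
  = (%t. (g * exp_weight g T t) * h y t + exp_weight g T t * lin_rhs a (%_ _. 0) h y t)"
 proof
  fix t
  have "(\<Sum>z\<in>UNIV. diag_shift g a y z t * (exp_weight g T t * h z t))
   = (\<Sum>z\<in>UNIV. exp_weight g T t * (a y z t * h z t) + (if y = z then g * exp_weight g T t * h z t else 0))"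
   by (intro sum.cong) (auto simp: diag_shift_def algebra_simps)
  thus "lin_rhs (diag_shift g a) (%_ _. 0) (%y t. exp_weight g T t * h y t) y t
   = (g * exp_weight g T t) * h y t + exp_weight g T t * lin_rhs a (%_ _. 0) h y t"
   by (simp add: lin_rhs_def sum.distrib sum_distrib_left)
 qed
 ultimately show "indef 0 T (%t. exp_weight g T t * h y t) (lin_rhs (diag_shift g a) (%_ _. 0) (%y t. exp_weight g T t * h y t) y)"
  by simp
qed

definition coupled :: "('a \<times> 'a) set => real => real => ('a::finite => 'a tfun) => bool" where
 "coupled E c C a \<longleftrightarrow> (\<forall>y z. bdd_borel (a y z)) \<and> (\<forall>y z t. abs (a y z t) <= C) \<and>
  (\<forall>y z t. y \<noteq> z --> 0 <= a y z t) \<and> (\<forall>y z t. (y, z) \<in> E --> c <= a y z t)"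

lemma coupledD:
 assumes "coupled E c C a"
 shows "bdd_borel (a y z)" "abs (a y z t) <= C" "y \<noteq> z ==> 0 <= a y z t" "(y, z) \<in> E ==> c <= a y z t"
 using assms unfolding coupled_def by blast+

lemma coupled_diag_shift:
 assumes "coupled E c C a" and irr: "\<And>y. (y, y) \<notin> E"
 shows "coupled E c (2 * C) (diag_shift C a)" "0 <= diag_shift C a y z t"
proof -
 note a = coupledD[OF assms(1)]
 show nonneg: "0 <= diag_shift C a y z t" for y z t
  using a(2)[of y z t] a(3)[of y z t] by (cases "y = z") (auto simp: diag_shift_def abs_le_iff)
 show "coupled E c (2 * C) (diag_shift C a)"
  unfolding coupled_def
 proof (intro conjI allI impI)
  show "abs (diag_shift C a y z t) <= 2 * C" for y z t using a(2)[of y z t] by (auto simp: diag_shift_def)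
  show "c <= diag_shift C a y z t" if "(y, z) \<in> E" for y z t using a(4)[OF that] that irr by (auto simp: diag_shift_def)
 qed (auto intro: nonneg bdd_borel_diag_shift a(1))
qed

lemma coupled_sol_nonneg:
 assumes "coupled E c C a" "\<And>y z t. 0 <= a y z t" "lin_sol a (%_ _. 0) T h" "\<forall>y. 0 <= h y T" "t \<in> {0..T}"
 shows "0 <= h y t"
proof (rule lin_sol_nonneg[where a = a and b = "%_ _. 0" and C = C, OF _ _ _ _ refl assms(3)])
 show "0 <= T" using assms(5) by simp
qed (use coupledD[OF assms(1)] assms in auto)

lemma coupled_sol_ge_integral:
 assumes cp: "coupled E c C a" and a0: "\<And>y z t. 0 <= a y z t" and sol: "lin_sol a (%_ _. 0) T h"
  and hT: "\<forall>y. 0 <= h y T" and t: "t \<in> {0..T}" and d: "\<And>u. d <= a y z u"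
 shows "h y T + integral {t..T} (%u. d * h z u) <= h y t"
proof -
 note a = coupledD(1)[OF cp] and nonneg = coupled_sol_nonneg[OF cp a0 sol hT]
 have "integral {t..T} (%u. d * h z u) <= integral {t..T} (lin_rhs a (%_ _. 0) h y)"
 proof (intro integral_bdd_mono bdd_borel_intros bdd_borel_lin_rhs a lin_sol_bdd[OF sol])
  fix u assume "u \<in> {t..T}"
  hence u: "0 <= h x u" for x using t by (intro nonneg) auto
  have "d * h z u <= a y z u * h z u" using d u by (intro mult_right_mono)
  also have "... <= (\<Sum>z\<in>UNIV. a y z u * h z u)" using u a0 by (intro member_le_sum) auto
  finally show "d * h z u <= lin_rhs a (%_ _. 0) h y u" by (simp add: lin_rhs_def)
 qed
 thus ?thesis using lin_sol_eq[OF sol t, of y] by simp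
qed

lemma harnack_along_path:
 fixes E :: "('a::finite \<times> 'a) set"
 assumes yz: "(y, z) \<in> E\<^sup>*" and c: "c > 0"
 shows "\<exists>K>0. \<exists>k. \<forall>a h t. coupled E c C a --> (\<forall>y z t. 0 <= a y z t) --> lin_sol a (%_ _. 0) T h --> (\<forall>y. 0 <= h y T) -->
  t \<in> {0..T} --> K * (T - t) ^ k * h z T <= h y t"
 using yz
proof (induction rule: converse_rtrancl_induct)
 case base
 have "h z T <= h z t"
  if "coupled E c C a" "\<And>y z t. 0 <= a y z t" "lin_sol a (%_ _. 0) T h" "\<forall>y. 0 <= h y T" "t \<in> {0..T}" for a h t
  using coupled_sol_ge_integral[OF that, where d = 0 and y = z] that(2) by simp
 thus ?case by (intro exI[of _ 1] conjI exI[of _ 0]) auto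
next
 case (step y y')
 then obtain K k where K: "K > 0"
  and comparison: "\<And>a h t. coupled E c C a ==> (\<forall>y z t. 0 <= a y z t) ==> lin_sol a (%_ _. 0) T h ==> (\<forall>y. 0 <= h y T) ==>
   t \<in> {0..T} ==> K * (T - t) ^ k * h z T <= h y' t" by blast
 have "c * K / real (Suc k) * (T - t) ^ Suc k * h z T <= h y t"
  if a: "coupled E c C a" "\<forall>y z t. 0 <= a y z t" and h: "lin_sol a (%_ _. 0) T h" "\<forall>y. 0 <= h y T" and t: "t \<in> {0..T}" for a h t
 proof -
  have "c * K / real (Suc k) * (T - t) ^ Suc k * h z T = (c * K * h z T) * integral {t..T} (%u. (T - u) ^ k)"
   using t by (subst integral_power_upto) auto
  also have "... = integral {t..T} (%u. (c * K * h z T) * (T - u) ^ k)"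
   by (simp only: integral_mult_right)
  also have "... <= integral {t..T} (%u. c * h y' u)"
  proof (rule integral_le)
   show "(%u. (c * K * h z T) * (T - u) ^ k) integrable_on {t..T}"
    by (intro integrable_continuous_real continuous_intros)
   show "(%u. c * h y' u) integrable_on {t..T}"
    by (intro bdd_borel_integrable bdd_borel_intros lin_sol_bdd[OF h(1)])
   fix u assume "u \<in> {t..T}"
   thus "(c * K * h z T) * (T - u) ^ k <= c * h y' u"
    using comparison[OF a h, of u] t c by (auto simp: mult_ac)
  qed
  also have "... <= h y t"
   using coupled_sol_ge_integral[OF a(1) _ h t, of c y y'] a(2) coupledD(4)[OF a(1) step.hyps(1)] h(2)[rule_format, of y] by fastforce
  finally show ?thesis .
 qed
 thus ?case
  using K c by (intro exI[of _ "c * K / real (Suc k)"] conjI exI[of _ "Suc k"]) auto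
qed

lemma harnack:
 fixes E :: "('a::finite \<times> 'a) set"
 assumes conn: "\<And>y z. (y, z) \<in> E\<^sup>*" and c: "c > 0" and T: "0 < T" and irr: "\<And>y. (y, y) \<notin> E"
 obtains \<kappa> where "\<kappa> > 0" "\<kappa> <= 1"
  "\<And>a h y z. coupled E c C a ==> lin_sol a (%_ _. 0) T h ==> \<forall>y. 0 <= h y T ==> \<kappa> * h z T <= h y 0"
  "\<And>a h y t. coupled E c C a ==> lin_sol a (%_ _. 0) T h ==> \<forall>y. 0 <= h y T ==> t \<in> {0..T} ==> \<kappa> * h y T <= h y t"
proof -
 define P where "P y z K k \<longleftrightarrow> (\<forall>a h t. coupled E c (2 * C) a --> (\<forall>y z t. 0 <= a y z t) --> lin_sol a (%_ _. 0) T h -->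
  (\<forall>y. 0 <= h y T) --> t \<in> {0..T} --> K * (T - t) ^ k * h z T <= h y t)" for y z :: 'a and K k
 have "\<exists>K>0. \<exists>k. P y z K k" for y z unfolding P_def by (rule harnack_along_path[OF conn c])
 then obtain K k where K: "\<And>y z. K y z > 0" and P: "\<And>y z. P y z (K y z) (k y z)" by metis
 note harnack_le = P[unfolded P_def, rule_format]
 let ?L = "insert 1 (range (%(y, z). K y z * T ^ k y z))"
 define m where "m = Min ?L"
 define \<kappa> where "\<kappa> = min 1 (exp (- abs C * T) * m)"
 have m_pos: "0 < m" unfolding m_def using K T by (subst Min_gr_iff) auto
 have m_le: "m <= l" if "l \<in> ?L" for l unfolding m_def by (rule Min_le[OF _ that]) simp
 have weighted: "\<kappa> * v <= h y t" if "t \<in> {0..T}" "0 <= C" "0 <= v" "l * v <= exp_weight C T t * h y t"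
   "l \<in> ?L" for h :: "'a tfun" and y t v l
 proof -
  have "\<kappa> * v <= (exp (- C * T) * l) * v"
   using that m_le[of l] unfolding \<kappa>_def by (intro mult_right_mono min.coboundedI2 mult_left_mono) auto
  also have "... <= exp (- C * T) * (exp_weight C T t * h y t)"
   using that(4) by (simp add: mult.assoc)
  also have "... = exp (- (C * t)) * h y t"
   using that(1) by (simp add: exp_weight_eq mult.assoc[symmetric] mult_exp_exp right_diff_distrib)
  also have "... <= h y t"
  proof -
   have "0 <= l" using that(5) K T by (auto simp: less_imp_le)
   hence "0 <= exp_weight C T t * h y t" using that(3,4) by (meson mult_nonneg_nonneg order_trans)
   hence "0 <= h y t" by (simp add: exp_weight_def zero_le_mult_iff)
   thus ?thesis using that(1,2) by (intro mult_left_le_one_le) auto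
  qed
  finally show ?thesis .
 qed
 show ?thesis
 proof (rule that)
  show "\<kappa> > 0" "\<kappa> <= 1" using m_pos by (auto simp: \<kappa>_def)
  fix a h assume a: "coupled E c C a" and h: "lin_sol a (%_ _. 0) T h" "\<forall>y. 0 <= h y T"
  have C: "0 <= C" using coupledD(2)[OF a] by (meson abs_ge_zero order_trans)
  note shifted = coupled_diag_shift[OF a irr]
  note sol = lin_sol_exp_weight[OF h(1) less_imp_le[OF T] coupledD(1)[OF a], of C]
  have hT: "exp_weight C T T * h y T = h y T" for y using T by (simp add: exp_weight_eq)
  show "\<kappa> * h z T <= h y 0" for y z
   using harnack_le[OF shifted(1) _ sol, of 0 y z] shifted(2) h(2) hT T C by (intro weighted[where l = "K y z * T ^ k y z"]) auto
  show "\<kappa> * h y T <= h y t" if t: "t \<in> {0..T}" for y t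
   using coupled_sol_ge_integral[OF shifted sol _ t, of 0 y y] shifted(2) h(2) hT t C by (intro weighted[where l = 1]) auto
 qed
qed

section \<open>Additive functionals of step paths\<close>

lemma left_lim_eqI:
 assumes "eventually (%s. X s = y) (at_left t)" shows "left_lim X t = y"
 unfolding left_lim_def
proof (rule the_equality[where P = "%y. eventually (%s. X s = y) (at_left t)", OF assms])
 fix z assume "eventually (%s. X s = z) (at_left t)"
 with assms have "eventually (%s. y = z) (at_left t)" by eventually_elim simp
 thus "z = y" by (simp add: eventually_const_iff trivial_limit_at_left_real)
qed

lemma left_lim_const:
 fixes t :: real
 assumes "u < t" "\<And>s. s \<in> {u<..<t} ==> X s = y" shows "left_lim X t = y"
 by (rule left_lim_eqI) (use assms in \<open>auto simp: eventually_at_left_field\<close>)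

lemma cadlag_left:
 assumes "cadlag X" "t > 0"
 obtains u where "u < t" "\<And>s. s \<in> {u<..<t} ==> X s = left_lim X t"
proof -
 obtain y where y: "eventually (%s. X s = y) (at_left t)" using assms unfolding cadlag_def by blast
 thus ?thesis
  using that left_lim_eqI[OF y] unfolding eventually_at_left_field by auto
qed

lemma cadlag_right:
 assumes "cadlag X" "t >= 0"
 obtains v where "v > t" "\<And>s. s \<in> {t..<v} ==> X s = X t"
proof -
 obtain b where "b > t" "\<forall>y>t. y < b --> X y = X t"
  using assms unfolding cadlag_def eventually_at_right_field by blast
 thus ?thesis
  by (intro that[of b]) (auto simp: less_eq_real_def)
qed

lemma cadlag_locally_const:
 assumes X: "cadlag X" and x: "0 <= x"
 obtains e where "e > 0" "\<And>s. x <= s ==> s < x + e ==> X s = X x"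
  "\<And>s. 0 <= s ==> x - e < s ==> s < x ==> X s = left_lim X x"
proof -
 obtain v where v: "v > x" "\<And>s. s \<in> {x..<v} ==> X s = X x" using cadlag_right[OF X x] by blast
 obtain u where u: "u < x" "\<And>s. 0 <= s ==> s \<in> {u<..<x} ==> X s = left_lim X x"
 proof (cases "x = 0")
  case True
  thus ?thesis by (intro that[of "- 1"]) auto
 next
  case False
  hence "0 < x" using x by simp
  then obtain w where "w < x" "\<And>s. s \<in> {w<..<x} ==> X s = left_lim X x" using cadlag_left[OF X] by blast
  thus ?thesis by (rule that)
 qed
 show ?thesis by (rule that[of "min (v - x) (x - u)"]) (use u(1) v(1) in simp, (rule u v, simp_all)+)
qed

lemma cadlag_no_jump_const:
 assumes X: "cadlag X" and ab: "0 <= a" "a <= b" and no_jump: "\<And>t. a < t ==> t <= b ==> left_lim X t = X t"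
 shows "X b = X a"
proof -
 define P where "P u v \<longleftrightarrow> (a <= u --> v <= b --> X v = X u)" for u v
 have "P a b"
 proof (rule Bolzano[OF ab(2)])
  show "P u w" if "P u v" "P v w" "u <= v" "v <= w" for u v w
   using that unfolding P_def by auto
  fix x assume x: "a <= x" "x <= b"
  obtain e where e: "e > 0" "\<And>s. x <= s ==> s < x + e ==> X s = X x"
   "\<And>s. 0 <= s ==> x - e < s ==> s < x ==> X s = left_lim X x"
   using cadlag_locally_const[OF X order_trans[OF ab(1) x(1)]] by metis
  have "P c d" if cd: "c <= x" "x <= d" "d - c < e" for c d
   unfolding P_def
  proof (intro impI)
   assume "a <= c" "d <= b"
   have "X c = X x" using e(3)[of c] no_jump[of x] cd ab \<open>a <= c\<close> x by (cases "c = x") auto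
   thus "X d = X c" using e(2)[of d] cd by simp
  qed
  thus "\<exists>d>0. \<forall>a b. a <= x \<and> x <= b \<and> b - a < d --> P a b" using e(1) by blast
 qed
 thus ?thesis by (simp add: P_def)
qed

lemma cadlag_jumps_isolated:
 assumes X: "cadlag X" and x: "0 <= x"
 obtains e where "e > 0" "\<And>t. 0 < t ==> t \<noteq> x ==> abs (t - x) < e ==> left_lim X t = X t"
proof -
 obtain e where e: "e > 0" "\<And>s. x <= s ==> s < x + e ==> X s = X x"
  "\<And>s. 0 <= s ==> x - e < s ==> s < x ==> X s = left_lim X x"
  using cadlag_locally_const[OF X x] by metis
 have "left_lim X t = X t" if t: "0 < t" "t \<noteq> x" "abs (t - x) < e" for t
 proof (cases "t < x")
  case True
  have "left_lim X t = left_lim X x"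
   using t True by (intro left_lim_const[of "max 0 (x - e)"] e(3)) (auto simp: abs_if)
  moreover have "X t = left_lim X x" using t True by (intro e(3)) auto
  ultimately show ?thesis by simp
 next
  case False
  have "left_lim X t = X x" using t False by (intro left_lim_const[of x] e(2)) auto
  moreover have "X t = X x" using t False by (intro e(2)) auto
  ultimately show ?thesis by simp
 qed
 thus ?thesis using that e(1) by blast
qed

lemma cadlag_finite_jumps:
 assumes X: "cadlag X" shows "finite (jumps X b)"
proof (rule ccontr)
 assume "infinite (jumps X b)"
 moreover have "jumps X b \<subseteq> {0..b}" by (auto simp: jumps_def)
 ultimately obtain x where x: "x \<in> {0..b}" "x islimpt jumps X b"
  using compact_Icc[of 0 b] unfolding compact_eq_Bolzano_Weierstrass by blast
 obtain e where "e > 0" "\<And>t. 0 < t ==> t \<noteq> x ==> abs (t - x) < e ==> left_lim X t = X t"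
  using cadlag_jumps_isolated[OF X, of x] x(1) by auto
 thus False using x(2) unfolding islimpt_approachable jumps_def by (force simp: dist_real_def)
qed

definition right_grid :: "nat => real => real" where
 "right_grid n u = (of_int \<lfloor>u * real (Suc n)\<rfloor> + 1) / real (Suc n)"

lemma right_grid_bounds: "u < right_grid n u" "right_grid n u <= u + inverse (real (Suc n))"
proof -
 have floor: "of_int \<lfloor>u * real (Suc n)\<rfloor> <= u * real (Suc n)" "u * real (Suc n) < of_int \<lfloor>u * real (Suc n)\<rfloor> + 1"
  by linarith+
 thus "u < right_grid n u" unfolding right_grid_def by (simp add: pos_less_divide_eq)
 have "right_grid n u <= (u * real (Suc n) + 1) / real (Suc n)"
  unfolding right_grid_def using floor by (intro divide_right_mono) auto
 thus "right_grid n u <= u + inverse (real (Suc n))" by (simp add: add_divide_distrib inverse_eq_divide)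
qed

lemma cadlag_eventually_right_grid:
 assumes X: "cadlag X" and u: "u >= 0" shows "\<forall>\<^sub>F n in sequentially. X (right_grid n u) = X u"
proof -
 obtain v where v: "v > u" "\<And>s. s \<in> {u..<v} ==> X s = X u" using cadlag_right[OF X u] by blast
 have "\<forall>\<^sub>F n in sequentially. inverse (real (Suc n)) < v - u"
  using v(1) by (intro order_tendstoD[OF LIMSEQ_inverse_real_of_nat]) auto
 thus ?thesis
 proof eventually_elim
  case (elim n)
  thus ?case using right_grid_bounds[where u = u and n = n] by (intro v(2)) auto
 qed
qed

lemma cadlag_level_set_borel:
 fixes X :: "real => 'v"
 assumes X: "cadlag X" shows "{u. 0 <= u \<and> X u = y} \<in> sets borel"
proof -
 have "{u. X (right_grid n u) = y} \<in> sets borel" for n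
 proof -
  have "{u. X (right_grid n u) = y} = (%u. \<lfloor>u * real (Suc n)\<rfloor>) -` {j. X ((of_int j + 1) / real (Suc n)) = y} \<inter> space borel"
   by (auto simp: right_grid_def)
  also have "... \<in> sets borel"
   by (intro measurable_sets[where A = "count_space UNIV"]) measurable
  finally show ?thesis .
 qed
 hence "{0..} \<inter> (\<Union>m. \<Inter>n\<in>{m..}. {u. X (right_grid n u) = y}) \<in> sets borel" by auto
 also have "{0..} \<inter> (\<Union>m. \<Inter>n\<in>{m..}. {u. X (right_grid n u) = y}) = {u. 0 <= u \<and> X u = y}"
 proof (intro set_eqI)
  fix u
  have "(\<forall>\<^sub>F n in sequentially. X (right_grid n u) = y) \<longleftrightarrow> X u = y" if "0 <= u"
  proof -
   have "(\<forall>\<^sub>F n in sequentially. X (right_grid n u) = y) \<longleftrightarrow> (\<forall>\<^sub>F n::nat in sequentially. X u = y)"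
    by (rule eventually_subst) (use cadlag_eventually_right_grid[OF X that] in eventually_elim, simp)
   thus ?thesis by simp
  qed
  thus "u \<in> {0..} \<inter> (\<Union>m. \<Inter>n\<in>{m..}. {u. X (right_grid n u) = y}) \<longleftrightarrow> u \<in> {u. 0 <= u \<and> X u = y}"
   by (auto simp: eventually_sequentially)
 qed
 finally show ?thesis .
qed

definition along :: "('v::finite => real => real) => (real => 'v) => real => real" where
 "along f X u = (\<Sum>y\<in>UNIV. indicator {u. 0 <= u \<and> X u = y} u * f y u)"

lemma along_eq: "0 <= u ==> along f X u = f (X u) u"
proof -
 assume "0 <= u"
 hence "along f X u = (\<Sum>y\<in>UNIV. if y = X u then f y u else 0)"
  unfolding along_def by (intro sum.cong) (auto simp: indicator_def)
 thus ?thesis by simp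
qed

lemma along_bdd:
 assumes "cadlag X" "\<And>y. bdd_borel (f y)" shows "bdd_borel (along f X)"
 unfolding along_def[abs_def]
proof (intro bdd_borel_sum bdd_borel_mult assms(2))
 show "bdd_borel (indicator {u. 0 <= u \<and> X u = y})" for y
  using cadlag_level_set_borel[OF assms(1)] by (intro bdd_borelI[where K = 1]) (auto simp: indicator_def)
qed

definition path_fun :: "real => ('v::finite => real => real) => (('v * 'v) tfun) => (real => 'v) => real" where
 "path_fun T f g X = integral {0..T} (along f X) + (\<Sum>t\<in>jumps X T. g (left_lim X t, X t) t)"

lemma path_fun_lin:
 assumes X: "cadlag X" and f: "\<And>y. bdd_borel (f y)" "\<And>y. bdd_borel (f1 y)"
 shows "path_fun T (%y u. f y u + s * f1 y u) (%e u. g e u + s * g1 e u) X = path_fun T f g X + s * path_fun T f1 g1 X"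
proof -
 have "along (%y u. f y u + s * f1 y u) X = (%u. along f X u + s * along f1 X u)"
  by (rule ext) (simp add: along_def distrib_left sum.distrib sum_distrib_left mult_ac)
 moreover have "integral {0..T} (%u. along f X u + s * along f1 X u) = integral {0..T} (along f X) + s * integral {0..T} (along f1 X)"
  using along_bdd[OF X, of f] along_bdd[OF X, of f1] f by (simp add: integral_bdd_add bdd_borel_intros)
 ultimately show ?thesis
  by (simp add: path_fun_def sum.distrib sum_distrib_left distrib_left)
qed

lemma path_fun_shift:
 assumes X: "cadlag X" and f: "\<And>y. bdd_borel (f y)" and T: "0 <= T"
 shows "path_fun T (%y u. f y u - d) g X = path_fun T f g X - d * T"
proof -
 have "integral {0..T} (along (%y u. f y u - d) X) = integral {0..T} (%u. along f X u - d)"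
  by (rule Henstock_Kurzweil_Integration.integral_cong) (auto simp: along_eq)
 also have "... = integral {0..T} (along f X) - d * T"
  using along_bdd[OF X, of f] f T by (simp add: integral_bdd_diff bdd_borel_intros mult.commute)
 finally show ?thesis by (simp add: path_fun_def)
qed

lemma path_fun_mono:
 assumes X: "cadlag X" and f: "\<And>y. bdd_borel (f y)" "\<And>y. bdd_borel (f' y)" and le: "\<And>y t. 0 <= t ==> f y t <= f' y t"
 shows "path_fun T f g X <= path_fun T f' g X"
proof -
 have "integral {0..T} (along f X) <= integral {0..T} (along f' X)"
  using f le by (intro integral_bdd_mono along_bdd X) (auto simp: along_eq)
 thus ?thesis by (simp add: path_fun_def)
qed

lemma path_fun_sum:
 assumes "cadlag Y" "finite S" "\<And>F y. F \<in> S ==> bdd_borel (fst F y)"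
 shows "path_fun T (%y t. \<Sum>F\<in>S. th F * fst F y t) (%e t. \<Sum>F\<in>S. th F * snd F e t) Y = (\<Sum>F\<in>S. th F * path_fun T (fst F) (snd F) Y)"
 using assms(2,3)
proof (induction S rule: finite_induct)
 case empty
 thus ?case by (simp add: path_fun_def along_def[abs_def])
next
 case (insert G S)
 have "bdd_borel (%t. \<Sum>F\<in>S. th F * fst F y t)" for y using insert.prems by (intro bdd_borel_intros) auto
 thus ?case
  using path_fun_lin[OF assms(1), of "%y t. \<Sum>F\<in>S. th F * fst F y t" "fst G" T "th G" "%e t. \<Sum>F\<in>S. th F * snd F e t" "snd G"] insert
  by (simp add: add.commute)
qed

definition mesh :: "real => nat => nat => real" where
 "mesh T N k = real k * T / real N"

definition mesh_cell :: "real => nat => nat => real set" where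
 "mesh_cell T N k = {mesh T N k..mesh T N (Suc k)}"

definition mesh_index :: "real => nat => real => nat" where
 "mesh_index T N t = nat (\<lceil>t * real N / T\<rceil> - 1)"

definition mesh_term :: "real => nat => ('v::finite => real => real) => ('v \<times> 'v) tfun => nat => 'v => 'v => real" where
 "mesh_term T N f g k y z = integral (mesh_cell T N k) (f y) + (if y = z then 0 else g (y, z) (mesh T N k))"

definition mesh_fun :: "real => nat => ('v::finite => real => real) => ('v \<times> 'v) tfun => (real => 'v) => real" where
 "mesh_fun T N f g X = (\<Sum>k<N. mesh_term T N f g k (X (mesh T N k)) (X (mesh T N (Suc k))))"

lemma mesh_0 [simp]: "mesh T N 0 = 0" by (simp add: mesh_def)

lemma mesh_N: "N > 0 ==> mesh T N N = T" by (simp add: mesh_def)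

lemma mesh_nonneg: "0 <= T ==> 0 <= mesh T N k" by (simp add: mesh_def)

lemma mesh_mono: "0 <= T ==> j <= k ==> mesh T N j <= mesh T N k"
 by (auto simp: mesh_def intro!: divide_right_mono mult_right_mono)

lemma mesh_Suc: "mesh T N (Suc k) = mesh T N k + T / real N"
 by (simp add: mesh_def add_divide_distrib distrib_right)

lemma mesh_end_in_cell: "0 <= T ==> mesh T N (Suc k) \<in> mesh_cell T N k"
 using mesh_mono[of T k "Suc k"] by (simp add: mesh_cell_def)

lemma mesh_le: "0 <= T ==> k <= N ==> N > 0 ==> mesh T N k <= T"
 using mesh_mono[of T k N N] by (simp add: mesh_N)

lemma sorted_mesh: "0 <= T ==> sorted (map (mesh T N) [a..<b])"
 unfolding sorted_map by (rule sorted_wrt_mono_rel[OF _ sorted_upt]) (rule mesh_mono)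

lemma mesh_width_tendsto: "(%N. T / real N) \<longlonglongrightarrow> 0"
 by real_asymp

lemma mesh_index_eq_iff:
 assumes "T > 0" "N > 0" "t > 0"
 shows "mesh_index T N t = k \<longleftrightarrow> mesh T N k < t \<and> t <= mesh T N (Suc k)"
proof -
 have "0 < t * real N / T" using assms by simp
 hence "mesh_index T N t = k \<longleftrightarrow> real k < t * real N / T \<and> t * real N / T <= real (Suc k)"
  unfolding mesh_index_def by linarith
 thus ?thesis using assms by (simp add: mesh_def field_simps)
qed

lemma mesh_index_less:
 assumes "T > 0" "N > 0" "t > 0" "t <= T" shows "mesh_index T N t < N"
proof -
 have "mesh T N (mesh_index T N t) < mesh T N N" using assms mesh_index_eq_iff[of T N t] by (force simp: mesh_N)
 thus ?thesis using assms mesh_mono[of T N "mesh_index T N t" N] by (meson less_imp_le not_le)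
qed

lemma mesh_index_tendsto:
 assumes T: "T > 0" and t: "t > 0" shows "(%N. mesh T N (mesh_index T N t)) \<longlonglongrightarrow> t"
proof (rule tendsto_sandwich)
 have "t - T / real N <= mesh T N (mesh_index T N t) \<and> mesh T N (mesh_index T N t) <= t" if "N > 0" for N
  using mesh_index_eq_iff[OF T that t, of "mesh_index T N t"] mesh_Suc[of T N "mesh_index T N t"] by linarith
 thus "\<forall>\<^sub>F N in sequentially. t - T / real N <= mesh T N (mesh_index T N t)"
  "\<forall>\<^sub>F N in sequentially. mesh T N (mesh_index T N t) <= t"
  by (auto intro!: eventually_mono[OF eventually_gt_at_top[of "0::nat"]])
 show "(%N. t - T / real N) \<longlonglongrightarrow> t" using tendsto_diff[OF tendsto_const mesh_width_tendsto, of t] by simp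
qed simp

lemma integral_mesh:
 assumes "bdd_borel k" "0 <= T"
 shows "integral {0..mesh T N n} k = (\<Sum>i<n. integral (mesh_cell T N i) k)"
proof (induction n)
 case (Suc n)
 thus ?case
  using integral_split[OF assms(1) mesh_nonneg[OF assms(2)] mesh_mono[OF assms(2), of n "Suc n" N]] by (simp add: mesh_cell_def)
qed simp

lemma abs_integral_mesh_cell_le:
 assumes "0 <= T" "bdd_borel k" "\<And>t. t \<in> mesh_cell T N i ==> abs (k t) <= L"
 shows "abs (integral (mesh_cell T N i) k) <= L * (T / real N)"
 using abs_integral_le[OF assms(2), of "mesh T N i" "mesh T N (Suc i)" L] assms(1,3)
 by (simp add: mesh_cell_def mesh_Suc)

lemma mesh_change_has_jump:
 assumes X: "cadlag X" and T: "T > 0" and k: "k < N" and u: "u \<in> mesh_cell T N k" "X u \<noteq> X (mesh T N k)"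
 shows "k \<in> mesh_index T N ` jumps X T"
proof -
 have cell_bounds: "0 <= mesh T N k" "mesh T N (Suc k) <= T" using T k by (auto intro: mesh_nonneg mesh_le)
 obtain t where t: "mesh T N k < t" "t <= u" "left_lim X t \<noteq> X t"
  using cadlag_no_jump_const[OF X cell_bounds(1), of u] u by (auto simp: mesh_cell_def)
 hence "mesh_index T N t = k" using T k u cell_bounds by (subst mesh_index_eq_iff) (auto simp: mesh_cell_def)
 moreover have "t \<in> jumps X T" using t u cell_bounds by (auto simp: jumps_def mesh_cell_def)
 ultimately show ?thesis by blast
qed

lemma mesh_count_le:
 fixes X :: "real => 'v::finite"
 assumes X: "cadlag X" and T: "T > 0"
 shows "mesh_fun T N (%_ _. 0) (%_ _. 1) X <= real (card (jumps X T))"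
proof -
 let ?K = "{k\<in>{..<N}. X (mesh T N k) \<noteq> X (mesh T N (Suc k))}"
 have "mesh_fun T N (%_ _. 0) (%_ _. 1) X = (\<Sum>k<N. if X (mesh T N k) \<noteq> X (mesh T N (Suc k)) then 1 else 0)"
  unfolding mesh_fun_def mesh_term_def by (intro sum.cong) auto
 also have "... = real (card ?K)" by (simp add: sum.If_cases Int_def)
 also have "card ?K <= card (jumps X T)"
 proof (rule surj_card_le[OF cadlag_finite_jumps[OF X]], rule subsetI)
  fix k assume "k \<in> ?K"
  thus "k \<in> mesh_index T N ` jumps X T"
   using mesh_end_in_cell[of T N k] T by (intro mesh_change_has_jump[OF X T, of k N "mesh T N (Suc k)"]) auto
 qed
 finally show ?thesis by simp
qed

lemma mesh_fun_bound:
 fixes X :: "real => 'v::finite"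
 assumes X: "cadlag X" and T: "T > 0" and f: "\<And>y. bdd_borel (f y)" "\<And>y t. abs (f y t) <= L" and g: "\<And>e t. abs (g e t) <= L" and N: "N > 0"
 shows "abs (mesh_fun T N f g X) <= L * T + L * real (card (jumps X T))"
proof -
 have L: "L >= 0" using g by (meson abs_ge_zero order_trans)
 have "abs (mesh_term T N f g k y z) <= L * (T / real N) + L * mesh_term T N (%_ _. 0) (%_ _. 1) k y z" for k y z
  using abs_integral_mesh_cell_le[OF less_imp_le[OF T] f(1), of N k y L] f(2) g[of "(y, z)" "mesh T N k"]
  unfolding mesh_term_def by auto
 hence "abs (mesh_fun T N f g X) <= (\<Sum>k<N. L * (T / real N) + L * mesh_term T N (%_ _. 0) (%_ _. 1) k (X (mesh T N k)) (X (mesh T N (Suc k))))"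
  unfolding mesh_fun_def by (intro order_trans[OF sum_abs sum_mono])
 also have "... = L * T + L * mesh_fun T N (%_ _. 0) (%_ _. 1) X"
  using N by (simp add: sum.distrib sum_distrib_left[symmetric] mesh_fun_def)
 also have "... <= L * T + L * real (card (jumps X T))"
  using mesh_count_le[OF X T] L by (intro add_left_mono mult_left_mono) auto
 finally show ?thesis .
qed

lemma finite_gap:
 fixes J :: "real set" assumes "finite J"
 obtains d where "d > 0" "\<And>s t. s \<in> J ==> t \<in> J ==> s \<noteq> t ==> d <= abs (s - t)"
proof -
 let ?P = "{p \<in> J \<times> J. fst p \<noteq> snd p}"
 let ?D = "insert 1 ((%p. abs (fst p - snd p)) ` ?P)"
 have finite_D: "finite ?D" using assms by (intro finite.insertI finite_imageI) auto
 show ?thesis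
 proof (rule that[of "Min ?D"])
  show "0 < Min ?D" using finite_D by (subst Min_gr_iff) auto
  fix s t assume "s \<in> J" "t \<in> J" "s \<noteq> t"
  thus "Min ?D <= abs (s - t)" using finite_D by (intro Min_le) (auto intro!: image_eqI[of _ _ "(s, t)"])
 qed
qed

context
 fixes X :: "real => 'v::finite" and T :: real and N :: nat
 assumes X: "cadlag X" and T: "T > 0" and N: "N > 0"
  and gap: "\<And>s t. s \<in> jumps X T ==> t \<in> jumps X T ==> s \<noteq> t ==> T / real N < abs (s - t)"
begin

lemma jump_index:
 assumes "t \<in> jumps X T"
 shows "mesh T N (mesh_index T N t) < t" "t <= mesh T N (Suc (mesh_index T N t))" "mesh_index T N t < N"
 using assms mesh_index_eq_iff[OF T N, of t] mesh_index_less[OF T N, of t] by (auto simp: jumps_def)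

lemma inj_on_mesh_index: "inj_on (mesh_index T N) (jumps X T)"
proof (rule inj_onI, rule ccontr)
 fix s t assume st: "s \<in> jumps X T" "t \<in> jumps X T" "mesh_index T N s = mesh_index T N t" "s \<noteq> t"
 have "abs (s - t) <= T / real N"
  using jump_index[OF st(1)] jump_index[OF st(2)] st(3) by (auto simp: mesh_Suc abs_if)
 thus False using gap[OF st(1,2,4)] by simp
qed

lemma mesh_jump_values:
 assumes t: "t \<in> jumps X T"
 shows "X (mesh T N (mesh_index T N t)) = left_lim X t" "X (mesh T N (Suc (mesh_index T N t))) = X t"
proof -
 let ?k = "mesh_index T N t"
 note k = jump_index[OF t]
 have cell_start: "0 <= mesh T N ?k" using T by (intro mesh_nonneg) simp
 have no_jump: "left_lim X s = X s" if s: "mesh T N ?k < s" "s <= mesh T N (Suc ?k)" "s \<noteq> t" for s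
 proof (rule ccontr)
  assume "left_lim X s \<noteq> X s"
  moreover have "mesh T N (Suc ?k) <= T" using k T N by (intro mesh_le) auto
  ultimately have "s \<in> jumps X T" using s cell_start by (auto simp: jumps_def)
  moreover have "abs (s - t) <= T / real N" using s k by (auto simp: mesh_Suc abs_if)
  ultimately show False using gap[of s t] t s by auto
 qed
 show "X (mesh T N (Suc ?k)) = X t"
  using k no_jump cell_start by (intro cadlag_no_jump_const[OF X]) auto
 obtain u where u: "u < t" "\<And>s. s \<in> {u<..<t} ==> X s = left_lim X t"
  using cadlag_left[OF X, of t] t by (auto simp: jumps_def)
 define s where "s = (max u (mesh T N ?k) + t) / 2"
 have s: "u < s" "mesh T N ?k < s" "s < t" using u k by (auto simp: s_def)
 have "X s = X (mesh T N ?k)" using s k no_jump cell_start by (intro cadlag_no_jump_const[OF X]) auto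
 thus "X (mesh T N ?k) = left_lim X t" using u s by auto
qed

lemma mesh_const_off_jumps:
 "k < N ==> k \<notin> mesh_index T N ` jumps X T ==> u \<in> mesh_cell T N k ==> X u = X (mesh T N k)"
 using mesh_change_has_jump[OF X T] by blast

lemma mesh_jump_sum:
 "(\<Sum>k<N. if X (mesh T N k) = X (mesh T N (Suc k)) then 0 else g (X (mesh T N k), X (mesh T N (Suc k))) (mesh T N k))
  = (\<Sum>t\<in>jumps X T. g (left_lim X t, X t) (mesh T N (mesh_index T N t)))" (is "(\<Sum>k<N. ?G k) = _")
proof -
 have "(\<Sum>k<N. ?G k) = (\<Sum>k\<in>mesh_index T N ` jumps X T. ?G k)"
 proof (rule sum.mono_neutral_right)
  show "mesh_index T N ` jumps X T \<subseteq> {..<N}" using jump_index(3) by auto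
  show "\<forall>k\<in>{..<N} - mesh_index T N ` jumps X T. ?G k = 0"
   using mesh_const_off_jumps[OF _ _ mesh_end_in_cell] T by (auto simp: less_imp_le)
 qed simp
 also have "... = (\<Sum>t\<in>jumps X T. ?G (mesh_index T N t))" by (simp add: sum.reindex[OF inj_on_mesh_index])
 also have "... = (\<Sum>t\<in>jumps X T. g (left_lim X t, X t) (mesh T N (mesh_index T N t)))"
  using mesh_jump_values by (intro sum.cong) (auto simp: jumps_def)
 finally show ?thesis .
qed

lemma mesh_integral_error:
 assumes f: "\<And>y. bdd_borel (f y)" "\<And>y t. abs (f y t) <= L"
 shows "abs (integral {0..T} (along f X) - (\<Sum>k<N. integral (mesh_cell T N k) (f (X (mesh T N k)))))
  <= real (card (jumps X T)) * (2 * L * (T / real N))"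
proof -
 let ?D = "%k. integral (mesh_cell T N k) (along f X) - integral (mesh_cell T N k) (f (X (mesh T N k)))"
 have pos: "0 <= u" if "u \<in> mesh_cell T N k" for u k
  using that mesh_nonneg[of T N k] T by (auto simp: mesh_cell_def)
 have "?D k = 0" if k: "k < N" "k \<notin> mesh_index T N ` jumps X T" for k
 proof -
  have "along f X u = f (X (mesh T N k)) u" if u: "u \<in> mesh_cell T N k" for u
   using mesh_const_off_jumps[OF k u] pos[OF u] by (simp add: along_eq)
  thus ?thesis using Henstock_Kurzweil_Integration.integral_cong[of "mesh_cell T N k" "along f X"] by simp
 qed
 moreover have "mesh_index T N ` jumps X T \<subseteq> {..<N}" using jump_index(3) by auto
 ultimately have "(\<Sum>k<N. ?D k) = (\<Sum>k\<in>mesh_index T N ` jumps X T. ?D k)"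
  by (intro sum.mono_neutral_right) auto
 moreover have "abs (?D k) <= 2 * L * (T / real N)" for k
  using abs_integral_mesh_cell_le[OF less_imp_le[OF T] along_bdd[where f = f, OF X f(1)], of N k L]
   abs_integral_mesh_cell_le[OF less_imp_le[OF T] f(1), of N k "X (mesh T N k)" L] f(2) pos
  by (fastforce simp: along_eq)
 ultimately have "abs (\<Sum>k<N. ?D k) <= (\<Sum>k\<in>mesh_index T N ` jumps X T. 2 * L * (T / real N))"
  by (simp only:) (intro order_trans[OF sum_abs sum_mono])
 moreover have "integral {0..T} (along f X) = (\<Sum>k<N. integral (mesh_cell T N k) (along f X))"
  using integral_mesh[OF along_bdd[where f = f, OF X f(1)] less_imp_le[OF T], of N N] N by (simp add: mesh_N)
 ultimately show ?thesis by (simp add: sum_subtractf card_image[OF inj_on_mesh_index])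
qed

end

lemma mesh_fun_tendsto:
 fixes X :: "real => 'v::finite"
 assumes X: "cadlag X" and T: "T > 0" and f: "\<And>y. bdd_borel (f y)" and g: "\<And>e. continuous_on UNIV (g e)"
 shows "(%N. mesh_fun T N f g X) \<longlonglongrightarrow> path_fun T f g X"
proof -
 let ?int = "%N. \<Sum>k<N. integral (mesh_cell T N k) (f (X (mesh T N k)))"
 let ?sum = "%N. \<Sum>t\<in>jumps X T. g (left_lim X t, X t) (mesh T N (mesh_index T N t))"
 obtain d where d: "d > 0" "\<And>s t. s \<in> jumps X T ==> t \<in> jumps X T ==> s \<noteq> t ==> d <= abs (s - t)"
  using finite_gap[OF cadlag_finite_jumps[OF X]] by metis
 obtain L where L: "\<And>y t. abs (f y t) <= L" using bdd_borel_family_bound[of f] f by metis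
 have fine: "\<forall>\<^sub>F N in sequentially. N > 0 \<and> (\<forall>s\<in>jumps X T. \<forall>t\<in>jumps X T. s \<noteq> t --> T / real N < abs (s - t))"
  using order_tendstoD(2)[OF mesh_width_tendsto[of T] d(1)] eventually_gt_at_top[of "0::nat"]
  by eventually_elim (use d(2) in force)
 have "?sum \<longlonglongrightarrow> (\<Sum>t\<in>jumps X T. g (left_lim X t, X t) t)"
  by (intro tendsto_sum continuous_on_tendsto_compose[OF g] mesh_index_tendsto[OF T]) (auto simp: jumps_def)
 moreover have "?int \<longlonglongrightarrow> integral {0..T} (along f X)"
 proof (rule Lim_transform2)
  show "(%N. integral {0..T} (along f X) - ?int N) \<longlonglongrightarrow> 0"
  proof (rule Lim_null_comparison)
   show "\<forall>\<^sub>F N in sequentially. norm (integral {0..T} (along f X) - ?int N) <= real (card (jumps X T)) * (2 * L * (T / real N))"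
    using fine by eventually_elim (use mesh_integral_error[where f = f, OF X T _ _ f L] in auto)
   show "(%N. real (card (jumps X T)) * (2 * L * (T / real N))) \<longlonglongrightarrow> 0"
    by (intro tendsto_mult_right_zero mesh_width_tendsto)
  qed
 qed simp
 ultimately have "(%N. ?int N + ?sum N) \<longlonglongrightarrow> path_fun T f g X" unfolding path_fun_def by (intro tendsto_add)
 moreover have "\<forall>\<^sub>F N in sequentially. ?int N + ?sum N = mesh_fun T N f g X"
  using fine
 proof eventually_elim
  case (elim N)
  thus ?case using mesh_jump_sum[OF X T, of N g] by (simp add: mesh_fun_def mesh_term_def sum.distrib)
 qed
 ultimately show ?thesis by (rule Lim_transform_eventually)
qed

section \<open>The Feynman--Kac formula\<close>

locale periodic_rates =
 fixes R :: "'v::finite => 'v tfun" and T0 B c :: real and E :: "('v * 'v) set"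
 assumes T0: "T0 > 0" and R_bdd: "\<And>y z. bdd_borel (R y z)" and R_nonneg: "\<And>y z t. 0 <= R y z t"
  and R_le: "\<And>y z t. R y z t <= B" and R_per: "\<And>y z t. R y z (t + T0) = R y z t"
  and R_off: "\<And>y z t. (y, z) \<notin> E ==> R y z t = 0" and c: "c > 0"
  and R_lo: "\<And>y z t. (y, z) \<in> E ==> c <= R y z t"
  and irr: "\<And>y. (y, y) \<notin> E" and conn: "\<And>y z. (y, z) \<in> E\<^sup>*"
begin

lemma B_nonneg: "0 <= B"
 using R_nonneg R_le by (meson order_trans)

lemma R_diag: "R y y t = 0"
 using R_off irr by blast

lemma R_abs: "abs (R y z t) <= B"
 using R_nonneg R_le by simp

definition bw :: "('v tfun) => (('v * 'v) tfun) => ('v tfun) => 'v tfun" where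
 "bw f g h y u = (\<Sum>z\<in>UNIV. R y z u * (exp (g (y, z) u) * h z u - h y u)) + f y u * h y u"

lemma bw_bdd:
 assumes "\<And>y. bdd_borel (f y)" "\<And>e. bdd_borel (g e)" "\<And>y. bdd_borel (h y)"
 shows "bdd_borel (bw f g h y)"
 unfolding bw_def[abs_def] using assms R_bdd by (intro bdd_borel_intros)

lemma bw_bound:
 assumes f: "\<And>y t. abs (f y t) <= L" and g: "\<And>e t. abs (g e t) <= L" and h: "\<And>y t. abs (h y t) <= H"
 shows "abs (bw f g h y u) <= real CARD('v) * (B * (exp L * H + H)) + L * H"
proof -
 have L: "0 <= L" "0 <= H" using g h by (meson abs_ge_zero order_trans)+
 have "abs (exp (g (y, z) u) * h z u - h y u) <= exp L * H + H" for z
 proof -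
  have "abs (exp (g (y, z) u) * h z u) <= exp L * H"
   unfolding abs_mult using g[of "(y, z)" u] h L by (intro mult_mono) auto
  thus ?thesis using h[of y u] by linarith
 qed
 hence "abs (R y z u * (exp (g (y, z) u) * h z u - h y u)) <= B * (exp L * H + H)" for z
  unfolding abs_mult using R_abs B_nonneg by (intro mult_mono) auto
 hence "abs (\<Sum>z\<in>UNIV. R y z u * (exp (g (y, z) u) * h z u - h y u)) <= (\<Sum>z\<in>(UNIV::'v set). B * (exp L * H + H))"
  by (intro order_trans[OF sum_abs sum_mono])
 moreover have "abs (f y u * h y u) <= L * H" unfolding abs_mult using f h L by (intro mult_mono) auto
 ultimately show ?thesis unfolding bw_def by simp
qed

lemma gen_diag: "gen R y y u = - (\<Sum>z\<in>UNIV. R y z u)"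
proof -
 have "(\<Sum>z\<in>UNIV - {y}. R y z u) = (\<Sum>z\<in>UNIV. R y z u)" by (intro sum.mono_neutral_left) (auto simp: R_diag)
 thus ?thesis by (simp add: gen_def)
qed

lemma gen_eq: "gen R y z u = R y z u - (if y = z then \<Sum>w\<in>UNIV. R y w u else 0)"
 by (simp add: gen_diag R_diag) (simp add: gen_def)

lemma gen_sum: "(\<Sum>z\<in>UNIV. gen R y z u * Z z) = (\<Sum>z\<in>UNIV. R y z u * (Z z - Z y))"
 by (simp add: gen_eq left_diff_distrib right_diff_distrib sum_subtractf sum_distrib_right if_distrib[of "%x. x * _"] cong: if_cong)

lemma gen_bdd: "bdd_borel (gen R y z)"
 unfolding gen_eq[abs_def] using R_bdd by (cases "y = z") (auto intro!: bdd_borel_intros)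

lemma gen_bound: "abs (gen R y z u) <= real CARD('v) * B"
proof (cases "y = z")
 case True
 have "abs (\<Sum>w\<in>UNIV. R y w u) <= (\<Sum>w\<in>(UNIV::'v set). B)"
  using R_abs by (intro order_trans[OF sum_abs sum_mono])
 thus ?thesis using True by (simp add: gen_diag)
next
 case False
 have "1 * B <= real CARD('v) * B" using B_nonneg by (intro mult_right_mono) (auto simp: Suc_leI)
 thus ?thesis using False R_abs[of y z u] by (simp add: gen_def)
qed

end

locale periodic_chain = periodic_rates R T0 B c E
 for R :: "'v::finite => 'v tfun" and T0 B c and E +
 fixes p :: "real => real => 'v => 'v => real" and M :: "'w measure" and X :: "'w => real => 'v" and x :: 'v
 assumes kol: "\<And>s t y z. 0 <= s ==> s <= t ==>
   (%u. \<Sum>w\<in>UNIV. p s u y w * gen R w z u) integrable_on {s..t} \<and>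
   p s t y z = (if y = z then 1 else 0) + integral {s..t} (%u. \<Sum>w\<in>UNIV. p s u y w * gen R w z u)"
  and chain: "markov_chain M X p x"
begin

sublocale prob_space M
 using chain unfolding markov_chain_def by blast

lemma X_cadlag: "om \<in> space M ==> cadlag (X om)"
 using chain unfolding markov_chain_def by blast

lemma X_measurable: "0 <= t ==> (%om. X om t) \<in> measurable M (count_space UNIV)"
 using chain unfolding markov_chain_def by blast

definition Ga :: real where "Ga = real CARD('v) * (real CARD('v) * B)"

lemma Ga_nonneg: "0 <= Ga"
 using B_nonneg by (simp add: Ga_def)

lemma p_cont: "0 <= s ==> continuous_on {s..t} (%u. p s u y z)"
proof (cases "s <= t")
 case True
 assume s: "0 <= s"
 have "continuous_on {s..t} (%u. (if y = z then 1 else 0) + integral {s..u} (%u. \<Sum>w\<in>UNIV. p s u y w * gen R w z u))"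
  using kol[OF s True] by (intro continuous_intros indefinite_integral_continuous_1) auto
 moreover have "(if y = z then 1 else 0) + integral {s..u} (%u. \<Sum>w\<in>UNIV. p s u y w * gen R w z u) = p s u y z"
  if "u \<in> {s..t}" for u
  using kol[OF s, of u y z] that by simp
 ultimately show ?thesis by (subst continuous_on_cong[OF refl]) (auto simp del: if_split_asm dest: sym)
qed simp

lemma gen_action_integral_bound:
 assumes "s <= t" and int: "\<And>z. (%u. \<Sum>w\<in>UNIV. v u w * gen R w z u) integrable_on {s..t}"
  and S: "\<And>u. u \<in> {s..t} ==> (\<Sum>w\<in>UNIV. abs (v u w)) <= S"
 shows "(\<Sum>z\<in>UNIV. abs (integral {s..t} (%u. \<Sum>w\<in>UNIV. v u w * gen R w z u))) <= Ga * S * (t - s)"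
proof -
 have "abs (integral {s..t} (%u. \<Sum>w\<in>UNIV. v u w * gen R w z u)) <= integral {s..t} (%u. S * (real CARD('v) * B))" for z
 proof (rule abs_integral_bound[OF int])
  fix u assume u: "u \<in> {s..t}"
  have "abs (\<Sum>w\<in>UNIV. v u w * gen R w z u) <= (\<Sum>w\<in>UNIV. abs (v u w) * (real CARD('v) * B))"
   using gen_bound by (intro order_trans[OF sum_abs sum_mono]) (simp add: abs_mult mult_left_mono)
  also have "... <= S * (real CARD('v) * B)"
   unfolding sum_distrib_right[symmetric] using S[OF u] B_nonneg by (intro mult_right_mono) auto
  finally show "abs (\<Sum>w\<in>UNIV. v u w * gen R w z u) <= S * (real CARD('v) * B)" .
 qed (simp add: integrable_const_ivl)
 hence "(\<Sum>z\<in>UNIV. abs (integral {s..t} (%u. \<Sum>w\<in>UNIV. v u w * gen R w z u))) <= (\<Sum>z\<in>(UNIV::'v set). S * (real CARD('v) * B) * (t - s))"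
  using assms(1) by (intro sum_mono) (simp add: mult_ac)
 thus ?thesis by (simp add: Ga_def mult_ac)
qed

definition small_step :: real where "small_step = 1 / (2 * (Ga + 1))"

lemma small_step: "small_step > 0" "Ga * small_step <= 1 / 2" "small_step <= 1"
 using Ga_nonneg by (auto simp: small_step_def field_simps)

lemma p_row_le_2:
 assumes s: "0 <= s" "s <= t" "t - s <= small_step" shows "(\<Sum>z\<in>UNIV. abs (p s t y z)) <= 2"
proof -
 let ?N = "%u. \<Sum>z\<in>UNIV. abs (p s u y z)"
 have "continuous_on {s..s + small_step} ?N" by (intro continuous_intros p_cont s(1))
 then obtain u where u: "u \<in> {s..s + small_step}" "\<forall>r\<in>{s..s + small_step}. ?N r <= ?N u"
  using continuous_attains_sup[of "{s..s + small_step}" ?N] small_step(1) by auto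
 have "?N u <= (\<Sum>z\<in>UNIV. (if y = z then 1 else 0) + abs (integral {s..u} (%r. \<Sum>w\<in>UNIV. p s r y w * gen R w z r)))"
  using kol[OF s(1), of u y] u(1) by (intro sum_mono) auto
 also have "... <= 1 + Ga * ?N u * (u - s)"
  using gen_action_integral_bound[of s u "%r. p s r y" "?N u"] kol[OF s(1), of u y] u by (auto simp: sum.distrib)
 also have "... <= 1 + Ga * ?N u * small_step"
  using u(1) Ga_nonneg by (intro add_left_mono mult_left_mono mult_nonneg_nonneg sum_nonneg) auto
 also have "... <= 1 + ?N u / 2" using mult_right_mono[OF small_step(2), of "?N u"] by (simp add: mult_ac sum_nonneg)
 finally have "?N u <= 2" by linarith
 thus ?thesis using u(2) s by force
qed

lemma p_row_linear:
 assumes s: "0 <= s" "s <= t" "t - s <= small_step"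
 shows "(\<Sum>z\<in>UNIV. abs (p s t y z - (if y = z then 1 else 0))) <= 2 * Ga * (t - s)"
proof -
 have "(\<Sum>z\<in>UNIV. abs (integral {s..t} (%u. \<Sum>w\<in>UNIV. p s u y w * gen R w z u))) <= Ga * 2 * (t - s)"
  using s kol[OF s(1,2)] p_row_le_2[OF s(1)] by (intro gen_action_integral_bound) auto
 thus ?thesis using kol[OF s(1,2), of y] by (simp add: mult_ac)
qed

lemma p_row_quadratic:
 assumes s: "0 <= s" "s <= t" "t - s <= small_step"
 shows "(\<Sum>z\<in>UNIV. abs (p s t y z - ((if y = z then 1 else 0) + integral {s..t} (gen R y z)))) <= 2 * Ga\<^sup>2 * (t - s)\<^sup>2"
proof -
 let ?\<delta> = "%z. if y = z then 1 else 0 :: real"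
 have int: "(%u. \<Sum>w\<in>UNIV. (p s u y w - ?\<delta> w) * gen R w z u) integrable_on {s..t}"
  and deviation: "p s t y z - (?\<delta> z + integral {s..t} (gen R y z)) = integral {s..t} (%u. \<Sum>w\<in>UNIV. (p s u y w - ?\<delta> w) * gen R w z u)" for z
 proof -
  have split: "(%u. \<Sum>w\<in>UNIV. (p s u y w - ?\<delta> w) * gen R w z u) = (%u. (\<Sum>w\<in>UNIV. p s u y w * gen R w z u) - gen R y z u)"
   by (simp add: left_diff_distrib sum_subtractf if_distrib[of "%x. x * _"] cong: if_cong)
  have p: "(%u. \<Sum>w\<in>UNIV. p s u y w * gen R w z u) integrable_on {s..t}" using kol[OF s(1,2)] by blast
  have g: "gen R y z integrable_on {s..t}" by (intro bdd_borel_integrable gen_bdd)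
  show "(%u. \<Sum>w\<in>UNIV. (p s u y w - ?\<delta> w) * gen R w z u) integrable_on {s..t}"
   unfolding split by (rule integrable_diff[OF p g])
  show "p s t y z - (?\<delta> z + integral {s..t} (gen R y z)) = integral {s..t} (%u. \<Sum>w\<in>UNIV. (p s u y w - ?\<delta> w) * gen R w z u)"
   unfolding split using kol[OF s(1,2), of y z] by (simp add: Henstock_Kurzweil_Integration.integral_diff[OF p g])
 qed
 have "(\<Sum>w\<in>UNIV. abs (p s u y w - ?\<delta> w)) <= 2 * Ga * (t - s)" if "u \<in> {s..t}" for u
 proof -
  have "(\<Sum>w\<in>UNIV. abs (p s u y w - ?\<delta> w)) <= 2 * Ga * (u - s)" using that s by (intro p_row_linear) auto
  also have "... <= 2 * Ga * (t - s)" using that Ga_nonneg by (intro mult_left_mono) auto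
  finally show ?thesis .
 qed
 from gen_action_integral_bound[OF s(2) int this] show ?thesis
  by (simp add: deviation power2_eq_square mult_ac)
qed

lemma transition_expansion:
 assumes s: "0 <= s" "s <= t" "t - s <= small_step" and Z: "\<And>z. abs (Z z) <= D"
 shows "abs ((\<Sum>z\<in>UNIV. p s t y z * Z z) - (Z y + integral {s..t} (%u. \<Sum>z\<in>UNIV. R y z u * (Z z - Z y)))) <= 2 * Ga\<^sup>2 * D * (t - s)\<^sup>2"
proof -
 let ?e = "%z. p s t y z - ((if y = z then 1 else 0) + integral {s..t} (gen R y z))"
 have D: "0 <= D" using Z[of y] by linarith
 have delta: "(\<Sum>z\<in>UNIV. (if y = z then 1 else 0) * Z z) = Z y" by (simp add: if_distrib[of "%x. x * _"] cong: if_cong)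
 have "integral {s..t} (%u. \<Sum>z\<in>UNIV. R y z u * (Z z - Z y)) = integral {s..t} (%u. \<Sum>z\<in>UNIV. gen R y z u * Z z)"
  by (simp add: gen_sum)
 also have "... = (\<Sum>z\<in>UNIV. integral {s..t} (gen R y z) * Z z)"
  using gen_bdd by (simp add: integral_bdd_sum bdd_borel_intros)
 finally have expansion: "(\<Sum>z\<in>UNIV. p s t y z * Z z) - (Z y + integral {s..t} (%u. \<Sum>z\<in>UNIV. R y z u * (Z z - Z y))) = (\<Sum>z\<in>UNIV. ?e z * Z z)"
  using delta by (simp add: left_diff_distrib distrib_right sum_subtractf sum.distrib)
 have "abs (\<Sum>z\<in>UNIV. ?e z * Z z) <= (\<Sum>z\<in>UNIV. abs (?e z) * D)"
  using Z by (intro order_trans[OF sum_abs sum_mono]) (simp add: abs_mult mult_left_mono)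
 also have "... <= 2 * Ga\<^sup>2 * (t - s)\<^sup>2 * D"
  unfolding sum_distrib_right[symmetric] using p_row_quadratic[OF s, of y] D by (intro mult_right_mono) auto
 finally show ?thesis unfolding expansion by (simp add: mult_ac)
qed

end

lemma exp_diff_le:
 fixes a b :: real assumes "a <= L" "b <= L" shows "abs (exp a - exp b) <= exp L * abs (a - b)"
proof -
 have one_sided: "exp a - exp b <= exp L * (a - b)" if "b <= a" "a <= L" for a b :: real
 proof -
  have "(1 - (a - b)) * exp a <= exp (b - a) * exp a" using exp_ge_add_one_self[of "b - a"] by (intro mult_right_mono) (auto simp: algebra_simps)
  hence "exp a - exp b <= (a - b) * exp a" by (simp add: mult_exp_exp left_diff_distrib)
  also have "... <= (a - b) * exp L" using that by (intro mult_left_mono) auto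
  finally show ?thesis by (simp add: mult.commute)
 qed
 show ?thesis using one_sided[of a b] one_sided[of b a] assms by (cases "b <= a") (auto simp: abs_minus_commute)
qed

lemma exp_linear_errors:
 fixes a b :: real
 assumes "abs a <= b" "b <= L" "0 <= b"
 shows "abs (exp a - 1) <= exp L * b" "abs (exp a - 1 - a) <= exp L * b\<^sup>2"
proof -
 have first: "abs (exp a - 1) <= exp L * abs a" using exp_diff_le[of a L 0] assms by simp
 also have "... <= exp L * b" using assms by simp
 finally show linear: "abs (exp a - 1) <= exp L * b" .
 have "(1 - a) * exp a <= exp (- a) * exp a" using exp_ge_add_one_self[of "- a"] by (intro mult_right_mono) auto
 hence "exp a - 1 - a <= a * (exp a - 1)" by (simp add: mult_exp_exp algebra_simps)
 also have "... <= abs a * abs (exp a - 1)" by (metis abs_ge_self abs_mult)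
 also have "... <= b * (exp L * b)" using linear assms by (intro mult_mono) auto
 finally have "exp a - 1 - a <= exp L * b\<^sup>2" by (simp add: power2_eq_square mult_ac)
 moreover have "0 <= exp a - 1 - a" using exp_ge_add_one_self[of a] by linarith
 ultimately show "abs (exp a - 1 - a) <= exp L * b\<^sup>2" by simp
qed

lemma exp_weight_error:
 fixes a b e ph d :: real
 assumes ph: "abs ph <= L * d" and d: "0 <= d" "d <= 1" and L: "0 <= L"
  and a: "abs a <= H" and b: "abs b <= Kb * d" and e: "abs e <= Ke * d\<^sup>2"
 shows "abs (exp ph * (a + b + e) - (a + b + ph * a)) <= exp L * (L\<^sup>2 * H + L * Kb + Ke) * d\<^sup>2"
proof -
 have Ld: "0 <= L * d" "L * d <= L" using L d by (auto simp: mult_left_le)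
 note errors = exp_linear_errors[OF ph Ld(2,1)]
 have "exp ph * (a + b + e) - (a + b + ph * a) = (exp ph - 1 - ph) * a + (exp ph - 1) * b + exp ph * e"
  by (simp add: algebra_simps)
 moreover have "abs ((exp ph - 1 - ph) * a) <= (exp L * (L * d)\<^sup>2) * H"
  unfolding abs_mult using errors a by (intro mult_mono) auto
 moreover have "abs ((exp ph - 1) * b) <= (exp L * (L * d)) * (Kb * d)"
  unfolding abs_mult using errors b Ld by (intro mult_mono) auto
 moreover have "abs (exp ph * e) <= exp L * (Ke * d\<^sup>2)"
  unfolding abs_mult using e ph Ld by (intro mult_mono) auto
 ultimately have "abs (exp ph * (a + b + e) - (a + b + ph * a))
  <= (exp L * (L * d)\<^sup>2) * H + (exp L * (L * d)) * (Kb * d) + exp L * (Ke * d\<^sup>2)"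
  by linarith
 thus ?thesis by (simp add: power2_eq_square algebra_simps)
qed

context periodic_chain
begin

lemma jump_sum_bound:
 assumes "\<And>z. abs (D z) <= C" shows "abs (\<Sum>z\<in>UNIV. R y z u * D z) <= real CARD('v) * (B * C)"
proof -
 have "abs (R y z u * D z) <= B * C" for z
  unfolding abs_mult using R_abs assms B_nonneg by (intro mult_mono) auto
 hence "abs (\<Sum>z\<in>UNIV. R y z u * D z) <= (\<Sum>z\<in>(UNIV::'v set). B * C)"
  by (intro order_trans[OF sum_abs sum_mono])
 thus ?thesis by simp
qed

lemma exp_mult_bound: "abs a <= L ==> abs b <= H ==> abs (exp a * b) <= exp L * H" for a b :: real
 unfolding abs_mult by (intro mult_mono) auto

lemma bw_frozen_error:
 assumes f: "\<And>y t. abs (f y t) <= L" and g: "\<And>e t. abs (g e t) <= L" and h: "\<And>y t. abs (h y t) <= H"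
  and osc: "\<And>e. abs (g e u - g e s) <= \<delta>" "\<And>z. abs (h z u - h z t) <= \<eta>"
 shows "abs (bw f g h y u - ((\<Sum>z\<in>UNIV. R y z u * (exp (g (y, z) s) * h z t - h y t)) + f y u * h y t))
  <= real CARD('v) * (B * (exp L * \<delta> * H + exp L * \<eta> + \<eta>)) + L * \<eta>"
proof -
 let ?D = "%z. exp (g (y, z) u) * h z u - h y u - (exp (g (y, z) s) * h z t - h y t)"
 have "abs (?D z) <= exp L * \<delta> * H + exp L * \<eta> + \<eta>" for z
 proof -
  have "abs (exp (g (y, z) u) - exp (g (y, z) s)) <= exp L * abs (g (y, z) u - g (y, z) s)"
   using g by (intro exp_diff_le) (auto simp: abs_le_iff)
  also have "... <= exp L * \<delta>" using osc(1) by (intro mult_left_mono) auto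
  finally have "abs ((exp (g (y, z) u) - exp (g (y, z) s)) * h z u) <= exp L * \<delta> * H"
   unfolding abs_mult using h by (intro mult_mono) (auto intro: order_trans[OF abs_ge_zero])
  moreover have "abs (exp (g (y, z) s) * (h z u - h z t)) <= exp L * \<eta>" using g osc(2) by (intro exp_mult_bound)
  ultimately show ?thesis using osc(2)[of y] unfolding left_diff_distrib right_diff_distrib by linarith
 qed
 hence "abs (\<Sum>z\<in>UNIV. R y z u * ?D z) <= real CARD('v) * (B * (exp L * \<delta> * H + exp L * \<eta> + \<eta>))"
  by (rule jump_sum_bound)
 moreover have "abs (f y u * (h y u - h y t)) <= L * \<eta>"
  unfolding abs_mult using f osc(2) by (intro mult_mono) (auto intro: order_trans[OF abs_ge_zero])
 moreover have "bw f g h y u - ((\<Sum>z\<in>UNIV. R y z u * (exp (g (y, z) s) * h z t - h y t)) + f y u * h y t)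
  = (\<Sum>z\<in>UNIV. R y z u * ?D z) + f y u * (h y u - h y t)"
  by (simp add: bw_def right_diff_distrib sum_subtractf)
 ultimately show ?thesis by linarith
qed

context
 fixes T :: real and f h :: "'v tfun" and g :: "('v * 'v) tfun" and L H :: real
 assumes T: "T > 0" and f: "\<And>y. bdd_borel (f y)" "\<And>y t. abs (f y t) <= L"
  and g: "\<And>e. continuous_on UNIV (g e)" "\<And>e. bdd_borel (g e)" "\<And>e t. abs (g e t) <= L"
  and h: "\<And>y. bdd_borel (h y)" "\<And>y t. abs (h y t) <= H" "\<And>y. indef 0 T (h y) (bw f g h y)"
begin

lemma backward_solution_integral_error:
 obtains K where "K >= 0" "\<And>s t y \<delta>. 0 <= s ==> s <= t ==> t <= T ==>
  \<forall>e. \<forall>u\<in>{s..t}. abs (g e u - g e s) <= \<delta> ==>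
  abs (h y s - (h y t + integral {s..t} (%u. \<Sum>z\<in>UNIV. R y z u * (exp (g (y, z) s) * h z t - h y t)) + integral {s..t} (f y) * h y t))
   <= K * (t - s) * ((t - s) + \<delta>)"
proof -
 define K0 where "K0 = real CARD('v) * (B * (exp L * H + H)) + L * H"
 define K where "K = real CARD('v) * (B * (exp L * H + exp L * K0 + K0)) + L * K0"
 have nonneg: "0 <= L" "0 <= H" using g(3) h(2) by (meson abs_ge_zero order_trans)+
 hence K: "0 <= K0" "0 <= K" using B_nonneg by (auto simp: K0_def K_def)
 show ?thesis
 proof (rule that[OF K(2)])
  fix s t y \<delta> assume st: "0 <= s" "s <= t" "t <= T" and "\<forall>e. \<forall>u\<in>{s..t}. abs (g e u - g e s) <= \<delta>"
  hence osc: "\<And>e u. u \<in> {s..t} ==> abs (g e u - g e s) <= \<delta>" by blast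
  let ?d = "t - s"
  let ?F = "%u. (\<Sum>z\<in>UNIV. R y z u * (exp (g (y, z) s) * h z t - h y t)) + f y u * h y t"
  have F: "bdd_borel ?F" using R_bdd f by (intro bdd_borel_intros)
  have bw: "bdd_borel (bw f g h y)" for y using f g h by (intro bw_bdd)
  have \<delta>: "0 <= \<delta>" using osc[of s undefined] st by auto
  have absorb: "exp L * \<delta> * H + exp L * (K0 * d) + K0 * d <= (exp L * H + exp L * K0 + K0) * (d + \<delta>)" if "0 <= d" for d
   using nonneg K \<delta> that by (simp add: algebra_simps)
  have "abs (h z u - h z t) <= K0 * ?d" if u: "u \<in> {s..t}" for z u
  proof -
   have "abs (h z u - h z t) <= K0 * abs (u - t)"
    unfolding K0_def using u st bw_bound[OF f(2) g(3) h(2)] by (intro indef_lipschitz[OF h(3) bw]) auto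
   also have "... <= K0 * ?d" using u K by (intro mult_left_mono) auto
   finally show ?thesis .
  qed
  hence "abs (bw f g h y u - ?F u) <= K * (?d + \<delta>)" if u: "u \<in> {s..t}" for u
  proof -
   have "abs (bw f g h y u - ?F u) <= real CARD('v) * (B * (exp L * \<delta> * H + exp L * (K0 * ?d) + K0 * ?d)) + L * (K0 * ?d)"
    using osc[OF u] \<open>\<And>z u. u \<in> {s..t} ==> abs (h z u - h z t) <= K0 * ?d\<close>[OF u] by (intro bw_frozen_error f(2) g(3) h(2))
   also have "... <= real CARD('v) * (B * ((exp L * H + exp L * K0 + K0) * (?d + \<delta>))) + L * (K0 * (?d + \<delta>))"
    using nonneg K B_nonneg st \<delta> by (intro add_mono mult_left_mono absorb) auto
   finally show ?thesis by (simp add: K_def algebra_simps)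
  qed
  hence "abs (integral {s..t} (%u. bw f g h y u - ?F u)) <= K * (?d + \<delta>) * ?d"
   using st by (intro abs_integral_le bdd_borel_diff F bw)
  moreover have "h y s = h y t + integral {s..t} (bw f g h y)" using st by (intro indefD[OF h(3)]) auto
  moreover have "integral {s..t} ?F = integral {s..t} (%u. \<Sum>z\<in>UNIV. R y z u * (exp (g (y, z) s) * h z t - h y t)) + integral {s..t} (f y) * h y t"
   using R_bdd f by (simp add: integral_bdd_add bdd_borel_intros)
  ultimately show "abs (h y s - (h y t + integral {s..t} (%u. \<Sum>z\<in>UNIV. R y z u * (exp (g (y, z) s) * h z t - h y t)) + integral {s..t} (f y) * h y t))
    <= K * ?d * (?d + \<delta>)"
   using F bw by (simp add: integral_bdd_diff mult_ac)
 qed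
qed

lemma local_error:
 obtains K where "K >= 0" "\<And>s t y \<delta>. 0 <= s ==> s <= t ==> t <= T ==> t - s <= small_step ==>
  \<forall>e. \<forall>u\<in>{s..t}. abs (g e u - g e s) <= \<delta> ==>
  abs ((\<Sum>z\<in>UNIV. p s t y z * exp (integral {s..t} (f y) + (if y = z then 0 else g (y, z) s)) * h z t) - h y s)
   <= K * (t - s) * ((t - s) + \<delta>)"
proof -
 obtain K1 where K1: "K1 >= 0" "\<And>s t y \<delta>. 0 <= s ==> s <= t ==> t <= T ==>
  \<forall>e. \<forall>u\<in>{s..t}. abs (g e u - g e s) <= \<delta> ==>
  abs (h y s - (h y t + integral {s..t} (%u. \<Sum>z\<in>UNIV. R y z u * (exp (g (y, z) s) * h z t - h y t)) + integral {s..t} (f y) * h y t))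
   <= K1 * (t - s) * ((t - s) + \<delta>)"
  using that by (rule backward_solution_integral_error)
 have nonneg: "0 <= L" "0 <= H" using g(3) h(2) by (meson abs_ge_zero order_trans)+
 define K2 where "K2 = exp L * (L\<^sup>2 * H + L * (real CARD('v) * (B * (exp L * H + H))) + 2 * Ga\<^sup>2 * (exp L * H))"
 have K2: "K2 >= 0" unfolding K2_def using nonneg B_nonneg by (intro mult_nonneg_nonneg add_nonneg_nonneg) auto
 show ?thesis
 proof (rule that[of "K1 + K2"])
  show "0 <= K1 + K2" using K1 K2 by simp
  fix s t y \<delta> assume st: "0 <= s" "s <= t" "t <= T" "t - s <= small_step" and osc: "\<forall>e. \<forall>u\<in>{s..t}. abs (g e u - g e s) <= \<delta>"
  let ?d = "t - s" and ?\<phi> = "integral {s..t} (f y)"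
  define Z where "Z z = exp (if y = z then 0 else g (y, z) s) * h z t" for z
  define A where "A = integral {s..t} (%u. \<Sum>z\<in>UNIV. R y z u * (Z z - Z y))"
  define P where "P = (\<Sum>z\<in>UNIV. p s t y z * Z z)"
  have d: "0 <= ?d" "?d <= 1" using st small_step by auto
  have Z: "abs (Z z) <= exp L * H" for z unfolding Z_def using g(3) h(2) nonneg by (intro exp_mult_bound) auto
  have Zy: "Z y = h y t" by (simp add: Z_def)
  have "abs (Z z - Z y) <= exp L * H + H" for z using Z[of z] h(2)[of y t] Zy by linarith
  hence A: "abs A <= real CARD('v) * (B * (exp L * H + H)) * ?d"
   unfolding A_def using R_bdd st jump_sum_bound by (intro abs_integral_le bdd_borel_intros) auto
  have "abs (P - (Z y + A)) <= 2 * Ga\<^sup>2 * (exp L * H) * ?d\<^sup>2"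
   unfolding P_def A_def using st by (intro transition_expansion Z) auto
  moreover have "abs (?\<phi>) <= L * ?d" using st f by (intro abs_integral_le) auto
  ultimately have "abs (exp ?\<phi> * (h y t + A + (P - (Z y + A))) - (h y t + A + ?\<phi> * h y t)) <= K2 * ?d\<^sup>2"
   unfolding K2_def using nonneg d h(2) A by (intro exp_weight_error) auto
  moreover have "abs (h y s - (h y t + A + ?\<phi> * h y t)) <= K1 * ?d * (?d + \<delta>)"
  proof -
   have jump_terms: "R y z u * (Z z - Z y) = R y z u * (exp (g (y, z) s) * h z t - h y t)" for z u
    by (cases "y = z") (auto simp: Z_def R_diag)
   show ?thesis unfolding A_def jump_terms using K1(2)[OF st(1-3) osc] .
  qed
  moreover have "K2 * ?d\<^sup>2 <= K2 * ?d * (?d + \<delta>)"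
  proof -
   have "0 <= \<delta>" using osc st by (meson abs_ge_zero atLeastAtMost_iff order_refl order_trans)
   thus ?thesis using K2 d by (simp add: power2_eq_square mult_left_mono mult.assoc)
  qed
  ultimately have "abs (exp ?\<phi> * P - h y s) <= (K1 + K2) * ?d * (?d + \<delta>)" unfolding Zy distrib_right by simp
  moreover have "exp ?\<phi> * P = (\<Sum>z\<in>UNIV. p s t y z * exp (?\<phi> + (if y = z then 0 else g (y, z) s)) * h z t)"
   unfolding P_def sum_distrib_left by (intro sum.cong refl) (simp add: Z_def exp_add mult_ac)
  ultimately show "abs ((\<Sum>z\<in>UNIV. p s t y z * exp (?\<phi> + (if y = z then 0 else g (y, z) s)) * h z t) - h y s) <= (K1 + K2) * ?d * (?d + \<delta>)"
   by simp
 qed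
qed

end

end

fun chain_val :: "(nat => 'v => 'v => real) => (nat => 'v => 'v => real) => ('v::finite => real) => nat => nat => 'v => real" where
 "chain_val P w q 0 k y = q y"
| "chain_val P w q (Suc j) k y = (\<Sum>z\<in>UNIV. P k y z * w k y z * chain_val P w q j (Suc k) z)"

fun list_weight :: "(nat => 'v => 'v => real) => ('v => real) => nat => 'v => 'v list => real" where
 "list_weight w q k y [] = q y"
| "list_weight w q k y (z # zs) = w k y z * list_weight w q (Suc k) z zs"

lemma sum_lists_Suc:
 fixes G :: "'v::finite list => real"
 shows "(\<Sum>zs\<in>{zs. length zs = Suc j}. G zs) = (\<Sum>z\<in>UNIV. \<Sum>zs\<in>{zs. length zs = j}. G (z # zs))"
proof -
 have lists_Suc: "{zs. length zs = Suc j} = (%(z, zs). z # zs) ` (UNIV \<times> {zs. length zs = j})"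
  by (auto simp: length_Suc_conv image_iff)
 have "inj_on (%(z, zs). z # zs) (UNIV \<times> {zs :: 'v list. length zs = j})"
  by (auto simp: inj_on_def)
 hence "(\<Sum>zs\<in>{zs. length zs = Suc j}. G zs) = (\<Sum>(z, zs)\<in>UNIV \<times> {zs. length zs = j}. G (z # zs))"
  unfolding lists_Suc by (subst sum.reindex) (auto simp: case_prod_unfold intro!: sum.cong)
 thus ?thesis by (simp add: sum.cartesian_product)
qed

lemma sum_fdd_list_weight:
 fixes p :: "real => real => 'v::finite => 'v => real"
 shows "(\<Sum>zs\<in>{zs. length zs = j}. list_weight w q k y zs * fdd p (ta k) y (map ta [Suc k..<Suc k + j]) zs)
  = chain_val (%k. p (ta k) (ta (Suc k))) w q j k y"
proof (induction j arbitrary: k y)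
 case (Suc j)
 have grid: "[Suc k..<Suc k + Suc j] = Suc k # [Suc (Suc k)..<Suc (Suc k) + j]" by (simp add: upt_conv_Cons)
 have "(\<Sum>zs\<in>{zs. length zs = Suc j}. list_weight w q k y zs * fdd p (ta k) y (map ta [Suc k..<Suc k + Suc j]) zs)
  = (\<Sum>z\<in>UNIV. p (ta k) (ta (Suc k)) y z * w k y z *
    (\<Sum>zs\<in>{zs. length zs = j}. list_weight w q (Suc k) z zs * fdd p (ta (Suc k)) z (map ta [Suc (Suc k)..<Suc (Suc k) + j]) zs))"
  unfolding sum_lists_Suc grid sum_distrib_left list.map fdd.simps list_weight.simps by (intro sum.cong refl) (simp add: mult_ac)
 thus ?case unfolding Suc.IH by simp
qed simp

lemma list_weight_exp:
 "list_weight (%k y z. exp (m k y z)) q k (Y k) (map Y [Suc k..<Suc k + j])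
  = exp (\<Sum>i\<in>{k..<k + j}. m i (Y i) (Y (Suc i))) * q (Y (k + j))"
proof (induction j arbitrary: k)
 case (Suc j)
 have grid: "[Suc k..<Suc k + Suc j] = Suc k # [Suc (Suc k)..<Suc (Suc k) + j]" by (simp add: upt_conv_Cons)
 have range: "{k..<k + Suc j} = insert k {Suc k..<Suc k + j}" by auto
 show ?case unfolding grid list.map list_weight.simps Suc.IH range by (simp add: exp_add)
qed simp

lemma chain_val_close:
 fixes P w :: "nat => 'v::finite => 'v => real"
 assumes w: "\<And>k y z. 0 <= w k y z" and rh: "1 <= rh" and ep: "0 <= ep"
  and row: "\<And>k y. k < N ==> (\<Sum>z\<in>UNIV. abs (P k y z) * w k y z) <= rh"
  and err: "\<And>k y. k < N ==> abs ((\<Sum>z\<in>UNIV. P k y z * w k y z * et (Suc k) z) - et k y) <= ep"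
  and q: "q = et N"
 shows "j <= N ==> abs (chain_val P w q j (N - j) y - et (N - j) y) <= real j * ep * rh ^ j"
proof (induction j arbitrary: y)
 case 0
 thus ?case by (simp add: q)
next
 case (Suc j)
 define k where "k = N - Suc j"
 have k: "Suc k = N - j" "k < N" using Suc.prems by (auto simp: k_def)
 have "abs (\<Sum>z\<in>UNIV. P k y z * w k y z * (chain_val P w q j (Suc k) z - et (Suc k) z))
   <= (\<Sum>z\<in>UNIV. abs (P k y z) * w k y z * (real j * ep * rh ^ j))"
 proof (rule order_trans[OF sum_abs sum_mono])
  fix z
  have "abs (chain_val P w q j (Suc k) z - et (Suc k) z) <= real j * ep * rh ^ j"
   unfolding k(1) using Suc by simp
  thus "abs (P k y z * w k y z * (chain_val P w q j (Suc k) z - et (Suc k) z)) <= abs (P k y z) * w k y z * (real j * ep * rh ^ j)"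
   unfolding abs_mult using w[of k y z] by (simp add: mult_left_mono)
 qed
 also have "... = (\<Sum>z\<in>UNIV. abs (P k y z) * w k y z) * (real j * ep * rh ^ j)" by (simp add: sum_distrib_right)
 also have "... <= rh * (real j * ep * rh ^ j)" using row[OF k(2)] ep rh by (intro mult_right_mono) auto
 finally have propagated: "abs (\<Sum>z\<in>UNIV. P k y z * w k y z * (chain_val P w q j (Suc k) z - et (Suc k) z)) <= real j * ep * rh ^ Suc j"
  by (simp add: mult_ac)
 have "chain_val P w q (Suc j) k y - et k y = (\<Sum>z\<in>UNIV. P k y z * w k y z * (chain_val P w q j (Suc k) z - et (Suc k) z))
   + ((\<Sum>z\<in>UNIV. P k y z * w k y z * et (Suc k) z) - et k y)"
  by (simp add: right_diff_distrib sum_subtractf)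
 hence "abs (chain_val P w q (Suc j) k y - et k y) <= real j * ep * rh ^ Suc j + ep"
  using propagated err[OF k(2), of y] by linarith
 also have "... <= real j * ep * rh ^ Suc j + ep * rh ^ Suc j"
  using ep rh mult_left_mono[OF one_le_power[OF rh, of "Suc j"] ep] by simp
 also have "... = real (Suc j) * ep * rh ^ Suc j" by (simp add: algebra_simps)
 finally show ?case unfolding k_def .
qed

lemma chain_val_bound:
 fixes P w :: "nat => 'v::finite => 'v => real"
 assumes w: "\<And>k y z. 0 <= w k y z" and rh: "0 <= rh"
  and row: "\<And>k y. k < N ==> (\<Sum>z\<in>UNIV. abs (P k y z) * w k y z) <= rh"
 shows "j + k <= N ==> abs (chain_val P w (%_. 1) j k y) <= rh ^ j"
proof (induction j arbitrary: k y)
 case (Suc j)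
 have "abs (chain_val P w (%_. 1) (Suc j) k y) <= (\<Sum>z\<in>UNIV. abs (P k y z) * w k y z * rh ^ j)"
  unfolding chain_val.simps
 proof (rule order_trans[OF sum_abs sum_mono])
  fix z
  show "abs (P k y z * w k y z * chain_val P w (%_. 1) j (Suc k) z) <= abs (P k y z) * w k y z * rh ^ j"
   unfolding abs_mult using w[of k y z] Suc by (simp add: mult_left_mono)
 qed
 also have "... = (\<Sum>z\<in>UNIV. abs (P k y z) * w k y z) * rh ^ j" by (simp add: sum_distrib_right)
 also have "... <= rh * rh ^ j" using row[of k y] Suc.prems rh by (intro mult_right_mono) auto
 finally show ?case by simp
qed simp

lemma uniform_modulus:
 fixes g :: "('e::finite) tfun"
 assumes g: "\<And>e. continuous_on UNIV (g e)" and "\<delta> > 0"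
 obtains d where "d > 0" "\<And>e s u. s \<in> {a..b} ==> u \<in> {a..b} ==> abs (u - s) < d ==> abs (g e u - g e s) < \<delta>"
proof -
 have "\<exists>d>0. \<forall>s\<in>{a..b}. \<forall>u\<in>{a..b}. dist u s < d --> dist (g e u) (g e s) < \<delta>" for e
  using compact_uniformly_continuous[OF continuous_on_subset[OF g], of "{a..b}" e] \<open>\<delta> > 0\<close>
  unfolding uniformly_continuous_on_def by auto
 then obtain d where d: "\<And>e. d e > 0" "\<And>e s u. s \<in> {a..b} ==> u \<in> {a..b} ==> dist u s < d e ==> dist (g e u) (g e s) < \<delta>"
  by metis
 have "Min (range d) > 0" "\<And>e. Min (range d) <= d e" using d(1) by auto
 thus ?thesis using d(2) by (intro that[of "Min (range d)"]) (auto simp: dist_real_def intro: less_le_trans)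
qed

context periodic_chain
begin

lemma list_event_measurable:
 assumes "\<And>t. t \<in> set ts ==> 0 <= t"
 shows "{om \<in> space M. \<forall>i<length ts. X om (ts ! i) = zs ! i} \<in> sets M"
proof -
 have "{om \<in> space M. \<forall>i\<in>{..<length ts}. X om (ts ! i) = zs ! i} \<in> sets M"
 proof (rule sets.sets_Collect_finite_All)
  fix i assume "i \<in> {..<length ts}"
  hence "(%om. X om (ts ! i)) \<in> measurable M (count_space UNIV)" using assms by (intro X_measurable) auto
  hence "(%om. X om (ts ! i)) -` {zs ! i} \<inter> space M \<in> sets M" by (rule measurable_sets) auto
  moreover have "(%om. X om (ts ! i)) -` {zs ! i} \<inter> space M = {om \<in> space M. X om (ts ! i) = zs ! i}" by auto
  ultimately show "{om \<in> space M. X om (ts ! i) = zs ! i} \<in> sets M" by simp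
 qed auto
 thus ?thesis by (simp only: Ball_def lessThan_iff)
qed

lemma chain_fdd:
 "length ts = length ys ==> sorted ts ==> (\<And>t. t \<in> set ts ==> 0 <= t) ==>
  prob {om \<in> space M. \<forall>i<length ts. X om (ts ! i) = ys ! i} = fdd p 0 x ts ys"
 using chain unfolding markov_chain_def by blast

lemma expectation_list:
 assumes ts: "sorted ts" "\<And>t. t \<in> set ts ==> 0 <= t"
 shows "integrable M (%om. G (map (X om) ts))"
  and "expectation (%om. G (map (X om) ts)) = (\<Sum>zs\<in>{zs. length zs = length ts}. G zs * fdd p 0 x ts zs)"
proof -
 let ?Z = "{zs :: 'v list. length zs = length ts}"
 define A where "A zs = {om \<in> space M. \<forall>i<length ts. X om (ts ! i) = zs ! i}" for zs
 have A: "A zs \<in> sets M" for zs unfolding A_def by (rule list_event_measurable) (rule ts(2))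
 have finite_Z: "finite ?Z" using finite_lists_length_eq[of "UNIV :: 'v set" "length ts"] by simp
 have map_sum: "G (map (X om) ts) = (\<Sum>zs\<in>?Z. G zs * indicator (A zs) om)" if "om \<in> space M" for om
 proof -
  have "(\<Sum>zs\<in>?Z. G zs * indicator (A zs) om) = (\<Sum>zs\<in>?Z. if zs = map (X om) ts then G zs else 0)"
   using that by (intro sum.cong) (auto simp: A_def indicator_def list_eq_iff_nth_eq)
  thus ?thesis using finite_Z by simp
 qed
 have int: "integrable M (%om. G zs * indicator (A zs) om)" for zs
  using A[of zs] by (intro integrable_mult_right integrable_real_indicator) (auto simp: emeasure_eq_measure)
 hence "integrable M (%om. \<Sum>zs\<in>?Z. G zs * indicator (A zs) om)" by (intro Bochner_Integration.integrable_sum)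
 thus "integrable M (%om. G (map (X om) ts))"
  by (subst Bochner_Integration.integrable_cong[OF refl map_sum]) assumption+
 have "expectation (%om. G (map (X om) ts)) = expectation (%om. \<Sum>zs\<in>?Z. G zs * indicator (A zs) om)"
  by (intro Bochner_Integration.integral_cong refl map_sum)
 also have "... = (\<Sum>zs\<in>?Z. expectation (%om. G zs * indicator (A zs) om))"
  by (rule Bochner_Integration.integral_sum) (rule int)
 also have "... = (\<Sum>zs\<in>?Z. G zs * measure M (A zs))"
  using A by (simp add: sets.Int_space_eq2)
 also have "... = (\<Sum>zs\<in>?Z. G zs * fdd p 0 x ts zs)"
 proof (intro sum.cong refl arg_cong2[where f = "(*)"])
  fix zs assume "zs \<in> ?Z"
  thus "measure M (A zs) = fdd p 0 x ts zs"
   unfolding A_def using ts by (intro chain_fdd) auto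
 qed
 finally show "expectation (%om. G (map (X om) ts)) = (\<Sum>zs\<in>?Z. G zs * fdd p 0 x ts zs)" .
qed

lemma X_0_AE: "AE om in M. X om 0 = x"
proof -
 have "measure M {om \<in> space M. \<forall>i<length [0::real]. X om ([0::real] ! i) = [x] ! i} = fdd p 0 x [0] [x]"
  by (rule chain_fdd) auto
 also have "... = 1" using kol[of 0 0 x x] by simp
 finally have "prob {om \<in> space M. X om 0 = x} = 1" by simp
 moreover have "{om \<in> space M. X om 0 = x} \<in> sets M" using list_event_measurable[of "[0]" "[x]"] by simp
 ultimately show ?thesis using prob_Collect_eq_1 by auto
qed

lemma mesh_fun_measurable:
 assumes T: "0 <= T" shows "(%om. mesh_fun T N f g (X om)) \<in> borel_measurable M"
 unfolding mesh_fun_def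
proof (intro borel_measurable_sum)
 fix k
 have X: "(%om. X om (mesh T N j)) \<in> measurable M (count_space UNIV)" for j
  using T by (intro X_measurable mesh_nonneg)
 have "(%om. mesh_term T N f g k y (X om (mesh T N (Suc k)))) \<in> borel_measurable M" for y
  by (rule measurable_compose[OF X]) simp
 thus "(%om. mesh_term T N f g k (X om (mesh T N k)) (X om (mesh T N (Suc k)))) \<in> borel_measurable M"
  by (rule measurable_compose_countable[OF _ X])
qed

lemma terminal_measurable: "0 <= T ==> (%om. q (X om T)) \<in> borel_measurable M"
 by (rule measurable_compose[OF X_measurable]) auto

lemma path_fun_measurable:
 assumes T: "T > 0" and f: "\<And>y. bdd_borel (f y)" and g: "\<And>e. continuous_on UNIV (g e)"
 shows "(%om. path_fun T f g (X om)) \<in> borel_measurable M"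
proof (rule borel_measurable_LIMSEQ_real)
 show "(%N. mesh_fun T N f g (X om)) \<longlonglongrightarrow> path_fun T f g (X om)" if "om \<in> space M" for om
  by (rule mesh_fun_tendsto[OF X_cadlag[OF that] T f g])
qed (use T in \<open>auto intro: mesh_fun_measurable\<close>)

lemma mesh_expectation:
 assumes T: "T > 0" and N: "N > 0"
 shows "integrable M (%om. exp (mesh_fun T N f g (X om)) * q (X om T))"
  and "expectation (%om. exp (mesh_fun T N f g (X om)) * q (X om T))
   = chain_val (%k. p (mesh T N k) (mesh T N (Suc k))) (%k y z. exp (mesh_term T N f g k y z)) q N 0 x"
proof -
 let ?Z = "%om. exp (mesh_fun T N f g (X om)) * q (X om T)"
 let ?ts = "map (mesh T N) [Suc 0..<Suc 0 + N]"
 let ?G = "list_weight (%k y z. exp (mesh_term T N f g k y z)) q 0 x"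
 have ts: "sorted ?ts" "\<And>t. t \<in> set ?ts ==> 0 <= t"
  using T mesh_nonneg by (auto intro!: sorted_mesh simp del: upt_Suc)
 have weight: "?Z om = ?G (map (X om) ?ts)" if "X om 0 = x" for om
  using list_weight_exp[of "mesh_term T N f g" q 0 "%i. X om (mesh T N i)" N] that N
  by (simp add: mesh_N mesh_fun_def lessThan_atLeast0 o_def)
 have AE_weight: "AE om in M. ?G (map (X om) ?ts) = ?Z om"
  using X_0_AE by eventually_elim (simp only: weight)
 have Z: "?Z \<in> borel_measurable M"
  using mesh_fun_measurable[OF less_imp_le[OF T], of N f g] terminal_measurable[OF less_imp_le[OF T], of q] by measurable
 show "integrable M ?Z"
  by (rule integrable_cong_AE_imp[OF expectation_list(1)[OF ts] Z AE_weight])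
 have "expectation ?Z = expectation (%om. ?G (map (X om) ?ts))"
  using AE_weight borel_measurable_integrable[OF expectation_list(1)[OF ts]] Z
  by (intro integral_cong_AE) (auto elim: eventually_mono)
 also have "... = (\<Sum>zs\<in>{zs. length zs = N}. ?G zs * fdd p (mesh T N 0) x ?ts zs)"
  using expectation_list(2)[OF ts, of ?G] by (simp only: length_map length_upt diff_add_inverse mesh_0)
 also have "... = chain_val (%k. p (mesh T N k) (mesh T N (Suc k))) (%k y z. exp (mesh_term T N f g k y z)) q N 0 x"
  by (rule sum_fdd_list_weight)
 finally show "expectation ?Z
   = chain_val (%k. p (mesh T N k) (mesh T N (Suc k))) (%k y z. exp (mesh_term T N f g k y z)) q N 0 x" .
qed

definition row_rate :: "real => real" where
 "row_rate L = exp L * L + 2 * Ga * exp (2 * L)"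

lemma row_rate_nonneg: "0 <= L ==> 0 <= row_rate L"
 using Ga_nonneg by (simp add: row_rate_def)

lemma row_bound:
 assumes f: "\<And>y. bdd_borel (f y)" "\<And>y t. abs (f y t) <= L" and g: "\<And>e t. abs (g e t) <= L"
  and s: "0 <= s" "s <= t" "t - s <= small_step"
 shows "(\<Sum>z\<in>UNIV. abs (p s t y z) * exp (integral {s..t} (f y) + (if y = z then 0 else g (y, z) s))) <= 1 + row_rate L * (t - s)"
proof -
 define ph where "ph = integral {s..t} (f y)"
 define w where "w z = exp (ph + (if y = z then 0 else g (y, z) s))" for z
 let ?\<delta> = "%z. if y = z then 1 else 0 :: real"
 have L: "0 <= L" using g by (meson abs_ge_zero order_trans)
 have ph: "abs ph <= L * (t - s)" unfolding ph_def using s by (intro abs_integral_le f)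
 have Ld: "L * (t - s) <= L" using L s small_step by (intro mult_left_le) auto
 have w: "0 <= w z" "w z <= exp (2 * L)" for z
  unfolding w_def using ph Ld g[of "(y, z)" s] L by auto
 have "(\<Sum>z\<in>UNIV. abs (p s t y z) * w z) <= (\<Sum>z\<in>UNIV. ?\<delta> z * w z + abs (p s t y z - ?\<delta> z) * exp (2 * L))"
 proof (rule sum_mono)
  fix z
  have "abs (p s t y z) * w z <= (?\<delta> z + abs (p s t y z - ?\<delta> z)) * w z" using w by (intro mult_right_mono) auto
  also have "... <= ?\<delta> z * w z + abs (p s t y z - ?\<delta> z) * exp (2 * L)"
   unfolding distrib_right using w by (intro add_left_mono mult_left_mono) auto
  finally show "abs (p s t y z) * w z <= ?\<delta> z * w z + abs (p s t y z - ?\<delta> z) * exp (2 * L)" .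
 qed
 also have "... = w y + (\<Sum>z\<in>UNIV. abs (p s t y z - ?\<delta> z)) * exp (2 * L)"
  by (simp add: sum.distrib sum_distrib_right if_distrib[of "%x. x * _"] cong: if_cong)
 also have "... <= (1 + exp L * (L * (t - s))) + 2 * Ga * (t - s) * exp (2 * L)"
  using exp_linear_errors(1)[OF ph Ld] p_row_linear[OF s, of y] s L
  by (intro add_mono mult_right_mono) (auto simp: w_def abs_le_iff)
 finally show ?thesis unfolding w_def ph_def by (simp add: row_rate_def algebra_simps)
qed

lemma mesh_row_bound:
 assumes T: "T > 0" and f: "\<And>y. bdd_borel (f y)" "\<And>y t. abs (f y t) <= L" and g: "\<And>e t. abs (g e t) <= L"
  and N: "N > 0" "T / real N <= small_step"
 shows "(\<Sum>z\<in>UNIV. abs (p (mesh T N k) (mesh T N (Suc k)) y z) * exp (mesh_term T N f g k y z)) <= 1 + row_rate L * (T / real N)"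
 using row_bound[where f = f and g = g and s = "mesh T N k" and t = "mesh T N (Suc k)" and y = y, OF f g] T N mesh_nonneg[of T N k]
 unfolding mesh_term_def mesh_cell_def by (simp add: mesh_Suc)

lemma mesh_row_power_le:
 assumes "0 < T" "0 <= L" "N > 0" shows "(1 + row_rate L * (T / real N)) ^ N <= exp (row_rate L * T)"
proof -
 have "0 <= row_rate L * T" using row_rate_nonneg assms by simp
 hence "- real N <= row_rate L * T" by linarith
 from exp_ge_one_plus_x_over_n_power_n[OF this assms(3)] show ?thesis by simp
qed

lemma eventually_mesh_fine: "\<forall>\<^sub>F N in sequentially. N > 0 \<and> T / real N <= small_step"
 using order_tendstoD(2)[OF mesh_width_tendsto[of T] small_step(1)] eventually_gt_at_top[of "0::nat"]
 by eventually_elim auto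

lemma mesh_exp_nn_integral_le:
 assumes T: "T > 0" and L: "0 <= L" and N: "N > 0" "T / real N <= small_step"
 shows "(\<integral>\<^sup>+om. ennreal (exp (mesh_fun T N (%_ _. 0) (%_ _. L) (X om))) \<partial>M) <= ennreal (exp (row_rate L * T))"
proof -
 let ?w = "%k y z. exp (mesh_term T N (%_ _. 0) (%_ _. L) k y z)"
 have "expectation (%om. exp (mesh_fun T N (%_ _. 0) (%_ _. L) (X om)))
   = chain_val (%k. p (mesh T N k) (mesh T N (Suc k))) ?w (%_. 1) N 0 x"
  using mesh_expectation(2)[OF T N(1), where q = "%_. 1"] by simp
 also have "... <= (1 + row_rate L * (T / real N)) ^ N"
 proof (rule order_trans[OF abs_ge_self chain_val_bound[where N = N]])
  show "(\<Sum>z\<in>UNIV. abs (p (mesh T N k) (mesh T N (Suc k)) y z) * ?w k y z) <= 1 + row_rate L * (T / real N)" for k y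
   using L by (intro mesh_row_bound T N) auto
 qed (use row_rate_nonneg[OF L] T in auto)
 also have "... <= exp (row_rate L * T)" using T L N by (intro mesh_row_power_le)
 finally show ?thesis
  using mesh_expectation(1)[OF T N(1), where q = "%_. 1"] by (subst nn_integral_eq_integral) (auto intro: ennreal_leI)
qed

lemma exp_jumps_integrable:
 assumes T: "T > 0" and L: "0 <= L"
 shows "integrable M (%om. exp (L * real (card (jumps (X om) T))))"
proof (rule integrableI_bounded)
 let ?Z = "%N om. exp (mesh_fun T N (%_ _. 0) (%_ _. L) (X om))"
 have jumps: "path_fun T (%_ _. 0) (%_ _. L) (X om) = L * real (card (jumps (X om) T))" for om
  by (simp add: path_fun_def along_def[abs_def])
 show "(%om. exp (L * real (card (jumps (X om) T)))) \<in> borel_measurable M"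
  using path_fun_measurable[OF T, of "%_ _. 0" "%_ _. L"] unfolding jumps by auto
 have "(\<integral>\<^sup>+om. ennreal (exp (L * real (card (jumps (X om) T)))) \<partial>M) = (\<integral>\<^sup>+om. liminf (%N. ennreal (?Z N om)) \<partial>M)"
 proof (rule nn_integral_cong)
  fix om assume "om \<in> space M"
  hence "(%N. ennreal (?Z N om)) \<longlonglongrightarrow> ennreal (exp (L * real (card (jumps (X om) T))))"
   using mesh_fun_tendsto[OF X_cadlag T, of om "%_ _. 0" "%_ _. L"] unfolding jumps
   by (intro tendsto_ennrealI tendsto_intros) auto
  thus "ennreal (exp (L * real (card (jumps (X om) T)))) = liminf (%N. ennreal (?Z N om))"
   by (rule lim_imp_Liminf[OF trivial_limit_sequentially, symmetric])
 qed
 also have "... <= liminf (%N. \<integral>\<^sup>+om. ennreal (?Z N om) \<partial>M)"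
  using T mesh_fun_measurable by (intro nn_integral_liminf) auto
 also have "... <= liminf (%N::nat. ennreal (exp (row_rate L * T)))"
  using eventually_mesh_fine[of T] by (intro Liminf_mono) (auto elim!: eventually_mono intro: mesh_exp_nn_integral_le[OF T L])
 also have "... < \<infinity>" by (simp add: Liminf_const)
 finally show "(\<integral>\<^sup>+om. ennreal (norm (exp (L * real (card (jumps (X om) T))))) \<partial>M) < \<infinity>" by simp
qed

context
 fixes T :: real and f h :: "'v tfun" and g :: "('v * 'v) tfun" and L H :: real
 assumes T: "T > 0" and f: "\<And>y. bdd_borel (f y)" "\<And>y t. abs (f y t) <= L"
  and g: "\<And>e. continuous_on UNIV (g e)" "\<And>e. bdd_borel (g e)" "\<And>e t. abs (g e t) <= L"
  and h: "\<And>y. bdd_borel (h y)" "\<And>y t. abs (h y t) <= H" "\<And>y. indef 0 T (h y) (bw f g h y)"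
begin

lemma L_nonneg: "0 <= L" and H_nonneg: "0 <= H"
 using g(3) h(2) by (meson abs_ge_zero order_trans)+

lemma mesh_expectation_close:
 obtains C where "C > 0" "\<And>N \<delta>. N > 0 ==> T / real N <= small_step ==>
   \<forall>e. \<forall>s\<in>{0..T}. \<forall>u\<in>{0..T}. abs (u - s) <= T / real N --> abs (g e u - g e s) <= \<delta> ==>
   abs (expectation (%om. exp (mesh_fun T N f g (X om)) * h (X om T) T) - h x 0) <= C * (T / real N + \<delta>)"
proof -
 obtain K where K: "K >= 0" and loc: "\<And>s t y \<delta>. 0 <= s ==> s <= t ==> t <= T ==> t - s <= small_step ==>
  \<forall>e. \<forall>u\<in>{s..t}. abs (g e u - g e s) <= \<delta> ==>
  abs ((\<Sum>z\<in>UNIV. p s t y z * exp (integral {s..t} (f y) + (if y = z then 0 else g (y, z) s)) * h z t) - h y s)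
   <= K * (t - s) * ((t - s) + \<delta>)"
  using that by (rule local_error[OF T f g h])
 show ?thesis
 proof (rule that[of "K * T * exp (row_rate L * T) + 1"])
  show "0 < K * T * exp (row_rate L * T) + 1" using K T by (intro add_nonneg_pos) auto
  fix N \<delta> assume N: "N > 0" "T / real N <= small_step"
   and "\<forall>e. \<forall>s\<in>{0..T}. \<forall>u\<in>{0..T}. abs (u - s) <= T / real N --> abs (g e u - g e s) <= \<delta>"
  hence osc: "\<And>e s u. s \<in> {0..T} ==> u \<in> {0..T} ==> abs (u - s) <= T / real N ==> abs (g e u - g e s) <= \<delta>" by blast
  let ?P = "%k. p (mesh T N k) (mesh T N (Suc k))" and ?w = "%k y z. exp (mesh_term T N f g k y z)"
  define \<epsilon> where "\<epsilon> = K * (T / real N) * (T / real N + \<delta>)"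
  have \<delta>: "0 <= \<delta>" using osc[of 0 0] T by auto
  have "abs ((\<Sum>z\<in>UNIV. ?P k y z * ?w k y z * h z (mesh T N (Suc k))) - h y (mesh T N k)) <= \<epsilon>" if k: "k < N" for k y
  proof -
   have cell: "0 <= mesh T N k" "mesh T N k <= mesh T N (Suc k)" "mesh T N (Suc k) <= T"
    "mesh T N (Suc k) - mesh T N k = T / real N"
    using T k by (auto simp: mesh_nonneg mesh_mono intro!: mesh_le) (simp add: mesh_Suc)
   hence "\<forall>e. \<forall>u\<in>{mesh T N k..mesh T N (Suc k)}. abs (g e u - g e (mesh T N k)) <= \<delta>"
    by (intro allI ballI osc) auto
   from loc[OF cell(1-3) _ this, of y] show ?thesis
    using N cell unfolding mesh_term_def mesh_cell_def \<epsilon>_def by simp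
  qed
  hence "abs (chain_val ?P ?w (%y. h y T) N (N - N) x - h x (mesh T N (N - N))) <= real N * \<epsilon> * (1 + row_rate L * (T / real N)) ^ N"
   using row_rate_nonneg[OF L_nonneg] mesh_row_bound[OF T f g(3) N] K T \<delta> N
   by (intro chain_val_close[where N = N and et = "%k y. h y (mesh T N k)"]) (auto simp: mesh_N \<epsilon>_def)
  also have "... <= real N * \<epsilon> * exp (row_rate L * T)"
   using T N K \<delta> L_nonneg by (intro mult_left_mono mesh_row_power_le) (auto simp: \<epsilon>_def)
  also have "... = (K * T * exp (row_rate L * T)) * (T / real N + \<delta>)" using N by (simp add: \<epsilon>_def)
  also have "... <= (K * T * exp (row_rate L * T) + 1) * (T / real N + \<delta>)"
   using T \<delta> by (intro mult_right_mono) auto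
  finally show "abs (expectation (%om. exp (mesh_fun T N f g (X om)) * h (X om T) T) - h x 0)
    <= (K * T * exp (row_rate L * T) + 1) * (T / real N + \<delta>)"
   using mesh_expectation(2)[OF T N(1), of f g "%y. h y T"] by simp
 qed
qed

lemma mesh_expectation_tendsto:
 "(%N. expectation (%om. exp (mesh_fun T N f g (X om)) * h (X om T) T)) \<longlonglongrightarrow> h x 0"
proof (rule tendstoI)
 fix r :: real assume r: "r > 0"
 obtain C where C: "C > 0" "\<And>N \<delta>. N > 0 ==> T / real N <= small_step ==>
   \<forall>e. \<forall>s\<in>{0..T}. \<forall>u\<in>{0..T}. abs (u - s) <= T / real N --> abs (g e u - g e s) <= \<delta> ==>
   abs (expectation (%om. exp (mesh_fun T N f g (X om)) * h (X om T) T) - h x 0) <= C * (T / real N + \<delta>)"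
  using that by (rule mesh_expectation_close)
 define \<delta> where "\<delta> = r / (4 * C)"
 have \<delta>: "\<delta> > 0" using r C by (simp add: \<delta>_def)
 obtain d where d: "d > 0" "\<And>e s u. s \<in> {0..T} ==> u \<in> {0..T} ==> abs (u - s) < d ==> abs (g e u - g e s) < \<delta>"
  using that by (rule uniform_modulus[where g = g, OF g(1) \<delta>])
 have "\<forall>\<^sub>F N in sequentially. T / real N < min d \<delta>"
  using d \<delta> by (intro order_tendstoD(2)[OF mesh_width_tendsto]) auto
 thus "\<forall>\<^sub>F N in sequentially. dist (expectation (%om. exp (mesh_fun T N f g (X om)) * h (X om T) T)) (h x 0) < r"
  using eventually_mesh_fine[of T]
 proof eventually_elim
  case (elim N)
  have "abs (expectation (%om. exp (mesh_fun T N f g (X om)) * h (X om T) T) - h x 0) <= C * (T / real N + \<delta>)"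
   using elim d(2) by (intro C(2)) (auto intro: less_imp_le)
  also have "... < C * (2 * \<delta>)" using elim C(1) by (intro mult_strict_left_mono) auto
  also have "... <= r" using C r by (simp add: \<delta>_def)
  finally show ?case by (simp add: dist_real_def)
 qed
qed

lemma mesh_weight_dominated:
 assumes "om \<in> space M" "N > 0"
 shows "abs (exp (mesh_fun T N f g (X om)) * h (X om T) T) <= exp (L * T) * H * exp (L * real (card (jumps (X om) T)))"
proof -
 have "abs (mesh_fun T N f g (X om)) <= L * T + L * real (card (jumps (X om) T))"
  using assms by (intro mesh_fun_bound X_cadlag T f g(3))
 hence "exp (mesh_fun T N f g (X om)) <= exp (L * T) * exp (L * real (card (jumps (X om) T)))"
  by (simp add: mult_exp_exp)
 hence "abs (exp (mesh_fun T N f g (X om)) * h (X om T) T) <= (exp (L * T) * exp (L * real (card (jumps (X om) T)))) * H"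
  unfolding abs_mult using h by (intro mult_mono) auto
 thus ?thesis by (simp add: mult_ac)
qed

lemma feynman_kac_bounded:
 "integrable M (%om. exp (path_fun T f g (X om)) * h (X om T) T)" (is "integrable M ?W")
 "expectation (%om. exp (path_fun T f g (X om)) * h (X om T) T) = h x 0"
proof -
 let ?Z = "%N om. exp (mesh_fun T (Suc N) f g (X om)) * h (X om T) T"
 have W: "?W \<in> borel_measurable M"
  using path_fun_measurable[OF T f(1) g(1)] terminal_measurable[OF less_imp_le[OF T], of "%y. h y T"] by measurable
 have Z: "?Z N \<in> borel_measurable M" for N
  using mesh_fun_measurable[OF less_imp_le[OF T], of "Suc N" f g] terminal_measurable[OF less_imp_le[OF T], of "%y. h y T"] by measurable
 have D: "integrable M (%om. exp (L * T) * H * exp (L * real (card (jumps (X om) T))))"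
  using exp_jumps_integrable[OF T L_nonneg] by (intro integrable_mult_right)
 have lim: "AE om in M. (%N. ?Z N om) \<longlonglongrightarrow> ?W om"
  using mesh_fun_tendsto[OF X_cadlag T f(1) g(1)] by (intro AE_I2 tendsto_intros LIMSEQ_Suc)
 have dom: "AE om in M. norm (?Z N om) <= exp (L * T) * H * exp (L * real (card (jumps (X om) T)))" for N
  using mesh_weight_dominated by (intro AE_I2) auto
 show "integrable M ?W" by (rule integrable_dominated_convergence[OF W Z D lim dom])
 show "expectation ?W = h x 0"
  using LIMSEQ_unique[OF integral_dominated_convergence[OF W Z D lim dom] LIMSEQ_Suc[OF mesh_expectation_tendsto]] .
qed

end

theorem feynman_kac:
 assumes T: "T > 0" and f: "\<And>y. bdd_borel (f y)" and g: "\<And>e. continuous_on UNIV (g e)" "\<And>e. bdd_borel (g e)"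
  and h: "\<And>y. bdd_borel (h y)" "\<And>y. indef 0 T (h y) (bw f g h y)"
 shows "integrable M (%om. exp (path_fun T f g (X om)) * h (X om T) T)"
  and "expectation (%om. exp (path_fun T f g (X om)) * h (X om T) T) = h x 0"
proof -
 obtain Lf where Lf: "\<And>y t. abs (f y t) <= Lf" using bdd_borel_family_bound[of f] f by metis
 obtain Lg where Lg: "\<And>e t. abs (g e t) <= Lg" using bdd_borel_family_bound[of g] g by metis
 obtain H where H: "\<And>y t. abs (h y t) <= H" using bdd_borel_family_bound[of h] h by metis
 have f': "abs (f y t) <= max Lf Lg" and g': "abs (g e t) <= max Lf Lg" for y t e
  using Lf[of y t] Lg[of e t] by auto
 show "integrable M (%om. exp (path_fun T f g (X om)) * h (X om T) T)"
  and "expectation (%om. exp (path_fun T f g (X om)) * h (X om T) T) = h x 0"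
  by (rule feynman_kac_bounded[OF T f f' g g' h(1) H h(2)])+
qed

end

section \<open>The principal eigenvalue\<close>

definition osc_ball :: "'v => real => (real^'v::finite) set" where
 "osc_ball y0 \<beta> = {\<zeta>. \<zeta> $ y0 = 0 \<and> (\<forall>y z. \<zeta> $ y - \<zeta> $ z <= \<beta>)}"

lemma abs_le_of_osc_ball: "\<zeta> \<in> osc_ball y0 \<beta> ==> abs (\<zeta> $ y) <= \<beta>"
proof -
 assume "\<zeta> \<in> osc_ball y0 \<beta>"
 hence "\<zeta> $ y - \<zeta> $ y0 <= \<beta>" "\<zeta> $ y0 - \<zeta> $ y <= \<beta>" "\<zeta> $ y0 = 0" unfolding osc_ball_def by blast+
 thus ?thesis by linarith
qed

lemma compact_osc_ball: "compact (osc_ball (y0 :: 'v::finite) \<beta>)"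
proof -
 have "closed (osc_ball y0 \<beta>)" unfolding osc_ball_def
  by (intro closed_Collect_conj closed_Collect_all closed_Collect_le closed_Collect_eq continuous_intros)
 moreover have "norm \<zeta> <= real CARD('v) * \<beta>" if "\<zeta> \<in> osc_ball y0 \<beta>" for \<zeta>
  using that by (intro norm_vec_le abs_le_of_osc_ball)
 hence "bounded (osc_ball y0 \<beta>)" unfolding bounded_iff by blast
 ultimately show ?thesis by (simp add: compact_eq_bounded_closed)
qed

lemma convex_osc_ball: "convex (osc_ball y0 \<beta>)"
 unfolding convex_def
proof (intro ballI allI impI)
 fix \<zeta> \<zeta>' :: "real^'a" and u v :: real
 assume \<zeta>: "\<zeta> \<in> osc_ball y0 \<beta>" "\<zeta>' \<in> osc_ball y0 \<beta>" and uv: "0 <= u" "0 <= v" "u + v = 1"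
 have "u * (\<zeta> $ y - \<zeta> $ z) + v * (\<zeta>' $ y - \<zeta>' $ z) <= \<beta>" for y z
  using \<zeta> uv by (intro convex_bound_le) (auto simp: osc_ball_def)
 thus "u *\<^sub>R \<zeta> + v *\<^sub>R \<zeta>' \<in> osc_ball y0 \<beta>" using \<zeta> by (simp add: osc_ball_def algebra_simps)
qed

lemma osc_brouwer:
 fixes G :: "real^'v::finite => real^'v"
 assumes G: "\<And>S. continuous_on S G" and \<beta>: "0 <= \<beta>"
  and osc: "\<And>\<zeta> y z. \<forall>y z. \<zeta> $ y - \<zeta> $ z <= \<beta> ==> G \<zeta> $ y - G \<zeta> $ z <= \<beta>"
 obtains \<zeta> a where "\<And>y. abs (\<zeta> $ y) <= \<beta>" "\<And>y. G \<zeta> $ y = \<zeta> $ y + a"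
proof -
 let ?F = "%\<zeta>. \<chi> y. G \<zeta> $ y - G \<zeta> $ undefined"
 obtain \<zeta> where \<zeta>: "\<zeta> \<in> osc_ball undefined \<beta>" "?F \<zeta> = \<zeta>"
 proof (rule brouwer[OF compact_osc_ball convex_osc_ball])
  have "0 \<in> osc_ball undefined \<beta>" using \<beta> by (simp add: osc_ball_def)
  thus "osc_ball undefined \<beta> \<noteq> {}" by blast
  show "continuous_on (osc_ball undefined \<beta>) ?F"
   using G by (intro continuous_on_vec_lambda continuous_intros)
  show "?F \<in> osc_ball undefined \<beta> \<rightarrow> osc_ball undefined \<beta>" using osc by (auto simp: osc_ball_def)
 qed
 show ?thesis
 proof (rule that)
  show "abs (\<zeta> $ y) <= \<beta>" for y by (rule abs_le_of_osc_ball[OF \<zeta>(1)])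
  show "G \<zeta> $ y = \<zeta> $ y + G \<zeta> $ undefined" for y
   using arg_cong[OF \<zeta>(2), of "%v. v $ y"] by simp
 qed
qed

lemma exp_weight_bounds:
 assumes "abs l <= K" "T > 0" "t \<in> {0..T}"
 shows "exp (- K) <= exp_weight (- l / T) T t" "exp_weight (- l / T) T t <= exp K"
proof -
 have "abs l * ((T - t) / T) <= K * 1" using assms by (intro mult_mono) auto
 hence "abs (- l / T * (T - t)) <= K" using assms by (auto simp: abs_mult abs_divide)
 thus "exp (- K) <= exp_weight (- l / T) T t" "exp_weight (- l / T) T t <= exp K"
  unfolding exp_weight_eq[OF assms(3)] exp_le_cancel_iff by (auto simp only: abs_le_iff neg_le_iff_le minus_le_iff[of K])
qed

lemma periodic_lin_sol:
 assumes T: "T > 0" and sol: "lin_sol a b T h" "\<And>y. h y 0 = h y T"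
  and a: "\<And>y z. bdd_borel (a y z)" "\<And>y z t. a y z (t + T) = a y z t"
  and b: "\<And>y. bdd_borel (b y)" "\<And>y t. b y (t + T) = b y t"
 obtains H where "\<And>y. bdd_borel (H y)" "\<And>y t. H y (t + T) = H y t" "\<And>t. \<exists>s\<in>{0..T}. \<forall>y. H y t = h y s"
  "\<And>y r t. indef r t (H y) (lin_rhs a b H y)"
proof -
 define H where "H y t = h y (pmod t T)" for y t
 note ext = periodic_extension[OF T lin_sol_bdd[OF sol(1)] sol(2)]
 have H: "bdd_borel (H y)" "t \<in> {0..T} ==> H y t = h y t" "H y (t + T) = H y t" for y t
  unfolding H_def[abs_def] using ext T by auto
 have "indef r t (H y) (lin_rhs a b H y)" for y r t
 proof (rule indef_periodic[OF T])
  show "bdd_borel (lin_rhs a b H y)" using a b H by (intro bdd_borel_lin_rhs)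
  show "lin_rhs a b H y (t + T) = lin_rhs a b H y t" for t by (simp add: lin_rhs_def a b H)
  show "indef 0 T (H y) (lin_rhs a b H y)"
   using lin_sol_indef[OF sol(1), of y]
   by (subst indef_cong[where h' = "h y" and k' = "lin_rhs a b h y"]) (auto simp: H lin_rhs_def)
 qed (rule H)
 moreover have "\<exists>s\<in>{0..T}. \<forall>y. H y t = h y s" for t
  using pmod_bounds[OF T, of t] by (intro bexI[of _ "pmod t T"]) (auto simp: H_def)
 ultimately show ?thesis using H by (intro that[of H])
qed

lemma lin_sol_integrate_const:
 assumes T: "0 <= T" and sol: "lin_sol a b T h" and a: "\<And>y z. bdd_borel (a y z)" and b: "\<And>y. bdd_borel (b y)"
  and rows: "\<And>y u. (\<Sum>z\<in>UNIV. a y z u) = 0"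
 shows "lin_sol a (%y u. b y u + d) T (%y t. h y t + d * (T - clip T t))"
 unfolding lin_sol_def
proof (intro allI conjI)
 fix y
 have clip: "bdd_borel (%t. T - clip T t)"
  using T by (intro bdd_borel_clip[where h = "%t. T - t"]) (auto intro!: continuous_intros)
 show "bdd_borel (%t. h y t + d * (T - clip T t))" by (intro bdd_borel_intros lin_sol_bdd[OF sol] clip)
 have "indef 0 T (%t. T - t) (%t. 1)" by (rule indef_of_deriv) (auto intro!: derivative_eq_intros)
 hence "indef 0 T (%t. T - clip T t) (%t. 1)"
  by (subst indef_cong[where h' = "%t. T - t" and k' = "%t. 1"]) (auto simp: clip_id)
 hence "indef 0 T (%t. h y t + d * (T - clip T t)) (%t. lin_rhs a b h y t + d * 1)"
  using a b lin_sol_bdd[OF sol]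
  by (intro indef_add indef_cmult lin_sol_indef[OF sol] bdd_borel_lin_rhs bdd_borel_const bdd_borel_mult) auto
 moreover have "lin_rhs a (%y u. b y u + d) (%y t. h y t + d * (T - clip T t)) y = (%t. lin_rhs a b h y t + d * 1)"
  by (rule ext) (simp add: lin_rhs_def distrib_left sum.distrib sum_distrib_right[symmetric] rows add.assoc)
 ultimately show "indef 0 T (%t. h y t + d * (T - clip T t)) (lin_rhs a (%y u. b y u + d) (%y t. h y t + d * (T - clip T t)) y)"
  by simp
qed

lemma positive_map_eigenvector:
 fixes F :: "real^'v::finite => real^'v"
 assumes F: "\<And>A. continuous_on A F" and pos: "0 < \<kappa>" "0 < U"
  and lower: "\<And>\<xi> y z. \<forall>z. 0 < \<xi> $ z ==> \<kappa> * \<xi> $ z <= F \<xi> $ y"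
  and upper: "\<And>\<xi> y m. \<forall>z. 0 < \<xi> $ z \<and> \<xi> $ z <= m ==> F \<xi> $ y <= U * m"
  and \<beta>: "\<beta> = abs (ln U) + abs (ln \<kappa>)"
 obtains \<xi> l where "\<And>y. exp (- \<beta>) <= \<xi> $ y \<and> \<xi> $ y <= exp \<beta>" "\<And>y. F \<xi> $ y = exp l * \<xi> $ y" "abs l <= 3 * \<beta>"
proof -
 let ?\<xi> = "%\<zeta>. \<chi> z. exp (\<zeta> $ z)"
 define G where "G \<zeta> = (\<chi> y. ln (F (?\<xi> \<zeta>) $ y))" for \<zeta>
 have F_pos: "0 < F (?\<xi> \<zeta>) $ y" for \<zeta> y
  by (rule less_le_trans[OF _ lower[of "?\<xi> \<zeta>" undefined y]]) (simp_all add: pos)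
 have G_bounds: "ln \<kappa> + \<zeta> $ z <= G \<zeta> $ y" "(\<And>z. \<zeta> $ z <= m) ==> G \<zeta> $ y <= ln U + m" for \<zeta> y z m
 proof -
  have "ln (\<kappa> * exp (\<zeta> $ z)) <= ln (F (?\<xi> \<zeta>) $ y)"
   using lower[of "?\<xi> \<zeta>" z y] F_pos[of \<zeta> y] pos by (subst ln_le_cancel_iff) auto
  thus "ln \<kappa> + \<zeta> $ z <= G \<zeta> $ y" using pos by (simp add: G_def ln_mult)
  assume "\<And>z. \<zeta> $ z <= m"
  hence "ln (F (?\<xi> \<zeta>) $ y) <= ln (U * exp m)"
   using upper[of "?\<xi> \<zeta>" "exp m" y] F_pos[of \<zeta> y] pos by (subst ln_le_cancel_iff) auto
  thus "G \<zeta> $ y <= ln U + m" using pos by (simp add: G_def ln_mult)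
 qed
 have "G \<zeta> $ y - G \<zeta> $ z <= \<beta>" for \<zeta> y z
 proof -
  have "Max (range (($) \<zeta>)) \<in> range (($) \<zeta>)" by (intro Max_in) auto
  then obtain w where w: "Max (range (($) \<zeta>)) = \<zeta> $ w" by (rule rangeE)
  have "\<zeta> $ z <= \<zeta> $ w" for z unfolding w[symmetric] by (rule Max_ge) auto
  from G_bounds(2)[OF this, of y] G_bounds(1)[of \<zeta> w z] show ?thesis unfolding \<beta> by linarith
 qed
 moreover have "continuous_on A G" for A
 proof -
  have "continuous_on A (%\<zeta>. F (?\<xi> \<zeta>) $ y)" for y
   by (intro continuous_on_component continuous_on_compose2[OF F[of UNIV]] continuous_on_vec_lambda continuous_intros) auto
  thus ?thesis unfolding G_def[abs_def] using F_pos
   by (intro continuous_on_vec_lambda continuous_on_ln) (auto simp: less_imp_neq[symmetric])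
 qed
 ultimately obtain \<zeta> l where \<zeta>: "\<And>y. abs (\<zeta> $ y) <= \<beta>" and fixp: "\<And>y. G \<zeta> $ y = \<zeta> $ y + l"
  using osc_brouwer[of G \<beta>] \<beta> by (metis abs_ge_zero add_nonneg_nonneg)
 show ?thesis
 proof (rule that)
  show "exp (- \<beta>) <= ?\<xi> \<zeta> $ y \<and> ?\<xi> \<zeta> $ y <= exp \<beta>" for y using \<zeta>[of y] by (simp add: abs_le_iff)
  show "F (?\<xi> \<zeta>) $ y = exp l * ?\<xi> \<zeta> $ y" for y
   using arg_cong[OF fixp[of y], of exp] F_pos[of \<zeta> y] by (simp add: G_def exp_add mult.commute)
  have "\<zeta> $ z <= \<beta>" for z using \<zeta>[of z] by simp
  from G_bounds(2)[OF this, of undefined] G_bounds(1)[of \<zeta> undefined undefined] abs_le_D2[OF \<zeta>[of undefined]]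
  have "l <= 3 * \<beta>" "- l <= 3 * \<beta>" unfolding fixp \<beta> by (simp_all add: abs_if split: if_splits)
  thus "abs l <= 3 * \<beta>" by simp
 qed
qed

lemma homogeneous_contraction:
 fixes h :: "'v::finite tfun"
 assumes a: "coupled E c C a" "\<forall>y u. (\<Sum>z\<in>UNIV. a y z u) = 0"
  and har: "\<And>a h y z. coupled E c C a ==> lin_sol a (%_ _. 0) T h ==> \<forall>y. 0 <= h y T ==> \<kappa> * h z T <= h y 0"
  and \<kappa>: "0 <= \<kappa>" "\<kappa> <= 1" and h: "lin_sol a (%_ _. 0) T h" "\<forall>y z. h y T - h z T <= \<beta>"
 shows "h y 0 - h z 0 <= (1 - \<kappa>) * \<beta>"
proof -
 have const: "lin_sol a (%_ _. 0) T (%_ _. k)" for k :: real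
  unfolding lin_sol_def lin_rhs_def using a(2) by (simp add: sum_distrib_right[symmetric] indef_const)
 have shift: "lin_sol a (%_ _. 0) T (%y t. h y t - k)" "lin_sol a (%_ _. 0) T (%y t. k - h y t)" for k
  using lin_sol_diff[OF h(1) const[of k] coupledD(1)[OF a(1)] bdd_borel_const bdd_borel_const]
   lin_sol_diff[OF const[of k] h(1) coupledD(1)[OF a(1)] bdd_borel_const bdd_borel_const] by simp_all
 let ?H = "range (%y. h y T)"
 have "Max ?H \<in> ?H" "Min ?H \<in> ?H" by (auto intro: Max_in Min_in)
 then obtain y1 y2 where y: "Max ?H = h y1 T" "Min ?H = h y2 T" by (elim rangeE)
 have extreme: "h y T <= h y1 T" "h y2 T <= h y T" for y unfolding y[symmetric] by (auto intro: Max_ge Min_le)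
 have "\<kappa> * (h y1 T - h y2 T) <= h z 0 - h y2 T" using har[OF a(1) shift(1)[of "h y2 T"], of y1 z] extreme by simp
 moreover have "0 <= h y1 T - h y 0"
  using har[OF a(1) shift(2)[of "h y1 T"], of y1 y] extreme by simp
 moreover have "(1 - \<kappa>) * (h y1 T - h y2 T) <= (1 - \<kappa>) * \<beta>" using h(2) \<kappa> by (intro mult_left_mono) auto
 ultimately show ?thesis by (simp add: algebra_simps)
qed

context
 fixes E :: "('v::finite * 'v) set" and c C T :: real
 assumes conn: "\<And>y z. (y, z) \<in> E\<^sup>*" and c: "c > 0" and T: "T > 0" and irr: "\<And>y. (y, y) \<notin> E"
begin

lemma periodic_eigenpair:
 obtains k1 k2 where "k1 > 0"
  "\<And>a. coupled E c C a ==> \<exists>l h. lin_sol (diag_shift (- l / T) a) (%_ _. 0) T h \<and> (\<forall>y. h y 0 = h y T) \<and>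
    (\<forall>t\<in>{0..T}. \<forall>y. k1 <= h y t \<and> h y t <= k2)"
proof -
 define U where "U = sol_bound (real CARD('v)) C T"
 obtain \<kappa> where \<kappa>: "\<kappa> > 0" and har: "\<And>a h y z. coupled E c C a ==> lin_sol a (%_ _. 0) T h ==> \<forall>y. 0 <= h y T ==> \<kappa> * h z T <= h y 0"
  "\<And>a h y t. coupled E c C a ==> lin_sol a (%_ _. 0) T h ==> \<forall>y. 0 <= h y T ==> t \<in> {0..T} ==> \<kappa> * h y T <= h y t"
  using harnack[OF conn c T irr, of C] by metis
 have U: "U > 0" by (simp add: U_def sol_bound_def)
 define \<beta> where "\<beta> = abs (ln U) + abs (ln \<kappa>)"
 have "\<exists>l h. lin_sol (diag_shift (- l / T) a) (%_ _. 0) T h \<and> (\<forall>y. h y 0 = h y T) \<and>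
    (\<forall>t\<in>{0..T}. \<forall>y. exp (- (3 * \<beta>)) * (\<kappa> * exp (- \<beta>)) <= h y t \<and> h y t <= exp (3 * \<beta>) * (U * exp \<beta>))"
  if cp: "coupled E c C a" for a
 proof -
  note a = coupledD(1,2)[OF cp]
  obtain S :: "real^'v => 'v tfun" where S: "\<And>\<xi>. lin_sol a (%_ _. 0) T (S \<xi>)" "\<And>\<xi> y. S \<xi> y T = \<xi> $ y"
   and cont: "\<And>A. continuous_on A (%\<xi>. \<chi> y. S \<xi> y 0)"
   using that by (rule lin_sol_solution_map[OF less_imp_le[OF T] a bdd_borel_const])
  have upper: "abs (S \<xi> y t) <= U * m" if "\<And>z. abs (\<xi> $ z) <= m" "t \<in> {0..T}" for \<xi> y t m
   using lin_sol_bound[OF less_imp_le[OF T] a bdd_borel_const refl S(1), of \<xi> m 0 t] that by (simp add: S(2) U_def)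
  obtain \<xi> l where \<xi>: "\<And>y. exp (- \<beta>) <= \<xi> $ y \<and> \<xi> $ y <= exp \<beta>" and eig: "\<And>y. (\<chi> y. S \<xi> y 0) $ y = exp l * \<xi> $ y" and l: "abs l <= 3 * \<beta>"
  proof (rule positive_map_eigenvector[OF cont \<kappa> U _ _ \<beta>_def])
   show "\<kappa> * \<xi> $ z <= (\<chi> y. S \<xi> y 0) $ y" if "\<forall>z. 0 < \<xi> $ z" for \<xi> y z
    using har(1)[OF cp S(1), of \<xi> z y] that by (simp add: S(2) less_imp_le)
   show "(\<chi> y. S \<xi> y 0) $ y <= U * m" if "\<forall>z. 0 < \<xi> $ z \<and> \<xi> $ z <= m" for \<xi> y m
    using upper[of \<xi> m 0 y] that T by (auto simp: abs_le_iff less_imp_le order_trans[OF _ less_imp_le])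
  qed blast
  have \<xi>_pos: "0 <= \<xi> $ y" for y using \<xi>[of y] by (meson exp_ge_zero order_trans)
  define h where "h y t = exp_weight (- l / T) T t * S \<xi> y t" for y t
  have "lin_sol (diag_shift (- l / T) a) (%_ _. 0) T h"
   unfolding h_def by (rule lin_sol_exp_weight[OF S(1) less_imp_le[OF T] a(1)])
  moreover have "h y 0 = h y T" for y
   using T eig[of y] by (simp add: h_def exp_weight_eq S(2) exp_minus)
  moreover have "exp (- (3 * \<beta>)) * (\<kappa> * exp (- \<beta>)) <= h y t" "h y t <= exp (3 * \<beta>) * (U * exp \<beta>)" if t: "t \<in> {0..T}" for y t
  proof -
   note weight = exp_weight_bounds[OF l T t]
   have "\<kappa> * exp (- \<beta>) <= \<kappa> * \<xi> $ y" using \<xi> \<kappa> by (intro mult_left_mono) auto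
   hence s: "\<kappa> * exp (- \<beta>) <= S \<xi> y t" using har(2)[OF cp S(1) _ t, of \<xi> y] \<xi>_pos by (simp add: S(2))
   moreover have "0 <= \<kappa> * exp (- \<beta>)" using \<kappa> by simp
   ultimately show "exp (- (3 * \<beta>)) * (\<kappa> * exp (- \<beta>)) <= h y t" "h y t <= exp (3 * \<beta>) * (U * exp \<beta>)"
    unfolding h_def using weight upper[of \<xi> "exp \<beta>" t y] \<xi> \<xi>_pos t by (auto intro!: mult_mono simp: exp_weight_def abs_le_iff)
  qed
  ultimately show ?thesis by blast
 qed
 thus ?thesis using \<kappa> by (intro that[of "exp (- (3 * \<beta>)) * (\<kappa> * exp (- \<beta>))" "exp (3 * \<beta>) * (U * exp \<beta>)"]) auto
qed

lemma periodic_poisson: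
 assumes D: "0 <= D"
 obtains P where "P >= 0" "\<And>a b. coupled E c C a ==> \<forall>y u. (\<Sum>z\<in>UNIV. a y z u) = 0 ==> \<forall>y. bdd_borel (b y) ==> \<forall>y t. abs (b y t) <= D ==>
   \<exists>\<alpha> \<psi>. abs \<alpha> <= P \<and> lin_sol a (%y u. b y u - \<alpha> / T) T \<psi> \<and> (\<forall>y. \<psi> y 0 = \<psi> y T) \<and> (\<forall>t\<in>{0..T}. \<forall>y. abs (\<psi> y t) <= P)"
proof -
 define U where "U = sol_bound (real CARD('v)) C T"
 obtain \<kappa> where \<kappa>: "\<kappa> > 0" "\<kappa> <= 1" and har: "\<And>a h y z. coupled E c C a ==> lin_sol a (%_ _. 0) T h ==> \<forall>y. 0 <= h y T ==> \<kappa> * h z T <= h y 0"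
  using harnack[OF conn c T irr, of C] by metis
 have U: "U > 0" by (simp add: U_def sol_bound_def)
 define \<beta> where "\<beta> = 2 * (U * (D * T)) / \<kappa>"
 have \<beta>: "0 <= \<beta>" "(1 - \<kappa>) * \<beta> + 2 * (U * (D * T)) = \<beta>" using U D T \<kappa> by (auto simp: \<beta>_def field_simps)
 define P where "P = U * (\<beta> + D * T) + \<beta>"
 have P: "0 <= P" using U \<beta> D T by (simp add: P_def)
 have "\<exists>\<alpha> \<psi>. abs \<alpha> <= 2 * P \<and> lin_sol a (%y u. b y u - \<alpha> / T) T \<psi> \<and> (\<forall>y. \<psi> y 0 = \<psi> y T) \<and> (\<forall>t\<in>{0..T}. \<forall>y. abs (\<psi> y t) <= 2 * P)"
  if cp: "coupled E c C a" and rows: "\<forall>y u. (\<Sum>z\<in>UNIV. a y z u) = 0" and b: "\<forall>y. bdd_borel (b y)" "\<forall>y t. abs (b y t) <= D" for a b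
 proof -
  note a = coupledD(1,2)[OF cp] and T' = less_imp_le[OF T]
  obtain S :: "real^'v => 'v tfun" where S: "\<And>\<xi>. lin_sol a b T (S \<xi>)" "\<And>\<xi> y. S \<xi> y T = \<xi> $ y"
   and cont: "\<And>A. continuous_on A (%\<xi>. \<chi> y. S \<xi> y 0)"
   using that by (rule lin_sol_solution_map[OF T' a b(1)[rule_format]])
  have bound: "abs (S \<xi> y t) <= U * (m + D * T)" if "\<And>z. abs (\<xi> $ z) <= m" "t \<in> {0..T}" for \<xi> y t m
   using lin_sol_bound[OF T' a b(1)[rule_format] refl S(1), of \<xi> m D t] that b(2) by (simp add: S(2) U_def)
  obtain \<zeta> \<alpha> where \<zeta>: "\<And>y. abs (\<zeta> $ y) <= \<beta>" and fixp: "\<And>y. (\<chi> y. S \<zeta> y 0) $ y = \<zeta> $ y + \<alpha>"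
  proof (rule osc_brouwer[OF cont \<beta>(1)])
   show "(\<chi> y. S \<zeta> y 0) $ y - (\<chi> y. S \<zeta> y 0) $ z <= \<beta>" if osc: "\<forall>y z. \<zeta> $ y - \<zeta> $ z <= \<beta>" for \<zeta> y z
   proof -
    have "S \<zeta> y 0 - S 0 y 0 - (S \<zeta> z 0 - S 0 z 0) <= (1 - \<kappa>) * \<beta>"
    proof (rule homogeneous_contraction[where h = "%y t. S \<zeta> y t - S 0 y t", OF cp rows])
     show "\<kappa> * h z T <= h y 0" if "coupled E c C a" "lin_sol a (%_ _. 0) T h" "\<forall>y. 0 <= h y T" for a h y z using har[OF that] .
     show "lin_sol a (%_ _. 0) T (%y t. S \<zeta> y t - S 0 y t)" using lin_sol_diff[OF S(1)[of \<zeta>] S(1)[of 0] a(1)] b(1) by simp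
    qed (use \<kappa> osc in \<open>auto simp: S(2)\<close>)
    moreover have "abs (S 0 y 0) <= U * (D * T)" for y using bound[of 0 0 0 y] T by simp
    from this[of y] this[of z] have "S 0 y 0 - S 0 z 0 <= 2 * (U * (D * T))" by linarith
    ultimately show ?thesis using \<beta>(2) by simp
   qed
  qed blast
  define \<psi> where "\<psi> y t = S \<zeta> y t + - \<alpha> / T * (T - clip T t)" for y t
  have "abs \<alpha> <= P"
   using bound[OF \<zeta>, of 0 undefined] fixp[of undefined] \<zeta>[of undefined] T by (simp add: P_def)
  moreover have "abs (\<psi> y t) <= 2 * P" if t: "t \<in> {0..T}" for y t
  proof -
   have "abs \<alpha> * ((T - t) / T) <= P * 1" using \<open>abs \<alpha> <= P\<close> T t by (intro mult_mono) auto
   hence "abs (- \<alpha> / T * (T - clip T t)) <= P" using T t by (simp add: abs_mult clip_id)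
   moreover have "abs (S \<zeta> y t) <= P" using bound[OF \<zeta> t, of y] \<beta> by (simp add: P_def)
   ultimately show ?thesis unfolding \<psi>_def mult_2 by (intro order_trans[OF abs_triangle_ineq add_mono])
  qed
  moreover have "lin_sol a (%y u. b y u + - \<alpha> / T) T \<psi>"
   unfolding \<psi>_def using rows b by (intro lin_sol_integrate_const T' S a(1)) auto
  moreover have "\<psi> y 0 = \<psi> y T" for y using T fixp[of y] by (simp add: \<psi>_def clip_id S(2))
  ultimately show ?thesis using P by (intro exI[of _ \<alpha>] exI[of _ \<psi>]) auto
 qed
 thus ?thesis using P by (intro that[of "2 * P"]) auto
qed

end

context periodic_rates
begin

definition test_pair :: "real => 'v tfun => ('v * 'v) tfun => bool" where
 "test_pair L f g \<longleftrightarrow> (\<forall>y. f y \<in> borel_measurable borel) \<and> (\<forall>y t. abs (f y t) <= L) \<and> (\<forall>y t. f y (t + T0) = f y t) \<and>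
  (\<forall>e. continuous_on UNIV (g e)) \<and> (\<forall>e t. abs (g e t) <= L) \<and> (\<forall>e t. g e (t + T0) = g e t)"

lemma test_pairD:
 assumes "test_pair L f g"
 shows "f y \<in> borel_measurable borel" "abs (f y t) <= L" "f y (t + T0) = f y t"
  "continuous_on UNIV (g e)" "abs (g e t) <= L" "g e (t + T0) = g e t"
 using assms unfolding test_pair_def by blast+

lemma test_pair_bdd:
 assumes "test_pair L f g" shows "bdd_borel (f y)" "bdd_borel (g e)"
 by (rule bdd_borelI[OF test_pairD(1,2)[OF assms]])
  (rule bdd_borelI[OF borel_measurable_continuous_onI[OF test_pairD(4)[OF assms]] test_pairD(5)[OF assms]])

lemma test_pair_nonneg: "test_pair L f g ==> 0 <= L"
 using test_pairD(2) by (meson abs_ge_zero order_trans)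

lemma test_pair_add:
 assumes "test_pair L f g" "test_pair L f1 g1" "abs s <= 1"
 shows "test_pair (2 * L) (%y u. f y u + s * f1 y u) (%e u. g e u + s * g1 e u)"
proof -
 have bound: "abs (a + s * b) <= 2 * L" if "abs a <= L" "abs b <= L" for a b :: real
 proof -
  have "abs (s * b) <= 1 * L" unfolding abs_mult using assms(3) that by (intro mult_mono) auto
  thus ?thesis using that by linarith
 qed
 note pairs = test_pairD[OF assms(1)] test_pairD[OF assms(2)]
 show ?thesis
  unfolding test_pair_def
  by (intro conjI allI bound pairs continuous_intros borel_measurable_add borel_measurable_times borel_measurable_const) (simp_all add: pairs)
qed

definition rate_mat :: "('v => 'v tfun) => 'v tfun => 'v => 'v tfun" where
 "rate_mat S d y z u = S y z u + (if y = z then d y u else 0)"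

lemma rate_mat_sum: "(\<Sum>z\<in>UNIV. rate_mat S d y z u * h z) = (\<Sum>z\<in>UNIV. S y z u * h z) + d y u * h y"
 by (simp add: rate_mat_def distrib_right sum.distrib if_distrib[of "%x. x * _"] cong: if_cong)

lemma rate_mat_coupled:
 assumes S: "\<And>y z. bdd_borel (S y z)" "\<And>y z u. 0 <= S y z u" "\<And>y z u. S y z u <= A" "\<And>y z u. (y, z) \<in> E ==> \<rho> <= S y z u"
  and d: "\<And>y. bdd_borel (d y)" "\<And>y u. abs (d y u) <= K"
 shows "coupled E \<rho> (A + K) (rate_mat S d)"
 unfolding coupled_def
proof (intro conjI allI impI)
 show "bdd_borel (rate_mat S d y z)" for y z
  unfolding rate_mat_def[abs_def] using S d by (cases "y = z") (auto intro!: bdd_borel_intros)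
 show "abs (rate_mat S d y z u) <= A + K" for y z u
  using S(2,3)[of y z u] d(2)[of y u] by (auto simp: rate_mat_def abs_le_iff)
 show "0 <= rate_mat S d y z u" if "y \<noteq> z" for y z u using S(2) that by (simp add: rate_mat_def)
 show "\<rho> <= rate_mat S d y z u" if "(y, z) \<in> E" for y z u
  using S(4)[OF that] that irr by (auto simp: rate_mat_def)
qed

lemma total_rate_bounds:
 assumes "\<And>y z u. 0 <= S y z u" "\<And>y z u. S y z u <= A"
 shows "0 <= (\<Sum>z\<in>UNIV. S y z u)" "(\<Sum>z\<in>(UNIV :: 'v set). S y z u) <= real CARD('v) * A"
 using assms sum_mono[of UNIV "%z. S y z u" "%_. A"] by (auto intro: sum_nonneg)

definition bw_mat :: "'v tfun => ('v * 'v) tfun => 'v => 'v tfun" where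
 "bw_mat f g = rate_mat (%y z u. R y z u * exp (g (y, z) u)) (%y u. f y u - (\<Sum>w\<in>UNIV. R y w u))"

lemma bw_eq: "bw f g h = lin_rhs (bw_mat f g) (%_ _. 0) h"
proof (intro ext)
 show "bw f g h y u = lin_rhs (bw_mat f g) (%_ _. 0) h y u" for y u
  using rate_mat_sum[where h = "%z. h z u"]
  by (simp add: bw_mat_def bw_def lin_rhs_def right_diff_distrib left_diff_distrib sum_subtractf sum_distrib_right mult.assoc)
qed

lemma bw_mat_shift: "bw_mat (%y u. f y u - d) g = diag_shift (- d) (bw_mat f g)"
 by (intro ext) (simp add: bw_mat_def rate_mat_def diag_shift_def)

lemma bw_mat_coupled:
 assumes "test_pair L f g"
 shows "coupled E (c * exp (- L)) (B * exp L + (L + real CARD('v) * B)) (bw_mat f g)"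
 unfolding bw_mat_def
proof (rule rate_mat_coupled)
 note tp = test_pairD[OF assms]
 show "bdd_borel (%u. R y z u * exp (g (y, z) u))" "bdd_borel (%u. f y u - (\<Sum>w\<in>UNIV. R y w u))" for y z
  using test_pair_bdd[OF assms] R_bdd by (auto intro!: bdd_borel_intros)
 show "0 <= R y z u * exp (g (y, z) u)" "R y z u * exp (g (y, z) u) <= B * exp L" for y z u
  using R_nonneg R_le B_nonneg tp(5)[of "(y, z)" u] by (auto intro!: mult_mono)
 show "c * exp (- L) <= R y z u * exp (g (y, z) u)" if "(y, z) \<in> E" for y z u
  using R_lo[OF that] R_nonneg tp(5)[of "(y, z)" u] by (intro mult_mono) auto
 show "abs (f y u - (\<Sum>w\<in>UNIV. R y w u)) <= L + real CARD('v) * B" for y u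
  using tp(2)[of y u] total_rate_bounds[of R B y u] R_nonneg R_le by (simp add: abs_le_iff)
qed

definition eigenfun :: "'v tfun => ('v * 'v) tfun => real => real => real => 'v tfun => bool" where
 "eigenfun f g l k1 k2 h \<longleftrightarrow> k1 > 0 \<and> (\<forall>y. bdd_borel (h y)) \<and> (\<forall>y t. k1 <= h y t \<and> h y t <= k2) \<and> (\<forall>y t. h y (t + T0) = h y t) \<and>
  (\<forall>y a b. indef a b (h y) (bw (%y u. f y u - l / T0) g h y))"

lemma eigenfunD:
 assumes "eigenfun f g l k1 k2 h"
 shows "k1 > 0" "bdd_borel (h y)" "k1 <= h y t" "h y t <= k2" "h y (t + T0) = h y t"
  "indef a b (h y) (bw (%y u. f y u - l / T0) g h y)" "h y t > 0"
proof -
 note h = assms[unfolded eigenfun_def]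
 show "k1 > 0" "bdd_borel (h y)" "k1 <= h y t" "h y t <= k2" "h y (t + T0) = h y t"
  "indef a b (h y) (bw (%y u. f y u - l / T0) g h y)"
  using h by blast+
 show "h y t > 0" using h by (meson less_le_trans)
qed

lemma eigenfun_exists:
 obtains k1 k2 where "k1 > 0" "\<And>f g. test_pair L f g ==> \<exists>l h. eigenfun f g l k1 k2 h"
proof -
 have "c * exp (- L) > 0" using c by simp
 note eigenpair = periodic_eigenpair[OF conn this T0 irr]
 obtain k1 k2 where k1: "k1 > 0" and pair: "\<And>a. coupled E (c * exp (- L)) (B * exp L + (L + real CARD('v) * B)) a ==>
   \<exists>l h. lin_sol (diag_shift (- l / T0) a) (%_ _. 0) T0 h \<and> (\<forall>y. h y 0 = h y T0) \<and> (\<forall>t\<in>{0..T0}. \<forall>y. k1 <= h y t \<and> h y t <= k2)"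
  using that by (rule eigenpair)
 have "\<exists>l h. eigenfun f g l k1 k2 h" if tp: "test_pair L f g" for f g
 proof -
  obtain l h where h: "lin_sol (bw_mat (%y u. f y u - l / T0) g) (%_ _. 0) T0 h" "\<And>y. h y 0 = h y T0"
   and k: "\<And>t y. t \<in> {0..T0} ==> k1 <= h y t \<and> h y t <= k2"
   using pair[OF bw_mat_coupled[OF tp]] by (auto simp: bw_mat_shift)
  have a: "bdd_borel (bw_mat (%y u. f y u - l / T0) g y z)" for y z
   unfolding bw_mat_shift by (intro bdd_borel_diag_shift coupledD(1)[OF bw_mat_coupled[OF tp]])
  have per: "bw_mat (%y u. f y u - l / T0) g y z (t + T0) = bw_mat (%y u. f y u - l / T0) g y z t" for y z t
   by (simp add: bw_mat_def rate_mat_def test_pairD(3,6)[OF tp] R_per)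
  obtain H where H: "\<And>y. bdd_borel (H y)" "\<And>y t. H y (t + T0) = H y t" "\<And>t. \<exists>s\<in>{0..T0}. \<forall>y. H y t = h y s"
   "\<And>y r t. indef r t (H y) (bw (%y u. f y u - l / T0) g H y)"
   using that unfolding bw_eq by (rule periodic_lin_sol[OF T0 h a per bdd_borel_const refl])
  have "k1 <= H y t \<and> H y t <= k2" for y t using H(3)[of t] k by metis
  thus ?thesis using H k1 unfolding eigenfun_def by blast
 qed
 thus ?thesis using that k1 by blast
qed

end

lemma exp_growth_le:
 assumes k: "k > 0" and growth_bound: "\<And>n. n >= 1 ==> k * exp (real n * l) <= K * exp (real n * l')"
 shows "l <= l'"
proof (rule ccontr)
 assume "\<not> l <= l'"
 hence d: "l - l' > 0" by simp
 have "k * (1 + real n * (l - l')) <= K" if n: "n >= 1" for n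
 proof -
  have "k * exp (real n * (l - l')) = k * exp (real n * l) * exp (- (real n * l'))"
   by (simp add: right_diff_distrib exp_diff exp_minus field_simps)
  also have "... <= K * exp (real n * l') * exp (- (real n * l'))" using growth_bound[OF n] by (intro mult_right_mono) auto
  also have "... = K" by (simp add: exp_minus)
  finally have "k * exp (real n * (l - l')) <= K" .
  moreover have "k * (1 + real n * (l - l')) <= k * exp (real n * (l - l'))" using k by (intro mult_left_mono) auto
  ultimately show ?thesis by linarith
 qed
 moreover obtain n :: nat where "K / k < real n * (l - l')" using reals_Archimedean3[OF d] by blast
 hence "K < k * (real n * (l - l'))" using k by (simp add: divide_less_eq mult_ac)
 moreover have "k * (real n * (l - l')) <= k * (1 + real (max 1 n) * (l - l'))"
  using k d by (intro mult_left_mono) (auto simp: mult_right_mono add_increasing)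
 ultimately show False by (smt (verit, best) max.cobounded1)
qed

context periodic_chain
begin

abbreviation psum :: "nat => 'v tfun => ('v * 'v) tfun => 'w => real" where
 "psum n f g om \<equiv> path_fun (real n * T0) f g (X om)"

definition part_fun :: "nat => 'v tfun => ('v * 'v) tfun => real" where
 "part_fun n f g = expectation (%om. exp (psum n f g om))"

lemma fk_bounds:
 assumes f: "\<And>y. bdd_borel (f y)" and g: "\<And>e. continuous_on UNIV (g e)" "\<And>e. bdd_borel (g e)"
  and h: "\<And>y. bdd_borel (h y)" "\<And>y a b. indef a b (h y) (bw f g h y)"
  and k: "k1 > 0" "\<And>y t. k1 <= h y t" "\<And>y t. h y t <= k2" and n: "n >= 1"
 shows "integrable M (%om. exp (psum n f g om))" "k1 / k2 <= part_fun n f g" "part_fun n f g <= k2 / k1"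
proof -
 let ?T = "real n * T0"
 let ?Z = "%om. exp (path_fun ?T f g (X om))"
 let ?W = "%om. ?Z om * h (X om ?T) ?T"
 have T: "?T > 0" using n T0 by simp
 have k2_pos: "k2 > 0" using k(1) order_trans[OF k(2) k(3)] by linarith
 note fk = feynman_kac[OF T f g h(1) h(2)]
 have Z: "?Z \<in> borel_measurable M" using path_fun_measurable[OF T f g(1)] by measurable
 have sandwich: "k1 * ?Z om <= ?W om" "?W om <= k2 * ?Z om" for om
  using k(2,3) by (auto simp: mult.commute intro: mult_left_mono)
 have k1_Z: "integrable M (%om. k1 * ?Z om)"
  using Z k by (intro Bochner_Integration.integrable_bound[OF fk(1)]) (auto simp: abs_mult intro!: AE_I2 order_trans[OF k(2) abs_ge_self])
 thus Z_int: "integrable M ?Z" using k by simp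
 have "k1 * part_fun n f g <= h x 0"
  unfolding part_fun_def using integral_mono[OF k1_Z fk(1) sandwich(1)] fk(2) by simp
 also have "... <= k2" by (rule k)
 finally show "part_fun n f g <= k2 / k1" using k by (simp add: pos_le_divide_eq mult.commute)
 have "k1 <= h x 0" by (rule k)
 also have "h x 0 <= k2 * part_fun n f g"
  unfolding part_fun_def using integral_mono[OF fk(1) integrable_mult_right[OF Z_int, of k2] sandwich(2)] fk(2) by simp
 finally show "k1 / k2 <= part_fun n f g" using k2_pos by (simp add: pos_divide_le_eq mult.commute)
qed

definition growth :: "'v tfun => ('v * 'v) tfun => real => bool" where
 "growth f g l \<longleftrightarrow> (\<exists>k1>0. \<exists>k2>0. \<forall>n\<ge>1. k1 * exp (real n * l) <= part_fun n f g \<and> part_fun n f g <= k2 * exp (real n * l))"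

definition lam :: "'v tfun => ('v * 'v) tfun => real" where
 "lam f g = (THE l. growth f g l)"

lemma growth_le:
 assumes "growth f g l" "\<And>n. n >= 1 ==> part_fun n f g <= K * exp (real n * l')"
 shows "l <= l'"
proof -
 obtain k where "k > 0" "\<And>n. n >= 1 ==> k * exp (real n * l) <= part_fun n f g" using assms(1) unfolding growth_def by blast
 thus ?thesis using exp_growth_le[of k l K l'] assms(2) by (meson order_trans)
qed

lemma growth_unique:
 assumes "growth f g l" "growth f g l'" shows "l = l'"
proof -
 have "l <= l'" if l: "growth f g l" "growth f g l'" for l l'
 proof -
  obtain K where "\<And>n. n >= 1 ==> part_fun n f g <= K * exp (real n * l')" using l(2) unfolding growth_def by blast
  thus ?thesis by (rule growth_le[OF l(1)])
 qed
 thus ?thesis using assms by (meson order_antisym)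
qed

lemma lam_eqI: "growth f g l ==> lam f g = l"
 unfolding lam_def by (rule the_equality) (auto intro: growth_unique)

lemma psum_shift:
 assumes "om \<in> space M" "\<And>y. bdd_borel (f y)"
 shows "psum n (%y u. f y u - l / T0) g om = psum n f g om - real n * l"
 using path_fun_shift[OF X_cadlag, of om f "real n * T0" "l / T0" g] assms T0 by simp

lemma exp_psum_shift:
 assumes "om \<in> space M" "\<And>y. bdd_borel (f y)"
 shows "exp (psum n f g om) = exp (real n * l) * exp (psum n (%y u. f y u - l / T0) g om)"
 using psum_shift[OF assms] by (simp add: mult_exp_exp)

lemma part_fun_shift:
 assumes "\<And>y. bdd_borel (f y)"
 shows "part_fun n f g = exp (real n * l) * part_fun n (%y u. f y u - l / T0) g"
proof -
 have "part_fun n f g = expectation (%om. exp (real n * l) * exp (psum n (%y u. f y u - l / T0) g om))"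
  unfolding part_fun_def using exp_psum_shift[where f = f, OF _ assms] by (rule Bochner_Integration.integral_cong[OF refl])
 thus ?thesis by (simp add: part_fun_def)
qed

lemma eigenfun_growth:
 assumes f: "\<And>y. bdd_borel (f y)" and g: "\<And>e. continuous_on UNIV (g e)" "\<And>e. bdd_borel (g e)"
  and h: "eigenfun f g l k1 k2 h"
 shows "growth f g l" and "\<And>n. n >= 1 ==> integrable M (%om. exp (psum n f g om))"
proof -
 note ef = eigenfunD[OF h]
 have k2_pos: "k2 > 0" using ef(4,7) by (meson less_le_trans)
 have "bdd_borel (%u. f y u - l / T0)" for y using f by (intro bdd_borel_intros)
 note bounds = fk_bounds[where f = "%y u. f y u - l / T0" and g = g and h = h, OF this g ef(2,6,1,3,4)]
 have "k1 / k2 * exp (real n * l) <= part_fun n f g \<and> part_fun n f g <= k2 / k1 * exp (real n * l)" if n: "n >= 1" for n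
  using mult_left_mono[OF bounds(2)[OF n], of "exp (real n * l)"] mult_left_mono[OF bounds(3)[OF n], of "exp (real n * l)"]
  unfolding part_fun_shift[where f = f and l = l, OF f] by (simp add: mult.commute)
 thus "growth f g l"
  unfolding growth_def using ef(1) k2_pos by (intro exI[of _ "k1 / k2"] exI[of _ "k2 / k1"] conjI) auto
 fix n :: nat assume n: "n >= 1"
 have "integrable M (%om. exp (real n * l) * exp (psum n (%y u. f y u - l / T0) g om))"
  using bounds(1)[OF n] by (intro integrable_mult_right)
 thus "integrable M (%om. exp (psum n f g om))"
  by (subst Bochner_Integration.integrable_cong[OF refl exp_psum_shift[where f = f and l = l, OF _ f]]) auto
qed

lemma perron:
 obtains k1 k2 where "k1 > 0" "\<And>f g. test_pair L f g ==> \<exists>h. eigenfun f g (lam f g) k1 k2 h"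
proof -
 obtain k1 k2 where k: "k1 > 0" "\<And>f g. test_pair L f g ==> \<exists>l h. eigenfun f g l k1 k2 h"
  using that by (rule eigenfun_exists)
 have "\<exists>h. eigenfun f g (lam f g) k1 k2 h" if tp: "test_pair L f g" for f g
 proof -
  obtain l h where h: "eigenfun f g l k1 k2 h" using k(2)[OF tp] by blast
  have "lam f g = l" by (rule lam_eqI[OF eigenfun_growth(1)[OF test_pair_bdd(1)[OF tp] test_pairD(4)[OF tp] test_pair_bdd(2)[OF tp] h]])
  thus ?thesis using h by blast
 qed
 thus ?thesis using that k(1) by blast
qed

lemma test_pair_lam:
 assumes tp: "test_pair L f g"
 shows "growth f g (lam f g)" "\<And>n. n >= 1 ==> integrable M (%om. exp (psum n f g om))"
proof -
 obtain k1 k2 h where h: "eigenfun f g (lam f g) k1 k2 h" using perron[of L] tp by metis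
 note g = eigenfun_growth[OF test_pair_bdd(1)[OF tp] test_pairD(4)[OF tp] test_pair_bdd(2)[OF tp] h]
 show "growth f g (lam f g)" "\<And>n. n >= 1 ==> integrable M (%om. exp (psum n f g om))" by (rule g; assumption?)+
qed

lemma bw_add_potential: "bw (%y u. f y u + d y u) g h y u = bw f g h y u + d y u * h y u"
 unfolding bw_def by (simp add: distrib_right)

lemma lam_le_of_supersolution:
 assumes tp: "test_pair L f g" and h: "\<And>y. bdd_borel (h y)" "\<And>y t. k1 <= h y t" "\<And>y t. h y t <= k2" and k1: "k1 > 0"
  and k: "\<And>y. bdd_borel (k y)" "\<And>y a b. indef a b (h y) (k y)"
  and super: "\<And>y u. bw (%y u. f y u - l / T0) g h y u <= k y u"
 shows "lam f g <= l"
proof (rule growth_le[OF test_pair_lam(1)[OF tp]])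
 fix n :: nat assume n: "n >= 1"
 define F where "F y u = f y u - l / T0 + (k y u - bw (%y u. f y u - l / T0) g h y u) / h y u" for y u
 note f = test_pair_bdd(1)[OF tp] and g = test_pair_bdd(2)[OF tp]
 have pos: "0 < h y u" for y u using h(2) k1 by (meson less_le_trans)
 have F: "bdd_borel (F y)" for y
  unfolding F_def[abs_def] using f g h k k1
  by (intro bdd_borel_add bdd_borel_diff bdd_borel_const bdd_borel_divide[where c = k1] bw_bdd)
 have "bw F g h y = k y" for y
  unfolding F_def[abs_def] using pos by (intro ext) (simp add: bw_add_potential less_imp_neq[symmetric])
 hence "indef a b (h y) (bw F g h y)" for y a b using k(2) by simp
 note bounds = fk_bounds[OF F test_pairD(4)[OF tp] g h(1) this k1 h(2,3) n]
 have "part_fun n (%y u. f y u - l / T0) g <= part_fun n F g"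
  unfolding part_fun_def
 proof (rule integral_mono'[OF bounds(1)])
  fix om assume "om \<in> space M"
  thus "exp (psum n (%y u. f y u - l / T0) g om) <= exp (psum n F g om)"
   unfolding exp_le_cancel_iff using F f super pos
   by (intro path_fun_mono X_cadlag) (auto intro!: bdd_borel_diff divide_nonneg_pos simp: F_def)
 qed simp
 also note bounds(3)
 finally have "exp (real n * l) * part_fun n (%y u. f y u - l / T0) g <= exp (real n * l) * (k2 / k1)"
  by (rule mult_left_mono) simp
 thus "part_fun n f g <= k2 / k1 * exp (real n * l)"
  unfolding part_fun_shift[where f = f and l = l, OF f] by (simp only: mult.commute)
qed

definition tilted_rates :: "('v * 'v) tfun => 'v tfun => 'v => 'v tfun" where
 "tilted_rates g h y z u = R y z u * exp (g (y, z) u) * h z u / h y u"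

lemma tilted_rates_bounds:
 assumes tp: "test_pair L f g" and h: "eigenfun f g l k1 k2 h"
 shows "bdd_borel (tilted_rates g h y z)" "0 <= tilted_rates g h y z u" "tilted_rates g h y z u <= B * exp L * k2 / k1"
  "(y, z) \<in> E ==> c * exp (- L) * k1 / k2 <= tilted_rates g h y z u" "tilted_rates g h y z (u + T0) = tilted_rates g h y z u"
proof -
 note ef = eigenfunD[OF h] and g = test_pairD(5)[OF tp, of "(y, z)" u]
 show "bdd_borel (tilted_rates g h y z)"
  unfolding tilted_rates_def[abs_def] using R_bdd test_pair_bdd(2)[OF tp] ef(2)
  by (intro bdd_borel_divide[where c = k1] bdd_borel_intros ef(1,3))
 show "0 <= tilted_rates g h y z u" unfolding tilted_rates_def using R_nonneg ef(7) by (simp add: less_imp_le)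
 have "R y z u * exp (g (y, z) u) * h z u <= B * exp L * k2"
  using R_le R_nonneg B_nonneg ef(4) ef(7)[of z u] g by (intro mult_mono) (auto simp: abs_le_iff)
 thus "tilted_rates g h y z u <= B * exp L * k2 / k1"
  unfolding tilted_rates_def using ef(1,3,7) B_nonneg order_trans[OF less_imp_le[OF ef(7)] ef(4)] by (intro frac_le) auto
 show "c * exp (- L) * k1 / k2 <= tilted_rates g h y z u" if "(y, z) \<in> E"
 proof -
  have "c * exp (- L) * k1 <= R y z u * exp (g (y, z) u) * h z u"
   using R_lo[OF that] R_nonneg c ef(1,3) g by (intro mult_mono) (auto simp: abs_le_iff)
  thus ?thesis unfolding tilted_rates_def using ef(4,7) R_nonneg
   by (intro frac_le) (auto intro!: mult_nonneg_nonneg simp: less_imp_le)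
 qed
 show "tilted_rates g h y z (u + T0) = tilted_rates g h y z u"
  by (simp add: tilted_rates_def R_per ef(5) test_pairD(6)[OF tp])
qed

lemma bw_doob_transform:
 assumes "\<And>y u. h y u \<noteq> 0"
 shows "bw (%y u. f y u + d y u) (%e u. g e u + g1 e u) (%y u. h y u * \<phi> y u) y u
  = h y u * (\<Sum>z\<in>UNIV. tilted_rates g h y z u * (exp (g1 (y, z) u) * \<phi> z u - \<phi> y u)) + bw f g h y u * \<phi> y u + d y u * (h y u * \<phi> y u)"
proof -
 have "h y u * tilted_rates g h y z u = R y z u * exp (g (y, z) u) * h z u" for z
  using assms[of y u] by (simp add: tilted_rates_def)
 hence terms: "h y u * (tilted_rates g h y z u * (exp (g1 (y, z) u) * \<phi> z u - \<phi> y u))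
   + R y z u * (exp (g (y, z) u) * h z u - h y u) * \<phi> y u
   = R y z u * (exp (g (y, z) u + g1 (y, z) u) * (h z u * \<phi> z u) - h y u * \<phi> y u)" for z
  by (simp add: mult.assoc[symmetric] exp_add) (simp add: algebra_simps)
 show ?thesis
  unfolding bw_add_potential unfolding bw_def
  by (simp add: sum_distrib_left sum_distrib_right distrib_right terms[symmetric] sum.distrib mult.assoc)
qed

lemma tilted_poisson:
 assumes k1: "k1 > 0"
 obtains P where "P >= 0" "\<And>f g f1 g1 l h. test_pair L f g ==> test_pair L f1 g1 ==> eigenfun f g l k1 k2 h ==>
  \<exists>\<alpha> \<psi>. abs \<alpha> <= P \<and> (\<forall>y. bdd_borel (\<psi> y)) \<and> (\<forall>y t. abs (\<psi> y t) <= P) \<and> (\<forall>y r t. indef r t (\<psi> y)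
   (%u. (\<Sum>z\<in>UNIV. tilted_rates g h y z u * (\<psi> z u - \<psi> y u + g1 (y, z) u)) + f1 y u - \<alpha> / T0))"
proof -
 define \<rho> where "\<rho> = c * exp (- L) * k1 / k2"
 define A where "A = B * exp L * k2 / k1"
 define D where "D = L + real CARD('v) * (A * L)"
 show ?thesis
 proof (cases "0 < k2 \<and> 0 <= L")
  case False
  hence "\<not> (test_pair L f g \<and> eigenfun f g l k1 k2 h)" for f g l h
   using test_pair_nonneg eigenfunD(4,7) by (meson less_le_trans)
  thus ?thesis using that[of 0] by blast
 next
  case True
  hence \<rho>: "0 < \<rho>" and A: "0 <= A" and D: "0 <= D" using c k1 B_nonneg by (auto simp: \<rho>_def A_def D_def)
  obtain P where P: "P >= 0" and sol: "\<And>a b. coupled E \<rho> (A + real CARD('v) * A) a ==> \<forall>y u. (\<Sum>z\<in>UNIV. a y z u) = 0 ==>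
    \<forall>y. bdd_borel (b y) ==> \<forall>y t. abs (b y t) <= D ==>
    \<exists>\<alpha> \<psi>. abs \<alpha> <= P \<and> lin_sol a (%y u. b y u - \<alpha> / T0) T0 \<psi> \<and> (\<forall>y. \<psi> y 0 = \<psi> y T0) \<and> (\<forall>t\<in>{0..T0}. \<forall>y. abs (\<psi> y t) <= P)"
   using that by (rule periodic_poisson[OF conn \<rho> T0 irr D])
  show ?thesis
  proof (rule that[OF P])
   fix f g f1 g1 l h assume tp: "test_pair L f g" "test_pair L f1 g1" and h: "eigenfun f g l k1 k2 h"
   let ?S = "tilted_rates g h"
   define d where "d y u = - (\<Sum>z\<in>UNIV. ?S y z u)" for y u
   define b where "b y u = f1 y u + (\<Sum>z\<in>UNIV. ?S y z u * g1 (y, z) u)" for y u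
   note S = tilted_rates_bounds[OF tp(1) h, folded \<rho>_def A_def]
   have d: "bdd_borel (d y)" "abs (d y u) <= real CARD('v) * A" for y u
    unfolding d_def[abs_def] using S(1) total_rate_bounds[of ?S A y u, OF S(2,3)] by (auto intro!: bdd_borel_intros)
   have b: "bdd_borel (b y)" for y
    unfolding b_def[abs_def] using S(1) test_pair_bdd[OF tp(2)] by (intro bdd_borel_intros)
   have "abs (b y u) <= D" for y u
   proof -
    have "abs (?S y z u * g1 (y, z) u) <= A * L" for z
     unfolding abs_mult using S(2,3)[of y z u] test_pairD(5)[OF tp(2)] A by (intro mult_mono) auto
    hence "abs (\<Sum>z\<in>UNIV. ?S y z u * g1 (y, z) u) <= (\<Sum>z\<in>(UNIV::'v set). A * L)" by (intro order_trans[OF sum_abs sum_mono])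
    thus ?thesis unfolding b_def D_def using test_pairD(2)[OF tp(2), of y u] by simp
   qed
   moreover have "(\<Sum>z\<in>UNIV. rate_mat ?S d y z u) = 0" for y u
    using rate_mat_sum[of ?S d y u "%_. 1"] by (simp add: d_def)
   ultimately obtain \<alpha> \<psi> where \<alpha>: "abs \<alpha> <= P" and \<psi>: "lin_sol (rate_mat ?S d) (%y u. b y u - \<alpha> / T0) T0 \<psi>" "\<And>y. \<psi> y 0 = \<psi> y T0"
     and bound: "\<And>t y. t \<in> {0..T0} ==> abs (\<psi> y t) <= P"
    using sol[OF rate_mat_coupled[of ?S A \<rho> d, OF S(1-4) d], of b] b by blast
   have per: "rate_mat ?S d y z (t + T0) = rate_mat ?S d y z t" "b y (t + T0) - \<alpha> / T0 = b y t - \<alpha> / T0" for y z t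
    by (simp_all add: rate_mat_def d_def b_def S(5) test_pairD(3,6)[OF tp(2)])
   have bdd: "bdd_borel (rate_mat ?S d y z)" "bdd_borel (%u. b y u - \<alpha> / T0)" for y z
    using coupledD(1)[OF rate_mat_coupled[of ?S A \<rho> d, OF S(1-4) d]] b by (auto intro: bdd_borel_intros)
   obtain \<Psi> where \<Psi>: "\<And>y. bdd_borel (\<Psi> y)" "\<And>y t. \<Psi> y (t + T0) = \<Psi> y t" "\<And>t. \<exists>s\<in>{0..T0}. \<forall>y. \<Psi> y t = \<psi> y s"
    "\<And>y r t. indef r t (\<Psi> y) (lin_rhs (rate_mat ?S d) (%y u. b y u - \<alpha> / T0) \<Psi> y)"
    using that by (rule periodic_lin_sol[OF T0 \<psi> bdd(1) per(1) bdd(2) per(2)])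
   have "lin_rhs (rate_mat ?S d) (%y u. b y u - \<alpha> / T0) \<Psi> y u
     = (\<Sum>z\<in>UNIV. ?S y z u * (\<Psi> z u - \<Psi> y u + g1 (y, z) u)) + f1 y u - \<alpha> / T0" for y u
    unfolding lin_rhs_def rate_mat_sum d_def b_def
    by (simp add: sum.distrib sum_subtractf distrib_left right_diff_distrib sum_distrib_right)
   hence "lin_rhs (rate_mat ?S d) (%y u. b y u - \<alpha> / T0) \<Psi> y
     = (%u. (\<Sum>z\<in>UNIV. ?S y z u * (\<Psi> z u - \<Psi> y u + g1 (y, z) u)) + f1 y u - \<alpha> / T0)" for y by blast
   moreover have "abs (\<Psi> y t) <= P" for y t using \<Psi>(3)[of t] bound by metis
   ultimately show "\<exists>\<alpha> \<psi>. abs \<alpha> <= P \<and> (\<forall>y. bdd_borel (\<psi> y)) \<and> (\<forall>y t. abs (\<psi> y t) <= P) \<and> (\<forall>y r t. indef r t (\<psi> y)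
     (%u. (\<Sum>z\<in>UNIV. ?S y z u * (\<psi> z u - \<psi> y u + g1 (y, z) u)) + f1 y u - \<alpha> / T0))"
    using \<alpha> \<Psi>(1,4) by (intro exI[of _ \<alpha>] exI[of _ \<Psi>]) auto
  qed
 qed
qed

lemma second_order_error:
 fixes S g :: "'v => real"
 assumes S: "\<And>z. 0 <= S z" "\<And>z. S z <= A" and g: "\<And>z. abs (g z) <= L" and \<psi>: "\<And>z. abs (\<psi> z) <= P" and s: "abs s <= 1" "abs s * P <= 1 / 2"
  and f: "abs f <= F" and L: "0 <= L" and C: "C = 2 * (real CARD('v) * (A * (exp L * L\<^sup>2 + exp L * L * P)) + F * P)"
 shows "(\<Sum>z\<in>UNIV. S z * (exp (s * g z) * (1 + s * \<psi> z) - (1 + s * \<psi> y))) + (s * f - C * s\<^sup>2) * (1 + s * \<psi> y)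
  <= s * ((\<Sum>z\<in>UNIV. S z * (\<psi> z - \<psi> y + g z)) + f)"
proof -
 have A: "0 <= A" and P: "0 <= P" and F: "0 <= F"
  using S[of y] \<psi>[of y] f by (meson abs_ge_zero order_trans)+
 define K where "K = exp L * L\<^sup>2 + exp L * L * P"
 have K: "0 <= K" using L P by (simp add: K_def)
 let ?e = "%z. exp (s * g z) - 1 - s * g z + (exp (s * g z) - 1) * (s * \<psi> z)"
 have error: "?e z <= K * s\<^sup>2" for z
 proof -
  have "abs (s * g z) <= abs s * L" "abs s * L <= L" using g L s by (auto simp: abs_mult intro: mult_left_mono mult_left_le_one_le)
  note errors = exp_linear_errors[OF this mult_nonneg_nonneg[OF abs_ge_zero L]]
  have "abs ((exp (s * g z) - 1) * (s * \<psi> z)) <= (exp L * (abs s * L)) * (abs s * P)"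
   unfolding abs_mult[of "_ - 1"] using errors(1) L \<psi>[of z] by (intro mult_mono) (auto simp: abs_mult mult_left_mono)
  hence "?e z <= exp L * (abs s * L)\<^sup>2 + (exp L * (abs s * L)) * (abs s * P)" using errors(2) by linarith
  also have "... = K * s\<^sup>2"
   unfolding K_def using power2_abs[of s] by (simp add: power2_eq_square algebra_simps)
  finally show ?thesis .
 qed
 have "S z * ?e z <= A * (K * s\<^sup>2)" for z
 proof -
  have "S z * ?e z <= S z * (K * s\<^sup>2)" using error S(1) by (intro mult_left_mono)
  also have "... <= A * (K * s\<^sup>2)" using S(2) K by (intro mult_right_mono) auto
  finally show ?thesis .
 qed
 hence "(\<Sum>z\<in>UNIV. S z * ?e z) <= (\<Sum>z\<in>(UNIV::'v set). A * (K * s\<^sup>2))" by (intro sum_mono)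
 moreover have "f * \<psi> y * s\<^sup>2 <= F * P * s\<^sup>2"
 proof (rule mult_right_mono)
  have "abs (f * \<psi> y) <= F * P" unfolding abs_mult using f \<psi> F by (intro mult_mono) auto
  thus "f * \<psi> y <= F * P" by linarith
 qed simp
 moreover have "C * s\<^sup>2 * (1 / 2) <= C * s\<^sup>2 * (1 + s * \<psi> y)"
 proof (rule mult_left_mono)
  have "abs (s * \<psi> y) <= abs s * P" unfolding abs_mult using \<psi> by (intro mult_left_mono) auto
  thus "1 / 2 <= 1 + s * \<psi> y" using s(2) by linarith
  show "0 <= C * s\<^sup>2" using A K P F by (simp add: C K_def[symmetric])
 qed
 moreover have "C * s\<^sup>2 * (1 / 2) = real CARD('v) * (A * (K * s\<^sup>2)) + F * P * s\<^sup>2"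
  unfolding C K_def[symmetric] by (simp add: algebra_simps)
 moreover have "(\<Sum>z\<in>UNIV. S z * (exp (s * g z) * (1 + s * \<psi> z) - (1 + s * \<psi> y)))
   = (\<Sum>z\<in>UNIV. S z * ?e z) + s * (\<Sum>z\<in>UNIV. S z * (\<psi> z - \<psi> y + g z))"
  unfolding sum_distrib_left sum.distrib[symmetric] by (intro sum.cong refl) (simp add: algebra_simps)
 moreover have "(s * f - C * s\<^sup>2) * (1 + s * \<psi> y) = s * f + f * \<psi> y * s\<^sup>2 - C * s\<^sup>2 * (1 + s * \<psi> y)"
  by (simp add: power2_eq_square algebra_simps)
 ultimately show ?thesis unfolding distrib_left[of s] sum_constant by linarith
qed

lemma second_order_supersolution:
 assumes tp: "test_pair L f g" "test_pair L f1 g1" and h: "eigenfun f g l k1 k2 h" and \<alpha>: "abs \<alpha> <= P"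
  and \<psi>: "\<And>y. bdd_borel (\<psi> y)" "\<And>y t. abs (\<psi> y t) <= P" "\<And>y r t. indef r t (\<psi> y)
   (%u. (\<Sum>z\<in>UNIV. tilted_rates g h y z u * (\<psi> z u - \<psi> y u + g1 (y, z) u)) + f1 y u - \<alpha> / T0)"
  and s: "abs s <= 1" "abs s * P <= 1 / 2"
  and C: "C = 2 * (real CARD('v) * (B * exp L * k2 / k1 * (exp L * L\<^sup>2 + exp L * L * P)) + (L + P / T0) * P)"
 shows "lam (%y u. f y u + s * f1 y u) (%e u. g e u + s * g1 e u) <= l + s * \<alpha> + T0 * C * s\<^sup>2"
proof -
 note ef = eigenfunD[OF h] and S = tilted_rates_bounds[OF tp(1) h]
 let ?D = "%y u. (\<Sum>z\<in>UNIV. tilted_rates g h y z u * (\<psi> z u - \<psi> y u + g1 (y, z) u)) + f1 y u - \<alpha> / T0"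
 let ?\<phi> = "%y u. 1 + s * \<psi> y u" and ?fl = "%y u. f y u - l / T0"
 let ?d = "%y u. s * (f1 y u - \<alpha> / T0) - C * s\<^sup>2"
 have D: "bdd_borel (?D y)" for y using S(1) \<psi>(1) test_pair_bdd[OF tp(2)] by (intro bdd_borel_intros)
 have bw: "bdd_borel (bw ?fl g h y)" for y using test_pair_bdd[OF tp(1)] ef(2) by (intro bw_bdd bdd_borel_intros)
 have \<phi>: "bdd_borel (?\<phi> y)" "1 / 2 <= ?\<phi> y u" "?\<phi> y u <= 2" "0 <= ?\<phi> y u" for y u
 proof -
  have "abs (s * \<psi> y u) <= abs s * P" unfolding abs_mult using \<psi>(2) by (intro mult_left_mono) auto
  thus "1 / 2 <= ?\<phi> y u" "?\<phi> y u <= 2" "0 <= ?\<phi> y u" using s(2) by (auto simp: abs_le_iff)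
 qed (use \<psi>(1) in \<open>intro bdd_borel_intros\<close>)
 show ?thesis
 proof (rule lam_le_of_supersolution[OF test_pair_add[OF tp s(1)]])
  show "bdd_borel (%u. h y u * ?\<phi> y u)" for y using ef(2) \<phi>(1) by (rule bdd_borel_mult)
  show "k1 * (1 / 2) <= h y u * ?\<phi> y u" for y u
   using ef(3)[of y u] ef(7)[of y u] \<phi>(2)[of y u] by (intro mult_mono) auto
  show "h y u * ?\<phi> y u <= k2 * 2" for y u
   using ef(4)[of y u] ef(7)[of y u] \<phi>(3,4)[of y u] by (intro mult_mono) auto
  show "k1 * (1 / 2) > 0" using ef(1) by simp
  show "bdd_borel (%u. bw ?fl g h y u * ?\<phi> y u + h y u * (0 + s * ?D y u))" for y
   by (intro bdd_borel_add bdd_borel_mult bdd_borel_const bw ef(2) D \<psi>(1))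
  show "indef a b (%u. h y u * ?\<phi> y u) (%u. bw ?fl g h y u * ?\<phi> y u + h y u * (0 + s * ?D y u))" for y a b
   by (rule indef_mult[OF ef(6) bw ef(2)])
    (intro indef_add indef_const indef_cmult \<psi> bdd_borel_add bdd_borel_mult bdd_borel_const D)+
  fix y u
  have potential: "(%y u. f y u + s * f1 y u - (l + s * \<alpha> + T0 * C * s\<^sup>2) / T0) = (%y u. ?fl y u + ?d y u)"
   using T0 by (intro ext) (simp add: add_divide_distrib right_diff_distrib)
  let ?S = "\<Sum>z\<in>UNIV. tilted_rates g h y z u * (exp (s * g1 (y, z) u) * ?\<phi> z u - ?\<phi> y u)"
  have nonzero: "h y u \<noteq> 0" for y u using ef(7)[of y u] by simp
  have "bw (%y u. f y u + s * f1 y u - (l + s * \<alpha> + T0 * C * s\<^sup>2) / T0) (%e u. g e u + s * g1 e u) (%y u. h y u * ?\<phi> y u) y u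
    = h y u * ?S + bw ?fl g h y u * ?\<phi> y u + ?d y u * (h y u * ?\<phi> y u)"
   unfolding potential by (rule bw_doob_transform[OF nonzero])
  also have "... = bw ?fl g h y u * ?\<phi> y u + h y u * (?S + ?d y u * ?\<phi> y u)"
   by (simp only: distrib_left mult.left_commute[of _ "h y u"] add_ac)
  also have "... <= bw ?fl g h y u * ?\<phi> y u + h y u * (s * ?D y u)"
  proof (intro add_left_mono mult_left_mono)
   have "abs (f1 y u - \<alpha> / T0) <= L + P / T0"
    using test_pairD(2)[OF tp(2), of y u] \<alpha> T0 by (intro order_trans[OF abs_triangle_ineq4 add_mono]) (auto simp: abs_divide divide_right_mono)
   from second_order_error[OF S(2,3) test_pairD(5)[OF tp(2)] \<psi>(2) s this test_pair_nonneg[OF tp(1)] C]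
   show "?S + ?d y u * ?\<phi> y u <= s * ?D y u"
    by (simp add: add_diff_eq)
   show "0 <= h y u" using ef(7)[of y u] by simp
  qed
  finally show "bw (%y u. f y u + s * f1 y u - (l + s * \<alpha> + T0 * C * s\<^sup>2) / T0) (%e u. g e u + s * g1 e u) (%y u. h y u * ?\<phi> y u) y u
    <= bw ?fl g h y u * ?\<phi> y u + h y u * (0 + s * ?D y u)" by simp
 qed
qed

theorem lam_second_order:
 obtains C2 s0 where "C2 >= 0" "s0 > 0" "s0 <= 1"
  "\<And>f g f1 g1. test_pair L f g ==> test_pair L f1 g1 ==> \<exists>\<alpha>. \<forall>s. abs s <= s0 -->
   lam (%y u. f y u + s * f1 y u) (%e u. g e u + s * g1 e u) <= lam f g + s * \<alpha> + C2 * s\<^sup>2"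
proof -
 obtain k1 k2 where k1: "k1 > 0" and eig: "\<And>f g. test_pair L f g ==> \<exists>h. eigenfun f g (lam f g) k1 k2 h"
  using that by (rule perron)
 obtain P where P: "P >= 0" and poisson: "\<And>f g f1 g1 l h. test_pair L f g ==> test_pair L f1 g1 ==> eigenfun f g l k1 k2 h ==>
  \<exists>\<alpha> \<psi>. abs \<alpha> <= P \<and> (\<forall>y. bdd_borel (\<psi> y)) \<and> (\<forall>y t. abs (\<psi> y t) <= P) \<and> (\<forall>y r t. indef r t (\<psi> y)
   (%u. (\<Sum>z\<in>UNIV. tilted_rates g h y z u * (\<psi> z u - \<psi> y u + g1 (y, z) u)) + f1 y u - \<alpha> / T0))"
  using that by (rule tilted_poisson[OF k1])
 define C where "C = 2 * (real CARD('v) * (B * exp L * k2 / k1 * (exp L * L\<^sup>2 + exp L * L * P)) + (L + P / T0) * P)"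
 define s0 where "s0 = 1 / (2 * (P + 1))"
 have s0: "s0 > 0" "s0 <= 1" "s0 * P <= 1 / 2" using P by (auto simp: s0_def field_simps)
 have "\<exists>\<alpha>. \<forall>s. abs s <= s0 --> lam (%y u. f y u + s * f1 y u) (%e u. g e u + s * g1 e u) <= lam f g + s * \<alpha> + abs (T0 * C) * s\<^sup>2"
  if tp: "test_pair L f g" "test_pair L f1 g1" for f g f1 g1
 proof -
  obtain h where h: "eigenfun f g (lam f g) k1 k2 h" using eig[OF tp(1)] by blast
  obtain \<alpha> \<psi> where "abs \<alpha> <= P" and \<psi>: "\<And>y. bdd_borel (\<psi> y)" "\<And>y t. abs (\<psi> y t) <= P" "\<And>y r t. indef r t (\<psi> y)
   (%u. (\<Sum>z\<in>UNIV. tilted_rates g h y z u * (\<psi> z u - \<psi> y u + g1 (y, z) u)) + f1 y u - \<alpha> / T0)"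
   using poisson[OF tp h] by blast
  have "lam (%y u. f y u + s * f1 y u) (%e u. g e u + s * g1 e u) <= lam f g + s * \<alpha> + abs (T0 * C) * s\<^sup>2" if s: "abs s <= s0" for s
  proof -
   have "lam (%y u. f y u + s * f1 y u) (%e u. g e u + s * g1 e u) <= lam f g + s * \<alpha> + T0 * C * s\<^sup>2"
   proof (rule second_order_supersolution[OF tp h \<open>abs \<alpha> <= P\<close> \<psi> _ _ C_def])
    show "abs s <= 1" "abs s * P <= 1 / 2" using s s0 mult_right_mono[OF s P] by linarith+
   qed
   also have "... <= lam f g + s * \<alpha> + abs (T0 * C) * s\<^sup>2" by (simp add: mult_right_mono)
   finally show ?thesis .
  qed
  thus ?thesis by blast
 qed
 from that[OF abs_ge_zero s0(1,2) this] show ?thesis by blast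
qed

end

section \<open>Measures on finitely many circles\<close>

lemma SpV_space [simp]: "space (SpV :: ('a * real) measure) = UNIV"
 by (simp add: space_pair_measure)

lemma SpV_measurable:
 fixes f :: "'a::finite => real => 'b::topological_space"
 assumes "\<And>y. f y \<in> borel_measurable borel"
 shows "(%p. f (fst p) (snd p)) \<in> borel_measurable SpV"
 by (rule measurable_pair_measure_countable1) (use assms in \<open>auto simp: countable_finite\<close>)

lemma SpV_slice_measurable:
 assumes "(%p. f (fst p) (snd p)) \<in> borel_measurable (SpV :: ('a * real) measure)"
 shows "f y \<in> borel_measurable borel"
proof -
 have "(%t. (y, t)) \<in> measurable lborel (SpV :: ('a * real) measure)" by measurable
 from measurable_compose[OF this assms] show ?thesis by simp
qed

lemma SpV_times_sets: "A \<in> sets borel ==> Y \<times> A \<in> sets (SpV :: ('a::finite * real) measure)"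
 by (intro pair_measureI) auto

lemma SpV_sets:
 "UNIV \<in> sets (SpV :: ('a::finite * real) measure)" "UNIV - UNIV \<times> {0..<T0} \<in> sets (SpV :: ('a * real) measure)"
 using SpV_times_sets[of UNIV "UNIV :: 'a set"] SpV_times_sets[of "{0..<T0}" "UNIV :: 'a set"] sets.compl_sets[of _ "SpV :: ('a * real) measure"] by force+

lemma nn_integral_SpV:
 fixes F :: "'a::finite * real => ennreal"
 assumes "F \<in> borel_measurable SpV"
 shows "(\<integral>\<^sup>+p. F p \<partial>SpV) = (\<Sum>y\<in>UNIV. \<integral>\<^sup>+t. F (y, t) \<partial>lborel)"
 by (subst lborel.nn_integral_fst[symmetric, OF assms]) (simp add: nn_integral_count_space_finite)

lemma integral_SpV:
 fixes F :: "'a::finite * real => real"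
 assumes F: "integrable SpV F"
 shows "\<And>y. integrable lborel (%t. F (y, t))" and "(LINT p|SpV. F p) = (\<Sum>y\<in>UNIV. \<integral>t. F (y, t) \<partial>lborel)"
proof -
 interpret pair_sigma_finite "count_space (UNIV :: 'a set)" lborel
  by (intro pair_sigma_finite.intro lborel.sigma_finite_measure_axioms sigma_finite_measure_count_space_finite) auto
 show "integrable lborel (%t. F (y, t))" for y using AE_integrable_fst'[OF F] by (simp add: AE_count_space)
 show "(LINT p|SpV. F p) = (\<Sum>y\<in>UNIV. \<integral>t. F (y, t) \<partial>lborel)"
  using integral_fst'[OF F] by (simp add: lebesgue_integral_count_space_finite)
qed

definition circle_measure :: "real => ('a::finite * real) measure => bool" where
 "circle_measure T0 nu \<longleftrightarrow> sets nu = sets SpV \<and> emeasure nu (space nu) < \<infinity> \<and> emeasure nu (space nu - UNIV \<times> {0..<T0}) = 0"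

lemma circle_measureD:
 assumes "circle_measure T0 nu"
 shows "finite_measure nu" "sets nu = sets SpV" "space nu = UNIV" "AE p in nu. snd p \<in> {0..<T0}"
proof -
 show finite: "finite_measure nu" using assms unfolding circle_measure_def by (intro finite_measureI) auto
 show sets_eq: "sets nu = sets SpV" using assms by (simp add: circle_measure_def)
 show space_UNIV: "space nu = UNIV" using sets_eq_imp_space_eq[OF sets_eq] by simp
 have "UNIV - UNIV \<times> {0..<T0} = (UNIV :: 'a set) \<times> (- {0..<T0})" by auto
 hence "UNIV - UNIV \<times> {0..<T0} \<in> null_sets nu"
  using assms space_UNIV sets_eq unfolding circle_measure_def null_sets_def by (auto intro!: SpV_times_sets)
 thus "AE p in nu. snd p \<in> {0..<T0}" by (rule AE_I') (auto simp: space_UNIV)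
qed

lemma circle_measurable: "circle_measure T0 nu ==> f \<in> borel_measurable SpV ==> f \<in> borel_measurable nu"
 by (simp only: measurable_cong_sets[OF circle_measureD(2) refl])

abbreviation itg :: "('a * real) measure => ('a tfun) => real" where
 "itg nu f \<equiv> \<integral>p. f (fst p) (snd p) \<partial>nu"

lemma cont_perD: "cont_per T0 u ==> continuous_on UNIV (u y)" "cont_per T0 u ==> u y (t + T0) = u y t"
 unfolding cont_per_def by blast+

lemma cont_per_bounded:
 fixes u :: "'a::finite => real => real"
 assumes u: "cont_per T0 u" and T0: "T0 > 0"
 obtains K where "K >= 0" "\<And>y t. abs (u y t) <= K"
proof -
 have "bdd_borel (u y)" for y
 proof -
  note cont = cont_perD(1)[OF u, of y] cont_perD(2)[OF u, of y]
  hence "bounded (u y ` {0..T0})" by (intro compact_imp_bounded compact_continuous_image continuous_on_subset[OF cont(1)]) auto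
  then obtain K where K: "\<forall>t\<in>{0..T0}. abs (u y t) <= K" by (auto simp: bounded_iff)
  have "abs (u y t) <= K" for t
   using bspec[OF K, of "pmod t T0"] periodic_pmod[of "u y" T0 t, OF cont(2)] pmod_bounds[OF T0, of t] by simp
  thus ?thesis using cont by (intro bdd_borelI borel_measurable_continuous_onI)
 qed
 thus ?thesis using bdd_borel_family_bound[of u] that by blast
qed

lemma cont_per_bdd:
 fixes u :: "'a::finite => real => real"
 assumes "cont_per T0 u" "T0 > 0" shows "bdd_borel (u y)"
proof -
 obtain K where "K >= 0" "\<And>y t. abs (u y t) <= K" using that by (rule cont_per_bounded[OF assms])
 thus ?thesis by (intro bdd_borelI borel_measurable_continuous_onI cont_perD(1)[OF assms(1)])
qed

lemma cont_per_measurable: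
 fixes u :: "'a::finite => real => real"
 assumes "cont_per T0 u" shows "(%p. u (fst p) (snd p)) \<in> borel_measurable SpV"
 by (rule SpV_measurable, rule borel_measurable_continuous_onI, rule cont_perD(1)[OF assms])

lemma circle_integrable_bounded:
 fixes f :: "'a::finite * real => real"
 assumes nu: "circle_measure T0 nu" and f: "f \<in> borel_measurable SpV" "\<And>p. abs (f p) <= K"
 shows "integrable nu f"
proof -
 interpret finite_measure nu by (rule circle_measureD(1)[OF nu])
 have "f \<in> borel_measurable nu" by (rule circle_measurable[OF nu f(1)])
 thus ?thesis using f(2) by (intro integrable_const_bound[where B = K]) auto
qed

lemma cont_per_integrable:
 fixes u :: "'a::finite => real => real"
 assumes nu: "circle_measure T0 nu" and T0: "T0 > 0" and u: "cont_per T0 u"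
 shows "integrable nu (%p. u (fst p) (snd p))"
proof -
 obtain K where "K >= 0" "\<And>y t. abs (u y t) <= K" using that by (rule cont_per_bounded[OF u T0])
 thus ?thesis by (intro circle_integrable_bounded[OF nu cont_per_measurable[OF u]])
qed

lemma cont_per_add: "cont_per T0 u ==> cont_per T0 v ==> cont_per T0 (%y t. u y t + v y t)"
 unfolding cont_per_def by (simp add: continuous_on_add)

lemma cont_per_cmult: "cont_per T0 u ==> cont_per T0 (%y t. k * u y t)"
 unfolding cont_per_def by (simp add: continuous_on_mult_left)

lemma cont_per_const: "cont_per T0 (%y t. k y)"
 unfolding cont_per_def by auto

lemma cont_per_mult: "cont_per T0 u ==> cont_per T0 v ==> cont_per T0 (%y t. u y t * v y t)"
 unfolding cont_per_def by (simp add: continuous_on_mult)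

context
 fixes T0 :: real and nu :: "('a::finite * real) measure"
 assumes T0: "T0 > 0" and nu: "circle_measure T0 nu"
begin

lemma L1_triangle:
 fixes f g h :: "'a * real => real"
 assumes "integrable nu f" "integrable nu g" "integrable nu h"
 shows "(LINT p|nu. abs (f p - h p)) <= (LINT p|nu. abs (f p - g p)) + (LINT p|nu. abs (g p - h p))"
proof -
 have "(LINT p|nu. abs (f p - h p)) <= (LINT p|nu. abs (f p - g p) + abs (g p - h p))"
  using assms by (intro integral_mono) auto
 also have "... = (LINT p|nu. abs (f p - g p)) + (LINT p|nu. abs (g p - h p))"
  using assms by (intro Bochner_Integration.integral_add) auto
 finally show ?thesis .
qed

definition approximable :: "('a * real => real) => bool" where
 "approximable f \<longleftrightarrow> integrable nu f \<and> (\<forall>\<epsilon>>0. \<exists>u. cont_per T0 u \<and> (LINT p|nu. abs (f p - u (fst p) (snd p))) < \<epsilon>)"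

lemma approximable_cont: "cont_per T0 u ==> approximable (%p. u (fst p) (snd p))"
 unfolding approximable_def using cont_per_integrable[OF nu T0, of u] by (auto intro!: exI[of _ u])

lemma approximable_const: "approximable (%p. k)"
 using approximable_cont[OF cont_per_const[of T0 "%_. k"]] by simp

lemma approximable_closed:
 assumes f: "integrable nu f" and close: "\<And>\<epsilon>. \<epsilon> > 0 ==> \<exists>g. approximable g \<and> (LINT p|nu. abs (f p - g p)) < \<epsilon>"
 shows "approximable f"
 unfolding approximable_def
proof (intro conjI allI impI f)
 fix \<epsilon> :: real assume "\<epsilon> > 0"
 then obtain g where g: "approximable g" "(LINT p|nu. abs (f p - g p)) < \<epsilon> / 2" using close[of "\<epsilon> / 2"] by auto
 then obtain u where u: "cont_per T0 u" "(LINT p|nu. abs (g p - u (fst p) (snd p))) < \<epsilon> / 2"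
  using half_gt_zero[OF \<open>\<epsilon> > 0\<close>] unfolding approximable_def by blast
 have "(LINT p|nu. abs (f p - u (fst p) (snd p))) < \<epsilon>"
  using L1_triangle[OF f _ cont_per_integrable[OF nu T0 u(1)], of g] g u(2) unfolding approximable_def by linarith
 thus "\<exists>u. cont_per T0 u \<and> (LINT p|nu. abs (f p - u (fst p) (snd p))) < \<epsilon>" using u(1) by blast
qed

lemma approximable_add:
 assumes "approximable f" "approximable g" shows "approximable (%p. f p + g p)"
 unfolding approximable_def
proof (intro conjI allI impI)
 have fg: "integrable nu f" "integrable nu g" using assms unfolding approximable_def by auto
 thus "integrable nu (%p. f p + g p)" by simp
 fix \<epsilon> :: real assume "\<epsilon> > 0"
 then obtain u v where u: "cont_per T0 u" "(LINT p|nu. abs (f p - u (fst p) (snd p))) < \<epsilon> / 2"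
  and v: "cont_per T0 v" "(LINT p|nu. abs (g p - v (fst p) (snd p))) < \<epsilon> / 2"
  using assms half_gt_zero[of \<epsilon>] unfolding approximable_def by blast
 note cont = cont_per_integrable[OF nu T0 u(1)] cont_per_integrable[OF nu T0 v(1)]
 have "(LINT p|nu. abs (f p + g p - (u (fst p) (snd p) + v (fst p) (snd p)))) < \<epsilon>"
  using L1_triangle[OF Bochner_Integration.integrable_add[OF fg]
    Bochner_Integration.integrable_add[OF cont(1) fg(2)] Bochner_Integration.integrable_add[OF cont]] u(2) v(2) by simp
 thus "\<exists>w. cont_per T0 w \<and> (LINT p|nu. abs (f p + g p - w (fst p) (snd p))) < \<epsilon>"
  using cont_per_add[OF u(1) v(1)] by (intro exI[of _ "%y t. u y t + v y t"]) auto
qed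

lemma approximable_mult:
 assumes f: "approximable f" and w: "cont_per T0 w" shows "approximable (%p. w (fst p) (snd p) * f p)"
 unfolding approximable_def
proof (intro conjI allI impI)
 obtain K where K: "K >= 0" "\<And>y t. abs (w y t) <= K" using that by (rule cont_per_bounded[OF w T0])
 have f_int: "integrable nu f" using f unfolding approximable_def by auto
 have mult: "integrable nu (%p. w (fst p) (snd p) * g p)" if "integrable nu g" for g
  using that K borel_measurable_integrable[OF cont_per_integrable[OF nu T0 w]]
  by (intro Bochner_Integration.integrable_bound[OF integrable_mult_right[OF that, of K]])
   (auto simp: abs_mult intro!: AE_I2 mult_right_mono)
 show "integrable nu (%p. w (fst p) (snd p) * f p)" by (rule mult[OF f_int])
 fix \<epsilon> :: real assume "\<epsilon> > 0"
 hence "\<epsilon> / (K + 1) > 0" using K by simp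
 then obtain u where u: "cont_per T0 u" "(LINT p|nu. abs (f p - u (fst p) (snd p))) < \<epsilon> / (K + 1)"
  using f unfolding approximable_def by meson
 note u_int = cont_per_integrable[OF nu T0 u(1)]
 have "(LINT p|nu. abs (w (fst p) (snd p) * f p - w (fst p) (snd p) * u (fst p) (snd p)))
   <= (LINT p|nu. (K + 1) * abs (f p - u (fst p) (snd p)))"
 proof (rule integral_mono)
  show "integrable nu (%p. abs (w (fst p) (snd p) * f p - w (fst p) (snd p) * u (fst p) (snd p)))"
   using mult[OF f_int] mult[OF u_int] by simp
  show "integrable nu (%p. (K + 1) * abs (f p - u (fst p) (snd p)))" using f_int u_int by simp
  show "abs (w (fst p) (snd p) * f p - w (fst p) (snd p) * u (fst p) (snd p)) <= (K + 1) * abs (f p - u (fst p) (snd p))" for p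
   unfolding right_diff_distrib[symmetric] abs_mult using K(2)[of "fst p" "snd p"] by (intro mult_right_mono) auto
 qed
 also have "... < \<epsilon>" using u K by (simp add: pos_less_divide_eq mult.commute)
 finally show "\<exists>v. cont_per T0 v \<and> (LINT p|nu. abs (w (fst p) (snd p) * f p - v (fst p) (snd p))) < \<epsilon>"
  using cont_per_mult[OF w u(1)] by (intro exI[of _ "%y t. w y t * u y t"]) auto
qed

lemma approximable_lim:
 assumes s: "\<And>i. approximable (s i)" and lim: "AE p in nu. (%i. s i p) \<longlonglongrightarrow> f p"
  and dom: "\<And>i. AE p in nu. abs (s i p) <= w p" and w: "integrable nu w" and f: "f \<in> borel_measurable nu"
 shows "approximable f"
proof (rule approximable_closed)
 have s_meas: "s i \<in> borel_measurable nu" for i using s unfolding approximable_def by auto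
 show f_int: "integrable nu f"
  using dom by (intro integrable_dominated_convergence[OF f s_meas w lim]) auto
 have "(%i. LINT p|nu. abs (f p - s i p)) \<longlonglongrightarrow> (LINT p|nu. 0)"
 proof (rule integral_dominated_convergence[where w = "%p. abs (f p) + w p"])
  show "AE p in nu. (%i. abs (f p - s i p)) \<longlonglongrightarrow> 0"
   using lim by eventually_elim (auto intro!: tendsto_eq_intros)
  show "AE p in nu. norm (abs (f p - s i p)) <= abs (f p) + w p" for i
   using dom[of i] by eventually_elim auto
 qed (use f s_meas f_int w in auto)
 moreover fix \<epsilon> :: real assume "\<epsilon> > 0"
 ultimately have "\<forall>\<^sub>F i in sequentially. (LINT p|nu. abs (f p - s i p)) < \<epsilon>" by (intro order_tendstoD) auto
 then obtain i where "(LINT p|nu. abs (f p - s i p)) < \<epsilon>" by (auto simp: eventually_sequentially)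
 thus "\<exists>g. approximable g \<and> (LINT p|nu. abs (f p - g p)) < \<epsilon>" using s[of i] by blast
qed

definition arc_cutoff :: "real => nat => real => real" where
 "arc_cutoff b k s = max 0 (1 - real k * min (max 0 (s - b)) (T0 - s))"

lemma arc_cutoff_tendsto:
 assumes "0 <= s" "s < T0" shows "(%k. arc_cutoff b k s) \<longlonglongrightarrow> indicator {..b} s"
proof (cases "s <= b")
 case False
 define d where "d = min (s - b) (T0 - s)"
 have "d > 0" using False assms by (simp add: d_def)
 then obtain m where "1 / d <= real m" using real_arch_simple by blast
 hence "1 <= real k * d" if "k >= m" for k
  using \<open>d > 0\<close> that by (simp add: divide_le_eq) (meson mult_right_mono less_imp_le of_nat_mono order_trans)
 hence "\<forall>\<^sub>F k in sequentially. arc_cutoff b k s = 0"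
  using False unfolding eventually_sequentially by (intro exI[of _ m]) (auto simp: arc_cutoff_def d_def)
 thus ?thesis using False by (simp add: tendsto_eventually)
qed (use assms in \<open>simp add: arc_cutoff_def\<close>)

lemma approximable_atMost: "approximable (%p. indicator {..b} (snd p))"
proof -
 interpret finite_measure nu by (rule circle_measureD(1)[OF nu])
 note AE = circle_measureD(4)[OF nu]
 have meas: "(%p. indicator {..b} (snd p) :: real) \<in> borel_measurable nu"
  by (rule circle_measurable[OF nu], rule SpV_measurable[where f = "%_. indicator {..b}"]) auto
 show ?thesis
 proof (cases "0 <= b")
  case True
  have "continuous_on UNIV (%t. arc_cutoff b k (pmod t T0))" for k
   unfolding arc_cutoff_def using True T0 by (intro continuous_pmod_extension[OF T0] continuous_intros) (auto simp: min_def)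
  hence cutoff: "cont_per T0 (%y::'a. %t. arc_cutoff b k (pmod t T0))" for k unfolding cont_per_def using T0 by auto
  show ?thesis
  proof (rule approximable_lim[where w = "%_. 1"])
   show "approximable (%p. arc_cutoff b k (pmod (snd p) T0))" for k using approximable_cont[OF cutoff] .
   show "AE p in nu. (%k. arc_cutoff b k (pmod (snd p) T0)) \<longlonglongrightarrow> indicator {..b} (snd p)"
    using AE by eventually_elim (auto simp: pmod_id intro: arc_cutoff_tendsto)
   show "AE p in nu. abs (arc_cutoff b k (pmod (snd p) T0)) <= 1" for k
    using pmod_bounds[OF T0] by (auto simp: arc_cutoff_def less_imp_le)
  qed (use meas in auto)
 next
  case False
  show ?thesis
  proof (rule approximable_lim[where s = "%_ _. 0" and w = "%_. 1"])
   show "AE p in nu. (%i. 0) \<longlonglongrightarrow> indicator {..b} (snd p)"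
    using AE by eventually_elim (use False in auto)
  qed (use meas approximable_const in auto)
 qed
qed

lemma approximable_compl:
 assumes "approximable (%p. indicator A (snd p))" shows "approximable (%p. indicator (UNIV - A) (snd p))"
proof -
 have "approximable (%p. 1 + (-1) * indicator A (snd p))"
  by (intro approximable_add approximable_const approximable_mult[where w = "%_ _. -1"] assms cont_per_const)
 thus ?thesis by (simp add: indicator_compl[symmetric] Compl_eq_Diff_UNIV[symmetric])
qed

lemma approximable_disjoint_UN:
 assumes A: "disjoint_family A" "\<And>i. A i \<in> sets borel" "\<And>i::nat. approximable (%p. indicator (A i) (snd p))"
 shows "approximable (%p. indicator (\<Union>i. A i) (snd p))"
proof (rule approximable_lim[where w = "%_. 1" and s = "%n p. indicator (\<Union>i<n. A i) (snd p)"])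
 interpret finite_measure nu by (rule circle_measureD(1)[OF nu])
 show "integrable nu (%_. 1 :: real)" by simp
 have "approximable (%p. \<Sum>i<n. indicator (A i) (snd p))" for n
  by (induction n) (simp_all add: approximable_const approximable_add A(3))
 moreover have "(\<Sum>i<n. indicator (A i) t) = (indicator (\<Union>i<n. A i) t :: real)" for n t
  using A(1) by (subst indicator_UN_disjoint) (auto simp: disjoint_family_on_def)
 ultimately show "approximable (%p. indicator (\<Union>i<n. A i) (snd p))" for n by simp
 show "AE p in nu. (%n. indicator (\<Union>i<n. A i) (snd p) :: real) \<longlonglongrightarrow> indicator (\<Union>i. A i) (snd p)"
  by (intro AE_I2 LIMSEQ_indicator_UN)
 show "(%p. indicator (\<Union>i. A i) (snd p) :: real) \<in> borel_measurable nu"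
  using A(2) by (intro circle_measurable[OF nu] SpV_measurable[where f = "%_. indicator (\<Union>i. A i)"]) auto
qed (auto simp: indicator_def)

lemma approximable_snd_set:
 assumes "B \<in> sets borel" shows "approximable (%p. indicator B (snd p))"
proof -
 have borel: "sets (borel :: real measure) = sigma_sets UNIV (range atMost)"
  by (subst borel_eq_atMost) (simp add: sets_measure_of)
 have "Int_stable (range (atMost :: real => _))"
 proof (rule Int_stableI)
  fix A B :: "real set" assume "A \<in> range atMost" "B \<in> range atMost"
  then obtain a b where "A \<inter> B = {..min a b}" by auto
  thus "A \<inter> B \<in> range atMost" by blast
 qed
 moreover have "range atMost \<subseteq> Pow (UNIV :: real set)" by simp
 moreover have "B \<in> sigma_sets UNIV (range atMost)" using assms borel by simp
 ultimately show ?thesis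
 proof (induction rule: sigma_sets_induct_disjoint[of "range atMost" UNIV])
  case (union A)
  thus ?case using borel by (intro approximable_disjoint_UN) (auto simp: image_subset_iff)
 qed (use approximable_atMost approximable_const[of 0] approximable_compl in auto)
qed

lemma approximable_integrable:
 assumes "integrable nu f" shows "approximable f"
 using assms
proof (induction rule: integrable_induct)
 case (base A r)
 have A: "A \<in> sets SpV" using base circle_measureD(2)[OF nu] by simp
 have slice: "{t. (y, t) \<in> A} \<in> sets borel" for y
  using sets_Pair1[OF A, of y] by (simp add: vimage_def)
 define w where "w y y' = (if y' = y then r else 0)" for y y' :: 'a
 have "approximable (%p. \<Sum>y\<in>Y. w y (fst p) * indicator {t. (y, t) \<in> A} (snd p))" if "finite Y" for Y
  using that
 proof (induction Y)
  case empty
  thus ?case using approximable_cont[OF cont_per_const[of T0 "%_. 0"]] by simp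
 next
  case (insert y Y)
  show ?case unfolding sum.insert[OF insert.hyps]
   by (rule approximable_add[OF approximable_mult[OF approximable_snd_set[OF slice[of y]] cont_per_const[of T0 "w y"]] insert.IH])
 qed
 from this[of UNIV] have "approximable (%p. \<Sum>y\<in>UNIV. w y (fst p) * indicator {t. (y, t) \<in> A} (snd p))" by simp
 moreover have "(%p. \<Sum>y\<in>UNIV. w y (fst p) * indicator {t. (y, t) \<in> A} (snd p)) = (%p. indicator A p *\<^sub>R r)"
 proof
  fix p :: "'a * real"
  have "(\<Sum>y\<in>UNIV. w y (fst p) * indicator {t. (y, t) \<in> A} (snd p)) = (\<Sum>y\<in>UNIV. if y = fst p then indicator A p * r else 0)"
   unfolding w_def by (intro sum.cong) (auto simp: indicator_def)
  thus "(\<Sum>y\<in>UNIV. w y (fst p) * indicator {t. (y, t) \<in> A} (snd p)) = indicator A p *\<^sub>R r" by simp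
 qed
 ultimately show ?case by simp
next
 case (add f g)
 show ?case by (rule approximable_add) (use add in auto)
next
 case (lim f s)
 show ?case
  by (rule approximable_lim[where s = s and w = "%p. 2 * abs (f p)"]) (use lim in auto)
qed

lemma approx_cont_per:
 assumes f: "f \<in> borel_measurable SpV" "\<And>p. abs (f p) <= K" and ep: "ep > 0"
 obtains u where "cont_per T0 u" "\<And>y t. abs (u y t) <= K" "(LINT p|nu. abs (f p - u (fst p) (snd p))) < ep"
proof -
 have f_int: "integrable nu f" by (rule circle_integrable_bounded[OF nu f])
 obtain u where u: "cont_per T0 u" "(LINT p|nu. abs (f p - u (fst p) (snd p))) < ep"
  using approximable_integrable[OF f_int] ep unfolding approximable_def by blast
 have K: "K >= 0" using f(2) by (meson abs_ge_zero order_trans)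
 define v where "v y t = max (- K) (min K (u y t))" for y t
 have v: "cont_per T0 v"
  using u(1) unfolding cont_per_def v_def by (simp add: continuous_on_max continuous_on_min)
 have "(LINT p|nu. abs (f p - v (fst p) (snd p))) <= (LINT p|nu. abs (f p - u (fst p) (snd p)))"
 proof (intro integral_mono)
  fix p show "abs (f p - v (fst p) (snd p)) <= abs (f p - u (fst p) (snd p))"
   using f(2)[of p] by (auto simp: v_def abs_le_iff max_def min_def)
 qed (use f_int cont_per_integrable[OF nu T0 u(1)] cont_per_integrable[OF nu T0 v] in auto)
 thus ?thesis using that[OF v] u(2) K by (auto simp: v_def)
qed

end

definition plus_measure :: "'b measure => 'b measure => 'b measure" where
 "plus_measure M N = measure_of (space M) (sets M) (%A. emeasure M A + emeasure N A)"

lemma plus_measure: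
 assumes s: "sets N = sets M"
 shows "sets (plus_measure M N) = sets M" "space (plus_measure M N) = space M"
  "A \<in> sets M ==> emeasure (plus_measure M N) A = emeasure M A + emeasure N A"
proof -
 show sets_space: "sets (plus_measure M N) = sets M" "space (plus_measure M N) = space M"
  unfolding plus_measure_def by (auto simp: space_measure_of_conv sets.space_closed)
 assume A: "A \<in> sets M"
 show "emeasure (plus_measure M N) A = emeasure M A + emeasure N A"
 proof (rule emeasure_measure_of[OF plus_measure_def])
  show "sets M \<subseteq> Pow (space M)" by (rule sets.space_closed)
  show "A \<in> sets (plus_measure M N)" using A sets_space by simp
  show "positive (sets (plus_measure M N)) (%A. emeasure M A + emeasure N A)" by (auto simp: positive_def)
  show "countably_additive (sets (plus_measure M N)) (%A. emeasure M A + emeasure N A)"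
   unfolding sets_space
  proof (rule countably_additiveI)
   fix A :: "nat => _" assume A: "range A \<subseteq> sets M" "disjoint_family A" "\<Union> (range A) \<in> sets M"
   have "(\<Sum>i. emeasure M (A i) + emeasure N (A i)) = (\<Sum>i. emeasure M (A i)) + (\<Sum>i. emeasure N (A i))"
    by (rule suminf_add[symmetric]) auto
   thus "(\<Sum>i. emeasure M (A i) + emeasure N (A i)) = emeasure M (\<Union> (range A)) + emeasure N (\<Union> (range A))"
    using A s by (simp add: suminf_emeasure)
  qed
 qed
qed

lemma plus_measure_ge:
 assumes "sets N = sets M" shows "M <= plus_measure M N" "N <= plus_measure M N"
proof -
 have space_eq: "space N = space M" by (rule sets_eq_imp_space_eq[OF assms])
 have "emeasure M A <= emeasure (plus_measure M N) A \<and> emeasure N A <= emeasure (plus_measure M N) A" for A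
 proof (cases "A \<in> sets M")
  case True
  thus ?thesis by (simp add: plus_measure(3)[OF assms])
 next
  case False
  thus ?thesis using assms by (simp add: emeasure_notin_sets)
 qed
 thus "M <= plus_measure M N" "N <= plus_measure M N"
  using plus_measure(1,2)[OF assms] assms space_eq by (auto simp: le_measure_iff intro!: le_funI)
qed

section \<open>The rate function dominates the conjugate of the eigenvalue\<close>

definition period :: "real => real => real" where
 "period T0 t = indicator {0..<T0} t"

lemma period_measurable [measurable]: "period T0 \<in> borel_measurable borel"
 unfolding period_def[abs_def] by measurable

lemma period_eq: "t \<in> {0..<T0} ==> period T0 t = 1" "t \<notin> {0..<T0} ==> period T0 t = 0" "0 <= period T0 t" "period T0 t <= 1"
 by (auto simp: period_def indicator_def)

definition slice_density :: "real => (real => 'a => real) => ('a::finite * real) measure" where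
 "slice_density T0 m = density SpV (%p. ennreal (m (snd p) (fst p)) * indicator {0..<T0} (snd p))"

lemma slice_density_alt:
 "slice_density T0 m = density SpV (%p. ennreal (period T0 (snd p) * m (snd p) (fst p)))"
 unfolding slice_density_def period_def by (rule arg_cong[where f = "density SpV"]) (auto simp: indicator_def)

abbreviation circ_int :: "real => (real => real) => real" where
 "circ_int T0 h \<equiv> \<integral>t. period T0 t * h t \<partial>lborel"

abbreviation circ_integrable :: "real => (real => real) => bool" where
 "circ_integrable T0 h \<equiv> integrable lborel (%t. period T0 t * h t)"

lemma itg_integrable:
 fixes f :: "'a::finite tfun"
 assumes nu: "circle_measure T0 nu" and f: "\<And>y. bdd_borel (f y)"
 shows "integrable nu (%p. f (fst p) (snd p))"
proof -
 obtain K where "K >= 0" "\<And>y t. abs (f y t) <= K" using that by (rule bdd_borel_family_bound[of f, OF f])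
 thus ?thesis by (intro circle_integrable_bounded[OF nu SpV_measurable[OF bdd_borel_measurable[OF f]]])
qed

lemma itg_diff:
 fixes f :: "'a::finite tfun"
 assumes "circle_measure T0 nu" "\<And>y. bdd_borel (f y)" "\<And>y. bdd_borel (g y)"
 shows "itg nu (%y t. f y t - g y t) = itg nu f - itg nu g"
 using assms by (intro Bochner_Integration.integral_diff itg_integrable)

definition has_slices :: "real => ('a::finite * real) measure => (real => 'a => real) => bool" where
 "has_slices T0 nu m \<longleftrightarrow> circle_measure T0 nu \<and> (%p. m (snd p) (fst p)) \<in> borel_measurable SpV \<and> (\<forall>t y. 0 <= m t y) \<and>
  nu = slice_density T0 m"

lemma has_slicesD:
 assumes "has_slices T0 nu m"
 shows "circle_measure T0 nu" "(%p. m (snd p) (fst p)) \<in> borel_measurable SpV" "0 <= m t y" "nu = slice_density T0 m"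
 using assms unfolding has_slices_def by auto

lemma has_slices_measurable: "has_slices T0 nu m ==> (%t. m t y) \<in> borel_measurable borel"
 using SpV_slice_measurable[of "%y t. m t y"] has_slicesD(2) by blast

context
 fixes T0 :: real and nu :: "('a::finite * real) measure" and m :: "real => 'a => real"
 assumes m: "has_slices T0 nu m"
begin

lemma slice_integral:
 assumes f: "\<And>y. bdd_borel (f y)"
 shows "circ_integrable T0 (%t. m t y * f y t)" "itg nu f = circ_int T0 (%t. \<Sum>y\<in>UNIV. m t y * f y t)"
proof -
 note m = has_slicesD[OF m]
 let ?g = "%p. period T0 (snd p) * m (snd p) (fst p)"
 have g: "?g \<in> borel_measurable SpV" using m(2) by measurable
 have nonneg: "AE p in SpV. 0 <= ?g p" using m(3) by (auto simp: period_eq)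
 have f_meas: "(%p. f (fst p) (snd p)) \<in> borel_measurable SpV" by (rule SpV_measurable[OF bdd_borel_measurable[OF f]])
 have "integrable (slice_density T0 m) (%p. f (fst p) (snd p))"
  using itg_integrable[OF m(1) f] m(4) by simp
 hence i: "integrable SpV (%p. ?g p * f (fst p) (snd p))"
  unfolding slice_density_alt using integrable_density[OF f_meas g nonneg] by simp
 thus int: "circ_integrable T0 (%t. m t y * f y t)" for y using integral_SpV(1)[OF i, of y] by (simp add: mult.assoc)
 have "itg nu f = (\<Sum>y\<in>UNIV. circ_int T0 (%t. m t y * f y t))"
  unfolding m(4) slice_density_alt using integral_density[OF f_meas g nonneg] integral_SpV(2)[OF i] by (simp add: mult.assoc)
 also have "... = circ_int T0 (%t. \<Sum>y\<in>UNIV. m t y * f y t)"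
  unfolding sum_distrib_left by (rule Bochner_Integration.integral_sum[symmetric]) (rule int)
 finally show "itg nu f = circ_int T0 (%t. \<Sum>y\<in>UNIV. m t y * f y t)" .
qed

lemma slice_integrable: "bdd_borel h ==> circ_integrable T0 (%t. m t y * h t)"
 using slice_integral(1)[of "%_. h"] .

lemma slice_integrable_sum:
 assumes "\<And>y. bdd_borel (f y)" shows "circ_integrable T0 (%t. \<Sum>y\<in>A. m t y * f y t)"
 unfolding sum_distrib_left using assms by (intro Bochner_Integration.integrable_sum slice_integrable)

lemma slice_integral_on:
 assumes E: "AE p in nu. fst p \<in> A" and f: "\<And>y. bdd_borel (f y)"
 shows "itg nu f = circ_int T0 (%t. \<Sum>y\<in>A. m t y * f y t)"
proof -
 define f' where "f' y t = (if y \<in> A then f y t else 0)" for y t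
 have f': "bdd_borel (f' y)" for y using f by (cases "y \<in> A") (auto simp: f'_def[abs_def])
 note meas = circle_measurable[OF has_slicesD(1)[OF m] SpV_measurable[OF bdd_borel_measurable]]
 have "itg nu f = itg nu f'"
  using E meas[of f, OF f] meas[of f', OF f'] by (intro integral_cong_AE) (auto simp: f'_def)
 also have "... = circ_int T0 (%t. \<Sum>y\<in>UNIV. if y \<in> A then m t y * f y t else 0)"
  by (subst slice_integral(2)[OF f']) (auto simp: f'_def intro!: Bochner_Integration.integral_cong sum.cong)
 finally show ?thesis by (simp add: sum.If_cases)
qed

lemma slice_AE:
 assumes "AE t in lborel. P t" shows "AE p in nu. P (snd p)"
proof -
 obtain N where N: "{t. \<not> P t} \<subseteq> N" "N \<in> null_sets lborel" using assms by (auto elim!: AE_E simp: null_sets_def)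
 have sets: "(UNIV :: 'a set) \<times> N \<in> sets SpV" using N(2) by (intro SpV_times_sets) auto
 have "emeasure SpV ((UNIV :: 'a set) \<times> N) = (\<integral>\<^sup>+p. indicator ((UNIV :: 'a set) \<times> N) p \<partial>SpV)" using sets by simp
 also have "... = (\<Sum>y\<in>(UNIV :: 'a set). \<integral>\<^sup>+t. indicator N t \<partial>lborel)"
  using sets by (subst nn_integral_SpV) (auto simp: indicator_times)
 also have "... = 0" using N(2) by (simp add: null_sets_def)
 finally have "(UNIV :: 'a set) \<times> N \<in> null_sets SpV" using sets by blast
 hence "AE p in (SpV :: ('a * real) measure). P (snd p)" by (rule AE_I') (use N(1) in auto)
 moreover have "(%p. ennreal (m (snd p) (fst p)) * indicator {0..<T0} (snd p)) \<in> borel_measurable SpV"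
  using has_slicesD(2)[OF m] by measurable
 ultimately show ?thesis unfolding has_slicesD(4)[OF m] slice_density_def by (subst AE_density) auto
qed

end

lemma Mstar_circle:
 assumes "(mu, Q) \<in> Mstar T0 E"
 shows "circle_measure T0 mu" "circle_measure T0 Q" "AE p in Q. fst p \<in> E" "emeasure mu (space mu) = ennreal T0"
proof -
 have s: "sets mu = sets SpV" "sets Q = sets SpV" and space_Q: "space Q = UNIV"
  using assms sets_eq_imp_space_eq[of Q SpV] by (auto simp: Mstar_def)
 show "circle_measure T0 mu" "emeasure mu (space mu) = ennreal T0" using assms by (auto simp: Mstar_def circle_measure_def)
 have edges_set: "E \<times> {0..<T0} \<in> sets Q" unfolding s by (rule SpV_times_sets) simp
 have n: "space Q - E \<times> {0..<T0} \<in> null_sets Q"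
  using assms edges_set by (auto simp: Mstar_def null_sets_def)
 have "UNIV \<times> {0..<T0} \<in> sets Q" unfolding s by (rule SpV_times_sets) simp
 hence "space Q - UNIV \<times> {0..<T0} \<in> null_sets Q" by (intro null_sets_subset[OF n] sets.compl_sets) (auto simp: space_Q)
 thus "circle_measure T0 Q" using assms by (auto simp: Mstar_def circle_measure_def)
 show "AE p in Q. fst p \<in> E" by (rule AE_I'[OF n]) auto
qed

definition ev :: "('v tfun) => (('v * 'v) tfun) => ('v * real) measure \<times> (('v * 'v) * real) measure => real" where
 "ev f g PQ = itg (fst PQ) f + itg (snd PQ) g"

lemma sum_pairs_E:
 fixes F :: "'v::finite * 'v => real"
 shows "(\<Sum>y\<in>UNIV. \<Sum>z\<in>UNIV. if (y, z) \<in> E then F (y, z) else 0) = (\<Sum>e\<in>E. F e)"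
proof -
 have "(\<Sum>y\<in>UNIV. \<Sum>z\<in>UNIV. if (y, z) \<in> E then F (y, z) else 0) = (\<Sum>e\<in>UNIV. if e \<in> E then F e else 0)"
  by (simp add: sum.cartesian_product)
 thus ?thesis by (simp add: sum.If_cases)
qed

lemma divg_pairing: "(\<Sum>y\<in>UNIV. divg E A y * ph y) = (\<Sum>e\<in>E. A e * (ph (fst e) - ph (snd e)))"
proof -
 have "(\<Sum>y\<in>UNIV. divg E A y * ph y) = (\<Sum>y\<in>UNIV. \<Sum>z\<in>UNIV. if (y, z) \<in> E then A (y, z) * ph y else 0)
   - (\<Sum>y\<in>UNIV. \<Sum>z\<in>UNIV. if (z, y) \<in> E then A (z, y) * ph y else 0)"
  unfolding divg_def left_diff_distrib sum_subtractf sum_distrib_right by (intro arg_cong2[where f = "(-)"] sum.cong) auto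
 also have "(\<Sum>y\<in>UNIV. \<Sum>z\<in>UNIV. if (z, y) \<in> E then A (z, y) * ph y else 0)
   = (\<Sum>z\<in>UNIV. \<Sum>y\<in>UNIV. if (z, y) \<in> E then A (z, y) * ph y else 0)" by (rule sum.swap)
 finally show ?thesis
  using sum_pairs_E[of E "%e. A e * ph (fst e)"] sum_pairs_E[of E "%e. A e * ph (snd e)"]
  by (simp only: right_diff_distrib sum_subtractf fst_conv snd_conv)
qed

lemma young:
 assumes "0 <= q" "0 <= p" shows "ennreal (q * G - p * (exp G - 1)) <= Phi q p"
proof (cases "q = 0")
 case True
 have "- (p * (exp G - 1)) <= p" using assms by (simp add: algebra_simps)
 thus ?thesis using True by (simp add: Phi_def ennreal_leI)
next
 case False
 show ?thesis
 proof (cases "p = 0")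
  case True
  thus ?thesis using False by (simp add: Phi_def)
 next
  case p_nonzero: False
  have pos: "q > 0" "p > 0" using assms False p_nonzero by auto
  have "1 + (G - ln (q / p)) <= exp (G - ln (q / p))" by (rule exp_ge_add_one_self)
  also have "... = p * exp G / q" using pos by (simp add: exp_diff)
  finally have "q * (1 + (G - ln (q / p))) <= p * exp G" using pos by (simp add: pos_le_divide_eq mult.commute)
  hence "q * G - p * (exp G - 1) <= q * ln (q / p) - (q - p)" by (simp add: algebra_simps)
  thus ?thesis using False p_nonzero by (simp add: Phi_def ennreal_leI)
 qed
qed

lemma integral_le_nn_integral:
 assumes "integrable M f" "\<And>x. x \<in> space M ==> ennreal (f x) <= F x"
 shows "ennreal (LINT x|M. f x) <= (\<integral>\<^sup>+x. F x \<partial>M)"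
proof -
 have max_int: "integrable M (%x. max 0 (f x))" using assms(1) by simp
 have "(LINT x|M. f x) <= (LINT x|M. max 0 (f x))" using assms(1) max_int by (intro integral_mono) auto
 hence "ennreal (LINT x|M. f x) <= ennreal (LINT x|M. max 0 (f x))" by (rule ennreal_leI)
 also have "... = (\<integral>\<^sup>+x. ennreal (max 0 (f x)) \<partial>M)" using max_int by (intro nn_integral_eq_integral[symmetric]) auto
 also have "... <= (\<integral>\<^sup>+x. F x \<partial>M)"
  using assms(2) by (intro nn_integral_mono) (auto simp: max_def ennreal_neg)
 finally show ?thesis .
qed

definition steklov :: "real => (real => real) => real => real" where
 "steklov d ph t = integral {t..t + d} ph / d"

lemma steklov_deriv:
 assumes ph: "continuous_on UNIV ph" and d: "d > 0"
 shows "(steklov d ph has_real_derivative (ph (t + d) - ph t) / d) (at t)"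
proof -
 define F where "F x = integral {t - 1..x} ph" for x
 have cont: "continuous_on A ph" for A using continuous_on_subset[OF ph] by blast
 have F: "(F has_real_derivative ph x) (at x)" if x: "t - 1 < x" for x
 proof -
  have "(F has_real_derivative ph x) (at x within {t - 1..x + 1})"
   unfolding F_def[abs_def] using x by (intro integral_has_real_derivative cont) auto
  thus ?thesis using at_within_interior[of x "{t - 1..x + 1}"] x by (simp add: interior_atLeastAtMost_real)
 qed
 have "((%x. (F (x + d) - F x) / d) has_real_derivative (ph (t + d) * 1 - ph t) / d) (at t)"
  using d by (intro DERIV_cdivide DERIV_diff DERIV_chain2[where f = F and g = "%x. x + d"] F derivative_eq_intros) auto
 moreover have "eventually (%x. steklov d ph x = (F (x + d) - F x) / d) (nhds t)"
 proof (rule eventually_mono[OF eventually_nhds_in_open[of "{t - 1<..}"]])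
  fix x assume "x \<in> {t - 1<..}"
  hence "integral {t - 1..x} ph + integral {x..x + d} ph = integral {t - 1..x + d} ph"
   using d by (intro Henstock_Kurzweil_Integration.integral_combine integrable_continuous_real cont) auto
  thus "steklov d ph x = (F (x + d) - F x) / d" by (simp add: steklov_def F_def)
 qed auto
 ultimately show ?thesis by (subst DERIV_cong_ev[OF refl _ refl]) auto
qed

lemma steklov_C1:
 assumes ph: "continuous_on UNIV ph" "\<And>t. ph (t + T0) = ph t" and d: "d > 0"
 shows "steklov d ph C1_differentiable_on UNIV" "steklov d ph (t + T0) = steklov d ph t"
proof -
 show "steklov d ph C1_differentiable_on UNIV"
  unfolding C1_differentiable_on_def
  using steklov_deriv[OF ph(1) d] d
  by (intro exI[of _ "%t. (ph (t + d) - ph t) / d"])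
   (auto simp: has_real_derivative_iff_has_vector_derivative intro!: continuous_intros continuous_on_compose2[OF ph(1)])
 have "integral {t..t + d} (%t. ph (t + T0)) = integral {t + T0..t + d + T0} ph" by (rule integral_shift_real)
 thus "steklov d ph (t + T0) = steklov d ph t"
  unfolding steklov_def using ph(2) by (simp add: add_ac)
qed

lemma mean_tendsto:
 assumes k: "bdd_borel k" and c: "isCont k t"
 shows "(%n. integral {t..t + 1 / real (Suc n)} k / (1 / real (Suc n))) \<longlonglongrightarrow> k t"
proof -
 have "((%u. integral {t..u} k) has_vector_derivative k t) (at t within {t..t + 1})"
  using bdd_borel_integrable[OF k] c
  by (intro integral_has_vector_derivative_continuous_at[where S = "{}", simplified]) (auto intro: continuous_at_imp_continuous_within)
 hence "((%u. (integral {t..u} k - integral {t..t} k) / (u - t)) \<longlongrightarrow> k t) (at t within {t..t + 1})"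
  by (simp only: has_real_derivative_iff_has_vector_derivative[symmetric] has_field_derivative_iff)
 moreover have "filterlim (%n. t + 1 / real (Suc n)) (at t within {t..t + 1}) sequentially"
  using tendsto_add[OF tendsto_const LIMSEQ_inverse_real_of_nat, of t]
  by (auto simp: filterlim_at inverse_eq_divide field_simps)
 ultimately have "(%n. (integral {t..t + 1 / real (Suc n)} k - integral {t..t} k) / (t + 1 / real (Suc n) - t)) \<longlonglongrightarrow> k t"
  by (rule filterlim_compose)
 thus ?thesis by simp
qed

lemma abs_steklov_le:
 assumes k: "bdd_borel k" "\<And>t. abs (k t) <= K" and d: "d > 0" shows "abs (steklov d k t) <= K"
 using abs_integral_le[OF k(1), of t "t + d" K] k(2) d by (simp add: steklov_def abs_divide divide_le_eq)

lemma steklov_bdd: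
 assumes \<phi>: "continuous_on UNIV \<phi>" "bdd_borel \<phi>" and d: "d > 0" shows "bdd_borel (steklov d \<phi>)"
proof -
 obtain K where K: "\<And>t. abs (\<phi> t) <= K" using bdd_borel_bound[OF \<phi>(2)] by blast
 have "continuous_on UNIV (steklov d \<phi>)"
  using steklov_deriv[OF \<phi>(1) d] by (meson DERIV_continuous continuous_at_imp_continuous_on)
 thus ?thesis using abs_steklov_le[OF \<phi>(2) K d] by (intro bdd_borelI borel_measurable_continuous_onI)
qed

lemma steklov_deriv_indef:
 assumes \<phi>: "continuous_on UNIV \<phi>" "\<And>a b. indef a b \<phi> k" and k: "bdd_borel k" and d: "d > 0"
 shows "deriv (steklov d \<phi>) = (%s. - steklov d k s)" "bdd_borel (deriv (steklov d \<phi>))"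
proof -
 have deriv: "deriv (steklov d \<phi>) s = (\<phi> (s + d) - \<phi> s) / d" for s
  by (rule DERIV_imp_deriv[OF steklov_deriv[OF \<phi>(1) d]])
 show deriv_eq: "deriv (steklov d \<phi>) = (%s. - steklov d k s)"
 proof
  fix s
  have "\<phi> s = \<phi> (s + d) + integral {s..s + d} k" using d by (intro indefD[OF \<phi>(2)]) auto
  hence "\<phi> (s + d) - \<phi> s = - integral {s..s + d} k" by linarith
  thus "deriv (steklov d \<phi>) s = - steklov d k s" unfolding deriv by (simp only: steklov_def minus_divide_left)
 qed
 have "continuous_on UNIV (%s. (\<phi> (s + d) - \<phi> s) / d)"
  using d by (intro continuous_intros continuous_on_compose2[OF \<phi>(1)]) auto
 hence "(%s. deriv (steklov d \<phi>) s) \<in> borel_measurable borel"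
  unfolding deriv by (rule borel_measurable_continuous_onI)
 moreover obtain K where "\<And>t. abs (k t) <= K" using bdd_borel_bound[OF k] by blast
 ultimately show "bdd_borel (deriv (steklov d \<phi>))"
  using abs_steklov_le[OF k _ d] by (intro bdd_borelI[where K = K]) (auto simp: deriv_eq)
qed

lemma LINT_period:
 fixes f :: "real => real"
 assumes "f \<in> borel_measurable borel"
 shows "(LINT s:{0..T0}|lborel. f s) = (LINT s|lborel. period T0 s * f s)"
 unfolding set_lebesgue_integral_def
proof (rule integral_cong_AE)
 have "AE s in lborel. s \<noteq> T0" by (rule AE_lborel_singleton)
 thus "AE s in lborel. indicator {0..T0} s *\<^sub>R f s = period T0 s * f s"
  by eventually_elim (auto simp: period_def indicator_def)
qed (use assms in auto)

lemma indef_continuous: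
 assumes "\<And>a b. indef a b h k" "bdd_borel k" shows "continuous_on UNIV h"
proof -
 obtain K where K: "K >= 0" "\<And>t. abs (k t) <= K" using assms(2) by (metis bdd_borel_bound)
 have "dist (h s) (h t) <= K * dist s t" for s t
  using indef_lipschitz[OF assms(1) assms(2) K(2), of t "min s t" "max s t" s] by (simp add: dist_real_def)
 thus ?thesis using K by (intro lipschitz_on_continuous_on[of K] lipschitz_onI) auto
qed

lemma ennreal_sum_le: "ennreal (\<Sum>i\<in>I. a i) <= (\<Sum>i\<in>I. ennreal (a i))"
proof -
 have "ennreal (\<Sum>i\<in>I. a i) <= ennreal (\<Sum>i\<in>I. max 0 (a i))" by (intro ennreal_leI sum_mono) auto
 also have "... = (\<Sum>i\<in>I. ennreal (max 0 (a i)))" by (rule sum_ennreal[symmetric]) auto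
 also have "... = (\<Sum>i\<in>I. ennreal (a i))" by (intro sum.cong) (auto simp: max_def ennreal_neg)
 finally show ?thesis .
qed

lemma Lambda_witD:
 assumes "Lambda_wit T0 E mu Q m q"
 shows "(%p. m (snd p) (fst p)) \<in> borel_measurable SpV" "\<And>t y. 0 <= m t y"
  "(%p. q (snd p) (fst p)) \<in> borel_measurable SpV" "\<And>t e. 0 <= q t e"
  "mu = slice_density T0 m" "Q = slice_density T0 q" "AE t in lborel. t \<in> {0..<T0} --> (\<Sum>y\<in>UNIV. m t y) = 1"
  "AE t in lborel. t \<in> {0..<T0} --> (\<forall>y z. (y, z) \<in> E --> m t y = 0 --> q t (y, z) = 0)"
 using assms unfolding Lambda_wit_def slice_density_def by blast+

lemma Lambda_wit_weak:
 assumes "Lambda_wit T0 E mu Q m q" "\<And>y. f y C1_differentiable_on UNIV" "\<And>y t. f y (t + T0) = f y t"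
 shows "(LINT s:{0..T0}|lborel. \<Sum>y\<in>UNIV. m s y * deriv (f y) s) = (LINT s:{0..T0}|lborel. \<Sum>y\<in>UNIV. divg E (q s) y * f y s)"
 using assms unfolding Lambda_wit_def by blast

lemma Lambda_wit_slices:
 assumes "(mu, Q) \<in> Mstar T0 E" "Lambda_wit T0 E mu Q m q"
 shows "has_slices T0 mu m" "has_slices T0 Q q"
 using Mstar_circle(1,2)[OF assms(1)] Lambda_witD[OF assms(2)] unfolding has_slices_def by auto

lemma Mstar_measure:
 fixes mu :: "('v::finite * real) measure"
 shows "(mu, Q) \<in> Mstar T0 E ==> 0 <= T0 ==> measure mu (space mu) = T0"
 using Mstar_circle(4)[of mu Q T0 E] by (simp add: measure_def)

lemma itg_steklov_tendsto:
 fixes nu :: "('a::finite * real) measure" and f :: "'b::finite tfun"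
 assumes nu: "circle_measure T0 nu" and f: "\<And>y. bdd_borel (f y)" "\<And>n y. steklov (1 / real (Suc n)) (f y) \<in> borel_measurable borel"
  and cont: "AE p in nu. isCont (f (i (fst p))) (snd p)"
 shows "(%n. itg nu (%y s. steklov (1 / real (Suc n)) (f (i y)) s)) \<longlonglongrightarrow> itg nu (%y. f (i y))"
proof -
 obtain K where K: "K >= 0" "\<And>y t. abs (f y t) <= K" using that by (rule bdd_borel_family_bound[of f, OF f(1)])
 interpret finite_measure nu by (rule circle_measureD(1)[OF nu])
 show ?thesis
 proof (rule integral_dominated_convergence[where w = "%_. K"])
  show "AE p in nu. (%n. steklov (1 / real (Suc n)) (f (i (fst p))) (snd p)) \<longlonglongrightarrow> f (i (fst p)) (snd p)"
   using cont unfolding steklov_def by eventually_elim (rule mean_tendsto[OF f(1)])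
  show "AE p in nu. norm (steklov (1 / real (Suc n)) (f (i (fst p))) (snd p)) <= K" for n
   using abs_steklov_le[OF f(1) K(2)] by (intro AE_I2) simp
  show "(%p. f (i (fst p)) (snd p)) \<in> borel_measurable nu"
   by (rule circle_measurable[OF nu SpV_measurable[where f = "%y. f (i y)"]]) (rule bdd_borel_measurable[OF f(1)])
  show "(%p. steklov (1 / real (Suc n)) (f (i (fst p))) (snd p)) \<in> borel_measurable nu" for n
   by (rule circle_measurable[OF nu SpV_measurable[where f = "%y. steklov _ (f (i y))"]]) (rule f(2))
 qed simp
qed

context
 fixes T0 :: real and E :: "('v::finite * 'v) set" and mu :: "('v * real) measure" and Q :: "(('v * 'v) * real) measure" and m q
 assumes PQ: "(mu, Q) \<in> Mstar T0 E" and wit: "Lambda_wit T0 E mu Q m q"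
begin

lemma continuity_equation_steklov:
 assumes \<phi>: "\<And>y. continuous_on UNIV (\<phi> y)" "\<And>y. bdd_borel (\<phi> y)" "\<And>y t. \<phi> y (t + T0) = \<phi> y t"
  and k: "\<And>y. bdd_borel (k y)" "\<And>y a b. indef a b (\<phi> y) (k y)" and d: "d > 0"
 shows "itg mu (%y s. - steklov d (k y) s) = itg Q (%e s. steklov d (\<phi> (fst e)) s - steklov d (\<phi> (snd e)) s)"
proof -
 note slices = Lambda_wit_slices[OF PQ wit]
 have deriv: "deriv (steklov d (\<phi> y)) = (%s. - steklov d (k y) s)" "bdd_borel (deriv (steklov d (\<phi> y)))" for y
  by (rule steklov_deriv_indef[OF \<phi>(1) k(2,1) d])+
 have "itg mu (%y. deriv (steklov d (\<phi> y))) = circ_int T0 (%s. \<Sum>y\<in>UNIV. m s y * deriv (steklov d (\<phi> y)) s)"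
  by (rule slice_integral(2)[OF slices(1) deriv(2)])
 also have "... = (LINT s:{0..T0}|lborel. \<Sum>y\<in>UNIV. m s y * deriv (steklov d (\<phi> y)) s)"
  using has_slices_measurable[OF slices(1)] bdd_borel_measurable[OF deriv(2)]
  by (intro LINT_period[symmetric] borel_measurable_sum borel_measurable_times)
 also have "... = (LINT s:{0..T0}|lborel. \<Sum>e\<in>E. q s e * (steklov d (\<phi> (fst e)) s - steklov d (\<phi> (snd e)) s))"
  using Lambda_wit_weak[OF wit, of "%y. steklov d (\<phi> y)"] steklov_C1[OF \<phi>(1,3) d] by (simp add: divg_pairing)
 also have "... = circ_int T0 (%s. \<Sum>e\<in>E. q s e * (steklov d (\<phi> (fst e)) s - steklov d (\<phi> (snd e)) s))"
  using has_slices_measurable[OF slices(2)] bdd_borel_measurable[OF steklov_bdd[OF \<phi>(1,2) d]]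
  by (intro LINT_period borel_measurable_sum borel_measurable_times borel_measurable_diff)
 also have "... = itg Q (%e s. steklov d (\<phi> (fst e)) s - steklov d (\<phi> (snd e)) s)"
  by (rule slice_integral_on[OF slices(2) Mstar_circle(3)[OF PQ], symmetric])
   (intro bdd_borel_diff steklov_bdd \<phi> d)
 finally show ?thesis unfolding deriv .
qed

lemma continuity_equation_indef:
 assumes \<phi>: "\<And>y. continuous_on UNIV (\<phi> y)" "\<And>y. bdd_borel (\<phi> y)" "\<And>y t. \<phi> y (t + T0) = \<phi> y t"
  and k: "\<And>y. bdd_borel (k y)" "\<And>y a b. indef a b (\<phi> y) (k y)"
  and cont: "AE t in lborel. t \<in> {0..<T0} --> (\<forall>y. isCont (k y) t)"
 shows "itg mu k = - itg Q (%e t. \<phi> (fst e) t - \<phi> (snd e) t)"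
proof -
 note slices = Lambda_wit_slices[OF PQ wit]
 note circle = has_slicesD(1)[OF slices(1)] has_slicesD(1)[OF slices(2)]
 let ?d = "%n. 1 / real (Suc n)"
 have steklov_k: "steklov (?d n) (k y) \<in> borel_measurable borel" for n y
 proof -
  have "(%s. - deriv (steklov (?d n) (\<phi> y)) s) \<in> borel_measurable borel"
   by (intro borel_measurable_uminus bdd_borel_measurable steklov_deriv_indef(2)[OF \<phi>(1) k(2,1)]) simp
  thus ?thesis by (subst (asm) steklov_deriv_indef(1)[OF \<phi>(1) k(2,1)]) simp_all
 qed
 have "AE p in mu. isCont (k (fst p)) (snd p)"
  using slice_AE[OF slices(1) cont] circle_measureD(4)[OF circle(1)] by eventually_elim auto
 from itg_steklov_tendsto[where i = "%y. y", OF circle(1) k(1) steklov_k this]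
 have "(%n. itg mu (%y s. - steklov (?d n) (k y) s)) \<longlonglongrightarrow> - itg mu k" by (simp add: tendsto_minus)
 moreover have "(%n. itg Q (%e s. steklov (?d n) (\<phi> (fst e)) s - steklov (?d n) (\<phi> (snd e)) s))
   \<longlonglongrightarrow> itg Q (%e t. \<phi> (fst e) t - \<phi> (snd e) t)"
 proof -
  have bdd: "bdd_borel (steklov (?d n) (\<phi> y))" for n y by (rule steklov_bdd[OF \<phi>(1,2)]) simp
  have lim: "(%n. itg Q (%e s. steklov (?d n) (\<phi> (i e)) s)) \<longlonglongrightarrow> itg Q (%e. \<phi> (i e))" for i :: "'v * 'v => 'v"
   using \<phi>(1) by (intro itg_steklov_tendsto[OF circle(2) \<phi>(2) bdd_borel_measurable[OF bdd]] AE_I2)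
    (simp add: continuous_on_eq_continuous_at)
  show ?thesis
   using tendsto_diff[OF lim[of fst] lim[of snd]]
    itg_diff[where f = "%e. steklov (?d _) (\<phi> (fst e))" and g = "%e. steklov (?d _) (\<phi> (snd e))", OF circle(2) bdd bdd]
    itg_diff[where f = "%e. \<phi> (fst e)" and g = "%e. \<phi> (snd e)", OF circle(2) \<phi>(2,2)] by (simp only:)
 qed
 moreover have "itg mu (%y s. - steklov (?d n) (k y) s) = itg Q (%e s. steklov (?d n) (\<phi> (fst e)) s - steklov (?d n) (\<phi> (snd e)) s)" for n
  by (rule continuity_equation_steklov[OF \<phi> k]) simp
 ultimately show ?thesis using LIMSEQ_unique by fastforce
qed

end

context periodic_rates
begin

lemma cont_per_test_pair:
 fixes f :: "'v tfun"
 assumes f: "cont_per T0 f" and g: "cont_per T0 g" obtains L where "test_pair L f g"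
proof -
 obtain K1 where K1: "K1 >= 0" "\<And>y t. abs (f y t) <= K1" using that by (rule cont_per_bounded[OF f T0])
 obtain K2 where K2: "K2 >= 0" "\<And>e t. abs (g e t) <= K2" using that by (rule cont_per_bounded[OF g T0])
 have "test_pair (max K1 K2) f g"
  unfolding test_pair_def using cont_perD[OF f] cont_perD[OF g] K1 K2
  by (auto simp: le_max_iff_disj intro!: borel_measurable_continuous_onI)
 thus ?thesis by (rule that)
qed

definition twisted :: "('v * 'v) tfun => 'v tfun => ('v * 'v) tfun" where
 "twisted g \<phi> e t = g e t - (\<phi> (fst e) t - \<phi> (snd e) t)"

definition log_slope :: "'v tfun => ('v * 'v) tfun => 'v tfun => 'v tfun" where
 "log_slope f g \<phi> y u = (\<Sum>z\<in>UNIV. R y z u * (exp (twisted g \<phi> (y, z) u) - 1)) + f y u"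

lemma log_slope_bdd:
 assumes "\<And>y. bdd_borel (f y)" "\<And>e. bdd_borel (g e)" "\<And>y. bdd_borel (\<phi> y)" shows "bdd_borel (log_slope f g \<phi> y)"
 unfolding log_slope_def[abs_def] twisted_def using assms R_bdd by (intro bdd_borel_intros)

lemma bw_exp: "bw f g (%y t. exp (\<phi> y t)) y u = exp (\<phi> y u) * log_slope f g \<phi> y u"
proof -
 have "R y z u * (exp (g (y, z) u) * exp (\<phi> z u) - exp (\<phi> y u)) = exp (\<phi> y u) * (R y z u * (exp (twisted g \<phi> (y, z) u) - 1))" for z
  by (simp add: twisted_def exp_add exp_diff field_simps)
 thus ?thesis by (simp only: bw_def log_slope_def distrib_left sum_distrib_left mult.commute[of "f y u"])
qed

lemma eigenfun_log:
 assumes tp: "test_pair L f g" and h: "eigenfun f g l k1 k2 h"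
 defines "\<phi> \<equiv> %y t. ln (h y t)"
 shows "bdd_borel (\<phi> y)" "\<phi> y (t + T0) = \<phi> y t" "indef a b (\<phi> y) (log_slope (%y u. f y u - l / T0) g \<phi> y)"
  "continuous_on UNIV (\<phi> y)"
proof -
 note ef = eigenfunD[OF h]
 let ?f = "%y u. f y u - l / T0"
 have bw: "bdd_borel (bw ?f g h y)" for y using test_pair_bdd[OF tp] ef(2) by (intro bw_bdd bdd_borel_intros)
 have exp_\<phi>: "(%y t. exp (\<phi> y t)) = h" unfolding \<phi>_def using ef(7) by (intro ext) simp
 show \<phi>: "bdd_borel (\<phi> y)" for y unfolding \<phi>_def by (rule bdd_borel_ln[OF ef(2,1,3)])
 show "\<phi> y (t + T0) = \<phi> y t" by (simp add: \<phi>_def ef(5))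
 have "bw ?f g h y u / h y u = log_slope ?f g \<phi> y u" for y u
  using bw_exp[of ?f g \<phi> y u] ef(7)[of y u] unfolding exp_\<phi> by (simp add: \<phi>_def)
 thus indef: "indef a b (\<phi> y) (log_slope ?f g \<phi> y)" for y a b
  using indef_ln[OF ef(6) bw ef(2,1,3), of a b y] by (simp add: \<phi>_def)
 show "continuous_on UNIV (\<phi> y)"
  using test_pair_bdd[OF tp] \<phi> by (intro indef_continuous[OF indef] log_slope_bdd bdd_borel_intros)
qed

lemma log_slope_cont:
 assumes "\<And>y z. isCont (R y z) t" "\<And>y. isCont (f y) t" "\<And>e. isCont (g e) t" "\<And>y. isCont (\<phi> y) t"
 shows "isCont (log_slope f g \<phi> y) t"
 unfolding log_slope_def[abs_def] twisted_def by (intro continuous_intros assms)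

lemma sum_flow_log_slope:
 "(\<Sum>y\<in>UNIV. m y * (f y u - log_slope f g \<phi> y u)) = - (\<Sum>e\<in>E. m (fst e) * R (fst e) (snd e) u * (exp (twisted g \<phi> e u) - 1))"
proof -
 have "(\<Sum>e\<in>E. m (fst e) * R (fst e) (snd e) u * (exp (twisted g \<phi> e u) - 1))
   = (\<Sum>y\<in>UNIV. \<Sum>z\<in>UNIV. m y * (R y z u * (exp (twisted g \<phi> (y, z) u) - 1)))"
  unfolding sum_pairs_E[of E, symmetric] by (intro sum.cong refl) (auto simp: R_off)
 thus ?thesis by (simp add: log_slope_def sum_distrib_left sum_negf)
qed

end

context periodic_chain
begin

theorem conj_le_rate:
 assumes ae: "AE t in lborel. t \<in> {0..<T0} --> (\<forall>y z. isCont (R y z) t)"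
  and PQ: "(mu, Q) \<in> Mstar T0 E" and wit: "Lambda_wit T0 E mu Q m q" and f: "cont_per T0 f" and g: "cont_per T0 g"
 shows "ennreal (ev f g (mu, Q) - lam f g) <= rate_int R T0 E m q"
proof -
 note slices = Lambda_wit_slices[OF PQ wit]
 note circle = has_slicesD(1)[OF slices(1)] has_slicesD(1)[OF slices(2)]
 obtain L where tp: "test_pair L f g" using that by (rule cont_per_test_pair[OF f g])
 obtain k1 k2 h where h: "eigenfun f g (lam f g) k1 k2 h" using perron[of L] tp by metis
 let ?f = "%y u. f y u - lam f g / T0"
 define \<phi> where "\<phi> y t = ln (h y t)" for y t
 note \<phi> = eigenfun_log[OF tp h, folded \<phi>_def]
 note bdd = test_pair_bdd[OF tp]
 have f_bdd: "bdd_borel (?f y)" for y using bdd by (intro bdd_borel_intros)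
 have slope: "bdd_borel (log_slope ?f g \<phi> y)" for y using f_bdd bdd \<phi> by (intro log_slope_bdd)
 have twist: "bdd_borel (twisted g \<phi> e)" for e unfolding twisted_def[abs_def] using bdd \<phi> by (intro bdd_borel_intros)
 have "AE t in lborel. t \<in> {0..<T0} --> (\<forall>y. isCont (log_slope ?f g \<phi> y) t)"
  using ae
 proof eventually_elim
  case (elim t)
  thus ?case using cont_perD(1)[OF f] cont_perD(1)[OF g] \<phi>(4)
   by (auto intro!: log_slope_cont continuous_intros simp: continuous_on_eq_continuous_at)
 qed
 from continuity_equation_indef[OF PQ wit \<phi>(4,1,2) slope \<phi>(3) this]
 have continuity: "itg mu (log_slope ?f g \<phi>) = - itg Q (%e t. \<phi> (fst e) t - \<phi> (snd e) t)" .
 note diff = bdd_borel_diff[OF f_bdd slope]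
 note mu_int = slice_integral(2)[where f = "%y t. ?f y t - log_slope ?f g \<phi> y t", OF slices(1) diff, unfolded sum_flow_log_slope[where f = ?f]]
  slice_integrable_sum[where A = UNIV and f = "%y t. ?f y t - log_slope ?f g \<phi> y t", OF slices(1) diff, unfolded sum_flow_log_slope[where f = ?f]]
 note Q_int = slice_integral_on[where f = "twisted g \<phi>", OF slices(2) Mstar_circle(3)[OF PQ] twist]
  slice_integrable_sum[where A = E and f = "twisted g \<phi>", OF slices(2) twist]
 define X where "X t = (\<Sum>e\<in>E. q t e * twisted g \<phi> e t - m t (fst e) * R (fst e) (snd e) t * (exp (twisted g \<phi> e t) - 1))" for t
 have "ev f g (mu, Q) - lam f g = itg mu ?f + itg Q g"
  using itg_diff[where f = f and g = "%_ _. lam f g / T0", OF circle(1) bdd(1) bdd_borel_const] Mstar_measure[OF PQ] T0 by (simp add: ev_def)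
 also have "... = itg mu (%y t. ?f y t - log_slope ?f g \<phi> y t) + itg Q (twisted g \<phi>)"
  using continuity itg_diff[where f = ?f and g = "log_slope ?f g \<phi>", OF circle(1) f_bdd slope]
   itg_diff[where f = g and g = "%e t. \<phi> (fst e) t - \<phi> (snd e) t", OF circle(2) bdd(2) bdd_borel_diff[OF \<phi>(1,1)]]
  unfolding twisted_def by linarith
 also have "... = circ_int T0 X"
  unfolding X_def sum_subtractf mu_int(1) Q_int(1)
  by (subst Bochner_Integration.integral_add[OF mu_int(2) Q_int(2), symmetric])
   (simp add: right_diff_distrib[symmetric])
 finally have ev: "ev f g (mu, Q) - lam f g = circ_int T0 X" .
 have X: "circ_integrable T0 X"
  unfolding X_def sum_subtractf right_diff_distrib[of "period T0 t" for t]
  using mu_int(2) by (intro Bochner_Integration.integrable_diff[OF Q_int(2)]) simp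
 show ?thesis
  unfolding ev rate_int_def
 proof (rule integral_le_nn_integral[OF X])
  fix t
  have "ennreal (X t) <= (\<Sum>e\<in>E. Phi (q t e) (m t (fst e) * R (fst e) (snd e) t))"
   unfolding X_def using has_slicesD(3)[OF slices(1)] has_slicesD(3)[OF slices(2)] R_nonneg
   by (intro order_trans[OF ennreal_sum_le] sum_mono young) auto
  thus "ennreal (period T0 t * X t) <= indicator {0..<T0} t * (\<Sum>e\<in>E. Phi (q t e) (m t (fst e) * R (fst e) (snd e) t))"
   by (cases "t \<in> {0..<T0}") (simp_all add: period_eq)
 qed
qed

end

section \<open>The conjugate of the eigenvalue dominates the rate function\<close>

lemma slice_density_circle:
 fixes m :: "real => 'a::finite => real"
 assumes m: "(%p. m (snd p) (fst p)) \<in> borel_measurable SpV" "\<And>t y. 0 <= m t y" and i: "\<And>y. integrable lborel (%t. period T0 t * m t y)"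
 shows "circle_measure T0 (slice_density T0 m)"
proof -
 let ?g = "%p. ennreal (period T0 (snd p) * m (snd p) (fst p))"
 have g: "?g \<in> borel_measurable SpV" using m(1) by measurable
 have s: "sets (slice_density T0 m) = sets SpV" "space (slice_density T0 m) = UNIV" unfolding slice_density_alt by auto
 have "emeasure (slice_density T0 m) UNIV = (\<integral>\<^sup>+p. ?g p \<partial>SpV)"
  unfolding slice_density_alt by (subst emeasure_density[OF g SpV_sets(1)]) simp
 also have "... = (\<Sum>y\<in>UNIV. \<integral>\<^sup>+t. ennreal (period T0 t * m t y) \<partial>lborel)"
  using nn_integral_SpV[OF g] by simp
 also have "... < \<infinity>"
  using i m(2) by (subst nn_integral_eq_integral) (auto simp: period_eq sum_ennreal)
 finally have finite_total: "emeasure (slice_density T0 m) UNIV < \<infinity>" .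
 have "emeasure (slice_density T0 m) (UNIV - UNIV \<times> {0..<T0}) = (\<integral>\<^sup>+p. ?g p * indicator (UNIV - UNIV \<times> {0..<T0}) p \<partial>SpV)"
  unfolding slice_density_alt by (rule emeasure_density[OF g SpV_sets(2)])
 also have "... = (\<integral>\<^sup>+p. 0 \<partial>(SpV :: ('a * real) measure))"
  by (intro nn_integral_cong) (auto simp: period_def indicator_def)
 finally show ?thesis using s finite_total by (simp add: circle_measure_def)
qed

lemma slice_density_exists:
 fixes nu :: "('a::finite * real) measure"
 assumes nu: "circle_measure T0 nu" and ac: "\<And>N. N \<in> null_sets SpV ==> N \<in> null_sets nu"
 obtains m where "(%p. m (snd p) (fst p)) \<in> borel_measurable SpV" "\<And>t y. 0 <= m t y" "nu = slice_density T0 m"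
proof -
 interpret pair_sigma_finite "count_space (UNIV :: 'a set)" lborel
  by (intro pair_sigma_finite.intro lborel.sigma_finite_measure_axioms sigma_finite_measure_count_space_finite) auto
 interpret sigma_finite_measure "SpV :: ('a * real) measure" by (rule sigma_finite_measure_axioms)
 note circle = circle_measureD[OF nu]
 have "absolutely_continuous SpV nu" using ac unfolding absolutely_continuous_def by blast
 then obtain F where F: "F \<in> borel_measurable SpV" "density SpV F = nu" using Radon_Nikodym circle(2) by metis
 have "(\<integral>\<^sup>+p. F p \<partial>SpV) = emeasure (density SpV F) UNIV"
  using emeasure_density[OF F(1) SpV_sets(1)] by simp
 also have "... < \<infinity>" using nu circle(3) F(2) by (simp add: circle_measure_def)
 finally have finite_ae: "AE p in SpV. F p \<noteq> \<infinity>" using F(1) by (intro nn_integral_PInf_AE) auto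
 let ?A = "UNIV - UNIV \<times> {0..<T0} :: ('a * real) set"
 note A = SpV_sets(2)[where 'a = 'a, of T0]
 have "(\<integral>\<^sup>+p. F p * indicator ?A p \<partial>SpV) = emeasure (density SpV F) ?A"
  by (rule emeasure_density[OF F(1) A, symmetric])
 also have "... = 0" using nu circle(3) F(2) by (simp add: circle_measure_def)
 finally have outside_ae: "AE p in SpV. F p * indicator ?A p = 0"
  using F(1) A by (subst (asm) nn_integral_0_iff_AE) auto
 define m where "m t y = enn2real (F (y, t))" for t y
 have m_meas: "(%p. m (snd p) (fst p)) \<in> borel_measurable SpV" unfolding m_def using F(1) by simp
 have "slice_density T0 m = density SpV F"
  unfolding slice_density_def
 proof (rule density_cong)
  show "AE p in SpV. ennreal (m (snd p) (fst p)) * indicator {0..<T0} (snd p) = F p"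
   using finite_ae outside_ae by eventually_elim (auto simp: m_def indicator_def mem_Times_iff less_top split: if_splits)
 qed (use m_meas F(1) in measurable)
 moreover have "\<And>t y. 0 <= m t y" by (simp add: m_def)
 ultimately show ?thesis using that[of m] m_meas F(2) by simp
qed

lemma integral_le_plus_measure:
 fixes f :: "'a::finite * real => real"
 assumes M: "circle_measure T0 M" and N: "circle_measure T0 N" and f: "f \<in> borel_measurable SpV" "\<And>p. abs (f p) <= K"
 shows "circle_measure T0 (plus_measure M N)"
  "(LINT p|M. abs (f p)) <= (LINT p|plus_measure M N. abs (f p))" "(LINT p|N. abs (f p)) <= (LINT p|plus_measure M N. abs (f p))"
proof -
 note circle = circle_measureD[OF M] circle_measureD[OF N]
 have s: "sets N = sets M" using circle by simp
 have A: "UNIV - UNIV \<times> {0..<T0} \<in> sets M" unfolding circle(2) by (rule SpV_sets)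
 show c: "circle_measure T0 (plus_measure M N)"
  using M N A sets.top[of M] plus_measure[OF s] circle unfolding circle_measure_def by (auto simp: ennreal_add_less_top)
 have f': "(%p. abs (f p)) \<in> borel_measurable SpV" using f by measurable
 have part_le: "(LINT p|M'. abs (f p)) <= (LINT p|plus_measure M N. abs (f p))" if M': "circle_measure T0 M'" "M' <= plus_measure M N" for M'
 proof -
  have nn_eq: "ennreal (LINT p|M''. abs (f p)) = (\<integral>\<^sup>+p. abs (f p) \<partial>M'')" if "circle_measure T0 M''" for M'' :: "('a * real) measure"
   using f(2) by (intro nn_integral_eq_integral[symmetric] circle_integrable_bounded[OF that f', of K]) auto
  have "(\<integral>\<^sup>+p. abs (f p) \<partial>M') <= (\<integral>\<^sup>+p. abs (f p) \<partial>plus_measure M N)"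
   using circle_measureD(2)[OF M'(1)] circle_measureD(2)[OF c] M'(2) by (intro nn_integral_mono_measure) auto
  thus ?thesis unfolding nn_eq[OF M'(1), symmetric] nn_eq[OF c, symmetric] by simp
 qed
 show "(LINT p|M. abs (f p)) <= (LINT p|plus_measure M N. abs (f p))" "(LINT p|N. abs (f p)) <= (LINT p|plus_measure M N. abs (f p))"
  using part_le M N plus_measure_ge[OF s] by blast+
qed


lemma eq_0_of_scaling: "(\<And>k::real. k * w <= a) ==> w = 0"
proof (rule ccontr)
 assume bound: "\<And>k. k * w <= a" and "w \<noteq> 0"
 thus False using bound[of "(a + 1) / w"] by simp
qed

lemma circ_int_eq_integral: "bdd_borel k ==> circ_int T0 k = integral {0..T0} k"
 by (simp add: LINT_period[symmetric] bdd_borel_measurable bdd_borel_LINT)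

definition arc_length :: "real => ('a::finite * real) measure" where
 "arc_length T0 = slice_density T0 (%_ _. 1)"

lemma arc_length_slices: "0 <= T0 ==> has_slices T0 (arc_length T0 :: ('a::finite * real) measure) (%_ _. 1)"
 unfolding has_slices_def arc_length_def
 by (auto intro!: slice_density_circle simp: period_def[abs_def] integrable_real_indicator)

lemma itg_arc_length:
 assumes "0 <= T0" "\<And>y. bdd_borel (f y)"
 shows "itg (arc_length T0) f = integral {0..T0} (%t. \<Sum>y\<in>UNIV. f y t)"
 using slice_integral(2)[where f = f, OF arc_length_slices[OF assms(1)] assms(2)] circ_int_eq_integral[OF bdd_borel_sum, of UNIV f T0] assms(2)
 by simp

lemma itg_le_of_close:
 fixes f :: "'a::finite tfun"
 assumes nu: "circle_measure T0 nu" and f: "\<And>y. bdd_borel (f y)" "\<And>y. bdd_borel (u y)"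
 shows "itg nu f <= itg nu u + itg nu (%y t. abs (f y t - u y t))"
proof -
 have "itg nu (%y t. f y t - u y t) <= itg nu (%y t. abs (f y t - u y t))"
  by (intro integral_mono itg_integrable[OF nu, of "%y t. f y t - u y t"] itg_integrable[OF nu, of "%y t. abs (f y t - u y t)"] bdd_borel_intros f) simp
 thus ?thesis using itg_diff[where f = f and g = u, OF nu f] by simp
qed

lemma approx_cont_per2:
 fixes f :: "'a::finite tfun"
 assumes T0: "T0 > 0" and nu: "circle_measure T0 nu1" "circle_measure T0 nu2" and f: "\<And>y. bdd_borel (f y)" "\<And>y t. abs (f y t) <= K" and \<epsilon>: "\<epsilon> > 0"
 obtains u where "cont_per T0 u" "\<And>y t. abs (u y t) <= K" "itg nu1 (%y t. abs (f y t - u y t)) < \<epsilon>" "itg nu2 (%y t. abs (f y t - u y t)) < \<epsilon>"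
proof -
 note meas = SpV_measurable[OF bdd_borel_measurable]
 obtain u where u: "cont_per T0 u" "\<And>y t. abs (u y t) <= K" "(LINT p|plus_measure nu1 nu2. abs (f (fst p) (snd p) - u (fst p) (snd p))) < \<epsilon>"
  using that by (rule approx_cont_per[OF T0 integral_le_plus_measure(1)[OF nu meas[of f, OF f(1)] f(2)] meas[of f, OF f(1)] f(2) \<epsilon>])
 have "(%p. f (fst p) (snd p) - u (fst p) (snd p)) \<in> borel_measurable SpV"
  using f cont_per_bdd[OF u(1) T0] by (intro meas[of "%y t. f y t - u y t"] bdd_borel_diff)
 moreover have "abs (f y t - u y t) <= 2 * K" for y t using u(2)[of y t] f(2)[of y t] by linarith
 ultimately show ?thesis using integral_le_plus_measure(2,3)[OF nu, of "%p. f (fst p) (snd p) - u (fst p) (snd p)" "2 * K"] u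
  by (intro that[OF u(1,2)]) (auto intro: order_le_less_trans)
qed

lemma null_slices_SpV:
 fixes N :: "('a::finite * real) set"
 assumes N: "N \<in> null_sets SpV"
 shows "{t. (y, t) \<in> N} \<in> null_sets lborel"
proof -
 have sets: "N \<in> sets SpV" using N by auto
 have slice: "{t. (y, t) \<in> N} \<in> sets borel" for y using sets_Pair1[OF sets, of y] by (simp add: vimage_def)
 have "emeasure SpV N = (\<integral>\<^sup>+p. indicator N p \<partial>SpV)" using sets by simp
 also have "... = (\<Sum>y\<in>UNIV. \<integral>\<^sup>+t. indicator N (y, t) \<partial>lborel)" using sets by (intro nn_integral_SpV borel_measurable_indicator)
 finally have "(\<integral>\<^sup>+t. indicator N (y, t) \<partial>lborel) = 0" using N by (auto simp: null_sets_def)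
 moreover have "(%t. indicator N (y, t)) = (indicator {t. (y, t) \<in> N} :: real => ennreal)" by (auto simp: indicator_def)
 ultimately show ?thesis using nn_integral_indicator[of "{t. (y, t) \<in> N}" lborel] slice[of y] by (simp add: null_sets_def)
qed

lemma slice_null:
 assumes "has_slices T0 nu m" "N \<in> null_sets SpV" shows "N \<in> null_sets nu"
proof -
 have "(%p. ennreal (period T0 (snd p) * m (snd p) (fst p))) \<in> borel_measurable SpV" using has_slicesD(2)[OF assms(1)] by measurable
 thus ?thesis
  using assms(2) AE_not_in[OF assms(2)] unfolding has_slicesD(4)[OF assms(1)] slice_density_alt
  by (subst null_sets_density_iff) (auto elim!: eventually_mono)
qed

lemma slice_zero_AE:
 fixes mu nu :: "('a::finite * real) measure"
 assumes m: "has_slices T0 mu m" and q: "has_slices T0 nu q" and ac: "\<And>A. A \<in> null_sets mu ==> A \<in> null_sets nu"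
 shows "AE t in lborel. t \<in> {0..<T0} --> (\<forall>y. m t y = 0 --> q t y = 0)"
proof -
 have dens: "(%p. ennreal (period T0 (snd p) * k (snd p) (fst p))) \<in> borel_measurable SpV" if "has_slices T0 la k" for k and la :: "('a * real) measure"
  using has_slicesD(2)[OF that] by measurable
 define A where "A = {p \<in> space SpV. m (snd p) (fst p) = 0}"
 have A: "A \<in> sets SpV" unfolding A_def using has_slicesD(2)[OF m] by measurable
 hence "A \<in> null_sets mu"
  unfolding has_slicesD(4)[OF m] slice_density_alt null_sets_density_iff[OF dens[OF m]] by (auto simp: A_def)
 hence "A \<in> null_sets nu" by (rule ac)
 hence "AE p in SpV. p \<in> A --> ennreal (period T0 (snd p) * q (snd p) (fst p)) = 0"
  unfolding has_slicesD(4)[OF q] slice_density_alt null_sets_density_iff[OF dens[OF q]] by simp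
 then obtain N where N: "{p \<in> space SpV. \<not> (p \<in> A --> ennreal (period T0 (snd p) * q (snd p) (fst p)) = 0)} \<subseteq> N" "N \<in> null_sets SpV"
  by (auto elim!: AE_E simp: null_sets_def)
 have "AE t in lborel. \<forall>y. t \<notin> {t. (y, t) \<in> N}"
  by (rule AE_all_countable[THEN iffD2, OF allI]) (rule AE_not_in[OF null_slices_SpV[OF N(2)]])
 thus ?thesis
 proof eventually_elim
  case (elim t)
  show ?case
  proof (intro impI allI)
   fix y assume t: "t \<in> {0..<T0}" "m t y = 0"
   hence "ennreal (q t y) = 0" using elim[THEN spec, of y] subsetD[OF N(1), of "(y, t)"] by (auto simp: A_def period_eq)
   thus "q t y = 0" using has_slicesD(3)[OF q, of t y] by (simp add: ennreal_eq_0_iff)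
  qed
 qed
qed

definition clipped_log :: "real => real => real => real" where
 "clipped_log k q p = (if q = 0 then - k else if p = 0 then 0 else max (- k) (min k (ln (q / p))))"

definition clipped_Phi :: "real => real => real => real" where
 "clipped_Phi k q p = q * clipped_log k q p - p * (exp (clipped_log k q p) - 1)"

lemma abs_clipped_log: "0 <= k ==> abs (clipped_log k q p) <= k"
 by (auto simp: clipped_log_def)

lemma clipped_Phi_nonneg:
 assumes "0 <= q" "0 <= p" "0 <= k" shows "0 <= clipped_Phi k q p"
proof (cases "q = 0 \<or> p = 0")
 case True
 thus ?thesis using assms by (auto simp: clipped_Phi_def clipped_log_def mult_le_0_iff)
next
 case False
 define G where "G = clipped_log k q p"
 have pos: "0 < q" "0 < p" using False assms by auto
 have "G = max (- k) (min k (ln (q / p)))" using False by (simp add: G_def clipped_log_def)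
 hence "0 <= G \<and> G <= ln (q / p) \<or> G <= 0 \<and> ln (q / p) <= G" using assms(3) by linarith
 hence "p * exp G * G <= q * G"
 proof (elim disjE conjE)
  assume G: "0 <= G" "G <= ln (q / p)"
  have "exp G <= q / p" using G(2) pos by (simp add: ln_ge_iff)
  hence "p * exp G <= q" using pos by (simp add: field_simps)
  thus ?thesis using G(1) by (rule mult_right_mono)
 next
  assume G: "G <= 0" "ln (q / p) <= G"
  have "exp (ln (q / p)) <= exp G" using G(2) by (simp only: exp_le_cancel_iff)
  hence "q / p <= exp G" using pos by simp
  hence "q <= p * exp G" using pos by (simp add: field_simps)
  thus ?thesis using G(1) by (rule mult_right_mono_neg)
 qed
 moreover have "exp G * (1 + (- G)) <= exp G * exp (- G)" by (intro mult_left_mono exp_ge_add_one_self) auto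
 hence "0 <= p * (exp G * G - (exp G - 1))" using assms(2) by (intro mult_nonneg_nonneg) (auto simp: mult_exp_exp algebra_simps)
 ultimately show ?thesis unfolding clipped_Phi_def G_def[symmetric] by (simp add: algebra_simps)
qed

lemma clipped_Phi_tendsto:
 assumes q: "0 <= q" and p: "0 <= p" "q \<noteq> 0 ==> p > 0"
 shows "(%k. ennreal (clipped_Phi (real k) q p)) \<longlonglongrightarrow> Phi q p"
proof (cases "q = 0")
 case True
 have "(%k. - (p * (exp (- real k) - 1))) \<longlonglongrightarrow> - (p * (0 - 1))"
  by (intro tendsto_intros filterlim_compose[OF exp_at_bot] filterlim_compose[OF filterlim_uminus_at_bot_at_top filterlim_real_sequentially])
 thus ?thesis using True by (auto simp: clipped_Phi_def clipped_log_def Phi_def intro!: tendsto_ennrealI)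
next
 case False
 obtain N where N: "abs (ln (q / p)) <= real N" using real_arch_simple by blast
 have "\<forall>\<^sub>F k in sequentially. ennreal (clipped_Phi (real k) q p) = Phi q p"
  using eventually_ge_at_top[of N]
 proof eventually_elim
  case (elim k)
  hence "abs (ln (q / p)) <= real k" using N by linarith
  hence "clipped_log (real k) q p = ln (q / p)" using False p(2) by (auto simp: clipped_log_def)
  thus ?case using False q p by (simp add: clipped_Phi_def Phi_def right_diff_distrib)
 qed
 thus ?thesis by (rule tendsto_eventually)
qed

context periodic_chain
begin

lemma lam_time:
 assumes u: "bdd_borel u" "\<And>t. u (t + T0) = u t"
 shows "lam (%_ t. u t) (%_ _. 0) = integral {0..T0} u"
proof (rule lam_eqI)
 have "path_fun (real n * T0) (%_ t. u t) (%_ _. 0) Y = real n * integral {0..T0} u" for n and Y :: "real => 'v"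
 proof -
  have "integral {0..real n * T0} (along (%_ t. u t) Y) = integral {0..real n * T0} u"
   by (intro Henstock_Kurzweil_Integration.integral_cong) (auto simp: along_eq)
  thus ?thesis using integral_periods[OF u less_imp_le[OF T0]] by (simp add: path_fun_def)
 qed
 hence "part_fun n (%_ t. u t) (%_ _. 0) = exp (real n * integral {0..T0} u)" for n
  unfolding part_fun_def by (simp add: prob_space)
 thus "growth (%_ t. u t) (%_ _. 0) (integral {0..T0} u)" unfolding growth_def by (intro exI[of _ 1] conjI) auto
qed

lemma test_pair_exists:
 assumes f: "\<And>y. bdd_borel (f y)" "\<And>y t. f y (t + T0) = f y t" and g: "cont_per T0 g"
 obtains L where "test_pair L f g"
proof -
 obtain K1 where K1: "K1 >= 0" "\<And>y t. abs (f y t) <= K1" using that by (rule bdd_borel_family_bound[of f, OF f(1)])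
 obtain K2 where K2: "K2 >= 0" "\<And>e t. abs (g e t) <= K2" using that by (rule cont_per_bounded[OF g T0])
 have "test_pair (max K1 K2) f g"
  unfolding test_pair_def using cont_perD[OF g] bdd_borel_measurable[OF f(1)] f(2) K1 K2 by (auto simp: le_max_iff_disj)
 thus ?thesis by (rule that)
qed

lemma lam_lipschitz:
 assumes u: "test_pair L u g" and f: "test_pair L' f g"
 shows "lam u g <= lam f g + integral {0..T0} (%t. \<Sum>y\<in>UNIV. abs (f y t - u y t))"
proof -
 obtain K where K: "\<And>n. n >= 1 ==> part_fun n f g <= K * exp (real n * lam f g)"
  using test_pair_lam(1)[OF f] unfolding growth_def by blast
 define w where "w t = (\<Sum>y\<in>UNIV. abs (f y t - u y t))" for t
 have w: "bdd_borel w" unfolding w_def[abs_def] using test_pair_bdd(1)[OF u] test_pair_bdd(1)[OF f] by (intro bdd_borel_intros)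
 have w_int: "integral {0..real n * T0} w = real n * integral {0..T0} w" for n
  using test_pairD(3)[OF u] test_pairD(3)[OF f] T0 by (intro integral_periods w) (auto simp: w_def)
 have psum_le: "psum n u g om <= psum n f g om + real n * integral {0..T0} w" if om: "om \<in> space M" for n om
 proof -
  have along: "bdd_borel (along u (X om))" "bdd_borel (along f (X om))"
   using test_pair_bdd(1)[OF u] test_pair_bdd(1)[OF f] by (auto intro: along_bdd X_cadlag[OF om])
  have "integral {0..real n * T0} (along u (X om)) <= integral {0..real n * T0} (%t. along f (X om) t + w t)"
  proof (intro integral_bdd_mono bdd_borel_add along w)
   fix t assume t: "t \<in> {0..real n * T0}"
   have "abs (f (X om t) t - u (X om t) t) <= w t" unfolding w_def by (rule member_le_sum[of _ _ "%y. abs (f y t - u y t)"]) auto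
   thus "along u (X om) t <= along f (X om) t + w t" using t by (simp add: along_eq)
  qed
  thus ?thesis using w_int by (simp add: path_fun_def integral_bdd_add[OF along(2) w])
 qed
 have "part_fun n u g <= K * exp (real n * (lam f g + integral {0..T0} w))" if n: "n >= 1" for n
 proof -
  have "part_fun n u g <= expectation (%om. exp (real n * integral {0..T0} w) * exp (psum n f g om))"
   unfolding part_fun_def using psum_le test_pair_lam(2)[OF u n] test_pair_lam(2)[OF f n]
   by (intro integral_mono integrable_mult_right) (simp_all only: mult_exp_exp exp_le_cancel_iff add.commute)
  also have "... = exp (real n * integral {0..T0} w) * part_fun n f g" by (simp add: part_fun_def)
  also have "... <= exp (real n * integral {0..T0} w) * (K * exp (real n * lam f g))" by (intro mult_left_mono K n) auto
  finally show ?thesis by (simp add: exp_add distrib_left mult_ac)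
 qed
 from growth_le[OF test_pair_lam(1)[OF u] this] show ?thesis by (simp add: w_def[abs_def])
qed

definition expected_flow :: "(real => 'v => real) => (('v * 'v) * real) measure" where
 "expected_flow m = slice_density T0 (%t e. m t (fst e) * R (fst e) (snd e) t)"

lemma expected_flow_slices:
 assumes m: "has_slices T0 mu m" shows "has_slices T0 (expected_flow m) (%t e. m t (fst e) * R (fst e) (snd e) t)"
proof -
 have "(%p. m (snd p) (fst (fst p)) * R (fst (fst p)) (snd (fst p)) (snd p)) \<in> borel_measurable SpV"
  by (rule SpV_measurable[where f = "%e t. m t (fst e) * R (fst e) (snd e) t"])
   (intro borel_measurable_times has_slices_measurable[OF m] bdd_borel_measurable[OF R_bdd])
 thus ?thesis
  unfolding has_slices_def expected_flow_def using has_slicesD(3)[OF m] R_nonneg slice_integrable[OF m R_bdd]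
  by (auto intro!: slice_density_circle)
qed

lemma itg_expected_flow:
 assumes m: "has_slices T0 mu m" and G: "\<And>e. bdd_borel (G e)"
 shows "itg (expected_flow m) G = itg mu (%y t. \<Sum>z\<in>UNIV. R y z t * G (y, z) t)"
proof -
 have "bdd_borel (%t. \<Sum>z\<in>UNIV. R y z t * G (y, z) t)" for y using G R_bdd by (intro bdd_borel_intros)
 note mu = slice_integral(2)[where f = "%y t. \<Sum>z\<in>UNIV. R y z t * G (y, z) t", OF m this]
 show ?thesis
  unfolding mu slice_integral(2)[where f = G, OF expected_flow_slices[OF m] G]
  by (simp add: sum_distrib_left mult.assoc sum.cartesian_product case_prod_beta)
qed

context
 fixes mu :: "('v * real) measure" and Q :: "(('v * 'v) * real) measure" and a :: real
 assumes PQ: "(mu, Q) \<in> Mstar T0 E"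
  and conj: "\<And>f g. cont_per T0 f ==> cont_per T0 g ==> ev f g (mu, Q) - lam f g <= a"
begin

lemma conj_borel:
 assumes f: "\<And>y. bdd_borel (f y)" "\<And>y t. f y (t + T0) = f y t" and g: "cont_per T0 g"
 shows "ev f g (mu, Q) - lam f g <= a"
proof (rule field_le_epsilon)
 fix \<epsilon> :: real assume \<epsilon>: "\<epsilon> > 0"
 obtain K where K: "K >= 0" "\<And>y t. abs (f y t) <= K" using that by (rule bdd_borel_family_bound[of f, OF f(1)])
 note mu = Mstar_circle(1)[OF PQ]
 obtain u where u: "cont_per T0 u" "\<And>y t. abs (u y t) <= K" "itg mu (%y t. abs (f y t - u y t)) < \<epsilon> / 2"
  "itg (arc_length T0) (%y t. abs (f y t - u y t)) < \<epsilon> / 2"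
  using that by (rule approx_cont_per2[OF T0 mu has_slicesD(1)[OF arc_length_slices[OF less_imp_le[OF T0]]] f(1) K(2) half_gt_zero[OF \<epsilon>]])
 note u_bdd = cont_per_bdd[OF u(1) T0]
 obtain L where L: "test_pair L u g" using that by (rule cont_per_test_pair[OF u(1) g])
 obtain L' where L': "test_pair L' f g" using that by (rule test_pair_exists[OF f g])
 have "bdd_borel (%t. abs (f y t - u y t))" for y using f(1) u_bdd by (intro bdd_borel_intros)
 from itg_arc_length[where f = "%y t. abs (f y t - u y t)", OF less_imp_le[OF T0] this] u(4)
 have "integral {0..T0} (%t. \<Sum>y\<in>UNIV. abs (f y t - u y t)) < \<epsilon> / 2" by simp
 thus "ev f g (mu, Q) - lam f g <= a + \<epsilon>"
  using lam_lipschitz[OF L L'] conj[OF u(1) g] itg_le_of_close[where f = f and u = u, OF mu f(1) u_bdd] u(3) by (simp add: ev_def)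
qed

lemma time_marginal:
 assumes w: "bdd_borel w" shows "itg mu (%_. w) = integral {0..T0} w"
proof -
 define v where "v t = w (pmod t T0)" for t
 note mu = circle_measureD[OF Mstar_circle(1)[OF PQ]]
 obtain K where K: "\<And>t. abs (w t) <= K" using bdd_borel_bound[OF w] by blast
 have v: "bdd_borel v" unfolding v_def
  using K by (intro bdd_borelI measurable_compose[OF pmod_measurable bdd_borel_measurable[OF w]])
 have per: "v (t + T0) = v t" for t using T0 by (simp add: v_def)
 have "k * (itg mu (%_. v) - integral {0..T0} v) <= a" for k
  using conj_borel[of "%_ t. k * v t" "%_ _. 0"] lam_time[of "%t. k * v t"] v per
  by (simp add: ev_def cont_per_def bdd_borel_mult right_diff_distrib)
 from eq_0_of_scaling[OF this] have "itg mu (%_. v) = integral {0..T0} v" by simp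
 moreover have "itg mu (%_. v) = itg mu (%_. w)"
 proof (rule integral_cong_AE)
  note meas = circle_measurable[OF Mstar_circle(1)[OF PQ] SpV_measurable]
  show "(%p. v (snd p)) \<in> borel_measurable mu" "(%p. w (snd p)) \<in> borel_measurable mu"
   using v w by (auto intro!: meas[of "%_. v"] meas[of "%_. w"] bdd_borel_measurable)
  show "AE p in mu. v (snd p) = w (snd p)" using mu(4) by eventually_elim (auto simp: v_def pmod_id)
 qed
 moreover have "integral {0..T0} v = integral {0..T0} w"
  by (rule integral_spike[of "{T0}"]) (auto simp: v_def pmod_id)
 ultimately show ?thesis by simp
qed

lemma conj_density:
 obtains m where "has_slices T0 mu m" "AE t in lborel. t \<in> {0..<T0} --> (\<Sum>y\<in>UNIV. m t y) = 1"
proof -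
 note mu = Mstar_circle(1)[OF PQ] and circle = circle_measureD[OF Mstar_circle(1)[OF PQ]]
 interpret finite_measure mu by (rule circle(1))
 have ac: "N \<in> null_sets mu" if N: "N \<in> null_sets SpV" for N
 proof -
  define A where "A = (\<Union>y. {t. (y, t) \<in> N})"
  have A: "A \<in> null_sets lborel" unfolding A_def by (intro null_sets_UN' null_slices_SpV[OF N]) auto
  have "itg mu (%_. indicator A) = (LINT p|mu. indicator (UNIV \<times> A) p)"
   by (rule Bochner_Integration.integral_cong) (auto simp: indicator_def)
  hence "measure mu (UNIV \<times> A) = itg mu (%_. indicator A)" using circle(3) by simp
  also have "... = integral {0..T0} (indicator A)" using A by (intro time_marginal bdd_borelI[of _ 1]) auto
  also have "... = (LINT t:{0..T0}|lborel. indicator A t)" using A by (intro bdd_borel_LINT[symmetric] bdd_borelI[of _ 1]) auto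
  also have "... = 0"
   unfolding set_lebesgue_integral_def by (intro integral_eq_zero_AE eventually_mono[OF AE_not_in[OF A]]) simp
  finally have "UNIV \<times> A \<in> null_sets mu" using A SpV_times_sets[of A UNIV] circle(2) by (auto simp: null_sets_def emeasure_eq_measure)
  thus ?thesis by (rule null_sets_subset) (use N circle(2) in \<open>auto simp: A_def\<close>)
 qed
 obtain m where m: "(%p. m (snd p) (fst p)) \<in> borel_measurable SpV" "\<And>t y. 0 <= m t y" "mu = slice_density T0 m"
  using slice_density_exists[OF mu ac] by blast
 hence slices: "has_slices T0 mu m" using mu by (simp add: has_slices_def)
 define s where "s t = (\<Sum>y\<in>UNIV. m t y) - 1" for t
 have sgn: "bdd_borel (%t. sgn (s t))"
  using has_slices_measurable[OF slices] unfolding s_def by (intro bdd_borelI[of _ 1]) (auto simp: sgn_if)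
 have "circ_int T0 (%t. sgn (s t)) = circ_int T0 (%t. \<Sum>y\<in>UNIV. m t y * sgn (s t))"
  using time_marginal[OF sgn] slice_integral(2)[OF slices, of "%_ t. sgn (s t)"] sgn by (simp add: circ_int_eq_integral)
 moreover have integrables: "circ_integrable T0 (%t. sgn (s t))" "circ_integrable T0 (%t. \<Sum>y\<in>UNIV. m t y * sgn (s t))"
  using slice_integrable[OF arc_length_slices[OF less_imp_le[OF T0]] sgn] slice_integrable_sum[OF slices, of "%_ t. sgn (s t)"] sgn by auto
 moreover have "(\<Sum>y\<in>UNIV. m t y * sgn (s t)) - sgn (s t) = abs (s t)" for t
  by (simp add: s_def sum_distrib_right[symmetric] left_diff_distrib abs_sgn)
 ultimately have "circ_int T0 (%t. abs (s t)) = 0" "circ_integrable T0 (%t. abs (s t))"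
  using Bochner_Integration.integral_diff[OF integrables(2,1)] Bochner_Integration.integrable_diff[OF integrables(2,1)]
  by (simp_all add: right_diff_distrib[symmetric])
 hence "AE t in lborel. period T0 t * abs (s t) = 0"
  using integral_nonneg_eq_0_iff_AE[of lborel "%t. period T0 t * abs (s t)"] by (simp add: period_eq)
 hence "AE t in lborel. t \<in> {0..<T0} --> (\<Sum>y\<in>UNIV. m t y) = 1"
  by eventually_elim (auto simp: period_eq s_def)
 thus ?thesis using that slices by blast
qed


lemma ev_le_of_log_slope:
 assumes \<phi>: "\<And>y t. (\<phi> y has_real_derivative \<phi>' y t) (at t)" "cont_per T0 \<phi>" "cont_per T0 \<phi>'" and g: "cont_per T0 g"
 shows "itg Q g - itg mu (log_slope \<phi>' g \<phi>) <= a"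
proof -
 let ?f = "%y t. - log_slope \<phi>' g \<phi> y t" and ?h = "%y t. exp (\<phi> y t)"
 note bdd = cont_per_bdd[OF \<phi>(2) T0] cont_per_bdd[OF \<phi>(3) T0] cont_per_bdd[OF g T0]
 have f: "bdd_borel (?f y)" for y using bdd by (intro bdd_borel_uminus log_slope_bdd)
 have f_per: "?f y (t + T0) = ?f y t" for y t
  using cont_perD(2)[OF \<phi>(2)] cont_perD(2)[OF \<phi>(3)] cont_perD(2)[OF g] by (simp add: log_slope_def twisted_def R_per)
 obtain L where L: "test_pair L ?f g" using that by (rule test_pair_exists[OF f f_per g])
 obtain K where K: "K >= 0" "\<And>y t. abs (\<phi> y t) <= K" using that by (rule cont_per_bounded[OF \<phi>(2) T0])
 have "bw ?f g ?h y t = - (exp (\<phi> y t) * \<phi>' y t)" for y t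
  unfolding bw_exp by (simp add: log_slope_def)
 hence "(?h y has_real_derivative - bw ?f g ?h y t) (at t)" for y t
  using \<phi>(1)[of y t] by (auto intro!: derivative_eq_intros)
 hence indef: "indef s t (?h y) (bw ?f g ?h y)" for y s t by (rule indef_of_deriv)
 have h: "bdd_borel (?h y)" "exp (- K) <= ?h y t" "?h y t <= exp K" for y t
  using bdd_borel_exp[OF bdd(1)] K(2)[of y t] by (auto simp: abs_le_iff)
 have "bdd_borel (bw ?f g ?h y)" for y by (intro bw_bdd h(1) f bdd(3))
 hence "lam ?f g <= 0" by (rule lam_le_of_supersolution[where h = ?h, OF L h exp_gt_zero _ indef]) simp
 moreover have "itg mu ?f = - itg mu (log_slope \<phi>' g \<phi>)" by simp
 ultimately show ?thesis using conj_borel[where f = ?f and g = g, OF f f_per g] by (simp add: ev_def)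
qed

lemma weak_continuity:
 assumes \<phi>: "\<And>y t. (\<phi> y has_real_derivative \<phi>' y t) (at t)" "cont_per T0 \<phi>" "cont_per T0 \<phi>'"
 shows "itg mu \<phi>' = itg Q (%e t. \<phi> (fst e) t - \<phi> (snd e) t)"
proof -
 let ?g = "%e t. \<phi> (fst e) t - \<phi> (snd e) t"
 have g: "cont_per T0 ?g" using \<phi>(2) by (auto simp: cont_per_def intro!: continuous_intros)
 have "k * (itg Q ?g - itg mu \<phi>') <= a" for k
 proof -
  have "log_slope (%y t. k * \<phi>' y t) (%e t. k * ?g e t) (%y t. k * \<phi> y t) = (%y t. k * \<phi>' y t)"
   by (intro ext) (simp add: log_slope_def twisted_def right_diff_distrib)
  moreover have "((%t. k * \<phi> y t) has_real_derivative k * \<phi>' y t) (at t)" for y t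
   using \<phi>(1)[of y t] by (auto intro!: derivative_eq_intros)
  from ev_le_of_log_slope[OF this cont_per_cmult[OF \<phi>(2)] cont_per_cmult[OF \<phi>(3)] cont_per_cmult[OF g], of k]
  have "itg Q (%e t. k * ?g e t) - itg mu (log_slope (%y t. k * \<phi>' y t) (%e t. k * ?g e t) (%y t. k * \<phi> y t)) <= a" .
  ultimately show ?thesis by (simp only: right_diff_distrib[of k "itg Q ?g" "itg mu \<phi>'"] integral_mult_right_zero)
 qed
 from eq_0_of_scaling[OF this] show ?thesis by simp
qed

lemma entropy_bound:
 assumes m: "has_slices T0 mu m" and G: "\<And>e. bdd_borel (G e)"
 shows "itg Q G - itg (expected_flow m) (%e t. exp (G e t) - 1) <= a"
proof (rule field_le_epsilon)
 fix \<epsilon> :: real assume \<epsilon>: "\<epsilon> > 0"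
 let ?P = "expected_flow m"
 note Q = Mstar_circle(2)[OF PQ] and P = has_slicesD(1)[OF expected_flow_slices[OF m]]
 obtain K where K: "K >= 0" "\<And>e t. abs (G e t) <= K" using that by (rule bdd_borel_family_bound[of G, OF G])
 have "\<epsilon> / (1 + exp K) > 0" using \<epsilon> by (simp add: add_pos_pos)
 then obtain u where u: "cont_per T0 u" "\<And>e t. abs (u e t) <= K" "itg Q (%e t. abs (G e t - u e t)) < \<epsilon> / (1 + exp K)"
   "itg ?P (%e t. abs (G e t - u e t)) < \<epsilon> / (1 + exp K)"
  using that by (rule approx_cont_per2[OF T0 Q P G K(2)])
 note u_bdd = cont_per_bdd[OF u(1) T0]
 let ?d = "%v w e t. abs (v e t - w e t)" and ?exp = "%v e t. exp (v e t) - 1"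
 have exp_bdd: "bdd_borel (?exp G e)" "bdd_borel (?exp u e)" for e by (intro bdd_borel_intros G u_bdd)+
 have d_bdd: "bdd_borel (?d (?exp u) (?exp G) e)" "bdd_borel (%t. exp K * ?d G u e t)" for e
  by (intro bdd_borel_intros G u_bdd)+
 have "itg ?P (?d (?exp u) (?exp G)) <= itg ?P (%e t. exp K * ?d G u e t)"
 proof (rule integral_mono)
  show "integrable ?P (%p. ?d (?exp u) (?exp G) (fst p) (snd p))" by (rule itg_integrable[OF P d_bdd(1)])
  show "integrable ?P (%p. exp K * ?d G u (fst p) (snd p))" by (rule itg_integrable[where f = "%e t. exp K * ?d G u e t", OF P d_bdd(2)])
  show "?d (?exp u) (?exp G) (fst p) (snd p) <= exp K * ?d G u (fst p) (snd p)" for p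
   using exp_diff_le[of "u (fst p) (snd p)" K "G (fst p) (snd p)"] u(2)[of "fst p" "snd p"] K(2)[of "fst p" "snd p"]
   by (simp add: abs_le_iff abs_minus_commute)
 qed
 moreover have "exp K * itg ?P (?d G u) <= exp K * (\<epsilon> / (1 + exp K))" using u(4) by (intro mult_left_mono) auto
 moreover have "\<epsilon> / (1 + exp K) + exp K * (\<epsilon> / (1 + exp K)) = \<epsilon>" by (simp add: field_simps add_pos_pos less_imp_neq[symmetric])
 moreover have "itg Q u - itg ?P (?exp u) <= a"
  using ev_le_of_log_slope[of "%_ _. 0" "%_ _. 0" u] u(1) itg_expected_flow[where G = "?exp u", OF m exp_bdd(2)]
  by (simp add: cont_per_const log_slope_def[abs_def] twisted_def)
 ultimately show "itg Q G - itg ?P (?exp G) <= a + \<epsilon>"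
  using itg_le_of_close[where f = G and u = u, OF Q G u_bdd] u(3)
   itg_le_of_close[where f = "?exp u" and u = "?exp G", OF P exp_bdd(2,1)] by simp
qed

lemma flow_null:
 assumes m: "has_slices T0 mu m" and A: "A \<in> null_sets (expected_flow m)" shows "A \<in> null_sets Q"
proof -
 note Q = circle_measureD[OF Mstar_circle(2)[OF PQ]] and P = circle_measureD[OF has_slicesD(1)[OF expected_flow_slices[OF m]]]
 have sets: "A \<in> sets SpV" using A P(2) by auto
 have "k * measure Q A <= a" for k
 proof -
  have "{t. (e, t) \<in> A} \<in> sets borel" for e using sets_Pair1[OF sets, of e] by (simp add: vimage_def)
  hence "bdd_borel (%t. k * indicator {t. (e, t) \<in> A} t)" for e by (intro bdd_borel_mult bdd_borel_const bdd_borelI[of _ 1]) auto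
  from entropy_bound[where G = "%e t. k * indicator {t. (e, t) \<in> A} t", OF m this]
  have "(LINT p|Q. k * indicator A p) - (LINT p|expected_flow m. exp (k * indicator A p) - 1) <= a" by (simp add: indicator_def)
  moreover have "(LINT p|expected_flow m. exp (k * indicator A p) - 1) = 0"
   by (intro integral_eq_zero_AE eventually_mono[OF AE_not_in[OF A]]) (simp add: indicator_def)
  ultimately show ?thesis using Q(3) by simp
 qed
 hence "measure Q A = 0" by (rule eq_0_of_scaling)
 thus ?thesis using sets Q(1,2) by (auto simp: null_sets_def finite_measure.emeasure_eq_measure)
qed

lemma weak_continuity_slices:
 assumes m: "has_slices T0 mu m" and q: "has_slices T0 Q q"
  and f: "\<And>y. f y C1_differentiable_on UNIV" "\<And>y t. f y (t + T0) = f y t"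
 shows "(LINT s:{0..T0}|lborel. \<Sum>y\<in>UNIV. m s y * deriv (f y) s) = (LINT s:{0..T0}|lborel. \<Sum>y\<in>UNIV. divg E (q s) y * f y s)"
proof -
 obtain D where D: "\<And>y t. (f y has_real_derivative D y t) (at t)" "\<And>y. continuous_on UNIV (D y)"
  using f(1) unfolding C1_differentiable_on_def has_real_derivative_iff_has_vector_derivative by (metis UNIV_I)
 have deriv: "deriv (f y) = D y" for y using D(1) by (auto intro: DERIV_imp_deriv)
 have f_cont: "cont_per T0 f" using f(2) D(1) unfolding cont_per_def by (metis DERIV_isCont continuous_at_imp_continuous_on)
 have "D y (t + T0) = D y t" for y t
 proof -
  have "((%t. f y (t + T0)) has_real_derivative D y (t + T0)) (at t)" using D(1) by (subst DERIV_shift[symmetric])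
  thus ?thesis using f(2) D(1)[of y t] by (simp add: DERIV_unique)
 qed
 hence D_cont: "cont_per T0 D" using D(2) by (simp add: cont_per_def)
 note bdd = cont_per_bdd[OF f_cont T0] cont_per_bdd[OF D_cont T0]
 let ?flux = "%e t. f (fst e) t - f (snd e) t"
 have "(LINT s:{0..T0}|lborel. \<Sum>y\<in>UNIV. m s y * deriv (f y) s) = circ_int T0 (%s. \<Sum>y\<in>UNIV. m s y * D y s)"
  unfolding deriv using has_slices_measurable[OF m] bdd_borel_measurable[OF bdd(2)]
  by (intro LINT_period borel_measurable_sum borel_measurable_times)
 also have "... = itg mu D" by (rule slice_integral(2)[OF m bdd(2), symmetric])
 also have "... = itg Q ?flux" by (rule weak_continuity[OF D(1) f_cont D_cont])
 also have "... = circ_int T0 (%s. \<Sum>e\<in>E. q s e * ?flux e s)"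
  using bdd(1) by (intro slice_integral_on[OF q Mstar_circle(3)[OF PQ]] bdd_borel_diff)
 also have "... = (LINT s:{0..T0}|lborel. \<Sum>y\<in>UNIV. divg E (q s) y * f y s)"
  unfolding divg_pairing using has_slices_measurable[OF q] bdd_borel_measurable[OF bdd(1)]
  by (intro LINT_period[symmetric] borel_measurable_sum borel_measurable_times borel_measurable_diff)
 finally show ?thesis .
qed

lemma conj_Lambda: "(mu, Q) \<in> Lambda T0 E"
proof -
 obtain m where m: "has_slices T0 mu m" "AE t in lborel. t \<in> {0..<T0} --> (\<Sum>y\<in>UNIV. m t y) = 1"
  using that by (rule conj_density)
 note P = expected_flow_slices[OF m(1)]
 have "N \<in> null_sets Q" if "N \<in> null_sets SpV" for N by (rule flow_null[OF m(1) slice_null[OF P that]])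
 then obtain q where "(%p. q (snd p) (fst p)) \<in> borel_measurable SpV" "\<And>t e. 0 <= q t e" "Q = slice_density T0 q"
  using that by (rule slice_density_exists[OF Mstar_circle(2)[OF PQ]])
 hence q: "has_slices T0 Q q" using Mstar_circle(2)[OF PQ] by (simp add: has_slices_def)
 have "AE t in lborel. t \<in> {0..<T0} --> (\<forall>e. m t (fst e) * R (fst e) (snd e) t = 0 --> q t e = 0)"
  by (rule slice_zero_AE[OF P q flow_null[OF m(1)]])
 hence "AE t in lborel. t \<in> {0..<T0} --> (\<forall>y z. (y, z) \<in> E --> m t y = 0 --> q t (y, z) = 0)"
  by eventually_elim (metis fst_conv mult_zero_left)
 hence "Lambda_wit T0 E mu Q m q"
  unfolding Lambda_wit_def using m(2) has_slicesD[OF m(1)] has_slicesD[OF q] weak_continuity_slices[OF m(1) q]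
  by (simp add: slice_density_def[symmetric])
 thus ?thesis unfolding Lambda_def using PQ by auto
qed

lemma clipped_rate_le:
 assumes m: "has_slices T0 mu m" and q: "has_slices T0 Q q"
 defines "flux \<equiv> %t e. m t (fst e) * R (fst e) (snd e) t"
 shows "(\<integral>\<^sup>+t. indicator {0..<T0} t * (\<Sum>e\<in>E. ennreal (clipped_Phi (real k) (q t e) (flux t e))) \<partial>lborel) <= ennreal a"
proof -
 note P = expected_flow_slices[OF m, folded flux_def]
 define G where "G e t = clipped_log (real k) (q t e) (flux t e)" for e t
 have G: "bdd_borel (G e)" for e
  using has_slices_measurable[OF q] has_slices_measurable[OF P] abs_clipped_log[of "real k"]
  by (intro bdd_borelI[of _ "real k"]) (auto simp: G_def[abs_def] clipped_log_def)
 have exp_bdd: "bdd_borel (%t. exp (G e t) - 1)" for e using G by (intro bdd_borel_intros)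
 have nonneg: "0 <= clipped_Phi (real k) (q t e) (flux t e)" for t e
  using has_slicesD(3)[OF q] has_slicesD(3)[OF P] by (intro clipped_Phi_nonneg) auto
 let ?Phi = "%t. \<Sum>e\<in>UNIV. clipped_Phi (real k) (q t e) (flux t e)"
 have Phi_eq: "?Phi t = (\<Sum>e\<in>UNIV. q t e * G e t) - (\<Sum>e\<in>UNIV. flux t e * (exp (G e t) - 1))" for t
  by (simp add: clipped_Phi_def G_def sum_subtractf)
 note integrables = slice_integrable_sum[where f = G and A = UNIV, OF q G] slice_integrable_sum[where f = "%e t. exp (G e t) - 1" and A = UNIV, OF P exp_bdd]
 have int: "circ_integrable T0 ?Phi" unfolding Phi_eq right_diff_distrib[of "period T0 t" for t] using integrables by (rule Bochner_Integration.integrable_diff)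
 have "circ_int T0 ?Phi = itg Q G - itg (expected_flow m) (%e t. exp (G e t) - 1)"
  unfolding Phi_eq right_diff_distrib[of "period T0 t" for t] slice_integral(2)[where f = G, OF q G] slice_integral(2)[where f = "%e t. exp (G e t) - 1", OF P exp_bdd]
  using integrables by (rule Bochner_Integration.integral_diff)
 also have "... <= a" by (rule entropy_bound[OF m G])
 finally have Phi_le: "circ_int T0 ?Phi <= a" .
 have "(\<integral>\<^sup>+t. indicator {0..<T0} t * (\<Sum>e\<in>E. ennreal (clipped_Phi (real k) (q t e) (flux t e))) \<partial>lborel)
   <= (\<integral>\<^sup>+t. ennreal (period T0 t * ?Phi t) \<partial>lborel)"
 proof (rule nn_integral_mono)
  fix t
  have "(\<Sum>e\<in>E. ennreal (clipped_Phi (real k) (q t e) (flux t e))) <= ennreal (?Phi t)"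
   using nonneg by (simp add: sum_ennreal ennreal_leI sum_mono2)
  thus "indicator {0..<T0} t * (\<Sum>e\<in>E. ennreal (clipped_Phi (real k) (q t e) (flux t e))) <= ennreal (period T0 t * ?Phi t)"
   by (simp add: period_def indicator_def)
 qed
 also have "... = ennreal (circ_int T0 ?Phi)"
  using nonneg by (intro nn_integral_eq_integral int) (auto simp: period_eq sum_nonneg)
 also have "... <= ennreal a" using Phi_le by (rule ennreal_leI)
 finally show ?thesis .
qed

lemma conj_rate_int:
 assumes wit: "Lambda_wit T0 E mu Q m q" shows "rate_int R T0 E m q <= ennreal a"
proof -
 note slices = Lambda_wit_slices[OF PQ wit] and P = expected_flow_slices[OF Lambda_wit_slices(1)[OF PQ wit]]
 define flux where "flux t e = m t (fst e) * R (fst e) (snd e) t" for t e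
 let ?F = "%k t. indicator {0..<T0} t * (\<Sum>e\<in>E. ennreal (clipped_Phi (real k) (q t e) (flux t e)))"
 have F: "?F k \<in> borel_measurable lborel" for k
  using has_slices_measurable[OF slices(2)] has_slices_measurable[OF P]
  unfolding clipped_Phi_def clipped_log_def flux_def by measurable
 have "AE t in lborel. indicator {0..<T0} t * (\<Sum>e\<in>E. Phi (q t e) (flux t e)) = liminf (%k. ?F k t)"
  using Lambda_witD(8)[OF wit]
 proof eventually_elim
  case (elim t)
  show ?case
  proof (cases "t \<in> {0..<T0}")
   case True
   have "(%k. ennreal (clipped_Phi (real k) (q t e) (flux t e))) \<longlonglongrightarrow> Phi (q t e) (flux t e)" if e: "e \<in> E" for e
   proof (rule clipped_Phi_tendsto)
    show "flux t e > 0" if "q t e \<noteq> 0"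
    proof -
     have "m t (fst e) > 0" using elim True e that has_slicesD(3)[OF slices(1), of t "fst e"] by (cases e) fastforce
     moreover have "R (fst e) (snd e) t > 0" using R_lo[of "fst e" "snd e" t] e c by simp
     ultimately show ?thesis by (simp add: flux_def)
    qed
   qed (use has_slicesD(3)[OF slices(2)] has_slicesD(3)[OF P, of t e] in \<open>auto simp: flux_def\<close>)
   hence "(%k. ?F k t) \<longlonglongrightarrow> indicator {0..<T0} t * (\<Sum>e\<in>E. Phi (q t e) (flux t e))"
    using True by (simp add: tendsto_sum)
   thus ?thesis by (intro lim_imp_Liminf[symmetric]) auto
  qed (simp add: Liminf_const)
 qed
 hence "rate_int R T0 E m q = (\<integral>\<^sup>+t. liminf (%k. ?F k t) \<partial>lborel)"
  unfolding rate_int_def flux_def by (rule nn_integral_cong_AE)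
 also have "... <= liminf (%k. \<integral>\<^sup>+t. ?F k t \<partial>lborel)" by (rule nn_integral_liminf[OF F])
 also have "... <= limsup (%k. \<integral>\<^sup>+t. ?F k t \<partial>lborel)" by (rule Liminf_le_Limsup) simp
 also have "... <= ennreal a" using clipped_rate_le[OF slices] by (intro Limsup_bounded) (auto simp: flux_def)
 finally show ?thesis .
qed

end

end

section \<open>Compactness and measurability\<close>

lemma circle_normalize:
 fixes nu :: "('a::finite * real) measure"
 assumes T0: "T0 > 0" and nu: "circle_measure T0 nu"
 obtains P where "circle_measure T0 P" "prob_space P" "\<And>f. cont_per T0 f ==> itg nu f = measure nu UNIV * itg P f"
proof (cases "measure nu UNIV = 0")
 case True
 interpret finite_measure nu by (rule circle_measureD(1)[OF nu])
 have "emeasure nu (space nu) = 0" using True circle_measureD(3)[OF nu] by (simp add: emeasure_eq_measure)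
 hence "AE p in nu. False" using AE_iff_measurable[of "space nu" nu "%_. False"] by simp
 hence "itg nu f = 0" for f by (intro integral_eq_zero_AE) auto
 moreover have "circle_measure T0 (return SpV (undefined :: 'a, 0))" using T0 SpV_sets[where 'a = 'a] by (simp add: circle_measure_def)
 moreover have "prob_space (return SpV (undefined :: 'a, 0::real))" by (rule prob_space_return) (simp add: space_pair_measure)
 ultimately show ?thesis using True by (intro that[of "return SpV (undefined, 0)"]) auto
next
 case False
 interpret finite_measure nu by (rule circle_measureD(1)[OF nu])
 note circle = circle_measureD[OF nu]
 let ?P = "density nu (%_. ennreal (1 / measure nu UNIV))"
 have mass: "measure nu UNIV > 0" using False by (simp add: less_le)
 have P: "emeasure ?P A = ennreal (1 / measure nu UNIV) * emeasure nu A" if "A \<in> sets SpV" for A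
  using that circle(2) by (simp add: emeasure_density_const)
 have total: "emeasure ?P UNIV = 1"
  using P[OF SpV_sets(1)] mass by (simp add: emeasure_eq_measure ennreal_mult'[symmetric])
 show ?thesis
 proof (rule that)
  show "circle_measure T0 ?P" using nu circle total P[OF SpV_sets(2)] by (simp add: circle_measure_def)
  show "prob_space ?P" using total circle(3) by (intro prob_spaceI) simp
  show "itg nu f = measure nu UNIV * itg ?P f" if "cont_per T0 f" for f
   using False circle_measurable[OF nu cont_per_measurable[OF that]] by (simp add: integral_density)
 qed
qed

definition track :: "real => 'a::countable => real set" where
 "track T0 y = {2 * real (to_nat y) * T0..2 * real (to_nat y) * T0 + T0}"

text \<open>The circles are laid out on disjoint tracks of the real line, where Helly's theorem applies.\<close>
definition layout :: "real => 'a::countable * real => real" where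
 "layout T0 q = 2 * real (to_nat (fst q)) * T0 + snd q"

definition unlayout :: "real => real => 'a::countable * real" where
 "unlayout T0 x = (from_nat (nat \<lfloor>x / (2 * T0)\<rfloor>), pmod x T0)"

lemma tracks_compact: "compact (\<Union>y::'a::finite. track T0 y)"
 unfolding track_def by (intro compact_UN) auto

lemma layout_track: "snd q \<in> {0..<T0} ==> layout T0 q \<in> track T0 (fst q)"
 by (simp add: layout_def track_def)

lemma layout_measurable: "layout T0 \<in> borel_measurable (SpV :: ('a::finite * real) measure)"
 unfolding layout_def[abs_def] by (rule SpV_measurable) auto

lemma unlayout_measurable: "(unlayout T0 :: real => 'a::finite * real) \<in> measurable borel SpV"
 unfolding unlayout_def[abs_def] by measurable

lemma layout_periodic:
 assumes "cont_per T0 f" shows "f (fst q) (layout T0 q) = f (fst q) (snd q)"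
 using periodic_add_nat[of "f (fst q)" T0 "snd q" "2 * to_nat (fst q)"] cont_perD(2)[OF assms] by (simp add: layout_def add.commute)

lemma unlayout_on_track:
 fixes f :: "'a::countable tfun"
 assumes T0: "T0 > 0" and x: "x \<in> track T0 y" and f: "cont_per T0 f"
 shows "case_prod f (unlayout T0 x) = f y x"
proof -
 have "\<lfloor>x / (2 * T0)\<rfloor> = int (to_nat y)"
  unfolding floor_eq_iff using x T0 by (auto simp: track_def field_simps)
 thus ?thesis using periodic_pmod[of "f y" T0 x] cont_perD(2)[OF f] by (simp add: unlayout_def)
qed

lemma cont_per_extension:
 fixes f :: "'a::finite tfun"
 assumes T0: "T0 > 0" and f: "cont_per T0 f" "\<And>y t. abs (f y t) <= K" and K: "0 <= K"
 obtains F where "continuous_on UNIV F" "\<And>x. abs (F x) <= K" "\<And>x y. x \<in> track T0 y ==> F x = f y x"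
proof -
 let ?f = "%x. case_prod f (unlayout T0 x)"
 have "continuous_on (track T0 y) ?f" for y :: 'a
  using unlayout_on_track[OF T0 _ f(1)] continuous_on_subset[OF cont_perD(1)[OF f(1)], of "track T0 y" y]
  by (subst continuous_on_cong[OF refl, of _ _ "f y"]) auto
 hence "continuous_on (\<Union>y::'a. track T0 y) ?f" by (intro continuous_on_closed_Union) (auto simp: track_def)
 moreover have "closedin (top_of_set UNIV) (\<Union>y::'a. track T0 y)" using compact_imp_closed[OF tracks_compact] by simp
 moreover have "norm (?f x) <= K" for x using f(2) by (simp add: case_prod_beta)
 ultimately obtain F where F: "continuous_on UNIV F" "\<And>x. x \<in> (\<Union>y::'a. track T0 y) ==> F x = ?f x" "\<And>x. x \<in> UNIV ==> norm (F x) <= K"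
  using Tietze[of _ ?f UNIV K] K by metis
 show ?thesis
 proof (rule that[OF F(1)])
  show "abs (F x) <= K" for x using F(3)[of x] by simp
  show "F x = f y x" if "x \<in> track T0 y" for x y using F(2)[of x] unlayout_on_track[OF T0 that f(1)] that by auto
 qed
qed

lemma tight_of_bounded:
 assumes D: "\<And>n. real_distribution (D n)" and bound: "\<And>n. AE x in D n. abs x <= b" shows "tight D"
 unfolding tight_def
proof (intro conjI allI impI D)
 fix \<epsilon> :: real assume "\<epsilon> > 0"
 have "measure (D n) {- abs b - 1<..abs b + 1} = 1" for n
 proof -
  interpret real_distribution "D n" by (rule D)
  have "AE x in D n. x \<in> {- abs b - 1<..abs b + 1}" using bound[of n] by eventually_elim auto
  thus ?thesis by (simp add: prob_eq_1)
 qed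
 thus "\<exists>a b. a < b \<and> (\<forall>n. 1 - \<epsilon> < measure (D n) {a<..b})"
  using \<open>\<epsilon> > 0\<close> by (intro exI[of _ "- abs b - 1"] exI[of _ "abs b + 1"]) auto
qed

lemma weak_limit_AE_in_closed:
 assumes D: "\<And>n. real_distribution (D n)" "real_distribution D'" "weak_conv_m D D'"
  and Z: "closed Z" "Z \<noteq> {}" "\<And>n. AE x in D n. x \<in> Z"
 shows "AE x in D'. x \<in> Z"
proof -
 interpret D': real_distribution D' by (rule D(2))
 let ?w = "%x. min 1 (infdist x Z)"
 have cont: "continuous_on UNIV ?w" by (intro continuous_intros)
 have bound: "abs (?w x) <= 1" for x using infdist_nonneg[of x Z] by auto
 have "integral\<^sup>L (D n) ?w = 0" for n by (intro integral_eq_zero_AE eventually_mono[OF Z(3)]) simp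
 moreover have "(%n. integral\<^sup>L (D n) ?w) \<longlonglongrightarrow> integral\<^sup>L D' ?w"
  using weak_conv_imp_integral_bdd_continuous_conv[OF D, of ?w 1] cont bound by (simp add: continuous_on_eq_continuous_at)
 ultimately have "integral\<^sup>L D' ?w = 0" by (simp add: LIMSEQ_const_iff)
 moreover have "integrable D' ?w"
  using bound borel_measurable_continuous_onI[OF cont] by (intro D'.integrable_const_bound[of _ 1]) auto
 ultimately have "AE x in D'. ?w x = 0" by (subst (asm) integral_nonneg_eq_0_iff_AE) (auto simp: infdist_nonneg)
 thus ?thesis by eventually_elim (use Z in \<open>auto simp: in_closed_iff_infdist_zero min_def split: if_splits\<close>)
qed

lemma circle_measure_unlayout:
 fixes D :: "real measure"
 assumes T0: "T0 > 0" and D: "real_distribution D"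
 shows "circle_measure T0 (distr D (SpV :: ('a::finite * real) measure) (unlayout T0))"
proof -
 interpret real_distribution D by (rule D)
 have meas: "unlayout T0 \<in> measurable D (SpV :: ('a * real) measure)" using unlayout_measurable[where 'a = 'a, of T0] by simp
 have "unlayout T0 -` (UNIV - UNIV \<times> {0..<T0} :: ('a * real) set) = {}" using pmod_bounds[OF T0] by (auto simp: unlayout_def)
 moreover have "emeasure (distr D SpV (unlayout T0)) (UNIV :: ('a * real) set) = 1"
  using emeasure_distr[OF meas SpV_sets(1)] emeasure_space_1 by simp
 ultimately show ?thesis by (simp add: circle_measure_def emeasure_distr[OF meas SpV_sets(2)])
qed

lemma circle_prob_seq_compact:
 fixes P :: "nat => ('a::finite * real) measure"
 assumes T0: "T0 > 0" and P: "\<And>n. circle_measure T0 (P n)" "\<And>n. prob_space (P n)"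
 obtains r P' where "strict_mono r" "circle_measure T0 P'" "\<And>f. cont_per T0 f ==> (%n. itg (P (r n)) f) \<longlonglongrightarrow> itg P' f"
proof -
 let ?Z = "\<Union>y::'a. track T0 y"
 define D where "D n = distr (P n) borel (layout T0)" for n
 have layout: "layout T0 \<in> borel_measurable (P n)" for n by (rule circle_measurable[OF P(1) layout_measurable])
 have D: "real_distribution (D n)" for n
  unfolding D_def using prob_space.real_distribution_distr[OF P(2) layout] .
 have AE_Z: "AE x in D n. x \<in> ?Z" for n
  unfolding D_def
 proof (subst AE_distr_iff[OF layout])
  have in_Z: "layout T0 q \<in> ?Z" if "snd q \<in> {0..<T0}" for q :: "'a * real" using layout_track[OF that] by blast
  show "AE q in P n. layout T0 q \<in> ?Z" using circle_measureD(4)[OF P(1)[of n]] by eventually_elim (rule in_Z)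
 next
  show "{x \<in> space borel. x \<in> ?Z} \<in> sets borel"
   using borel_compact[OF tracks_compact[where 'a = 'a, of T0]] by (simp only: space_borel UNIV_I simp_thms Collect_mem_eq)
 qed
 obtain b where b: "\<forall>x\<in>?Z. norm x <= b" using compact_imp_bounded[OF tracks_compact] unfolding bounded_iff by blast
 have "AE x in D n. abs x <= b" for n using AE_Z[of n] by eventually_elim (use b in force)
 from tight_imp_convergent_subsubsequence[OF tight_of_bounded[of D, OF D this] strict_mono_id]
 obtain r D' where r: "strict_mono r" "real_distribution D'" "weak_conv_m (%n. D (r n)) D'"
  by (auto simp: comp_def)
 have AE_Z': "AE x in D'. x \<in> ?Z"
  using compact_imp_closed[OF tracks_compact] T0 by (intro weak_limit_AE_in_closed[OF D r(2,3)] AE_Z) (auto simp: track_def)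
 interpret D': real_distribution D' by (rule r(2))
 define P' where "P' = distr D' (SpV :: ('a * real) measure) (unlayout T0)"
 have unlayout: "unlayout T0 \<in> measurable D' (SpV :: ('a * real) measure)" using unlayout_measurable[where 'a = 'a, of T0] by simp
 have "(%n. itg (P (r n)) f) \<longlonglongrightarrow> itg P' f" if f: "cont_per T0 f" for f
 proof -
  obtain K where K: "K >= 0" "\<And>y t. abs (f y t) <= K" using that by (rule cont_per_bounded[OF f T0])
  obtain F where F: "continuous_on UNIV F" "\<And>x. abs (F x) <= K" "\<And>x y. x \<in> track T0 y ==> F x = f y x"
   using that by (rule cont_per_extension[OF T0 f K(2,1)])
  note f_meas = cont_per_measurable[OF f] and F_meas = borel_measurable_continuous_onI[OF F(1)]
  have F_layout: "F (layout T0 q) = f (fst q) (snd q)" if "snd q \<in> {0..<T0}" for q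
   using F(3)[OF layout_track[OF that]] layout_periodic[OF f] by simp
  have "integral\<^sup>L (D n) F = (LINT q|P n. F (layout T0 q))" for n unfolding D_def by (rule integral_distr[OF layout F_meas])
  also have "... n = itg (P n) f" for n
   by (intro integral_cong_AE circle_measurable[OF P(1) f_meas] measurable_compose[OF layout F_meas]
     eventually_mono[OF circle_measureD(4)[OF P(1)] F_layout])
  finally have "integral\<^sup>L (D n) F = itg (P n) f" for n .
  moreover have "integral\<^sup>L D' F = (LINT x|D'. case_prod f (unlayout T0 x))"
   using AE_Z' F(3) unlayout_on_track[OF T0 _ f] F_meas measurable_compose[OF unlayout f_meas]
   by (intro integral_cong_AE) (auto elim!: eventually_mono simp: case_prod_beta)
  hence "integral\<^sup>L D' F = itg P' f" unfolding P'_def using integral_distr[OF unlayout f_meas] by (simp add: case_prod_beta)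
  moreover have "(%n. integral\<^sup>L (D (r n)) F) \<longlonglongrightarrow> integral\<^sup>L D' F"
   using weak_conv_imp_integral_bdd_continuous_conv[OF D r(2,3), of F K] F(1,2) by (simp add: continuous_on_eq_continuous_at)
  ultimately show ?thesis by simp
 qed
 thus ?thesis using that r(1) circle_measure_unlayout[OF T0 r(2)] unfolding P'_def by blast
qed

lemma circle_seq_compact:
 fixes nu :: "nat => ('a::finite * real) measure"
 assumes T0: "T0 > 0" and nu: "\<And>n. circle_measure T0 (nu n)" and S: "\<And>n. measure (nu n) UNIV <= S"
 obtains r nu' where "strict_mono r" "circle_measure T0 nu'" "\<And>f. cont_per T0 f ==> (%n. itg (nu (r n)) f) \<longlonglongrightarrow> itg nu' f"
proof -
 define s where "s n = measure (nu n) UNIV" for n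
 obtain s' r1 where s': "s' \<in> {0..S}" "strict_mono r1" "(s \<circ> r1) \<longlonglongrightarrow> s'"
  using seq_compactE[OF compact_imp_seq_compact[OF compact_Icc], of s 0 S] S by (auto simp: s_def)
 have "\<forall>n. \<exists>P. circle_measure T0 P \<and> prob_space P \<and> (\<forall>f. cont_per T0 f --> itg (nu n) f = s n * itg P f)"
  unfolding s_def using circle_normalize[OF T0 nu] by metis
 then obtain P where P: "\<And>n. circle_measure T0 (P n)" "\<And>n. prob_space (P n)" "\<And>n f. cont_per T0 f ==> itg (nu n) f = s n * itg (P n) f"
  by metis
 obtain r2 P' where P': "strict_mono r2" "circle_measure T0 P'" "\<And>f. cont_per T0 f ==> (%n. itg (P (r1 (r2 n))) f) \<longlonglongrightarrow> itg P' f"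
  using that by (rule circle_prob_seq_compact[OF T0 P(1,2)[of "r1 _"]])
 note circle = circle_measureD[OF P'(2)]
 let ?nu' = "density P' (%_. ennreal s')"
 have "circle_measure T0 ?nu'"
  using P'(2) circle SpV_sets[where 'a = 'a] by (simp add: circle_measure_def emeasure_density_const ennreal_mult_less_top)
 moreover have "(%n. itg (nu ((r1 \<circ> r2) n)) f) \<longlonglongrightarrow> itg ?nu' f" if f: "cont_per T0 f" for f
 proof -
  have "(%n. s (r1 (r2 n)) * itg (P (r1 (r2 n))) f) \<longlonglongrightarrow> s' * itg P' f"
   using LIMSEQ_subseq_LIMSEQ[OF s'(3) P'(1)] by (intro tendsto_mult P'(3)[OF f]) (simp add: comp_def)
  moreover have "itg ?nu' f = s' * itg P' f"
   using circle_measurable[OF P'(2) cont_per_measurable[OF f]] s'(1) by (subst integral_density) auto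
  ultimately show ?thesis by (simp add: P(3)[OF f])
 qed
 ultimately show ?thesis using that[OF strict_mono_o[OF s'(2) P'(1)]] by blast
qed


text \<open>The linear correction makes the values at 0 and \<open>T0\<close> agree.\<close>
definition mono_per :: "real => nat => real => real" where
 "mono_per T0 k t = pmod t T0 ^ k - (T0 ^ k - 0 ^ k) * pmod t T0 / T0"

lemma mono_per_cont: "T0 > 0 ==> continuous_on UNIV (mono_per T0 k)" "T0 > 0 ==> mono_per T0 k (t + T0) = mono_per T0 k t"
 unfolding mono_per_def[abs_def]
 by (rule continuous_pmod_extension[where v = "%u. u ^ k - (T0 ^ k - 0 ^ k) * u / T0"]) (auto intro!: continuous_intros)

lemma mono_per_dense:
 assumes T0: "T0 > 0" and f: "continuous_on UNIV f" "\<And>t. f (t + T0) = f t" and e: "e > 0"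
 shows "\<exists>a n. \<forall>t. abs (f t - (\<Sum>k\<le>n. a k * mono_per T0 k t)) <= e"
proof -
 obtain g where g: "real_polynomial_function g" "\<And>u. u \<in> {0..T0} ==> abs (f u - g u) < e / 3"
  using Stone_Weierstrass_real_polynomial_function[of "{0..T0}" f "e / 3"] continuous_on_subset[OF f(1)] e by auto
 then obtain a n where a: "g = (%x. \<Sum>i\<le>n. a i * x ^ i)" using real_polynomial_function_iff_sum by auto
 have "abs (f t - (\<Sum>k\<le>n. a k * mono_per T0 k t)) <= e" for t
 proof -
  define u where "u = pmod t T0"
  have u: "0 <= u" "u < T0" "f u = f t" using pmod_bounds[OF T0] periodic_pmod[of f T0 t] f(2) by (auto simp: u_def)
  define v where "v = (g T0 - g 0) * (u / T0)"
  have "a k * mono_per T0 k t = a k * u ^ k - (a k * T0 ^ k - a k * 0 ^ k) * (u / T0)" for k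
   using T0 by (simp add: mono_per_def u_def[symmetric] field_simps)
  hence "(\<Sum>k\<le>n. a k * mono_per T0 k t) = g u - v"
   unfolding v_def a by (simp only: sum_subtractf sum_distrib_right[symmetric])
  moreover have "f T0 = f 0" using f(2)[of 0] by simp
  hence "abs (g T0 - g 0) <= 2 * (e / 3)" using g(2)[of 0] g(2)[of T0] T0 by (simp only: atLeastAtMost_iff) linarith
  hence "abs v <= 2 * (e / 3) * 1"
   unfolding abs_mult v_def using u T0 e by (intro mult_mono) auto
  moreover have "abs (f t - g u) < e / 3" using g(2)[of u] u by simp
  ultimately show ?thesis by linarith
 qed
 thus ?thesis by blast
qed

lemma weak_nbhd:
 assumes "generate_topology_on ({{(mu, Q). itg mu f \<in> U} | f U. cont_per T0 f \<and> open U} \<union>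
   {{(mu, Q). itg Q g \<in> U} | g U. cont_per T0 g \<and> open U}) W" "PQ \<in> W"
 shows "\<exists>S e. finite S \<and> e > 0 \<and> (\<forall>F\<in>S. cont_per T0 (fst F) \<and> cont_per T0 (snd F)) \<and>
  {PQ'. \<forall>F\<in>S. abs (ev (fst F) (snd F) PQ' - ev (fst F) (snd F) PQ) < e} \<subseteq> W"
 using assms
proof (induction rule: generate_topology_on.induct)
 case (Int a b)
 obtain S e where S: "finite S" "e > 0" "\<forall>F\<in>S. cont_per T0 (fst F) \<and> cont_per T0 (snd F)"
  "{PQ'. \<forall>F\<in>S. abs (ev (fst F) (snd F) PQ' - ev (fst F) (snd F) PQ) < e} \<subseteq> a" using Int by auto
 obtain S' e' where S': "finite S'" "e' > 0" "\<forall>F\<in>S'. cont_per T0 (fst F) \<and> cont_per T0 (snd F)"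
  "{PQ'. \<forall>F\<in>S'. abs (ev (fst F) (snd F) PQ' - ev (fst F) (snd F) PQ) < e'} \<subseteq> b" using Int by auto
 show ?case using S S' by (intro exI[of _ "S \<union> S'"] exI[of _ "min e e'"]) auto
next
 case (UN K)
 thus ?case by (meson UnionE Union_upper order_trans)
next
 case (Basis s)
 have ball: "\<exists>e>0. \<forall>v. abs (v - v0) < e --> v \<in> U" if "open U" "v0 \<in> U" for U and v0 :: real
  using that unfolding open_real by (metis)
 from Basis(1) consider f U where "s = {(mu, Q). itg mu f \<in> U}" "cont_per T0 f" "open U"
  | g U where "s = {(mu, Q). itg Q g \<in> U}" "cont_per T0 g" "open U" by blast
 thus ?case
 proof cases
  case 1
  then obtain e where "e > 0" "\<forall>v. abs (v - itg (fst PQ) f) < e --> v \<in> U" using ball[of U] Basis(2) by (cases PQ) auto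
  thus ?thesis using 1 by (intro exI[of _ "{(f, %_ _. 0)}"] exI[of _ e]) (auto simp: ev_def cont_per_def)
 next
  case 2
  then obtain e where "e > 0" "\<forall>v. abs (v - itg (snd PQ) g) < e --> v \<in> U" using ball[of U] Basis(2) by (cases PQ) auto
  thus ?thesis using 2 by (intro exI[of _ "{(%_ _. 0, g)}"] exI[of _ e]) (auto simp: ev_def cont_per_def)
 qed
qed auto

lemma Mstar_topspace: "topspace (Mstar_top T0 E) = Mstar T0 E"
proof -
 have "UNIV \<in> {{(mu, Q). itg mu f \<in> U} | f U. cont_per T0 f \<and> open U}"
  by (rule CollectI, rule exI[of _ "%_ _. 0"], rule exI[of _ UNIV]) (auto simp: cont_per_def)
 thus ?thesis unfolding Mstar_top_def weak_top_def by (auto simp: topology_generated_by_topspace)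
qed

lemma Mstar_nbhd:
 assumes "openin (Mstar_top T0 E) G" "PQ \<in> G"
 obtains S e where "finite S" "e > 0" "\<forall>F\<in>S. cont_per T0 (fst F) \<and> cont_per T0 (snd F)"
  "{PQ' \<in> Mstar T0 E. \<forall>F\<in>S. abs (ev (fst F) (snd F) PQ' - ev (fst F) (snd F) PQ) < e} \<subseteq> G"
proof -
 obtain W where W: "openin (weak_top T0) W" "G = W \<inter> Mstar T0 E"
  using assms(1) unfolding Mstar_top_def openin_subtopology by blast
 from weak_nbhd[OF W(1)[unfolded weak_top_def openin_topology_generated_by_iff], of PQ] assms(2) W(2) that
 show ?thesis by blast
qed

lemma ev_openin:
 assumes f: "cont_per T0 f" and g: "cont_per T0 g" and U: "open U"
 shows "openin (Mstar_top T0 E) {PQ \<in> Mstar T0 E. ev f g PQ \<in> U}"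
proof -
 let ?S = "{{(mu, Q). itg mu f \<in> U} | f U. cont_per T0 f \<and> open U} \<union>
   {{(mu, Q). itg Q g \<in> U} | g U. cont_per T0 g \<and> open U}"
 have "openin (weak_top T0) {PQ. itg (fst PQ) f \<in> V}"
  "openin (weak_top T0) {PQ. itg (snd PQ) g \<in> V}" if "open V" for V
  unfolding weak_top_def using that f g
  by (auto intro!: topology_generated_by_Basis exI[of _ f] exI[of _ g] exI[of _ V] simp: case_prod_beta)
 hence "openin (Mstar_top T0 E) {PQ \<in> Mstar T0 E. itg (fst PQ) f \<in> V}"
  "openin (Mstar_top T0 E) {PQ \<in> Mstar T0 E. itg (snd PQ) g \<in> V}" if "open V" for V
  using that unfolding Mstar_top_def openin_subtopology by blast+
 hence "continuous_map (Mstar_top T0 E) euclideanreal (%PQ. \<integral>p. f (fst p) (snd p) \<partial>fst PQ)"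
  "continuous_map (Mstar_top T0 E) euclideanreal (%PQ. \<integral>p. g (fst p) (snd p) \<partial>snd PQ)"
  unfolding continuous_map_def Mstar_topspace by auto
 from continuous_map_add[OF this] have "continuous_map (Mstar_top T0 E) euclideanreal (ev f g)" by (simp add: ev_def[abs_def])
 thus ?thesis using U unfolding continuous_map_def Mstar_topspace by auto
qed

lemma ev_sum:
 fixes E :: "('v::finite * 'v) set"
 assumes PQ: "PQ \<in> Mstar T0 E" and T0: "T0 > 0" and fg: "\<And>j. j \<in> J ==> cont_per T0 (f j)" "\<And>j. j \<in> J ==> cont_per T0 (g j)"
 shows "ev (%y t. \<Sum>j\<in>J. a j * f j y t) (%e t. \<Sum>j\<in>J. a j * g j e t) PQ = (\<Sum>j\<in>J. a j * ev (f j) (g j) PQ)"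
proof -
 obtain mu Q where PQ': "PQ = (mu, Q)" "(mu, Q) \<in> Mstar T0 E" using PQ by (cases PQ) auto
 show ?thesis
  using cont_per_integrable[OF Mstar_circle(1)[OF PQ'(2)] T0 fg(1)] cont_per_integrable[OF Mstar_circle(2)[OF PQ'(2)] T0 fg(2)]
  by (simp add: ev_def PQ'(1) sum.distrib[symmetric] distrib_left)
qed

lemma ev_close:
 fixes E :: "('v::finite * 'v) set"
 assumes PQ: "PQ \<in> Mstar T0 E" and T0: "T0 > 0" and fg: "cont_per T0 f" "cont_per T0 g" "cont_per T0 f'" "cont_per T0 g'"
  and d: "\<And>y t. abs (f y t - f' y t) <= d" "\<And>e t. abs (g e t - g' e t) <= d"
 shows "abs (ev f g PQ - ev f' g' PQ) <= d * (T0 + ev (%_ _. 0) (%_ _. 1) PQ)"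
proof -
 obtain mu Q where PQ': "PQ = (mu, Q)" "(mu, Q) \<in> Mstar T0 E" using PQ by (cases PQ) auto
 note circle = Mstar_circle[OF PQ'(2)]
 have part_le: "abs (itg nu u - itg nu u') <= d * measure nu UNIV"
  if nu: "circle_measure T0 nu" and u: "cont_per T0 u" "cont_per T0 u'" "\<And>y t. abs (u y t - u' y t) <= d" for nu and u u' :: "'b::finite => real => real"
 proof -
  interpret finite_measure nu by (rule circle_measureD(1)[OF nu])
  note integrables = cont_per_integrable[OF nu T0 u(1)] cont_per_integrable[OF nu T0 u(2)]
  have "abs (itg nu u - itg nu u') = abs (\<integral>p. u (fst p) (snd p) - u' (fst p) (snd p) \<partial>nu)" using integrables by simp
  also have "... <= (LINT p|nu. abs (u (fst p) (snd p) - u' (fst p) (snd p)))" by (rule integral_abs_bound)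
  also have "... <= (LINT p|nu. d)" using integrables u(3) by (intro integral_mono) auto
  finally show ?thesis using circle_measureD(3)[OF nu] by (simp add: mult.commute)
 qed
 have "measure mu UNIV = T0" using circle(4) T0 circle_measureD(3)[OF circle(1)] by (simp add: measure_def)
 thus ?thesis
  using part_le[OF circle(1) fg(1,3) d(1)] part_le[OF circle(2) fg(2,4) d(2)] circle_measureD(3)[OF circle(2)]
  by (simp add: ev_def PQ'(1) distrib_left)
qed

definition coord_f :: "real => ('v + 'v * 'v) \<times> nat => 'v tfun" where
 "coord_f T0 j y t = (if fst j = Inl y then mono_per T0 (snd j) t else 0)"

definition coord_g :: "real => ('v + 'v * 'v) \<times> nat => ('v * 'v) tfun" where
 "coord_g T0 j e t = (if fst j = Inr e then mono_per T0 (snd j) t else 0)"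

text \<open>Countably many functionals that determine the weak topology: open sets are pulled back from
 a countable product of real lines, so they are measurable, and sequential compactness implies compactness.\<close>
definition coords :: "real => ('v * real) measure \<times> (('v * 'v) * real) measure => ('v + 'v * 'v) \<times> nat => real" where
 "coords T0 PQ j = ev (coord_f T0 j) (coord_g T0 j) PQ"

lemma coord_cont_per: "T0 > 0 ==> cont_per T0 (coord_f T0 j)" "T0 > 0 ==> cont_per T0 (coord_g T0 j)"
proof -
 have "coord_f T0 j y = (if fst j = Inl y then mono_per T0 (snd j) else (%_. 0))"
  "coord_g T0 j x = (if fst j = Inr x then mono_per T0 (snd j) else (%_. 0))" for y x
  by (auto simp: coord_f_def coord_g_def fun_eq_iff)
 thus "T0 > 0 ==> cont_per T0 (coord_f T0 j)" "T0 > 0 ==> cont_per T0 (coord_g T0 j)"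
  using mono_per_cont by (simp_all add: cont_per_def)
qed


lemma coords_mass:
 fixes PQ :: "('v::finite * real) measure \<times> (('v * 'v) * real) measure"
 assumes T0: "T0 > 0" and PQ: "PQ \<in> Mstar T0 E"
 shows "(\<Sum>j\<in>range Inr \<times> {0}. coords T0 PQ j) = ev (%_ _. 0) (%_ _. 1) PQ"
proof -
 let ?J = "range Inr \<times> {0} :: (('v + 'v * 'v) \<times> nat) set"
 have f: "(\<Sum>j\<in>?J. 1 * coord_f T0 j y t) = 0" for y t by (rule sum.neutral) (auto simp: coord_f_def)
 have "(\<Sum>j\<in>?J. 1 * coord_g T0 j e t) = (\<Sum>j\<in>?J. if j = (Inr e, 0) then 1 else 0)" for e t
  by (rule sum.cong) (auto simp: coord_g_def mono_per_def)
 hence g: "(\<Sum>j\<in>?J. 1 * coord_g T0 j e t) = 1" for e t by simp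
 have "(\<Sum>j\<in>?J. 1 * coords T0 PQ j) = ev (%y t. \<Sum>j\<in>?J. 1 * coord_f T0 j y t) (%e t. \<Sum>j\<in>?J. 1 * coord_g T0 j e t) PQ"
  unfolding coords_def by (rule ev_sum[OF PQ T0 coord_cont_per[OF T0], symmetric])
 thus ?thesis unfolding f g by simp
qed

lemma coords_approx:
 fixes f :: "'v::finite tfun"
 assumes T0: "T0 > 0" and fg: "cont_per T0 f" "cont_per T0 g" and d: "d > 0"
 obtains l where "continuous_on UNIV l"
  "\<And>PQ. PQ \<in> Mstar T0 E ==> abs (ev f g PQ - l (coords T0 PQ)) <= d * (T0 + ev (%_ _. 0) (%_ _. 1) PQ)"
proof -
 define h where "h i = (case i of Inl y => f y | Inr x => g x)" for i
 have "\<forall>i. \<exists>a n. \<forall>t. abs (h i t - (\<Sum>k\<le>n. a k * mono_per T0 k t)) <= d"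
  using cont_perD[OF fg(1)] cont_perD[OF fg(2)] by (auto intro!: mono_per_dense[OF T0 _ _ d] simp: h_def split: sum.split)
 then obtain a n where a: "\<And>i t. abs (h i t - (\<Sum>k\<le>n i. a i k * mono_per T0 k t)) <= d" by metis
 define J where "J = (SIGMA i:UNIV. {..n i})"
 have select: "(\<Sum>j\<in>J. a (fst j) (snd j) * (if fst j = i then mono_per T0 (snd j) t else 0)) = (\<Sum>k\<le>n i. a i k * mono_per T0 k t)" for i t
 proof -
  have "(\<Sum>k\<le>n i'. a i' k * (if i' = i then mono_per T0 k t else 0)) = (if i' = i then \<Sum>k\<le>n i. a i k * mono_per T0 k t else 0)" for i' by simp
  moreover have "(\<Sum>i'\<in>UNIV. \<Sum>k\<le>n i'. a i' k * (if i' = i then mono_per T0 k t else 0))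
    = (\<Sum>j\<in>J. a (fst j) (snd j) * (if fst j = i then mono_per T0 (snd j) t else 0))"
   unfolding J_def by (subst sum.Sigma) (auto simp: case_prod_beta)
  ultimately show ?thesis by simp
 qed
 define l where "l th = (\<Sum>j\<in>J. a (fst j) (snd j) * th j)" for th
 have "continuous_on UNIV l"
  unfolding l_def[abs_def] by (intro continuous_intros continuous_on_product_coordinates)
 moreover have "abs (ev f g PQ - l (coords T0 PQ)) <= d * (T0 + ev (%_ _. 0) (%_ _. 1) PQ)" if PQ: "PQ \<in> Mstar T0 E" for PQ
 proof -
  have "l (coords T0 PQ) = ev (%y t. \<Sum>j\<in>J. a (fst j) (snd j) * coord_f T0 j y t) (%e t. \<Sum>j\<in>J. a (fst j) (snd j) * coord_g T0 j e t) PQ"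
   unfolding l_def coords_def by (rule ev_sum[OF PQ T0 coord_cont_per[OF T0], symmetric])
  thus ?thesis
   using a[of "Inl _"] a[of "Inr _"] fg select[of "Inl _"] select[of "Inr _"] T0
   by (simp only:) (intro ev_close[OF PQ T0], auto simp: h_def coord_f_def coord_g_def cont_per_def mono_per_cont intro!: continuous_intros)
 qed
 ultimately show ?thesis by (rule that)
qed

lemma ev_coords:
 fixes f :: "'v::finite tfun"
 assumes T0: "T0 > 0" and fg: "cont_per T0 f" "cont_per T0 g" and PQ: "PQ \<in> Mstar T0 E" and \<epsilon>: "\<epsilon> > 0"
 obtains U where "open U" "coords T0 PQ \<in> U" "\<And>PQ'. PQ' \<in> Mstar T0 E ==> coords T0 PQ' \<in> U ==> abs (ev f g PQ' - ev f g PQ) < \<epsilon>"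
proof -
 let ?m = "ev (%_ _. 0) (%_ _. 1)"
 define mass where "mass th = (\<Sum>j\<in>range Inr \<times> {0}. th j)" for th :: "('v + 'v * 'v) \<times> nat => real"
 have mass: "mass (coords T0 PQ') = ?m PQ'" if "PQ' \<in> Mstar T0 E" for PQ' :: "('v * real) measure \<times> (('v * 'v) * real) measure"
  unfolding mass_def by (rule coords_mass[OF T0 that])
 have m_nonneg: "0 <= ?m PQ" by (simp add: ev_def)
 define d where "d = \<epsilon> / (4 * (T0 + ?m PQ + 1))"
 have d: "d > 0" using \<epsilon> T0 m_nonneg by (simp add: d_def)
 obtain l where l: "continuous_on UNIV l" "\<And>PQ. PQ \<in> Mstar T0 E ==> abs (ev f g PQ - l (coords T0 PQ)) <= d * (T0 + ?m PQ)"
  using that by (rule coords_approx[OF T0 fg d])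
 let ?U = "{th. abs (l th - l (coords T0 PQ)) < \<epsilon> / 4} \<inter> {th. mass th < mass (coords T0 PQ) + 1}"
 have "continuous_on UNIV mass"
  unfolding mass_def[abs_def] by (intro continuous_intros continuous_on_product_coordinates)
 hence "open ?U" by (intro open_Int open_Collect_less continuous_intros l)
 moreover have "abs (ev f g PQ' - ev f g PQ) < \<epsilon>" if PQ': "PQ' \<in> Mstar T0 E" "coords T0 PQ' \<in> ?U" for PQ'
 proof -
  have "d * (T0 + ?m PQ') <= d * (T0 + ?m PQ + 1)" using d PQ'(2) mass[OF PQ] mass[OF PQ'(1)] by (intro mult_left_mono) auto
  moreover have "d * (T0 + ?m PQ) <= d * (T0 + ?m PQ + 1)" using d by (intro mult_left_mono) auto
  moreover have "d * (T0 + ?m PQ + 1) = \<epsilon> / 4"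
   using T0 m_nonneg nonzero_mult_div_cancel_right[of "T0 + ?m PQ + 1" "\<epsilon> / 4"] by (simp add: d_def)
  ultimately show ?thesis using l(2)[OF PQ] l(2)[OF PQ'(1)] PQ'(2) \<epsilon> by auto
 qed
 ultimately show ?thesis using that[of ?U] \<epsilon> by auto
qed


lemma Mstar_open_coords:
 fixes E :: "('v::finite * 'v) set"
 assumes T0: "T0 > 0" and G: "openin (Mstar_top T0 E) G"
 obtains U where "open U" "G = {PQ \<in> Mstar T0 E. coords T0 PQ \<in> U}"
proof -
 have GM: "G \<subseteq> Mstar T0 E" using openin_subset[OF G] by (simp add: Mstar_topspace)
 have "\<exists>U. open U \<and> coords T0 PQ \<in> U \<and> {PQ' \<in> Mstar T0 E. coords T0 PQ' \<in> U} \<subseteq> G" if PQ: "PQ \<in> G" for PQ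
 proof -
  obtain S e where S: "finite S" "e > 0" "\<forall>F\<in>S. cont_per T0 (fst F) \<and> cont_per T0 (snd F)"
   "{PQ' \<in> Mstar T0 E. \<forall>F\<in>S. abs (ev (fst F) (snd F) PQ' - ev (fst F) (snd F) PQ) < e} \<subseteq> G" by (rule Mstar_nbhd[OF G PQ])
  have "\<forall>F\<in>S. \<exists>U. open U \<and> coords T0 PQ \<in> U \<and> (\<forall>PQ'\<in>Mstar T0 E. coords T0 PQ' \<in> U --> abs (ev (fst F) (snd F) PQ' - ev (fst F) (snd F) PQ) < e)"
  proof
   fix F assume F: "F \<in> S"
   show "\<exists>U. open U \<and> coords T0 PQ \<in> U \<and> (\<forall>PQ'\<in>Mstar T0 E. coords T0 PQ' \<in> U --> abs (ev (fst F) (snd F) PQ' - ev (fst F) (snd F) PQ) < e)"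
    by (rule ev_coords[OF T0, of "fst F" "snd F" PQ E e]) (use S(2,3) F PQ GM in blast)+
  qed
  then obtain U where U: "\<forall>F\<in>S. open (U F) \<and> coords T0 PQ \<in> U F \<and> (\<forall>PQ'\<in>Mstar T0 E. coords T0 PQ' \<in> U F --> abs (ev (fst F) (snd F) PQ' - ev (fst F) (snd F) PQ) < e)"
   by (rule bchoice[THEN exE])
  hence "{PQ' \<in> Mstar T0 E. coords T0 PQ' \<in> (\<Inter>F\<in>S. U F)} \<subseteq> G" "coords T0 PQ \<in> (\<Inter>F\<in>S. U F)" using S(4) by blast+
  thus ?thesis using U S(1) by (intro exI[of _ "\<Inter>F\<in>S. U F"]) (simp add: open_INT)
 qed
 hence "\<forall>PQ\<in>G. \<exists>U. open U \<and> coords T0 PQ \<in> U \<and> {PQ' \<in> Mstar T0 E. coords T0 PQ' \<in> U} \<subseteq> G" by blast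
 then obtain U where U: "\<forall>PQ\<in>G. open (U PQ) \<and> coords T0 PQ \<in> U PQ \<and> {PQ' \<in> Mstar T0 E. coords T0 PQ' \<in> U PQ} \<subseteq> G"
  by (rule bchoice[THEN exE])
 have "G = {PQ \<in> Mstar T0 E. coords T0 PQ \<in> (\<Union>PQ\<in>G. U PQ)}" using U GM by blast
 moreover have "open (\<Union>PQ\<in>G. U PQ)" using U by (intro open_UN) blast
 ultimately show ?thesis using that by blast
qed


definition off_edge :: "('v * 'v) set => ('v * 'v) tfun" where
 "off_edge E e t = indicator (- E) e"

lemma Mstar_iff_off_edge:
 assumes mu: "circle_measure T0 mu" and Q: "circle_measure T0 Q"
 shows "(mu, Q) \<in> Mstar T0 E \<longleftrightarrow> emeasure mu UNIV = ennreal T0 \<and> itg Q (off_edge E) = 0"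
proof -
 note circle = circle_measureD[OF mu] circle_measureD[OF Q]
 have "E \<times> {0..<T0} \<in> sets Q" unfolding circle(6) by (rule SpV_times_sets) simp
 hence "UNIV - E \<times> {0..<T0} \<in> sets Q" using sets.compl_sets circle(7) by metis
 hence "emeasure Q (UNIV - E \<times> {0..<T0}) = 0 \<longleftrightarrow> (AE p in Q. p \<in> E \<times> {0..<T0})"
  using circle(7) by (subst AE_iff_measurable) auto
 also have "... \<longleftrightarrow> (AE p in Q. fst p \<in> E)"
 proof
  show "AE p in Q. p \<in> E \<times> {0..<T0}" if "AE p in Q. fst p \<in> E"
   using that circle(8) by eventually_elim (auto simp: mem_Times_iff)
 qed (auto elim!: eventually_mono)
 also have "... \<longleftrightarrow> itg Q (off_edge E) = 0"
 proof -
  have "integrable Q (%p. off_edge E (fst p) (snd p))" by (rule itg_integrable[OF Q]) (simp add: off_edge_def[abs_def])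
  thus ?thesis by (subst integral_nonneg_eq_0_iff_AE) (auto simp: off_edge_def indicator_def)
 qed
 finally show ?thesis using mu Q circle by (auto simp: Mstar_def circle_measure_def)
qed

lemma compactin_of_coordinates:
 assumes coords: "\<And>G. openin X G ==> \<exists>U. open U \<and> G = {x \<in> topspace X. c x \<in> U}"
  and K: "K \<subseteq> topspace X" "compact (c ` K)"
 shows "compactin X K"
 unfolding compactin_def
proof (intro conjI allI impI K)
 fix UU assume UU: "Ball UU (openin X) \<and> K \<subseteq> \<Union>UU"
 have "\<forall>G\<in>UU. \<exists>U. open U \<and> (\<forall>x. x \<in> G \<longleftrightarrow> x \<in> topspace X \<and> c x \<in> U)"
 proof
  fix G assume "G \<in> UU"
  hence "openin X G" using UU by blast
  from coords[OF this] show "\<exists>U. open U \<and> (\<forall>x. x \<in> G \<longleftrightarrow> x \<in> topspace X \<and> c x \<in> U)" by blast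
 qed
 then obtain U where U: "\<forall>G\<in>UU. open (U G) \<and> (\<forall>x. x \<in> G \<longleftrightarrow> x \<in> topspace X \<and> c x \<in> U G)" by (rule bchoice[THEN exE])
 have "c ` K \<subseteq> (\<Union>G\<in>UU. U G)"
 proof (rule image_subsetI)
  fix x assume "x \<in> K"
  then obtain G where "G \<in> UU" "x \<in> G" using UU by blast
  thus "c x \<in> (\<Union>G\<in>UU. U G)" using U by blast
 qed
 then obtain D where D: "D \<subseteq> UU" "finite D" "c ` K \<subseteq> (\<Union>G\<in>D. U G)"
  by (rule compactE_image[OF K(2), rotated]) (use U in auto)
 have "x \<in> \<Union>D" if x: "x \<in> K" for x
 proof -
  obtain G where "G \<in> D" "c x \<in> U G" using D(3) x by blast
  thus ?thesis using U D(1) x K(1) by blast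
 qed
 thus "\<exists>FF. finite FF \<and> FF \<subseteq> UU \<and> K \<subseteq> \<Union>FF" using D(1,2) by blast
qed

lemma Mstar_seq_compact:
 fixes PQ :: "nat => ('v::finite * real) measure \<times> (('v * 'v) * real) measure"
 assumes T0: "T0 > 0" and PQ: "\<And>n. PQ n \<in> Mstar T0 E" "\<And>n. ev (%_ _. 0) (%_ _. 1) (PQ n) <= b"
 obtains r PQ' where "strict_mono r" "PQ' \<in> Mstar T0 E"
  "\<And>f g. cont_per T0 f ==> cont_per T0 g ==> (%n. ev f g (PQ (r n))) \<longlonglongrightarrow> ev f g PQ'"
proof -
 have "(fst (PQ n), snd (PQ n)) \<in> Mstar T0 E" for n using PQ(1)[of n] by simp
 note Mstar = Mstar_circle[OF this] Mstar_iff_off_edge[OF Mstar_circle(1,2)[OF this], THEN iffD1, OF this]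
 have mass: "measure (fst (PQ n)) UNIV = T0" for n using Mstar(5)[of n] T0 by (simp add: measure_def)
 obtain r1 mu where mu: "strict_mono r1" "circle_measure T0 mu" "\<And>f. cont_per T0 f ==> (%n. itg (fst (PQ (r1 n))) f) \<longlonglongrightarrow> itg mu f"
  using that by (rule circle_seq_compact[OF T0 Mstar(1) eq_refl[OF mass]])
 have "measure (snd (PQ (r1 n))) UNIV <= b" for n
  using PQ(2)[of "r1 n"] circle_measureD(3)[OF Mstar(2)[of "r1 n"]] by (simp add: ev_def)
 then obtain r2 Q where Q: "strict_mono r2" "circle_measure T0 Q"
   "\<And>g. cont_per T0 g ==> (%n. itg (snd (PQ (r1 (r2 n)))) g) \<longlonglongrightarrow> itg Q g"
  using that by (rule circle_seq_compact[OF T0 Mstar(2)])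
 have mu_lim: "(%n. itg (fst (PQ (r1 (r2 n)))) f) \<longlonglongrightarrow> itg mu f" if "cont_per T0 f" for f
  using LIMSEQ_subseq_LIMSEQ[OF mu(3)[OF that] Q(1)] by (simp add: comp_def)
 interpret finite_measure mu by (rule circle_measureD(1)[OF mu(2)])
 have "measure mu UNIV = T0"
  using mu(3)[of "%_ _. 1"] mass circle_measureD(3)[OF Mstar(1)] circle_measureD(3)[OF mu(2)]
  by (simp add: cont_per_const LIMSEQ_const_iff)
 moreover have "itg Q (off_edge E) = 0"
  using Q(3)[of "off_edge E"] Mstar(5) by (simp add: off_edge_def[abs_def] cont_per_const LIMSEQ_const_iff)
 ultimately have "(mu, Q) \<in> Mstar T0 E" unfolding Mstar_iff_off_edge[OF mu(2) Q(2)] by (simp add: emeasure_eq_measure)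
 thus ?thesis
  using mu_lim Q(3) by (intro that[OF strict_mono_o[OF mu(1) Q(1)]]) (auto simp: ev_def intro!: tendsto_add)
qed

lemma Mstar_compact:
 fixes E :: "('v::finite * 'v) set"
 assumes T0: "T0 > 0"
 shows "compactin (Mstar_top T0 E) {PQ \<in> Mstar T0 E. ev (%_ _. 0) (%_ _. 1) PQ <= b}" (is "compactin _ ?K")
proof (rule compactin_of_coordinates[where c = "coords T0"])
 show "\<exists>U. open U \<and> G = {PQ \<in> topspace (Mstar_top T0 E). coords T0 PQ \<in> U}" if "openin (Mstar_top T0 E) G" for G
  unfolding Mstar_topspace by (rule Mstar_open_coords[OF T0 that]) blast
 have "seq_compact (coords T0 ` ?K)"
 proof (rule seq_compactI)
  fix th :: "nat => ('v + 'v * 'v) \<times> nat => real" assume "\<forall>n. th n \<in> coords T0 ` ?K"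
  hence "\<forall>n. \<exists>PQ. PQ \<in> ?K \<and> th n = coords T0 PQ" by blast
  from choice[OF this] obtain PQ where PQ: "\<And>n. PQ n \<in> ?K" "\<And>n. th n = coords T0 (PQ n)" by blast
  have "PQ n \<in> Mstar T0 E" "ev (%_ _. 0) (%_ _. 1) (PQ n) <= b" for n using PQ(1)[of n] by auto
  then obtain r PQ' where r: "strict_mono r" "PQ' \<in> Mstar T0 E"
    "\<And>f g. cont_per T0 f ==> cont_per T0 g ==> (%n. ev f g (PQ (r n))) \<longlonglongrightarrow> ev f g PQ'"
   using that by (rule Mstar_seq_compact[OF T0])
  have "ev (%_ _. 0) (%_ _. 1) PQ' <= b" using PQ(1) by (intro LIMSEQ_le_const2[OF r(3)]) (auto simp: cont_per_const)
  moreover have "limitin (product_topology (%_. euclidean) UNIV) (th \<circ> r) (coords T0 PQ') sequentially"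
   unfolding limitin_componentwise using r(3)[OF coord_cont_per[OF T0]] by (simp add: PQ(2) comp_def coords_def)
  hence "(th \<circ> r) \<longlonglongrightarrow> coords T0 PQ'" unfolding euclidean_product_topology by simp
  ultimately show "\<exists>l\<in>coords T0 ` ?K. \<exists>r. strict_mono r \<and> (th \<circ> r) \<longlonglongrightarrow> l"
   using r(1,2) by (intro bexI[of _ "coords T0 PQ'"] exI[of _ r] conjI imageI) simp_all
 qed
 thus "compact (coords T0 ` ?K)" by (simp add: compact_eq_seq_compact_metric)
qed (auto simp: Mstar_topspace)

section \<open>The large deviation principle\<close>

lemma nn_integral_mix:
 assumes s: "sets nu1 = sets nu" "sets nu2 = sets nu" and e: "\<And>A. A \<in> sets nu ==> emeasure nu A = a * emeasure nu1 A + b * emeasure nu2 A"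
  and F: "F \<in> borel_measurable nu"
 shows "(\<integral>\<^sup>+p. F p \<partial>nu) = a * (\<integral>\<^sup>+p. F p \<partial>nu1) + b * (\<integral>\<^sup>+p. F p \<partial>nu2)"
proof -
 have meas: "measurable nu1 (borel :: ennreal measure) = measurable nu borel" "measurable nu2 (borel :: ennreal measure) = measurable nu borel"
  using s by (auto intro!: measurable_cong_sets)
 note space_eq = sets_eq_imp_space_eq[OF s(1)] sets_eq_imp_space_eq[OF s(2)]
 from F show ?thesis
 proof (induction rule: borel_measurable_induct)
  case (cong f g)
  thus ?case using nn_integral_cong[of nu f g] nn_integral_cong[of nu1 f g] nn_integral_cong[of nu2 f g] space_eq by simp
 next
  case (set A) thus ?case using s e by simp
 next
  case (mult u v) thus ?case using meas by (simp add: nn_integral_cmult distrib_left mult.left_commute)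
 next
  case (add u v) thus ?case using meas by (simp add: nn_integral_add distrib_left ac_simps)
 next
  case (seq U)
  have incseq: "incseq (%i. \<integral>\<^sup>+p. U i p \<partial>N)" for N using seq(3) by (auto simp: incseq_def le_fun_def intro!: nn_integral_mono)
  have U: "(\<integral>\<^sup>+p. (SUP i. U i) p \<partial>N) = (SUP i. \<integral>\<^sup>+p. U i p \<partial>N)" if "measurable N (borel :: ennreal measure) = measurable nu borel" for N
   using nn_integral_monotone_convergence_SUP[of U N] seq that by (simp add: SUP_apply[abs_def])
  show ?case
   unfolding U[OF refl] U[OF meas(1)] U[OF meas(2)] SUP_mult_left_ennreal seq.IH
   using incseq by (intro ennreal_SUP_add) (auto simp: incseq_def intro!: mult_left_mono)
 qed
qed

lemma integral_mix:
 fixes nu :: "('a::finite * real) measure"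
 assumes c: "circle_measure T0 nu" "circle_measure T0 nu1" "circle_measure T0 nu2" and ab: "0 <= a" "0 <= b"
  and mix: "\<And>A. A \<in> sets SpV ==> emeasure nu A = ennreal a * emeasure nu1 A + ennreal b * emeasure nu2 A"
  and f: "cont_per T0 f" and T0: "T0 > 0"
 shows "itg nu f = a * itg nu1 f + b * itg nu2 f"
proof -
 obtain K where K: "K >= 0" "\<And>y t. abs (f y t) <= K" using that by (rule cont_per_bounded[OF f T0])
 note circle = circle_measureD[OF c(1)] circle_measureD[OF c(2)] circle_measureD[OF c(3)]
 have nonneg_case: "itg nu h = a * itg nu1 h + b * itg nu2 h"
  if h: "cont_per T0 h" "\<And>y t. 0 <= h y t" for h
 proof -
  have itg: "ennreal (itg N h) = (\<integral>\<^sup>+p. h (fst p) (snd p) \<partial>N)" if "circle_measure T0 N" for N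
   using h by (intro nn_integral_eq_integral[symmetric] cont_per_integrable[OF that T0]) auto
  have nonneg: "0 <= itg N h" for N using h(2) by simp
  have "ennreal (itg nu h) = ennreal a * ennreal (itg nu1 h) + ennreal b * ennreal (itg nu2 h)"
   unfolding itg[OF c(1)] itg[OF c(2)] itg[OF c(3)]
   by (rule nn_integral_mix) (use circle mix circle_measurable[OF c(1)] cont_per_measurable[OF h(1)] in auto)
  also have "... = ennreal (a * itg nu1 h + b * itg nu2 h)"
   using ab nonneg by (simp add: ennreal_mult ennreal_plus)
  finally show ?thesis using ab nonneg by (subst (asm) ennreal_inj) auto
 qed
 have shifted: "(LINT p|N. f (fst p) (snd p) + K) = itg N f + (LINT p|N. K)" if "circle_measure T0 N" for N
  using cont_per_integrable[OF that T0 f] finite_measure.integrable_const[OF circle_measureD(1)[OF that]] by (subst Bochner_Integration.integral_add) auto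
 have "0 <= f y t + K" for y t using K(2)[of y t] by linarith
 hence "(LINT p|nu. f (fst p) (snd p) + K) = a * (LINT p|nu1. f (fst p) (snd p) + K) + b * (LINT p|nu2. f (fst p) (snd p) + K)"
  by (intro nonneg_case[of "%y t. f y t + K"] cont_per_add f cont_per_const)
 moreover have "(LINT p|nu. K) = a * (LINT p|nu1. K) + b * (LINT p|nu2. K)"
  by (rule nonneg_case[of "%_ _. K"]) (use K in \<open>auto simp: cont_per_const\<close>)
 ultimately show ?thesis unfolding shifted[OF c(1)] shifted[OF c(2)] shifted[OF c(3)] by (simp add: distrib_left)
qed

lemma integral_scale_measure:
 fixes f :: "'a => real"
 assumes "0 <= c" "f \<in> borel_measurable M" shows "(LINT x|scale_measure (ennreal c) M. f x) = c * (LINT x|M. f x)"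
proof -
 have "scale_measure (ennreal c) M = density M (%_. ennreal c)" by (rule measure_eqI) (auto simp: emeasure_density_const)
 thus ?thesis using assms by (simp add: integral_density)
qed

lemma limsup_eln_le:
 assumes p: "\<And>n. n >= 1 ==> p n <= K * exp (- (real n * a))" and K: "K > 0"
 shows "limsup (%n. eln (p n) / ereal (real n)) <= ereal (- a)"
proof -
 have "limsup (%n. eln (p n) / ereal (real n)) <= limsup (%n. ereal (ln K / real n - a))"
 proof (rule Limsup_mono)
  show "\<forall>\<^sub>F n in sequentially. eln (p n) / ereal (real n) <= ereal (ln K / real n - a)"
   using eventually_ge_at_top[of 1]
  proof eventually_elim
   case (elim n)
   show ?case
   proof (cases "p n <= 0")
    case False
    hence "ln (p n) <= ln (K * exp (- (real n * a)))" using p[OF elim] by simp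
    hence "ln (p n) / real n <= (ln K - real n * a) / real n" using K by (simp add: ln_mult divide_right_mono)
    thus ?thesis using False elim by (simp add: eln_def diff_divide_distrib)
   qed (use elim in \<open>simp add: eln_def\<close>)
  qed
 qed
 also have "(%n. ln K / real n - a) \<longlonglongrightarrow> 0 - a" by (intro tendsto_diff tendsto_const lim_const_over_n)
 hence "limsup (%n. ereal (ln K / real n - a)) = ereal (- a)" by (intro lim_imp_Limsup) auto
 finally show ?thesis .
qed

lemma liminf_eln_ge:
 assumes p: "\<And>n. n >= N ==> k * exp (- (real n * a)) <= p n" and k: "k > 0"
 shows "ereal (- a) <= liminf (%n. eln (p n) / ereal (real n))"
proof -
 have "(%n. ln k / real n - a) \<longlonglongrightarrow> 0 - a" by (intro tendsto_diff tendsto_const lim_const_over_n)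
 hence "ereal (- a) = liminf (%n. ereal (ln k / real n - a))" by (intro lim_imp_Liminf[symmetric]) auto
 also have "... <= liminf (%n. eln (p n) / ereal (real n))"
 proof (rule Liminf_mono)
  show "\<forall>\<^sub>F n in sequentially. ereal (ln k / real n - a) <= eln (p n) / ereal (real n)"
   using eventually_ge_at_top[of "max 1 N"]
  proof eventually_elim
   case (elim n)
   have pos: "0 < k * exp (- (real n * a))" using k by simp
   hence "ln (k * exp (- (real n * a))) <= ln (p n)" using p[of n] elim by simp
   hence "(ln k - real n * a) / real n <= ln (p n) / real n" using k by (simp add: ln_mult divide_right_mono)
   thus ?case using pos p[of n] elim by (simp add: eln_def diff_divide_distrib)
  qed
 qed
 finally show ?thesis .
qed


lemma sum_fun_upd:
 fixes th :: "'i => real"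
 assumes "finite S" "i \<in> S"
 shows "(\<Sum>j\<in>S. h j ((th(i := th i + s)) j)) = (\<Sum>j\<in>S. h j (th j)) + (h i (th i + s) - h i (th i) :: real)"
 using assms by (simp add: sum.remove[of S i])

definition quad_bound :: "'i set => (('i => real) => real) => real => real => ('i => real) => ('i => real) => bool" where
 "quad_bound S F C s0 th w \<longleftrightarrow> (\<forall>i\<in>S. \<forall>s. abs s <= s0 --> F (th(i := th i + s)) <= F th + s * w i + C * s\<^sup>2)"

definition penalised :: "'i set => ('i => real) => real => (('i => real) => real) => ('i => real) => real" where
 "penalised S v \<eta> F th = F th - (\<Sum>i\<in>S. th i * v i) + \<eta> * (\<Sum>i\<in>S. (th i)\<^sup>2)"

lemma penalised_near_minimiser:
 assumes lower: "\<And>th. (\<Sum>i\<in>S. th i * v i) - a <= F th" and zero: "F (%_. 0) = 0" and \<eta>: "\<eta> > 0" and \<kappa>: "0 < \<kappa>" "\<kappa> <= 1"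
 obtains th where "\<And>th'. penalised S v \<eta> F th <= penalised S v \<eta> F th' + \<kappa>\<^sup>2" "\<eta> * (\<Sum>i\<in>S. (th i)\<^sup>2) <= a + 1"
proof -
 let ?J = "penalised S v \<eta> F"
 have J_lower: "\<eta> * (\<Sum>i\<in>S. (th i)\<^sup>2) - a <= ?J th" for th using lower[of th] by (simp add: penalised_def)
 have "- a <= ?J th" for th
  using J_lower[of th] mult_nonneg_nonneg[OF less_imp_le[OF \<eta>] sum_nonneg[of S "%i. (th i)\<^sup>2"]] by simp
 hence bdd: "bdd_below (range ?J)" by (intro bdd_belowI[of _ "- a"]) auto
 obtain th where th: "?J th < Inf (range ?J) + \<kappa>\<^sup>2" using cInf_lessD[of "range ?J" "Inf (range ?J) + \<kappa>\<^sup>2"] \<kappa> by auto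
 have near: "?J th <= ?J th' + \<kappa>\<^sup>2" for th' using th cInf_lower[OF _ bdd, of "?J th'"] by (auto intro: less_imp_le order_trans)
 have "?J (%_. 0) = 0" by (simp add: penalised_def zero)
 moreover have "\<kappa>\<^sup>2 <= 1" using \<kappa> by (intro power_le_one) auto
 ultimately have "\<eta> * (\<Sum>i\<in>S. (th i)\<^sup>2) <= a + 1" using near[of "%_. 0"] J_lower[of th] by linarith
 thus ?thesis using that near by blast
qed

lemma penalised_near_minimiser_slope:
 assumes S: "finite S" "i \<in> S" and near: "\<And>th'. penalised S v \<eta> F th <= penalised S v \<eta> F th' + \<kappa>\<^sup>2"
  and quad: "quad_bound S F C s0 th w" and \<kappa>: "0 < \<kappa>" "\<kappa> <= s0"
 shows "abs (v i - w i - 2 * \<eta> * th i) <= (C + \<eta> + 1) * \<kappa>"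
proof -
 define x y where "x = v i - w i - 2 * \<eta> * th i" and "y = (C + \<eta> + 1) * \<kappa>"
 have slope: "s * x <= y * \<kappa>" if s: "abs s = \<kappa>" for s
 proof -
  have "penalised S v \<eta> F (th(i := th i + s)) = F (th(i := th i + s)) - ((\<Sum>j\<in>S. th j * v j) + s * v i)
    + \<eta> * ((\<Sum>j\<in>S. (th j)\<^sup>2) + ((th i + s)\<^sup>2 - (th i)\<^sup>2))"
   using sum_fun_upd[OF S, of "%j x. x * v j"] sum_fun_upd[OF S, of "%j x. x\<^sup>2"]
   by (simp add: penalised_def distrib_right del: fun_upd_apply)
  moreover have "F (th(i := th i + s)) <= F th + s * w i + C * s\<^sup>2" using quad S(2) s \<kappa> unfolding quad_bound_def by auto
  ultimately have "0 <= s * w i + C * s\<^sup>2 - s * v i + \<eta> * (2 * th i * s + s\<^sup>2) + \<kappa>\<^sup>2"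
   using near[of "th(i := th i + s)"] by (simp add: penalised_def[of _ _ _ _ th] power2_sum algebra_simps)
  moreover have "s\<^sup>2 = \<kappa>\<^sup>2" using s by (metis power2_abs)
  ultimately show ?thesis by (simp add: x_def y_def power2_eq_square algebra_simps)
 qed
 have "\<kappa> * x <= \<kappa> * y" "\<kappa> * (- x) <= \<kappa> * y" using slope[of \<kappa>] slope[of "- \<kappa>"] \<kappa>(1) by (simp_all add: mult.commute)
 from this[THEN mult_left_le_imp_le[OF _ \<kappa>(1)]] show ?thesis unfolding x_def[symmetric] y_def[symmetric] by (simp add: abs_le_iff)
qed

text \<open>The penalty \<open>\<eta> |th|\<^sup>2\<close> confines the near minimiser to a ball on which the quadratic bound is uniform.\<close>
lemma slopes_near:
 fixes F :: "('i => real) => real"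
 assumes S: "finite S" and lower: "\<And>th. (\<Sum>i\<in>S. th i * v i) - a <= F th" and zero: "F (%_. 0) = 0"
  and a: "0 <= a" and \<epsilon>: "\<epsilon> > 0" and \<delta>: "\<delta> > 0"
  and smooth: "\<And>r. r > 0 ==> \<exists>C\<ge>0. \<exists>s0>0. s0 <= 1 \<and> (\<forall>th. (\<forall>i\<in>S. abs (th i) <= r) --> (\<exists>w. quad_bound S F C s0 th w))"
 obtains th w C s0 where "C >= 0" "s0 > 0" "quad_bound S F C s0 th w" "\<And>i. i \<in> S ==> abs (v i - w i) <= \<epsilon>"
  "- (a + \<delta>) <= F th - (\<Sum>i\<in>S. th i * w i)"
proof -
 define \<eta> where "\<eta> = (\<epsilon> / 4)\<^sup>2 / (a + 1)"
 have \<eta>: "\<eta> > 0" "\<eta> * (a + 1) = (\<epsilon> / 4)\<^sup>2" using \<epsilon> a by (auto simp: \<eta>_def)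
 define r where "r = \<epsilon> / (4 * \<eta>)"
 have r: "r > 0" using \<epsilon> \<eta> by (simp add: r_def)
 obtain C s0 where C: "C >= 0" "s0 > 0" "s0 <= 1" "\<And>th. \<forall>i\<in>S. abs (th i) <= r ==> \<exists>w. quad_bound S F C s0 th w" using smooth[OF r] by metis
 define c where "c = C + \<eta> + 1"
 define R where "R = real (card S) * r + 1"
 have pos: "c > 0" "R > 0" using C(1) \<eta> r by (auto simp: c_def R_def intro!: add_nonneg_pos mult_nonneg_nonneg)
 define \<kappa> where "\<kappa> = min s0 (min (\<epsilon> / (2 * c)) (\<delta> / (R * c)))"
 have "\<kappa> <= \<epsilon> / (2 * c)" "\<kappa> <= \<delta> / (R * c)" by (auto simp: \<kappa>_def)
 hence \<kappa>: "0 < \<kappa>" "\<kappa> <= s0" "c * \<kappa> <= \<epsilon> / 2" "c * \<kappa> * R <= \<delta>" using C \<epsilon> \<delta> pos by (auto simp: \<kappa>_def field_simps)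
 have "\<kappa> <= 1" using \<kappa>(2) C(3) by simp
 obtain th where th: "\<And>th'. penalised S v \<eta> F th <= penalised S v \<eta> F th' + \<kappa>\<^sup>2" "\<eta> * (\<Sum>i\<in>S. (th i)\<^sup>2) <= a + 1"
  using that by (rule penalised_near_minimiser[OF lower zero \<eta>(1) \<kappa>(1) \<open>\<kappa> <= 1\<close>])
 have small: "\<eta> * abs (th i) <= \<epsilon> / 4" if i: "i \<in> S" for i
 proof (rule power2_le_imp_le)
  have "(th i)\<^sup>2 <= (\<Sum>i\<in>S. (th i)\<^sup>2)" using S i by (intro member_le_sum) auto
  hence "\<eta> * (th i)\<^sup>2 <= a + 1" using th(2) \<eta>(1) by (meson mult_left_mono less_imp_le order_trans)
  hence "\<eta> * (\<eta> * (th i)\<^sup>2) <= \<eta> * (a + 1)" using \<eta>(1) by (intro mult_left_mono) auto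
  thus "(\<eta> * abs (th i))\<^sup>2 <= (\<epsilon> / 4)\<^sup>2" by (simp add: \<eta>(2) power_mult_distrib power2_eq_square mult_ac)
 qed (use \<epsilon> in simp)
 have ball: "abs (th i) <= r" if "i \<in> S" for i using small[OF that] \<eta>(1) by (simp add: r_def field_simps)
 then obtain w where w: "quad_bound S F C s0 th w" using C(4) by blast
 have slope: "abs (v i - w i - 2 * \<eta> * th i) <= c * \<kappa>" if "i \<in> S" for i
  unfolding c_def by (rule penalised_near_minimiser_slope[OF S that th(1) w \<kappa>(1,2)])
 show ?thesis
 proof (rule that[OF C(1,2) w])
  show "abs (v i - w i) <= \<epsilon>" if i: "i \<in> S" for i
  proof -
   have "abs (2 * \<eta> * th i) <= \<epsilon> / 2" using small[OF i] \<eta>(1) by (simp add: abs_mult)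
   thus ?thesis using slope[OF i] \<kappa>(3) by linarith
  qed
  have "(\<Sum>i\<in>S. - (c * \<kappa> * r)) <= (\<Sum>i\<in>S. th i * (v i - w i))"
  proof (rule sum_mono)
   fix i assume i: "i \<in> S"
   have "abs (th i * (v i - w i - 2 * \<eta> * th i)) <= r * (c * \<kappa>)"
    unfolding abs_mult using ball[OF i] slope[OF i] r by (intro mult_mono) auto
   moreover have "0 <= \<eta> * (th i * th i)" using \<eta>(1) by simp
   ultimately show "- (c * \<kappa> * r) <= th i * (v i - w i)" by (simp add: abs_le_iff algebra_simps)
  qed
  moreover have "(\<Sum>i\<in>S. - (c * \<kappa> * r)) = - (c * \<kappa> * R) + c * \<kappa>" by (simp add: R_def algebra_simps)
  moreover have "0 <= c * \<kappa>" using pos \<kappa>(1) by simp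
  ultimately show "- (a + \<delta>) <= F th - (\<Sum>i\<in>S. th i * w i)"
   using lower[of th] \<kappa>(4) by (simp add: right_diff_distrib sum_subtractf)
 qed
qed

lemma exp_tilt_le:
 fixes th w x :: "'i => real" and \<epsilon> :: real
 assumes S: "finite S" and \<sigma>: "\<sigma> > 0" and N: "N >= 0"
 defines "window \<equiv> \<forall>i\<in>S. abs (x i - N * w i) < N * \<epsilon>"
 shows "exp (\<Sum>i\<in>S. th i * x i) <= of_bool window * exp (N * (\<Sum>i\<in>S. th i * w i + \<epsilon> * abs (th i)))
   + (\<Sum>d\<in>S \<times> {\<sigma>, - \<sigma>}. exp (- (N * (snd d * w (fst d) + \<sigma> * \<epsilon>))) * exp (\<Sum>i\<in>S. (th(fst d := th (fst d) + snd d)) i * x i))"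
proof (cases window)
 case True
 have "th i * x i <= N * (th i * w i + \<epsilon> * abs (th i))" if "i \<in> S" for i
 proof -
  have "abs (x i - N * w i) <= N * \<epsilon>" using True that by (auto simp: window_def less_imp_le)
  hence "abs (th i * (x i - N * w i)) <= abs (th i) * (N * \<epsilon>)" unfolding abs_mult by (rule mult_left_mono) simp
  thus ?thesis by (simp add: abs_le_iff algebra_simps)
 qed
 hence "(\<Sum>i\<in>S. th i * x i) <= N * (\<Sum>i\<in>S. th i * w i + \<epsilon> * abs (th i))" unfolding sum_distrib_left by (rule sum_mono)
 hence "exp (\<Sum>i\<in>S. th i * x i) <= of_bool window * exp (N * (\<Sum>i\<in>S. th i * w i + \<epsilon> * abs (th i)))" using True by simp
 thus ?thesis by (rule add_increasing2[OF sum_nonneg, rotated]) simp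
next
 case False
 then obtain i where i: "i \<in> S" "N * \<epsilon> <= abs (x i - N * w i)" by (auto simp: window_def not_less)
 define s where "s = (if 0 <= x i - N * w i then \<sigma> else - \<sigma>)"
 have "\<sigma> * (N * \<epsilon>) <= \<sigma> * abs (x i - N * w i)" using i(2) \<sigma> by simp
 also have "... = s * (x i - N * w i)" by (simp add: s_def abs_if right_diff_distrib)
 finally have "0 <= - (N * (s * w i + \<sigma> * \<epsilon>)) + s * x i" by (simp add: algebra_simps)
 moreover have "(\<Sum>j\<in>S. (th(i := th i + s)) j * x j) = (\<Sum>j\<in>S. th j * x j) + s * x i"
  using sum_fun_upd[OF S i(1), of "%j t. t * x j"] by (simp add: distrib_right del: fun_upd_apply)
 ultimately have "exp (\<Sum>j\<in>S. th j * x j) <= exp (- (N * (s * w i + \<sigma> * \<epsilon>))) * exp (\<Sum>j\<in>S. (th(i := th i + s)) j * x j)"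
  by (simp add: mult_exp_exp del: fun_upd_apply)
 also have "... <= (\<Sum>d\<in>S \<times> {\<sigma>, - \<sigma>}. exp (- (N * (snd d * w (fst d) + \<sigma> * \<epsilon>))) * exp (\<Sum>i\<in>S. (th(fst d := th (fst d) + snd d)) i * x i))"
  using S i(1) by (intro order_trans[OF _ member_le_sum[of "(i, s)"]]) (auto simp: s_def simp del: fun_upd_apply)
 finally show ?thesis using False by simp
qed

lemma eventually_ge_of_exp_gap:
 fixes P :: "nat => real"
 assumes k: "k > 0" and \<gamma>: "\<gamma> > 0"
  and gap: "\<And>n. n >= 1 ==> k * exp (real n * l) <= P n * exp (real n * b) + K * exp (real n * (l - \<gamma>))"
 obtains N where "\<And>n. n >= N ==> k / 2 * exp (real n * (l - b)) <= P n"
proof -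
 have "(%n. K * exp (- (\<gamma> * real n))) \<longlonglongrightarrow> K * 0"
  by (intro tendsto_intros filterlim_compose[OF exp_at_bot] filterlim_compose[OF filterlim_uminus_at_bot_at_top]
    filterlim_tendsto_pos_mult_at_top[OF tendsto_const \<gamma> filterlim_real_sequentially])
 hence "\<forall>\<^sub>F n in sequentially. K * exp (- (\<gamma> * real n)) < k / 2" using k by (intro order_tendstoD) auto
 then obtain N where N: "\<And>n. n >= N ==> K * exp (- (\<gamma> * real n)) < k / 2" by (auto simp: eventually_sequentially)
 have "k / 2 * exp (real n * (l - b)) <= P n" if n: "n >= max N 1" for n
 proof -
  have split: "exp (real n * (l - \<gamma>)) = exp (- (\<gamma> * real n)) * exp (real n * l)" by (simp add: mult_exp_exp algebra_simps)
  have "K * exp (- (\<gamma> * real n)) * exp (real n * l) <= k / 2 * exp (real n * l)"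
   using N[of n] n by (intro mult_right_mono) auto
  moreover have "k * exp (real n * l) <= P n * exp (real n * b) + K * exp (- (\<gamma> * real n)) * exp (real n * l)"
   using gap[of n] n unfolding split by (simp add: mult.assoc)
  ultimately have "k / 2 * exp (real n * l) <= P n * exp (real n * b)" by linarith
  hence "k / 2 * exp (real n * l) * exp (- (real n * b)) <= P n * exp (real n * b) * exp (- (real n * b))" by (rule mult_right_mono) simp
  thus ?thesis by (simp add: mult.assoc mult_exp_exp right_diff_distrib)
 qed
 thus ?thesis by (rule that)
qed


context periodic_chain
begin

abbreviation emp :: "nat => 'w => ('v * real) measure \<times> (('v * 'v) * real) measure" where
 "emp n om \<equiv> (emp_meas T0 n (X om), emp_flow T0 n (X om))"

lemma path_point_measurable:
 assumes "om \<in> space M" shows "(%t. (X om t, pmod t T0)) \<in> measurable (restrict_space lborel {0..b}) SpV"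
proof -
 let ?L = "restrict_space lborel {0..b}"
 have "X om \<in> measurable ?L (count_space UNIV)"
 proof (rule measurable_count_space_eq2[THEN iffD2], simp, intro conjI ballI)
  fix y
  have "X om -` {y} \<inter> space ?L = {u. 0 <= u \<and> X om u = y} \<inter> {0..b}" by (auto simp: space_restrict_space)
  thus "X om -` {y} \<inter> space ?L \<in> sets ?L"
   using cadlag_level_set_borel[OF X_cadlag[OF assms], of y] by (auto simp: sets_restrict_space)
 qed simp
 moreover have "(%t. pmod t T0) \<in> borel_measurable ?L" by (rule measurable_restrict_space1) simp
 ultimately show ?thesis by (intro measurable_Pair) auto
qed

lemma itg_emp_meas:
 assumes om: "om \<in> space M" and f: "\<And>y. bdd_borel (f y)"
 shows "itg (emp_meas T0 n (X om)) f = integral {0..real n * T0} (along (%y t. f y (pmod t T0)) (X om)) / n"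
proof -
 let ?L = "restrict_space lborel {0..real n * T0}"
 have "bdd_borel (%t. f y (pmod t T0))" for y
  using bdd_borel_bound[OF f[of y]] measurable_compose[OF pmod_measurable bdd_borel_measurable[OF f]] by (metis bdd_borelI)
 hence along: "bdd_borel (along (%y t. f y (pmod t T0)) (X om))" by (rule along_bdd[OF X_cadlag[OF om]])
 have "itg (emp_meas T0 n (X om)) f = (1 / real n) * (LINT t|?L. f (X om t) (pmod t T0))"
  unfolding emp_meas_def using SpV_measurable[of f, OF bdd_borel_measurable[OF f]] path_point_measurable[OF om]
  by (subst integral_scale_measure) (auto simp: integral_distr)
 also have "(LINT t|?L. f (X om t) (pmod t T0)) = (LINT t|lborel. indicator {0..real n * T0} t *\<^sub>R f (X om t) (pmod t T0))"
  by (rule integral_restrict_space) simp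
 also have "... = (LINT t:{0..real n * T0}|lborel. along (%y t. f y (pmod t T0)) (X om) t)"
  unfolding set_lebesgue_integral_def by (rule Bochner_Integration.integral_cong) (auto simp: along_eq indicator_def)
 finally show ?thesis by (simp add: bdd_borel_LINT[OF along])
qed

lemma itg_emp_flow:
 assumes om: "om \<in> space M" and g: "\<And>e. bdd_borel (g e)"
 shows "itg (emp_flow T0 n (X om)) g = (\<Sum>t\<in>jumps (X om) (real n * T0). g (left_lim (X om) t, X om t) (pmod t T0)) / n"
 unfolding emp_flow_def
 using SpV_measurable[of g, OF bdd_borel_measurable[OF g]] cadlag_finite_jumps[OF X_cadlag[OF om]]
 by (subst integral_scale_measure) (auto simp: integral_distr lebesgue_integral_count_space_finite space_pair_measure)

lemma emp_circle:
 assumes om: "om \<in> space M" and n: "n >= 1"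
 shows "circle_measure T0 (emp_meas T0 n (X om))" "circle_measure T0 (emp_flow T0 n (X om))"
  "emeasure (emp_meas T0 n (X om)) UNIV = ennreal T0"
proof -
 let ?L = "restrict_space lborel {0..real n * T0}" and ?Y = "%t. (X om t, pmod t T0)"
 let ?J = "jumps (X om) (real n * T0)" and ?Z = "%t. ((left_lim (X om) t, X om t), pmod t T0)"
 note Y = path_point_measurable[OF om, of "real n * T0"]
 have Z: "?Z \<in> measurable (count_space ?J) SpV" by (auto simp: space_pair_measure)
 have "emeasure (distr ?L SpV ?Y) UNIV = ennreal (real n * T0)"
  using T0 by (simp add: emeasure_distr[OF Y SpV_sets(1)] emeasure_restrict_space space_restrict_space)
 thus total: "emeasure (emp_meas T0 n (X om)) UNIV = ennreal T0"
  using n T0 by (simp add: emp_meas_def ennreal_mult[symmetric])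
 have "?Y -` (UNIV - UNIV \<times> {0..<T0}) = {}" "?Z -` (UNIV - UNIV \<times> {0..<T0}) = {}" using pmod_bounds[OF T0] by auto
 hence outside: "emeasure (distr ?L SpV ?Y) (UNIV - UNIV \<times> {0..<T0}) = 0" "emeasure (distr (count_space ?J) SpV ?Z) (UNIV - UNIV \<times> {0..<T0}) = 0"
  by (simp_all add: emeasure_distr[OF Y SpV_sets(2)] emeasure_distr[OF Z SpV_sets(2)])
 show "circle_measure T0 (emp_meas T0 n (X om))"
  using total outside(1) unfolding circle_measure_def by (simp add: emp_meas_def space_scale_measure)
 have "emeasure (distr (count_space ?J) SpV ?Z) UNIV < \<infinity>"
  using cadlag_finite_jumps[OF X_cadlag[OF om]] by (simp add: emeasure_distr[OF Z SpV_sets(1)] of_nat_less_top)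
 thus "circle_measure T0 (emp_flow T0 n (X om))"
  using outside(2) unfolding circle_measure_def by (simp add: emp_flow_def space_scale_measure ennreal_mult_less_top)
qed

lemma emp_ev:
 assumes om: "om \<in> space M" and fg: "cont_per T0 f" "cont_per T0 g"
 shows "ev f g (emp n om) = psum n f g om / n"
proof -
 note bdd = cont_per_bdd[OF fg(1) T0] cont_per_bdd[OF fg(2) T0]
 have "f y (pmod t T0) = f y t" "g e (pmod t T0) = g e t" for y e t
  using cont_perD(2)[OF fg(1)] cont_perD(2)[OF fg(2)] by (intro periodic_pmod; simp)+
 thus ?thesis
  using itg_emp_meas[of om f n, OF om bdd(1)] itg_emp_flow[of om g n, OF om bdd(2)]
  by (simp add: ev_def path_fun_def add_divide_distrib)
qed

text \<open>A path that jumps outside \<open>E\<close> has its empirical flow outside \<open>Mstar T0 E\<close>; this has probability 0 only.\<close>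
lemma emp_Mstar:
 assumes om: "om \<in> space M" and n: "n >= 1"
 shows "emp n om \<in> Mstar T0 E \<longleftrightarrow> psum n (%_ _. 0) (off_edge E) om = 0"
proof -
 have "bdd_borel (off_edge E e)" for e :: "'v * 'v" by (simp add: off_edge_def[abs_def])
 from itg_emp_flow[of om "off_edge E" n, OF om this] show ?thesis
  unfolding Mstar_iff_off_edge[OF emp_circle(1,2)[OF om n]] using emp_circle(3)[OF om n] n
  by (simp add: path_fun_def along_def[abs_def] off_edge_def[abs_def])
qed

lemma emp_Mstar_AE:
 assumes n: "n >= 1" shows "AE om in M. emp n om \<in> Mstar T0 E"
proof -
 let ?S = "%om. psum n (%_ _. 0) (off_edge E) om"
 have bw: "bw (%_ _. 0) (off_edge E) (%_ _. 1) y = (%_. 0)" for y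
  using R_off by (auto simp: bw_def off_edge_def indicator_def fun_eq_iff intro!: sum.neutral)
 have "indef a b (%_. 1) (%_. 0)" for a b by (auto simp: indef_def)
 moreover have "bdd_borel (off_edge E e)" for e :: "'v * 'v" by (simp add: off_edge_def[abs_def])
 ultimately have int: "integrable M (%om. exp (?S om))" "part_fun n (%_ _. 0) (off_edge E) = 1"
  using fk_bounds[of "%_ _. 0" "off_edge E" "%_ _. 1" 1 1 n] n by (simp_all add: bw off_edge_def)
 have "0 <= ?S om" for om by (auto simp: path_fun_def along_def[abs_def] off_edge_def intro!: sum_nonneg)
 moreover have "(LINT om|M. exp (?S om) - 1) = 0" using int by (simp add: part_fun_def prob_space)
 ultimately have "AE om in M. exp (?S om) - 1 = 0"
  using int(1) by (subst (asm) integral_nonneg_eq_0_iff_AE) auto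
 thus ?thesis using emp_Mstar[OF _ n] by (auto elim!: AE_mp intro!: AE_I2)
qed

lemma psum_measurable:
 assumes "cont_per T0 f" "cont_per T0 g" "n >= 1" shows "(%om. psum n f g om) \<in> borel_measurable M"
 using assms T0 cont_per_bdd[OF assms(1) T0] cont_perD(1)[OF assms(2)] by (intro path_fun_measurable) auto

lemma emp_open_event:
 assumes G: "openin (Mstar_top T0 E) G" and n: "n >= 1" shows "{om \<in> space M. emp n om \<in> G} \<in> sets M"
proof -
 obtain U where U: "open U" "G = {PQ \<in> Mstar T0 E. coords T0 PQ \<in> U}" by (rule Mstar_open_coords[OF T0 G])
 have "(%om. coords T0 (emp n om)) \<in> borel_measurable M"
 proof (rule measurable_coordinatewise_then_product)
  fix j
  note cont = coord_cont_per[OF T0, of j]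
  have "(%om. psum n (coord_f T0 j) (coord_g T0 j) om / real n) \<in> borel_measurable M" using psum_measurable[OF cont n] by simp
  thus "(%om. coords T0 (emp n om) j) \<in> borel_measurable M"
   by (subst measurable_cong[where g = "%om. psum n (coord_f T0 j) (coord_g T0 j) om / real n"]) (auto simp: coords_def emp_ev[OF _ cont])
 qed
 hence "(%om. coords T0 (emp n om)) -` U \<inter> space M \<in> sets M" using U(1) by (intro measurable_sets) auto
 moreover have "(%om. psum n (%_ _. 0) (off_edge E) om) -` {0} \<inter> space M \<in> sets M"
  by (rule measurable_sets[OF psum_measurable[OF _ _ n]]) (auto simp: off_edge_def[abs_def] cont_per_const)
 moreover have "{om \<in> space M. emp n om \<in> G}
   = ((%om. coords T0 (emp n om)) -` U \<inter> space M) \<inter> ((%om. psum n (%_ _. 0) (off_edge E) om) -` {0} \<inter> space M)"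
  unfolding U(2) using emp_Mstar[OF _ n] by auto
 ultimately show ?thesis by (simp only: sets.Int)
qed

abbreviation cont_tests :: "('v tfun \<times> ('v * 'v) tfun) set" where
 "cont_tests \<equiv> {F. cont_per T0 (fst F) \<and> cont_per T0 (snd F)}"

abbreviation "test_val F PQ \<equiv> ev (fst F) (snd F) PQ"

abbreviation "test_lam F \<equiv> lam (fst F) (snd F)"

abbreviation "test_sum n F om \<equiv> psum n (fst F) (snd F) om"

abbreviation "test_part n F \<equiv> part_fun n (fst F) (snd F)"

lemma test_part_bounds:
 assumes "F \<in> cont_tests"
 obtains k K where "k > 0" "K > 0" "\<forall>n\<ge>1. integrable M (%om. exp (test_sum n F om)) \<and>
  k * exp (real n * test_lam F) <= test_part n F \<and> test_part n F <= K * exp (real n * test_lam F)"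
proof -
 have "cont_per T0 (fst F)" "cont_per T0 (snd F)" using assms by auto
 then obtain L where L: "test_pair L (fst F) (snd F)" using that by (rule cont_per_test_pair)
 show ?thesis using that test_pair_lam[OF L] unfolding growth_def by blast
qed

lemma chebyshev:
 assumes F: "F \<in> cont_tests"
 shows "\<exists>K>0. \<forall>n\<ge>1. {om \<in> space M. real n * (test_lam F + a) <= test_sum n F om} \<in> events \<and>
  prob {om \<in> space M. real n * (test_lam F + a) <= test_sum n F om} <= K * exp (- (real n * a))"
proof -
 obtain k K where "k > 0" and K: "K > 0" "\<forall>n\<ge>1. integrable M (%om. exp (test_sum n F om)) \<and>
   k * exp (real n * test_lam F) <= test_part n F \<and> test_part n F <= K * exp (real n * test_lam F)"
  by (rule test_part_bounds[OF F])
 have "{om \<in> space M. real n * (test_lam F + a) <= test_sum n F om} \<in> events \<and>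
   prob {om \<in> space M. real n * (test_lam F + a) <= test_sum n F om} <= K * exp (- (real n * a))"
  if n: "n >= 1" for n
 proof -
  let ?S = "test_sum n F" and ?b = "real n * (test_lam F + a)"
  let ?A = "{om \<in> space M. ?b <= ?S om}"
  have A: "?A \<in> events" using psum_measurable[of "fst F" "snd F" n] F n by simp
  have int: "integrable M (%om. exp (?S om))" using K(2) n by blast
  have "prob ?A = (LINT om|M. indicator ?A om)" using A sets.sets_into_space[OF A] by (simp add: Int_absorb2)
  also have "... <= (LINT om|M. exp (- ?b) * exp (?S om))"
   using int A by (intro integral_mono integrable_mult_right integrable_real_indicator) (auto simp: indicator_def mult_exp_exp emeasure_eq_measure)
  also have "... = exp (- ?b) * test_part n F" by (simp add: part_fun_def)
  also have "... <= exp (- ?b) * (K * exp (real n * test_lam F))" using K n by (intro mult_left_mono) auto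
  also have "... = K * exp (- (real n * a))" by (simp add: mult.left_commute mult_exp_exp algebra_simps)
  finally show ?thesis using A by blast
 qed
 thus ?thesis using K(1) by blast
qed

lemma superlevel_open: "F \<in> cont_tests ==> openin (Mstar_top T0 E) {PQ \<in> Mstar T0 E. b < test_val F PQ}"
 using ev_openin[of T0 "fst F" "snd F" "{b<..}" E] by simp

definition tilt :: "('v tfun \<times> ('v * 'v) tfun) set => ('v tfun \<times> ('v * 'v) tfun => real) => 'v tfun \<times> ('v * 'v) tfun" where
 "tilt S th = ((%y t. \<Sum>F\<in>S. th F * fst F y t), (%e t. \<Sum>F\<in>S. th F * snd F e t))"

lemma tilt_cont: "S \<subseteq> cont_tests ==> tilt S th \<in> cont_tests"
 by (auto simp: tilt_def cont_per_def intro!: continuous_intros sum.cong)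

lemma test_val_tilt: "PQ \<in> Mstar T0 E ==> S \<subseteq> cont_tests ==> test_val (tilt S th) PQ = (\<Sum>F\<in>S. th F * test_val F PQ)"
 unfolding tilt_def fst_conv snd_conv by (intro ev_sum[OF _ T0]) auto

lemma test_sum_tilt:
 assumes "om \<in> space M" "finite S" "S \<subseteq> cont_tests"
 shows "test_sum n (tilt S th) om = (\<Sum>F\<in>S. th F * test_sum n F om)"
 unfolding tilt_def fst_conv snd_conv
 using assms by (intro path_fun_sum X_cadlag cont_per_bdd[OF _ T0]) auto

lemma tilt_fun_upd:
 assumes "finite S" "F \<in> S"
 shows "tilt S (th(F := th F + s))
  = ((%y t. fst (tilt S th) y t + s * fst F y t), (%e t. snd (tilt S th) e t + s * snd F e t))"
 using sum_fun_upd[OF assms, of "%F' x. x * fst F' _ _"] sum_fun_upd[OF assms, of "%F' x. x * snd F' _ _"]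
 by (simp add: tilt_def fun_eq_iff distrib_right del: fun_upd_apply)

lemma cont_tests_bounded:
 assumes "finite S" "S \<subseteq> cont_tests"
 shows "\<exists>K\<ge>0. \<forall>F\<in>S. (\<forall>y t. abs (fst F y t) <= K) \<and> (\<forall>e t. abs (snd F e t) <= K)"
 using assms
proof (induction S rule: finite_induct)
 case (insert F S)
 obtain K where K: "K >= 0" "\<forall>F\<in>S. (\<forall>y t. abs (fst F y t) <= K) \<and> (\<forall>e t. abs (snd F e t) <= K)" using insert by auto
 have "cont_per T0 (fst F)" "cont_per T0 (snd F)" using insert.prems by auto
 then obtain L where L: "test_pair L (fst F) (snd F)" using that by (rule cont_per_test_pair)
 show ?case
  using K test_pairD(2,5)[OF L] by (intro exI[of _ "max K L"]) (auto simp: le_max_iff_disj)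
qed auto

lemma test_lam_tilt_smooth:
 assumes S: "finite S" "S \<subseteq> cont_tests" and r: "r > 0"
 shows "\<exists>C\<ge>0. \<exists>s0>0. s0 <= 1 \<and> (\<forall>th. (\<forall>F\<in>S. abs (th F) <= r) --> (\<exists>w. quad_bound S (%th. test_lam (tilt S th)) C s0 th w))"
proof -
 obtain K where K: "K >= 0" "\<And>F y t. F \<in> S ==> abs (fst F y t) <= K" "\<And>F e t. F \<in> S ==> abs (snd F e t) <= K"
  using cont_tests_bounded[OF S] by blast
 define L where "L = K + real (card S) * (r * K)"
 have KL: "K <= L" "real (card S) * (r * K) <= L" using K(1) r by (simp_all add: L_def)
 have pair: "test_pair L (fst F) (snd F)" if "F \<in> cont_tests" "\<And>y t. abs (fst F y t) <= L" "\<And>e t. abs (snd F e t) <= L" for F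
  using that unfolding test_pair_def cont_per_def by (auto intro: borel_measurable_continuous_onI)
 have pair_S: "test_pair L (fst F) (snd F)" if "F \<in> S" for F
  using that S(2) by (intro pair order_trans[OF K(2)[OF that] KL(1)] order_trans[OF K(3)[OF that] KL(1)]) auto
 have pair_tilt: "test_pair L (fst (tilt S th)) (snd (tilt S th))" if th: "\<forall>F\<in>S. abs (th F) <= r" for th
 proof -
  have bound: "abs (\<Sum>F\<in>S. th F * u F) <= L" if u: "\<And>F. F \<in> S ==> abs (u F) <= K" for u
  proof -
   have "abs (\<Sum>F\<in>S. th F * u F) <= (\<Sum>F\<in>S. r * K)"
    using th u r by (intro order_trans[OF sum_abs] sum_mono) (auto simp: abs_mult intro!: mult_mono)
   thus ?thesis using KL(2) by simp
  qed
  show ?thesis using K(2,3) by (intro pair tilt_cont S(2)) (auto simp: tilt_def intro!: bound)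
 qed
 obtain C s0 where C: "C >= 0" "s0 > 0" "s0 <= 1" "\<And>f g f1 g1. test_pair L f g ==> test_pair L f1 g1 ==> \<exists>\<alpha>. \<forall>s. abs s <= s0 -->
   lam (%y u. f y u + s * f1 y u) (%e u. g e u + s * g1 e u) <= lam f g + s * \<alpha> + C * s\<^sup>2"
  using that by (rule lam_second_order[of L])
 have "\<exists>w. quad_bound S (%th. test_lam (tilt S th)) C s0 th w" if th: "\<forall>F\<in>S. abs (th F) <= r" for th
 proof -
  have "\<forall>F\<in>S. \<exists>w. \<forall>s. abs s <= s0 --> test_lam (tilt S (th(F := th F + s))) <= test_lam (tilt S th) + s * w + C * s\<^sup>2"
   using C(4)[OF pair_tilt[OF th] pair_S] by (simp add: tilt_fun_upd[OF S(1)] del: fun_upd_apply)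
  from bchoice[OF this] show ?thesis unfolding quad_bound_def by blast
 qed
 thus ?thesis using C(1-3) by blast
qed

lemma test_part_tilt_le:
 fixes w and \<epsilon> :: real
 assumes S: "finite S" "S \<subseteq> cont_tests" and \<sigma>: "\<sigma> > 0" and n: "n >= 1"
 defines "window \<equiv> {om \<in> space M. \<forall>F\<in>S. abs (test_sum n F om - real n * w F) < real n * \<epsilon>}"
 shows "window \<in> events"
  "test_part n (tilt S th) <= prob window * exp (real n * (\<Sum>F\<in>S. th F * w F + \<epsilon> * abs (th F)))
   + (\<Sum>d\<in>S \<times> {\<sigma>, - \<sigma>}. exp (- (real n * (snd d * w (fst d) + \<sigma> * \<epsilon>))) * test_part n (tilt S (th(fst d := th (fst d) + snd d))))"
proof -
 have "(%om. test_sum n F om) \<in> borel_measurable M" if "F \<in> S" for F using S(2) that n by (intro psum_measurable) auto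
 thus window: "window \<in> events"
  unfolding window_def using S(1) by (intro sets.sets_Collect_finite_All) (auto intro!: borel_measurable_less borel_measurable_abs borel_measurable_diff)
 let ?b = "\<Sum>F\<in>S. th F * w F + \<epsilon> * abs (th F)" and ?upd = "%d. th(fst d := th (fst d) + snd d)"
 let ?c = "%d. exp (- (real n * (snd d * w (fst d) + \<sigma> * \<epsilon>)))"
 have int: "integrable M (%om. exp (test_sum n (tilt S th') om))" for th'
 proof -
  obtain k K where "k > 0" "K > 0" "\<forall>n\<ge>1. integrable M (%om. exp (test_sum n (tilt S th') om)) \<and>
    k * exp (real n * test_lam (tilt S th')) <= test_part n (tilt S th') \<and> test_part n (tilt S th') <= K * exp (real n * test_lam (tilt S th'))"
   by (rule test_part_bounds[OF tilt_cont[OF S(2)]])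
  thus ?thesis using n by blast
 qed
 have ind: "integrable M (%om. indicator window om * exp (real n * ?b))" using window by (simp add: emeasure_eq_measure)
 have "test_part n (tilt S th) <= (LINT om|M. indicator window om * exp (real n * ?b) + (\<Sum>d\<in>S \<times> {\<sigma>, - \<sigma>}. ?c d * exp (test_sum n (tilt S (?upd d)) om)))"
  unfolding part_fun_def
 proof (intro integral_mono Bochner_Integration.integrable_add Bochner_Integration.integrable_sum integrable_mult_right int ind)
  fix om assume om: "om \<in> space M"
  show "exp (test_sum n (tilt S th) om) <= indicator window om * exp (real n * ?b) + (\<Sum>d\<in>S \<times> {\<sigma>, - \<sigma>}. ?c d * exp (test_sum n (tilt S (?upd d)) om))"
   unfolding test_sum_tilt[OF om S]
   using exp_tilt_le[OF S(1) \<sigma>, of "real n" th "%F. test_sum n F om" w \<epsilon>] om by (simp add: window_def indicator_def del: fun_upd_apply)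
 qed
 also have "... = prob window * exp (real n * ?b) + (\<Sum>d\<in>S \<times> {\<sigma>, - \<sigma>}. ?c d * test_part n (tilt S (?upd d)))"
  using int ind sets.sets_into_space[OF window] by (simp add: part_fun_def Int_absorb2 del: fun_upd_apply)
 finally show "test_part n (tilt S th) <= prob window * exp (real n * ?b) + (\<Sum>d\<in>S \<times> {\<sigma>, - \<sigma>}. ?c d * test_part n (tilt S (?upd d)))" .
qed

lemma test_part_upd_le:
 assumes S: "finite S" "S \<subseteq> cont_tests" and quad: "quad_bound S (%th. test_lam (tilt S th)) C s0 th w"
  and d: "d \<in> S \<times> {\<sigma>, - \<sigma>}" and \<sigma>: "0 < \<sigma>" "\<sigma> <= s0" "C * \<sigma> <= \<epsilon> / 2"
 shows "\<exists>K>0. \<forall>n\<ge>1. exp (- (real n * (snd d * w (fst d) + \<sigma> * \<epsilon>))) * test_part n (tilt S (th(fst d := th (fst d) + snd d)))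
   <= K * exp (real n * (test_lam (tilt S th) - \<sigma> * \<epsilon> / 2))"
proof -
 let ?l = "test_lam (tilt S th)" and ?F = "tilt S (th(fst d := th (fst d) + snd d))" and ?c = "snd d * w (fst d) + \<sigma> * \<epsilon>"
 obtain k K where K: "K > 0" "\<forall>n\<ge>1. integrable M (%om. exp (test_sum n ?F om)) \<and>
   k * exp (real n * test_lam ?F) <= test_part n ?F \<and> test_part n ?F <= K * exp (real n * test_lam ?F)"
  by (rule test_part_bounds[OF tilt_cont[OF S(2)]])
 have "abs (snd d) = \<sigma>" using d \<sigma>(1) by auto
 hence "(snd d)\<^sup>2 = \<sigma> * \<sigma>" by (metis power2_abs power2_eq_square)
 moreover have "C * \<sigma> * \<sigma> <= \<epsilon> / 2 * \<sigma>" using \<sigma> by (intro mult_right_mono) auto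
 moreover have "test_lam ?F <= ?l + snd d * w (fst d) + C * (snd d)\<^sup>2"
  using quad d \<sigma>(2) \<open>abs (snd d) = \<sigma>\<close> unfolding quad_bound_def by auto
 ultimately have lam: "test_lam ?F - ?c <= ?l - \<sigma> * \<epsilon> / 2" by (simp add: mult_ac)
 have "exp (- (real n * ?c)) * test_part n ?F <= K * exp (real n * (?l - \<sigma> * \<epsilon> / 2))" if n: "n >= 1" for n
 proof -
  have "exp (- (real n * ?c)) * test_part n ?F <= exp (- (real n * ?c)) * (K * exp (real n * test_lam ?F))"
   using K n by (intro mult_left_mono) auto
  also have "... = K * exp (real n * (test_lam ?F - ?c))" by (simp add: mult.left_commute mult_exp_exp right_diff_distrib)
  also have "... <= K * exp (real n * (?l - \<sigma> * \<epsilon> / 2))" using mult_left_mono[OF lam, of "real n"] K(1) by simp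
  finally show ?thesis .
 qed
 thus ?thesis using K(1) by blast
qed

lemma tilt_concentration:
 assumes S: "finite S" "S \<subseteq> cont_tests" and quad: "quad_bound S (%th. test_lam (tilt S th)) C s0 th w"
  and C: "C >= 0" "s0 > 0" and \<epsilon>: "\<epsilon> > 0"
 obtains k N where "k > 0" "\<And>n. n >= N ==> k * exp (real n * (test_lam (tilt S th) - (\<Sum>F\<in>S. th F * w F + \<epsilon> * abs (th F))))
  <= prob {om \<in> space M. \<forall>F\<in>S. abs (test_sum n F om - real n * w F) < real n * \<epsilon>}"
proof -
 define \<sigma> where "\<sigma> = min s0 (\<epsilon> / 2 / (C + 1))"
 have \<sigma>: "0 < \<sigma>" "\<sigma> <= s0" using C \<epsilon> by (auto simp: \<sigma>_def)
 have "\<sigma> <= \<epsilon> / 2 / (C + 1)" by (simp add: \<sigma>_def)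
 hence "\<sigma> * (C + 1) <= \<epsilon> / 2" using C(1) by (subst (asm) pos_le_divide_eq) auto
 hence C_\<sigma>: "C * \<sigma> <= \<epsilon> / 2" using \<sigma>(1) by (simp add: distrib_left mult.commute)
 let ?l = "test_lam (tilt S th)" and ?b = "\<Sum>F\<in>S. th F * w F + \<epsilon> * abs (th F)" and ?D = "S \<times> {\<sigma>, - \<sigma>}"
 let ?rest = "%n d. exp (- (real n * (snd d * w (fst d) + \<sigma> * \<epsilon>))) * test_part n (tilt S (th(fst d := th (fst d) + snd d)))"
 have "\<forall>d\<in>?D. \<exists>K>0. \<forall>n\<ge>1. ?rest n d <= K * exp (real n * (?l - \<sigma> * \<epsilon> / 2))"
  using test_part_upd_le[OF S quad _ \<sigma>(1,2) C_\<sigma>] by blast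
 from bchoice[OF this] obtain K where K: "\<And>d n. d \<in> ?D ==> n >= 1 ==> ?rest n d <= K d * exp (real n * (?l - \<sigma> * \<epsilon> / 2))" by blast
 obtain k K' where k: "k > 0" "\<forall>n\<ge>1. integrable M (%om. exp (test_sum n (tilt S th) om)) \<and>
   k * exp (real n * ?l) <= test_part n (tilt S th) \<and> test_part n (tilt S th) <= K' * exp (real n * ?l)"
  by (rule test_part_bounds[OF tilt_cont[OF S(2)]])
 let ?P = "%n. prob {om \<in> space M. \<forall>F\<in>S. abs (test_sum n F om - real n * w F) < real n * \<epsilon>}"
 have gap: "k * exp (real n * ?l) <= ?P n * exp (real n * ?b) + (\<Sum>d\<in>?D. K d) * exp (real n * (?l - \<sigma> * \<epsilon> / 2))" if n: "n >= 1" for n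
 proof -
  have "(\<Sum>d\<in>?D. ?rest n d) <= (\<Sum>d\<in>?D. K d) * exp (real n * (?l - \<sigma> * \<epsilon> / 2))"
   unfolding sum_distrib_right using n by (intro sum_mono K)
  moreover have "k * exp (real n * ?l) <= test_part n (tilt S th)" using k(2) n by blast
  ultimately show ?thesis using test_part_tilt_le(2)[OF S \<sigma>(1) n, of th w \<epsilon>] by linarith
 qed
 have \<gamma>: "\<sigma> * \<epsilon> / 2 > 0" using \<sigma>(1) \<epsilon> by simp
 obtain N where "\<And>n. n >= N ==> k / 2 * exp (real n * (?l - ?b)) <= ?P n"
  using gap that by (rule eventually_ge_of_exp_gap[OF k(1) \<gamma>])
 thus ?thesis using k(1) by (intro that[of "k / 2" N]) auto
qed


context
 fixes I :: "('v * real) measure \<times> (('v * 'v) * real) measure => ennreal"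
 assumes dual: "\<And>PQ a. PQ \<in> Mstar T0 E ==> 0 <= a ==> I PQ <= ennreal a \<longleftrightarrow> (\<forall>F\<in>cont_tests. test_val F PQ - test_lam F <= a)"
begin

lemma ldp_good: "compactin (Mstar_top T0 E) {PQ \<in> Mstar T0 E. I PQ <= ennreal a}"
proof -
 let ?a = "max a 0" and ?K = "{PQ \<in> Mstar T0 E. I PQ <= ennreal a}"
 let ?U = "%F. {PQ \<in> Mstar T0 E. test_lam F + ?a < test_val F PQ}" and ?one = "(%_ _. 0, %_ _. 1) :: 'v tfun \<times> ('v * 'v) tfun"
 have "ennreal ?a = ennreal a" by (simp add: max_def ennreal_neg)
 hence level: "I PQ <= ennreal a \<longleftrightarrow> (\<forall>F\<in>cont_tests. \<not> test_lam F + ?a < test_val F PQ)" if "PQ \<in> Mstar T0 E" for PQ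
  using dual[OF that, of ?a] by (simp add: not_less diff_le_eq add.commute)
 have "?K = topspace (Mstar_top T0 E) - \<Union>(?U ` cont_tests)" unfolding Mstar_topspace using level by blast
 hence closed: "closedin (Mstar_top T0 E) ?K" using superlevel_open by (auto intro!: closedin_diff openin_Union)
 have one: "?one \<in> cont_tests" by (simp add: cont_per_const)
 have "test_val ?one PQ <= test_lam ?one + ?a" if "PQ \<in> ?K" for PQ
 proof -
  have "\<forall>F\<in>cont_tests. \<not> test_lam F + ?a < test_val F PQ" using level that by blast
  from bspec[OF this one] show ?thesis by (simp only: not_less)
 qed
 hence "?K \<subseteq> {PQ \<in> Mstar T0 E. ev (%_ _. 0) (%_ _. 1) PQ <= test_lam ?one + ?a}" by auto
 thus ?thesis by (rule closed_compactin[OF Mstar_compact[OF T0] _ closed])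
qed

lemma scaled_test_le:
 assumes k: "0 <= k" "ennreal k * I PQ < \<top>" and PQ: "PQ \<in> Mstar T0 E" and F: "F \<in> cont_tests"
 shows "k * (test_val F PQ - test_lam F) <= enn2real (ennreal k * I PQ)"
proof (cases "k = 0")
 case False
 hence "I PQ < \<top>" using k by (auto simp: ennreal_mult_less_top)
 then obtain a where a: "0 <= a" "I PQ = ennreal a" by (cases "I PQ") auto
 hence "test_val F PQ - test_lam F <= a" using dual[OF PQ a(1)] F by simp
 thus ?thesis using a k(1) by (simp add: ennreal_mult[symmetric] mult_left_mono)
qed simp

lemma ldp_convex:
 assumes M: "(mu1, Q1) \<in> Mstar T0 E" "(mu2, Q2) \<in> Mstar T0 E" "(mu, Q) \<in> Mstar T0 E" and l: "0 <= l" "l <= 1"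
  and mix: "\<forall>A\<in>sets SpV. emeasure mu A = ennreal l * emeasure mu1 A + ennreal (1 - l) * emeasure mu2 A"
   "\<forall>A\<in>sets SpV. emeasure Q A = ennreal l * emeasure Q1 A + ennreal (1 - l) * emeasure Q2 A"
 shows "I (mu, Q) <= ennreal l * I (mu1, Q1) + ennreal (1 - l) * I (mu2, Q2)"
proof (cases "ennreal l * I (mu1, Q1) < \<top> \<and> ennreal (1 - l) * I (mu2, Q2) < \<top>")
 case True
 let ?b = "enn2real (ennreal l * I (mu1, Q1)) + enn2real (ennreal (1 - l) * I (mu2, Q2))"
 have "test_val F (mu, Q) - test_lam F <= ?b" if F: "F \<in> cont_tests" for F
 proof -
  have fg: "cont_per T0 (fst F)" "cont_per T0 (snd F)" using F by auto
  have "test_val F (mu, Q) = l * test_val F (mu1, Q1) + (1 - l) * test_val F (mu2, Q2)"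
   using integral_mix[OF Mstar_circle(1)[OF M(3)] Mstar_circle(1)[OF M(1)] Mstar_circle(1)[OF M(2)] l(1) _ _ fg(1) T0, of "1 - l"]
    integral_mix[OF Mstar_circle(2)[OF M(3)] Mstar_circle(2)[OF M(1)] Mstar_circle(2)[OF M(2)] l(1) _ _ fg(2) T0, of "1 - l"] mix l
   by (simp add: ev_def distrib_left)
  hence "test_val F (mu, Q) - test_lam F = l * (test_val F (mu1, Q1) - test_lam F) + (1 - l) * (test_val F (mu2, Q2) - test_lam F)"
   by (simp add: algebra_simps)
  also have "... <= ?b" using True l by (intro add_mono scaled_test_le M(1,2) F) auto
  finally show ?thesis .
 qed
 hence "I (mu, Q) <= ennreal ?b" using dual[OF M(3), of ?b] by simp
 thus ?thesis using True by (simp add: ennreal_plus)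
qed (auto simp: not_less top_unique)

lemma finite_test_cover:
 assumes C: "closedin (Mstar_top T0 E) C" and a: "0 <= a" "\<And>PQ. PQ \<in> C ==> \<not> I PQ <= ennreal a"
 obtains T where "finite T" "T \<noteq> {}" "T \<subseteq> cont_tests" "\<And>PQ. PQ \<in> C ==> \<exists>F\<in>T. test_lam F + a <= test_val F PQ"
proof -
 have C_sub: "C \<subseteq> Mstar T0 E" using closedin_subset[OF C] by (simp add: Mstar_topspace)
 let ?H = "%F. {PQ \<in> Mstar T0 E. test_lam F + a < test_val F PQ}" and ?one = "(%_ _. 0, %_ _. 1) :: 'v tfun \<times> ('v * 'v) tfun"
 let ?K = "{PQ \<in> Mstar T0 E. ev (%_ _. 0) (%_ _. 1) PQ <= test_lam ?one + a}"
 have one: "?one \<in> cont_tests" by (simp add: cont_per_const)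
 have "compactin (Mstar_top T0 E) (?K \<inter> C)" by (rule compact_Int_closedin[OF Mstar_compact[OF T0] C])
 moreover have "\<forall>U\<in>?H ` cont_tests. openin (Mstar_top T0 E) U" using superlevel_open by blast
 moreover have "?K \<inter> C \<subseteq> \<Union>(?H ` cont_tests)"
 proof
  fix PQ assume PQ: "PQ \<in> ?K \<inter> C"
  then obtain F where "F \<in> cont_tests" "\<not> test_val F PQ - test_lam F <= a" using a(2)[of PQ] dual[of PQ a] a(1) by blast
  thus "PQ \<in> \<Union>(?H ` cont_tests)" using PQ by (intro UN_I[of F]) auto
 qed
 ultimately obtain FF where FF: "finite FF" "FF \<subseteq> ?H ` cont_tests" "?K \<inter> C \<subseteq> \<Union>FF" unfolding compactin_def by meson
 from finite_subset_image[OF FF(1,2)] obtain T where T: "T \<subseteq> cont_tests" "finite T" "FF = ?H ` T" by blast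
 show ?thesis
 proof (rule that)
  show "finite (insert ?one T)" "insert ?one T \<noteq> {}" "insert ?one T \<subseteq> cont_tests" using T one by auto
  show "\<exists>F\<in>insert ?one T. test_lam F + a <= test_val F PQ" if PQ: "PQ \<in> C" for PQ
  proof (cases "PQ \<in> ?K")
   case True
   hence "PQ \<in> \<Union>(?H ` T)" using PQ FF(3) T(3) by blast
   thus ?thesis by (auto intro: less_imp_le)
  qed (use PQ C_sub in auto)
 qed
qed

lemma ldp_upper:
 assumes C: "closedin (Mstar_top T0 E) C" and a: "0 <= a" "\<And>PQ. PQ \<in> C ==> \<not> I PQ <= ennreal a"
 obtains K where "K > 0" "\<And>n. n >= 1 ==> prob {om \<in> space M. emp n om \<in> C} <= K * exp (- (real n * a))"
proof -
 obtain T where T: "finite T" "T \<noteq> {}" "T \<subseteq> cont_tests" "\<And>PQ. PQ \<in> C ==> \<exists>F\<in>T. test_lam F + a <= test_val F PQ"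
  using a(2) that by (rule finite_test_cover[OF C a(1)])
 let ?A = "%n F. {om \<in> space M. real n * (test_lam F + a) <= test_sum n F om}"
 have "\<forall>F\<in>T. \<exists>K>0. \<forall>n\<ge>1. ?A n F \<in> events \<and> prob (?A n F) <= K * exp (- (real n * a))" using chebyshev T(3) by blast
 from bchoice[OF this] obtain K where K: "\<And>F. F \<in> T ==> K F > 0" "\<And>F n. F \<in> T ==> n >= 1 ==> ?A n F \<in> events \<and> prob (?A n F) <= K F * exp (- (real n * a))" by blast
 have sum_pos: "(\<Sum>F\<in>T. K F) > 0" using K(1) T(1,2) by (intro sum_pos) auto
 have "prob {om \<in> space M. emp n om \<in> C} <= (\<Sum>F\<in>T. K F) * exp (- (real n * a))" if n: "n >= 1" for n
 proof -
  have "{om \<in> space M. emp n om \<in> C} \<subseteq> (\<Union>F\<in>T. ?A n F)"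
  proof
   fix om assume om: "om \<in> {om \<in> space M. emp n om \<in> C}"
   then obtain F where F: "F \<in> T" "test_lam F + a <= test_val F (emp n om)" using T(4) by blast
   have "test_val F (emp n om) = test_sum n F om / n" using om F(1) T(3) by (intro emp_ev) auto
   hence "test_sum n F om = n * test_val F (emp n om)" using n by simp
   hence "om \<in> ?A n F" using om mult_left_mono[OF F(2), of "real n"] by simp
   thus "om \<in> (\<Union>F\<in>T. ?A n F)" using F(1) by blast
  qed
  hence "prob {om \<in> space M. emp n om \<in> C} <= prob (\<Union>F\<in>T. ?A n F)" using K(2) n T(1) by (intro finite_measure_mono sets.finite_UN) auto
  also have "... <= (\<Sum>F\<in>T. prob (?A n F))" using K(2) n by (intro finite_measure_subadditive_finite T(1)) auto
  also have "... <= (\<Sum>F\<in>T. K F * exp (- (real n * a)))" using K(2) n by (intro sum_mono) auto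
  finally show ?thesis by (simp add: sum_distrib_right)
 qed
 thus ?thesis using that sum_pos by blast
qed

lemma emp_near_AE:
 assumes n: "n >= 1" and S: "S \<subseteq> cont_tests"
  and G: "{PQ' \<in> Mstar T0 E. \<forall>F\<in>S. abs (test_val F PQ' - test_val F PQ) < \<epsilon>} \<subseteq> G"
  and w: "\<And>F. F \<in> S ==> abs (test_val F PQ - w F) <= \<epsilon> / 2" and \<zeta>: "\<zeta> <= \<epsilon> / 2"
 shows "AE om in M. om \<in> {om \<in> space M. \<forall>F\<in>S. abs (test_sum n F om - real n * w F) < real n * \<zeta>} --> om \<in> {om \<in> space M. emp n om \<in> G}"
 using emp_Mstar_AE[OF n]
proof eventually_elim
 case (elim om)
 show ?case
 proof
  assume om: "om \<in> {om \<in> space M. \<forall>F\<in>S. abs (test_sum n F om - real n * w F) < real n * \<zeta>}"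
  have "abs (test_val F (emp n om) - test_val F PQ) < \<epsilon>" if F: "F \<in> S" for F
  proof -
   have "test_sum n F om = n * test_val F (emp n om)" using emp_ev[of om "fst F" "snd F" n] S F om n by auto
   moreover have "abs (test_sum n F om - real n * w F) < real n * \<zeta>" using om F by blast
   ultimately have "real n * abs (test_val F (emp n om) - w F) < real n * \<zeta>"
    by (simp only: right_diff_distrib[symmetric] abs_mult abs_of_nat)
   hence "abs (test_val F (emp n om) - w F) < \<zeta>" using n by simp
   thus ?thesis using w[OF F] \<zeta> by linarith
  qed
  thus "om \<in> {om \<in> space M. emp n om \<in> G}" using G elim om by blast
 qed
qed

lemma ldp_lower:
 assumes G: "openin (Mstar_top T0 E) G" and PQ: "PQ \<in> G" and a: "0 <= a" "I PQ <= ennreal a" and \<delta>: "\<delta> > 0"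
 obtains k N where "k > 0" "\<And>n. n >= N ==> k * exp (- (real n * (a + \<delta>))) <= prob {om \<in> space M. emp n om \<in> G}"
proof -
 have PQ_Mstar: "PQ \<in> Mstar T0 E" using openin_subset[OF G] PQ by (auto simp: Mstar_topspace)
 obtain S \<epsilon> where S: "finite S" "\<epsilon> > 0" "\<forall>F\<in>S. cont_per T0 (fst F) \<and> cont_per T0 (snd F)"
  "{PQ' \<in> Mstar T0 E. \<forall>F\<in>S. abs (test_val F PQ' - test_val F PQ) < \<epsilon>} \<subseteq> G" by (rule Mstar_nbhd[OF G PQ])
 have tests: "S \<subseteq> cont_tests" using S(3) by auto
 let ?F = "%th. test_lam (tilt S th)"
 have lower: "(\<Sum>F\<in>S. th F * test_val F PQ) - a <= ?F th" for th
  using bspec[OF iffD1[OF dual[OF PQ_Mstar a(1)] a(2)] tilt_cont[OF tests, of th]]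
  unfolding test_val_tilt[OF PQ_Mstar tests] by linarith
 have zero: "?F (%_. 0) = 0" using lam_time[of "%_. 0"] by (simp add: tilt_def)
 obtain th w C s0 where th: "C >= 0" "s0 > 0" "quad_bound S ?F C s0 th w" "\<And>F. F \<in> S ==> abs (test_val F PQ - w F) <= \<epsilon> / 2"
   "- (a + \<delta> / 2) <= ?F th - (\<Sum>F\<in>S. th F * w F)"
  using test_lam_tilt_smooth[OF S(1) tests] that by (rule slopes_near[OF S(1) lower zero a(1) half_gt_zero[OF S(2)] half_gt_zero[OF \<delta>]])
 define A where "A = (\<Sum>F\<in>S. abs (th F)) + 1"
 have A: "A > 0" "(\<Sum>F\<in>S. abs (th F)) <= A" by (auto simp: A_def intro!: add_nonneg_pos sum_nonneg)
 define \<zeta> where "\<zeta> = min (\<epsilon> / 2) (\<delta> / 2 / A)"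
 have "\<zeta> <= \<delta> / 2 / A" by (simp add: \<zeta>_def)
 hence "\<zeta> * A <= \<delta> / 2" using A(1) by (simp only: pos_le_divide_eq)
 moreover have \<zeta>: "\<zeta> > 0" "\<zeta> <= \<epsilon> / 2" using S(2) \<delta> A by (auto simp: \<zeta>_def)
 ultimately have "\<zeta> * (\<Sum>F\<in>S. abs (th F)) <= \<delta> / 2" using mult_left_mono[OF A(2), of \<zeta>] by linarith
 hence exponent: "- (a + \<delta>) <= ?F th - (\<Sum>F\<in>S. th F * w F + \<zeta> * abs (th F))"
  using th(5) by (simp add: sum.distrib sum_distrib_left[symmetric])
 obtain k N where k: "k > 0" "\<And>n. n >= N ==> k * exp (real n * (?F th - (\<Sum>F\<in>S. th F * w F + \<zeta> * abs (th F))))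
   <= prob {om \<in> space M. \<forall>F\<in>S. abs (test_sum n F om - real n * w F) < real n * \<zeta>}"
  using that by (rule tilt_concentration[OF S(1) tests th(3,1,2) \<zeta>(1)])
 have "k * exp (- (real n * (a + \<delta>))) <= prob {om \<in> space M. emp n om \<in> G}" if n: "n >= max N 1" for n
 proof -
  have "- (real n * (a + \<delta>)) <= real n * (?F th - (\<Sum>F\<in>S. th F * w F + \<zeta> * abs (th F)))"
   using mult_left_mono[OF exponent, of "real n"] by (simp only: mult_minus_right of_nat_0_le_iff)
  hence "k * exp (- (real n * (a + \<delta>))) <= k * exp (real n * (?F th - (\<Sum>F\<in>S. th F * w F + \<zeta> * abs (th F))))" using k(1) by simp
  also have "... <= prob {om \<in> space M. \<forall>F\<in>S. abs (test_sum n F om - real n * w F) < real n * \<zeta>}" using k(2) n by simp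
  also have "... <= prob {om \<in> space M. emp n om \<in> G}"
   using n by (intro finite_measure_mono_AE emp_near_AE[OF _ tests S(4) th(4) \<zeta>(2)] emp_open_event[OF G]) auto
  finally show ?thesis .
 qed
 thus ?thesis by (rule that[OF k(1)])
qed

lemma ldp_limsup:
 assumes C: "closedin (Mstar_top T0 E) C"
 shows "limsup (%n. eln (prob {om \<in> space M. emp n om \<in> C}) / ereal (real n)) <= - enn2ereal (INF PQ\<in>C. I PQ)" (is "?L <= - enn2ereal ?m")
proof -
 have le_uminus: "z <= - y" if "y <= - z" for y z :: ereal using ereal_minus_le_minus[of "- y" z] that by simp
 have "enn2ereal ?m <= - ?L"
 proof (rule dense_le)
  fix z assume z: "z < enn2ereal ?m"
  show "z <= - ?L"
  proof (cases "z < 0")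
   case True
   have "?L <= ereal (- 0)" by (rule limsup_eln_le[where K = 1]) auto
   hence "0 <= - ?L" using le_uminus[of ?L 0] by (simp add: zero_ereal_def[symmetric])
   thus ?thesis using True by (meson less_imp_le order_trans)
  next
   case False
   then obtain a where a: "z = ereal a" "0 <= a" using z by (cases z) auto
   have "ennreal a < ?m" using z a by (simp add: less_ennreal.rep_eq enn2ereal_ennreal)
   hence "\<not> I PQ <= ennreal a" if "PQ \<in> C" for PQ using INF_lower[OF that, of I] by (meson leD less_le_trans not_le)
   then obtain K where "K > 0" "\<And>n. n >= 1 ==> prob {om \<in> space M. emp n om \<in> C} <= K * exp (- (real n * a))"
    using that by (rule ldp_upper[OF C a(2)])
   hence "?L <= ereal (- a)" by (intro limsup_eln_le[of _ K])
   thus ?thesis unfolding a(1) using le_uminus[of ?L "ereal a"] by simp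
  qed
 qed
 thus ?thesis by (rule le_uminus)
qed

lemma ldp_liminf:
 assumes G: "openin (Mstar_top T0 E) G"
 shows "- enn2ereal (INF PQ\<in>G. I PQ) <= liminf (%n. eln (prob {om \<in> space M. emp n om \<in> G}) / ereal (real n))" (is "_ <= ?L")
proof -
 have "e2ennreal (- ?L) <= I PQ" if PQ: "PQ \<in> G" for PQ
 proof (cases "I PQ")
  case (real a)
  have "ereal (- a) <= ?L"
  proof (rule ereal_le_epsilon2)
   fix \<delta> :: real assume \<delta>: "0 < \<delta>"
   obtain k N where "k > 0" "\<And>n. n >= N ==> k * exp (- (real n * (a + \<delta>))) <= prob {om \<in> space M. emp n om \<in> G}"
    using that by (rule ldp_lower[OF G PQ real(1) eq_refl[OF real(2)] \<delta>])
   hence "ereal (- (a + \<delta>)) <= ?L" by (intro liminf_eln_ge)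
   thus "ereal (- a) <= ?L + ereal \<delta>" by (cases ?L) auto
  qed
  hence "- ?L <= ereal a" by (simp add: ereal_uminus_le_reorder)
  hence "e2ennreal (- ?L) <= e2ennreal (ereal a)" by (rule e2ennreal_mono)
  thus ?thesis using real by simp
 qed simp
 hence "e2ennreal (- ?L) <= (INF PQ\<in>G. I PQ)" by (intro INF_greatest)
 hence "enn2ereal (e2ennreal (- ?L)) <= enn2ereal (INF PQ\<in>G. I PQ)" by (simp add: less_eq_ennreal.rep_eq)
 moreover have "- ?L <= enn2ereal (e2ennreal (- ?L))" by (cases "0 <= - ?L") (auto simp: enn2ereal_e2ennreal e2ennreal_neg zero_ennreal.rep_eq not_le less_imp_le)
 ultimately have "- ?L <= enn2ereal (INF PQ\<in>G. I PQ)" by (rule order_trans[rotated])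
 thus ?thesis by (simp add: ereal_uminus_le_reorder)
qed

end

lemma rate_le_iff:
 assumes r: "Edges r = E" "\<And>y z t. t >= 0 ==> R y z t = r y z t" and cont: "AE t in lborel. t \<in> {0..<T0} --> (\<forall>y z. isCont (R y z) t)"
  and PQ: "PQ \<in> Mstar T0 E" and a: "0 <= a"
 shows "rate r T0 PQ <= ennreal a \<longleftrightarrow> (\<forall>F\<in>cont_tests. test_val F PQ - test_lam F <= a)"
proof -
 define mq where "mq = (SOME mq. Lambda_wit T0 E (fst PQ) (snd PQ) (fst mq) (snd mq))"
 have PQ': "(fst PQ, snd PQ) \<in> Mstar T0 E" using PQ by simp
 have "rate_int r T0 E m q = rate_int R T0 E m q" for m q
  unfolding rate_int_def by (rule nn_integral_cong) (simp add: r(2) indicator_def)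
 hence rate: "rate r T0 PQ = (if PQ \<in> Lambda T0 E then rate_int R T0 E (fst mq) (snd mq) else \<infinity>)"
  unfolding rate_def Let_def mq_def r(1) by simp
 have wit: "Lambda_wit T0 E (fst PQ) (snd PQ) (fst mq) (snd mq)" if L: "PQ \<in> Lambda T0 E"
 proof -
  obtain m q where "Lambda_wit T0 E (fst PQ) (snd PQ) m q" using L by (cases PQ) (auto simp: Lambda_def)
  hence "\<exists>mq. Lambda_wit T0 E (fst PQ) (snd PQ) (fst mq) (snd mq)" by (intro exI[of _ "(m, q)"]) simp
  thus ?thesis unfolding mq_def by (rule someI_ex)
 qed
 show ?thesis
 proof
  assume le: "rate r T0 PQ <= ennreal a"
  hence L: "PQ \<in> Lambda T0 E" using rate by (auto simp: top_unique split: if_splits)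
  show "\<forall>F\<in>cont_tests. test_val F PQ - test_lam F <= a"
  proof
   fix F :: "'v tfun \<times> ('v * 'v) tfun" assume "F \<in> cont_tests"
   hence "ennreal (test_val F PQ - test_lam F) <= rate r T0 PQ"
    using conj_le_rate[OF cont PQ' wit[OF L], of "fst F" "snd F"] rate L by simp
   thus "test_val F PQ - test_lam F <= a" using le a by (metis order_trans ennreal_le_iff)
  qed
 next
  assume "\<forall>F\<in>cont_tests. test_val F PQ - test_lam F <= a"
  hence conj: "ev f g (fst PQ, snd PQ) - lam f g <= a" if "cont_per T0 f" "cont_per T0 g" for f g using that by auto
  have L: "PQ \<in> Lambda T0 E" using conj_Lambda[OF PQ' conj] by simp
  show "rate r T0 PQ <= ennreal a" using conj_rate_int[OF PQ' conj wit[OF L]] rate L by simp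
 qed
qed

end

lemma periodised_eq:
 assumes T0: "T0 > 0" and per: "\<And>t. t >= 0 ==> k (t + T0) = k t" and t: "t >= 0"
 shows "k (pmod t T0) = k t"
proof -
 have shift: "k (u + real n * T0) = k u" if "u >= 0" for u n
 proof (induction n)
  case (Suc n)
  have "0 <= u + real n * T0" using that T0 by simp
  from per[OF this] Suc show ?case by (simp add: algebra_simps)
 qed simp
 have "0 <= \<lfloor>t / T0\<rfloor>" using t T0 by simp
 hence "t = pmod t T0 + real (nat \<lfloor>t / T0\<rfloor>) * T0" using pmod_decomp[of t T0] by simp
 thus ?thesis using shift[of "pmod t T0" "nat \<lfloor>t / T0\<rfloor>"] pmod_bounds(1)[OF T0] by simp
qed

lemma rate_eq_0_off_edges:
 assumes T0: "T0 > 0" and r: "\<And>t. t >= 0 ==> 0 <= r y z t" "\<And>t. t >= 0 ==> r y z (t + T0) = r y z t" "\<And>t. t >= 0 ==> r y y t = 0"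
  and A1: "(\<exists>t>0. r y z t > 0) ==> (\<forall>t>0. r y z t > 0)" and off: "(y, z) \<notin> Edges r" and t: "t >= 0"
 shows "r y z t = 0"
proof (cases "y = z")
 case False
 have zero: "r y z u = 0" if "u > 0" for u
 proof (rule ccontr)
  assume "r y z u \<noteq> 0"
  hence "\<forall>t>0. r y z t > 0" using A1 r(1)[of u] that by force
  thus False using False off by (simp add: Edges_def)
 qed
 show ?thesis using t zero[of t] zero[of T0] r(2)[of 0] T0 by (cases "t = 0") auto
qed (use r(3) t in simp)

lemma kolmogorov_transition_cong:
 assumes "\<And>y z t. t >= 0 ==> R y z t = r y z t"
 shows "kolmogorov_transition R p \<longleftrightarrow> kolmogorov_transition r p"
proof -
 have "gen R w z u = gen r w z u" if "u >= 0" for w z u using assms[OF that] by (simp add: gen_def)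
 hence "(%u. \<Sum>w\<in>UNIV. p s u y w * gen R w z u) integrable_on {s..t} \<longleftrightarrow> (%u. \<Sum>w\<in>UNIV. p s u y w * gen r w z u) integrable_on {s..t}"
  "integral {s..t} (%u. \<Sum>w\<in>UNIV. p s u y w * gen R w z u) = integral {s..t} (%u. \<Sum>w\<in>UNIV. p s u y w * gen r w z u)"
  if "0 <= s" for s t y z
  using that by (auto intro!: integrable_cong Henstock_Kurzweil_Integration.integral_cong)
 thus ?thesis unfolding kolmogorov_transition_def by simp
qed

lemma periodised_chain:
 fixes r :: "'v::finite => 'v => real => real" and T0 :: real
 defines "R \<equiv> %y z t. r y z (pmod t T0)"
 assumes T0: "T0 > 0" and r_nonneg: "\<And>y z t. t >= 0 ==> r y z t >= 0"
  and r_meas: "\<And>y z. r y z \<in> borel_measurable (restrict_space lborel {0..})"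
  and r_eq: "\<And>y z t. t >= 0 ==> R y z t = r y z t" and off: "\<And>y z t. (y, z) \<notin> Edges r ==> t >= 0 ==> r y z t = 0"
  and conn: "\<And>y z. (y, z) \<in> (Edges r)\<^sup>*"
  and sup: "\<exists>B. \<forall>(y, z)\<in>Edges r. \<forall>t\<in>{0..T0}. r y z t <= B" and inf: "\<exists>c>0. \<forall>(y, z)\<in>Edges r. \<forall>t\<in>{0..T0}. c <= r y z t"
  and trans: "kolmogorov_transition r p" and chain: "markov_chain M X p x"
 shows "\<exists>B c. periodic_chain R T0 B c (Edges r) p M X x"
proof -
 obtain B where B: "\<And>y z t. (y, z) \<in> Edges r ==> t \<in> {0..T0} ==> r y z t <= B" using sup by fast
 obtain c where c: "c > 0" "\<And>y z t. (y, z) \<in> Edges r ==> t \<in> {0..T0} ==> c <= r y z t" using inf by fast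
 have range: "pmod t T0 \<in> {0..T0}" for t using pmod_bounds[OF T0, of t] by simp
 have "(%t. pmod t T0) \<in> measurable borel (restrict_space lborel {0..})"
  using range by (intro measurable_restrict_space2) auto
 from measurable_compose[OF this r_meas] have meas: "R y z \<in> borel_measurable borel" for y z by (simp add: R_def)
 have nonneg: "0 <= R y z t" for y z t using r_nonneg range[of t] by (simp add: R_def)
 have zero: "R y z t = 0" if "(y, z) \<notin> Edges r" for y z t using off[OF that] range[of t] by (simp add: R_def)
 have upper: "R y z t <= max B 0" for y z t
  using B[of y z "pmod t T0"] range[of t] zero[of y z t] by (cases "(y, z) \<in> Edges r") (auto simp: R_def)
 have "kolmogorov_transition R p" using trans kolmogorov_transition_cong[of R r] r_eq by simp
 hence "periodic_chain R T0 (max B 0) c (Edges r) p M X x"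
  using T0 nonneg zero upper c range conn chain meas
  by unfold_locales (auto simp: R_def Edges_def kolmogorov_transition_def intro!: bdd_borelI[of _ "max B 0"])
 thus ?thesis by blast
qed


theorem theorem2:
  fixes r :: "'v::finite \<Rightarrow> 'v \<Rightarrow> real \<Rightarrow> real"
    and T0 :: real
    and p :: "real \<Rightarrow> real \<Rightarrow> 'v \<Rightarrow> 'v \<Rightarrow> real"
    and M :: "'w measure" and X :: "'w \<Rightarrow> real \<Rightarrow> 'v" and x :: 'v
  assumes T0_pos: "T0 > 0"
    and r_nonneg: "\<And>y z t. t \<ge> 0 \<Longrightarrow> r y z t \<ge> 0"
    and r_meas: "\<And>y z. r y z \<in> borel_measurable (restrict_space lborel {0..})"
    and r_locint: "\<And>y z b. set_integrable lborel {0..b} (r y z)"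
    and r_per: "\<And>y z t. t \<ge> 0 \<Longrightarrow> r y z (t + T0) = r y z t"
    and r_diag: "\<And>y t. t \<ge> 0 \<Longrightarrow> r y y t = 0"
    and A1: "\<And>y z. (\<exists>t>0. r y z t > 0) \<Longrightarrow> (\<forall>t>0. r y z t > 0)"
    and A2: "\<And>y z. (y, z) \<in> (Edges r)\<^sup>*"
    and A3_sup: "\<exists>B. \<forall>(y, z)\<in>Edges r. \<forall>t\<in>{0..T0}. r y z t \<le> B"
    and A3_inf: "\<exists>c>0. \<forall>(y, z)\<in>Edges r. \<forall>t\<in>{0..T0}. c \<le> r y z t"
    and A4: "{t \<in> {0..<T0}. \<exists>y z. \<not> isCont (\<lambda>s. r y z (pmod s T0)) t} \<in> null_sets lborel"
    and trans: "kolmogorov_transition r p"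
    and chain: "markov_chain M X p x"
  shows
    "(\<forall>a::real. compactin (Mstar_top T0 (Edges r)) {PQ \<in> Mstar T0 (Edges r). rate r T0 PQ \<le> ennreal a})
     \<and> (\<forall>\<mu>1 Q1 \<mu>2 Q2 \<mu> Q (l::real).
          (\<mu>1, Q1) \<in> Mstar T0 (Edges r) \<longrightarrow> (\<mu>2, Q2) \<in> Mstar T0 (Edges r) \<longrightarrow>
          (\<mu>, Q) \<in> Mstar T0 (Edges r) \<longrightarrow> 0 \<le> l \<longrightarrow> l \<le> 1 \<longrightarrow>
          (\<forall>A\<in>sets SpV. emeasure \<mu> A = ennreal l * emeasure \<mu>1 A + ennreal (1 - l) * emeasure \<mu>2 A) \<longrightarrow>
          (\<forall>A\<in>sets SpV. emeasure Q A = ennreal l * emeasure Q1 A + ennreal (1 - l) * emeasure Q2 A) \<longrightarrow>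
          rate r T0 (\<mu>, Q) \<le> ennreal l * rate r T0 (\<mu>1, Q1) + ennreal (1 - l) * rate r T0 (\<mu>2, Q2))
     \<and> (\<forall>C. closedin (Mstar_top T0 (Edges r)) C \<longrightarrow>
          limsup (\<lambda>n. eln (measure M {\<omega> \<in> space M. (emp_meas T0 n (X \<omega>), emp_flow T0 n (X \<omega>)) \<in> C})
                      / ereal (real n))
          \<le> - enn2ereal (INF PQ\<in>C. rate r T0 PQ))
     \<and> (\<forall>G. openin (Mstar_top T0 (Edges r)) G \<longrightarrow>
          liminf (\<lambda>n. eln (measure M {\<omega> \<in> space M. (emp_meas T0 n (X \<omega>), emp_flow T0 n (X \<omega>)) \<in> G})
                      / ereal (real n))
          \<ge> - enn2ereal (INF PQ\<in>G. rate r T0 PQ))"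
proof -
 define R where "R = (%y z t. r y z (pmod t T0))"
 have R_eq: "R y z t = r y z t" if "t >= 0" for y z t
  unfolding R_def by (rule periodised_eq[where k = "r y z", OF T0_pos r_per that])
 have off: "r y z t = 0" if "(y, z) \<notin> Edges r" "t >= 0" for y z t
  by (rule rate_eq_0_off_edges[OF T0_pos r_nonneg r_per r_diag A1 that])
 have "\<exists>B c. periodic_chain R T0 B c (Edges r) p M X x"
  unfolding R_def
  by (rule periodised_chain[OF T0_pos r_nonneg r_meas R_eq[unfolded R_def] off A2 A3_sup A3_inf trans chain])
 then obtain B c where "periodic_chain R T0 B c (Edges r) p M X x" by blast
 then interpret periodic_chain R T0 B c "Edges r" p M X x .
 have cont: "AE t in lborel. t \<in> {0..<T0} --> (\<forall>y z. isCont (R y z) t)"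
  using AE_not_in[OF A4] unfolding R_def by eventually_elim auto
 have dual: "rate r T0 PQ <= ennreal a \<longleftrightarrow> (\<forall>F\<in>cont_tests. test_val F PQ - test_lam F <= a)"
  if "PQ \<in> Mstar T0 (Edges r)" "0 <= a" for PQ a by (rule rate_le_iff[OF refl R_eq cont that])
 show ?thesis
  by (intro conjI allI impI; (rule ldp_good[OF dual] ldp_convex[OF dual] ldp_limsup[OF dual] ldp_liminf[OF dual]; assumption))
qed

end
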